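(* Let $\Theta\in(0,1)$, $p_0,p_1\in(0,\infty)$ and $\tau_0,\tau_1\in[0,\infty)$. If $\tau:=(1-\Theta)\tau_0+\Theta\tau_1$, $\frac1p:=\frac{1-\Theta}{p_0}+\frac\Theta{p_1}$ and $p_0\,\tau_0=p_1\,\tau_1$, then $$\left\langle\mathcal{L}^{\tau_0}_{p_0}(\mathbb{R}^n),\mathcal{L}^{\tau_1}_{p_1}(\mathbb{R}^n),\Theta\right\rangle=\mathcal{L}^\tau_p(\mathbb{R}^n).$$ (Here the convention is used that, in case $\tau=1/p$, the spaces are defined with either $p\in[1,\infty)$ and $k\ge0$, or $p\in(0,1)$ and $k=0$.)
   Context: Equalities of quasi-Banach spaces are equalities of sets with equivalent quasi-norms. Campanato spaces: let $B(x,r)$ be the ball in $\mathbb{R}^n$ with center $x$ and radius $r$; $\mathcal{P}_k$ is the set of polynomials on $\mathbb{R}^n$ of order at most $k$, and $\mathcal{P}_{-1}:=\{0\}$. Let $p\in(0,\infty)$, $\tau\in[0,\infty)$ and let the integer $k\ge-1$ satisfy $k+1>n(\tau-1/p)$. Then $\mathcal{L}^\tau_p(\mathbb{R}^n)$ is the collection of all measurable $f$ on $\mathbb{R}^n$ with $|f|^p$ locally integrable such that $$\sup_{x\in\mathbb{R}^n}\sup_{0<r\le1}\Big[\int_{B(x,r)}|f(y)|^pdy\Big]^{1/p}+\sup_{x\in\mathbb{R}^n}\sup_{0<r\le1}|B(x,r)|^{-\tau}\Big[\inf_{P\in\mathcal{P}_k}\int_{B(x,r)}|f(y)-P(y)|^pdy\Big]^{1/p}<\infty,$$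 with this expression as quasi-norm. It is a known fact that the space is quasi-Banach and independent, up to equivalent quasi-norms, of the admissible $k$ (subject to the convention in the claim when $\tau=1/p$). $\pm$-method of Gustavsson and Peetre: let $(X_0,X_1)$ be a couple of quasi-Banach spaces continuously embedded in a common Hausdorff topological vector space, with $X_0+X_1$ carrying the usual sum quasi-norm, and $\Theta\in(0,1)$. An $a\in X_0+X_1$ belongs to $\langle X_0,X_1,\Theta\rangle$ if there is a sequence $\{a_i\}_{i\in\mathbb{Z}}\subset X_0\cap X_1$ with $a=\sum_{i\in\mathbb{Z}}a_i$ (convergence in $X_0+X_1$) such that, for any finite $F\subset\mathbb{Z}$, any bounded sequence $\{\varepsilon_i\}_{i\in\mathbb{Z}}\subset\mathbb{C}$ and $j\in\{0,1\}$, $\|\sum_{i\in F}\varepsilon_i2^{i(j-\Theta)}a_i\|_{X_j}\le C\sup_{i\in\mathbb{Z}}|\varepsilon_i|$ with a constant $C\ge0$ independent of $F$ and $j$. The quasi-norm of $a$ is the infimum of all such $C$. *)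

theory Defs
  imports "HOL-Analysis.Analysis"
begin

text \<open>
  Quasi-Banach spaces of complex-valued functions are represented by a carrier together with an
  \<^typ>\<open>ennreal\<close>-valued quasi-norm, of which only the values on the carrier matter. Elements are
  functions rather than classes modulo equality almost everywhere: the carriers below are closed
  under modification on null sets and the quasi-norms are invariant under it, so equality of
  carriers amounts to equality of the sets of classes.
\<close>

type_synonym 'a quasi_space = "('a \<Rightarrow> complex) set \<times> (('a \<Rightarrow> complex) \<Rightarrow> ennreal)"

abbreviation carrier :: "'a quasi_space \<Rightarrow> ('a \<Rightarrow> complex) set"
  where "carrier \<equiv> fst"

abbreviation qnorm :: "'a quasi_space \<Rightarrow> ('a \<Rightarrow> complex) \<Rightarrow> ennreal"
  where "qnorm \<equiv> snd"

definition quasi_space_eq :: "'a quasi_space \<Rightarrow> 'a quasi_space \<Rightarrow> bool"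
  where "quasi_space_eq X Y \<longleftrightarrow>
    carrier X = carrier Y \<and>
    (\<exists>c>0. \<exists>C>0. \<forall>f\<in>carrier X.
       ennreal c * qnorm X f \<le> qnorm Y f \<and> qnorm Y f \<le> ennreal C * qnorm X f)"


subsection \<open>Campanato spaces\<close>

text \<open>The degree bound is an integer; for \<open>k = -1\<close> the sum is empty, which gives \<open>{0}\<close>.\<close>

definition polys :: "int \<Rightarrow> (real ^ 'n \<Rightarrow> complex) set"
  where "polys k = {P. \<exists>c :: ('n \<Rightarrow> nat) \<Rightarrow> complex. P =
    (\<lambda>y. \<Sum>\<alpha> | int (\<Sum>i\<in>UNIV. \<alpha> i) \<le> k. c \<alpha> * of_real (\<Prod>i\<in>UNIV. (y $ i) ^ \<alpha> i))}"

definition campanato_norm :: "real \<Rightarrow> real \<Rightarrow> int \<Rightarrow> (real ^ 'n \<Rightarrow> complex) \<Rightarrow> ennreal"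
  where "campanato_norm \<tau> p k f =
    (SUP x. SUP r\<in>{0<..1}.
       ennreal ((LINT y:ball x r|lebesgue. cmod (f y) powr p) powr (1 / p))) +
    (SUP x. SUP r\<in>{0<..1}.
       ennreal (measure lebesgue (ball x r) powr (- \<tau>) *
         (INF P\<in>polys k. LINT y:ball x r|lebesgue. cmod (f y - P y) powr p) powr (1 / p)))"

text \<open>
  Local integrability of \<open>|f|\<^sup>p\<close> is part of the carrier, so all integrals in the quasi-norm of an
  element of the carrier exist; the Bochner integral's default value 0 is never used.
\<close>

definition campanato :: "real \<Rightarrow> real \<Rightarrow> int \<Rightarrow> (real ^ 'n) quasi_space"
  where "campanato \<tau> p k =
    ({f. f \<in> borel_measurable lebesgue \<and>
         (\<forall>K. compact K \<longrightarrow> set_integrable lebesgue K (\<lambda>y. cmod (f y) powr p)) \<and>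
         campanato_norm \<tau> p k f < \<infinity>},
     campanato_norm \<tau> p k)"

definition admissible_degree :: "nat \<Rightarrow> real \<Rightarrow> real \<Rightarrow> int \<Rightarrow> bool"
  where "admissible_degree n \<tau> p k \<longleftrightarrow>
    k \<ge> -1 \<and> real_of_int k + 1 > real n * (\<tau> - 1 / p) \<and>
    (\<tau> = 1 / p \<longrightarrow> (p \<ge> 1 \<and> k \<ge> 0) \<or> (0 < p \<and> p < 1 \<and> k = 0))"


subsection \<open>The plus-minus method of Gustavsson and Peetre\<close>

definition sum_space :: "'a quasi_space \<Rightarrow> 'a quasi_space \<Rightarrow> 'a quasi_space"
  where "sum_space X0 X1 =
    ({a. \<exists>b\<in>carrier X0. \<exists>c\<in>carrier X1. a = (\<lambda>y. b y + c y)},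
     \<lambda>a. INF (b, c)\<in>{(b, c). b \<in> carrier X0 \<and> c \<in> carrier X1 \<and> a = (\<lambda>y. b y + c y)}.
           qnorm X0 b + qnorm X1 c)"

definition pm_bound :: "'a quasi_space \<Rightarrow> real \<Rightarrow> (int \<Rightarrow> 'a \<Rightarrow> complex) \<Rightarrow> real \<Rightarrow> bool"
  where "pm_bound X s a C \<longleftrightarrow>
    (\<forall>F (\<epsilon> :: int \<Rightarrow> complex). finite F \<longrightarrow> bounded (range \<epsilon>) \<longrightarrow>
       qnorm X (\<lambda>y. \<Sum>i\<in>F. \<epsilon> i * of_real (2 powr (of_int i * s)) * a i y)
         \<le> ennreal (C * (SUP i. cmod (\<epsilon> i))))"

text \<open>
  Convergence of the series over the integers is taken along the finite subsets. Together with the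
  bounds, this is equivalent to convergence of the two one-sided series.
\<close>

definition pm_admissible ::
    "'a quasi_space \<Rightarrow> 'a quasi_space \<Rightarrow> real \<Rightarrow> ('a \<Rightarrow> complex) \<Rightarrow> real \<Rightarrow> bool"
  where "pm_admissible X0 X1 \<Theta> a C \<longleftrightarrow>
    C \<ge> 0 \<and>
    (\<exists>s :: int \<Rightarrow> 'a \<Rightarrow> complex.
       range s \<subseteq> carrier X0 \<inter> carrier X1 \<and>
       ((\<lambda>F. qnorm (sum_space X0 X1) (\<lambda>y. a y - (\<Sum>i\<in>F. s i y))) \<longlongrightarrow> 0)
         (finite_subsets_at_top UNIV) \<and>
       pm_bound X0 (0 - \<Theta>) s C \<and> pm_bound X1 (1 - \<Theta>) s C)"

definition pm_interpolation ::
    "'a quasi_space \<Rightarrow> 'a quasi_space \<Rightarrow> real \<Rightarrow> 'a quasi_space"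
  where "pm_interpolation X0 X1 \<Theta> =
    ({a \<in> carrier (sum_space X0 X1). \<exists>C. pm_admissible X0 X1 \<Theta> a C},
     \<lambda>a. INF C\<in>{C. pm_admissible X0 X1 \<Theta> a C}. ennreal C)"

end

theory Submission
  imports Defs "HOL-Real_Asymp.Real_Asymp"
begin

text \<open>
  Put \<open>s = n (\<tau> - 1/p)\<close> and likewise \<open>s0\<close>, \<open>s1\<close>; the hypothesis says \<open>p0 s0 = p1 s1 = p s\<close>. On cubes of
  side \<open>l \<le> 1\<close> the Campanato condition becomes the \<open>L\<^sup>p\<close> mean approximability by polynomials up to
  \<open>M l powr s\<close>, where the degree may be changed as long as it exceeds \<open>s\<close>.

  If \<open>s < 0\<close>, no polynomials are needed. These spaces are lattices and \<open>f\<close> decomposes into the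
  pieces of \<open>f\<close> on the level sets of \<open>|f| powr (p/p1 - p/p0)\<close>. Conversely, averaging the plus-minus
  bounds over all subsets of the index set controls the size of the single pieces, and Hoelder's
  inequality interpolates the Morrey bounds.

  If \<open>s \<ge> 0\<close>, the John--Nirenberg inequality allows replacing all exponents by 1, so that only the
  smoothness varies. Splitting the series of a plus-minus decomposition in two at a suitable index,
  depending on \<open>l\<close>, gives one inclusion. For the other one, glue near-optimal polynomials on dyadic
  cubes by a partition of unity; the differences of consecutive levels are smooth pieces of
  frequency \<open>2\<^sup>m\<close> and size \<open>2 powr (- m s)\<close>, and grouping them according to \<open>\<lfloor>- m (s1 - s0)\<rfloor>\<close> is an
  admissible decomposition.
\<close>

subsection \<open>Polynomials\<close>

text \<open>With \<open>c = p0 * \<tau>0\<close>, each of the three triples satisfies p s = n (c -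
  1). Hence \<open>s0\<close>, \<open>s1\<close> and \<open>s\<close> have the same sign, and one
  regime covers all three spaces. For exponents below 1 a function need not be locally integrable,
  so neither mean values nor linear projections onto polynomials are available. Near-minimal
  polynomials take their place. Two of them are compared by a Remez estimate, whose constants depend
  only on degree, dimension and exponent and not on the cube. The sign enters the John--Nirenberg
  argument because, for s >= 0, the bound on the oscillation over a subcube is never worse than the
  bound over the cube itself. At s = 0 the smooth pieces would not decay, but then
  \<open>s0 = s1 = 0\<close> and the function alone is a decomposition. A quasi-norm is represented
  by the relation "bounded by M" with M > 0, so infima have to be handled only where this relation
  meets the given definitions.\<close>

definition mon :: "('n \<Rightarrow> nat) \<Rightarrow> real ^ 'n::finite \<Rightarrow> complex"
  where "mon \<alpha> y = of_real (\<Prod>i\<in>UNIV. (y $ i) ^ \<alpha> i)"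

lemma finite_multiindices: "finite {\<alpha> :: 'n::finite \<Rightarrow> nat. int (\<Sum>i\<in>UNIV. \<alpha> i) \<le> k}"
proof (rule finite_subset)
  show "{\<alpha> :: 'n \<Rightarrow> nat. int (\<Sum>i\<in>UNIV. \<alpha> i) \<le> k} \<subseteq> PiE UNIV (\<lambda>_. {..nat k})"
  proof
    fix \<alpha> :: "'n \<Rightarrow> nat" assume a: "\<alpha> \<in> {\<alpha>. int (\<Sum>i\<in>UNIV. \<alpha> i) \<le> k}"
    have "\<alpha> i \<le> nat k" for i
    proof -
      have "\<alpha> i \<le> (\<Sum>i\<in>UNIV. \<alpha> i)" by (rule member_le_sum) auto
      with a show ?thesis by (simp del: of_nat_sum)
    qed
    then show "\<alpha> \<in> PiE UNIV (\<lambda>_. {..nat k})" by auto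
  qed
qed (auto intro: finite_PiE)

lemma polys_iff: "P \<in> polys k \<longleftrightarrow> (\<exists>c. P = (\<lambda>y. \<Sum>\<alpha> | int (\<Sum>i\<in>UNIV. \<alpha> i) \<le> k. c \<alpha> * mon \<alpha> y))"
  by (simp add: polys_def mon_def)

lemma polys_add: "P \<in> polys k \<Longrightarrow> Q \<in> polys k \<Longrightarrow> (\<lambda>y. P y + Q y) \<in> polys k"
  unfolding polys_iff
  apply safe
  subgoal for c d by (rule exI[of _ "\<lambda>\<alpha>. c \<alpha> + d \<alpha>"]) (simp add: distrib_right sum.distrib)
  done

lemma polys_scale: "P \<in> polys k \<Longrightarrow> (\<lambda>y. c * P y) \<in> polys k"
  unfolding polys_iff
  apply safe
  subgoal for d by (rule exI[of _ "\<lambda>\<alpha>. c * d \<alpha>"]) (simp add: sum_distrib_left mult.assoc)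
  done

lemma polys_0: "(\<lambda>y. 0) \<in> polys k"
  unfolding polys_iff by (rule exI[of _ "\<lambda>_. 0"]) simp

lemma polys_diff: "P \<in> polys k \<Longrightarrow> Q \<in> polys k \<Longrightarrow> (\<lambda>y. P y - Q y) \<in> polys k"
  using polys_add[of P k "\<lambda>y. (-1) * Q y"] polys_scale[of Q k "-1"] by simp

lemma polys_minus: "P \<in> polys k \<Longrightarrow> (\<lambda>y. - P y) \<in> polys k"
  using polys_scale[of P k "-1"] by simp

lemma polys_sum: "(\<And>i. i \<in> A \<Longrightarrow> P i \<in> polys k) \<Longrightarrow> (\<lambda>y. \<Sum>i\<in>A. P i y) \<in> polys k"
  by (induction A rule: infinite_finite_induct) (auto intro: polys_0 polys_add)

lemma polys_mon:
  assumes "int (\<Sum>i\<in>UNIV. \<alpha> i) \<le> k" shows "mon \<alpha> \<in> polys k"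
  unfolding polys_iff
proof (rule exI[of _ "\<lambda>\<beta>. if \<beta> = \<alpha> then 1 else 0"], rule ext)
  fix y
  have "(\<Sum>\<beta> | int (\<Sum>i\<in>UNIV. \<beta> i) \<le> k. (if \<beta> = \<alpha> then 1 else 0) * mon \<beta> y)
      = (\<Sum>\<beta> | int (\<Sum>i\<in>UNIV. \<beta> i) \<le> k. if \<beta> = \<alpha> then mon \<alpha> y else 0)"
    by (rule sum.cong) auto
  also have "\<dots> = mon \<alpha> y"
    using assms finite_multiindices[of k] by (subst sum.delta) auto
  finally show "mon \<alpha> y = (\<Sum>\<beta> | int (\<Sum>i\<in>UNIV. \<beta> i) \<le> k. (if \<beta> = \<alpha> then 1 else 0) * mon \<beta> y)" ..
qed

lemma polys_induct [consumes 1, case_names zero mon add]: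
  assumes "P \<in> polys k"
    and zero: "R (\<lambda>y. 0)"
    and mon: "\<And>\<alpha> c. int (\<Sum>i\<in>UNIV. \<alpha> i) \<le> k \<Longrightarrow> R (\<lambda>y. c * mon \<alpha> y)"
    and add: "\<And>f g. R f \<Longrightarrow> R g \<Longrightarrow> R (\<lambda>y. f y + g y)"
  shows "R P"
proof -
  obtain c where P: "P = (\<lambda>y. \<Sum>\<alpha> | int (\<Sum>i\<in>UNIV. \<alpha> i) \<le> k. c \<alpha> * mon \<alpha> y)"
    using assms(1) unfolding polys_iff by blast
  have "R (\<lambda>y. \<Sum>\<alpha>\<in>A. c \<alpha> * mon \<alpha> y)" if "finite A" "A \<subseteq> {\<alpha>. int (\<Sum>i\<in>UNIV. \<alpha> i) \<le> k}" for A
    using that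
  proof (induction A rule: finite_induct)
    case empty then show ?case using zero by simp
  next
    case (insert a A)
    then show ?case using add[OF mon[of a "c a"]] by auto
  qed
  then show ?thesis unfolding P using finite_multiindices[of k] by blast
qed

lemma polys_mono:
  assumes "P \<in> polys j" "j \<le> k" shows "P \<in> polys k"
  using assms(1)
proof (induction rule: polys_induct)
  case (mon \<alpha> c)
  then show ?case using assms(2) by (intro polys_scale polys_mon) auto
qed (auto intro: polys_0 polys_add)

lemma polys_neg: "P \<in> polys k \<Longrightarrow> k < 0 \<Longrightarrow> P = (\<lambda>y. 0)"
  by (erule polys_induct) auto

lemma mon_mult: "mon \<alpha> y * mon \<beta> y = mon (\<lambda>i. \<alpha> i + \<beta> i) y"
  by (simp add: mon_def power_add prod.distrib)

lemma polys_mult: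
  assumes "P \<in> polys j" "Q \<in> polys k" shows "(\<lambda>y. P y * Q y) \<in> polys (j + k)"
  using assms(1)
proof (induction rule: polys_induct)
  case (mon \<alpha> c)
  from assms(2) show ?case
  proof (induction rule: polys_induct)
    case (mon \<beta> d)
    have "(\<lambda>y. (c * d) * mon (\<lambda>i. \<alpha> i + \<beta> i) y) \<in> polys (j + k)"
      using \<open>int (sum \<alpha> UNIV) \<le> j\<close> mon by (intro polys_scale polys_mon) (auto simp: sum.distrib)
    then show ?case by (simp add: mon_mult[symmetric] mult_ac)
  next
    case (add f g)
    from polys_add[OF this] show ?case by (simp add: distrib_left)
  qed (simp add: polys_0)
next
  case (add f g)
  from polys_add[OF this] show ?case by (simp add: distrib_right)
qed (simp add: polys_0)

lemma polys_const: "0 \<le> k \<Longrightarrow> (\<lambda>y. c) \<in> polys k"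
  using polys_scale[OF polys_mon[of "\<lambda>_. 0" k], of c] by (simp add: mon_def)

lemma polys_coord: "(\<lambda>y. of_real (y $ i)) \<in> polys 1"
proof -
  have "mon (\<lambda>j. if j = i then 1 else 0) = (\<lambda>y. of_real (y $ i))"
    by (rule ext) (simp add: mon_def if_distrib[of "\<lambda>e. _ ^ e"] cong: if_cong)
  then show ?thesis
    using polys_mon[of "\<lambda>j. if j = i then 1 else 0" 1] by simp
qed

text \<open>Product closure of degree-graded properties gives the affine substitution and the
  degree drop of differences at once.\<close>

lemma prod_graded_induct:
  fixes d :: "'i \<Rightarrow> nat"
  assumes "finite I" and one: "R 0 (\<lambda>y. 1)"
    and mult: "\<And>f g a b. R a f \<Longrightarrow> R b g \<Longrightarrow> R (a + b) (\<lambda>y. f y * g y)"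
    and "\<And>i. i \<in> I \<Longrightarrow> R 1 (f i)"
  shows "R (int (\<Sum>i\<in>I. d i)) (\<lambda>y. \<Prod>i\<in>I. f i y ^ d i)"
proof -
  have pow: "R (int m) (\<lambda>y. f i y ^ m)" if "i \<in> I" for i m
  proof (induction m)
    case (Suc m)
    then show ?case using mult[OF assms(4)[OF that] Suc] by simp
  qed (simp add: one)
  have "R (int (\<Sum>i\<in>J. d i)) (\<lambda>y. \<Prod>i\<in>J. f i y ^ d i)" if "finite J" "J \<subseteq> I" for J
    using that
  proof (induction J rule: finite_induct)
    case (insert j J)
    then show ?case using mult[OF pow[of j "d j"], of "int (\<Sum>i\<in>J. d i)"] by simp
  qed (simp add: one)
  then show ?thesis using assms(1) by blast
qed

lemma mon_of_real: "mon \<alpha> y = (\<Prod>i\<in>UNIV. of_real (y $ i) ^ \<alpha> i)"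
  by (simp add: mon_def)

lemma polys_affine:
  assumes "P \<in> polys k" shows "(\<lambda>y. P (a + h *\<^sub>R y)) \<in> polys k"
  using assms
proof (induction rule: polys_induct)
  case (mon \<alpha> c)
  have "(\<lambda>y. \<Prod>i\<in>UNIV. (of_real ((a + h *\<^sub>R y) $ i) :: complex) ^ \<alpha> i) \<in> polys (int (\<Sum>i\<in>UNIV. \<alpha> i))"
  proof (rule prod_graded_induct[where R = "\<lambda>k f. f \<in> polys k"])
    fix i
    have "(\<lambda>y. of_real (a $ i) + of_real h * of_real (y $ i)) \<in> polys 1"
      by (intro polys_add polys_scale polys_coord polys_const) simp
    then show "(\<lambda>y. of_real ((a + h *\<^sub>R y) $ i)) \<in> polys 1" by simp
  qed (auto intro: polys_const polys_mult)
  from polys_scale[OF polys_mono[OF this mon]] show ?case by (simp add: mon_of_real)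
qed (auto intro: polys_0 polys_add)

lemma polys_translate: "P \<in> polys k \<Longrightarrow> (\<lambda>y. P (y + v)) \<in> polys k"
  using polys_affine[of P k v 1] by (simp add: add.commute)

lemma polys_difference:
  assumes "P \<in> polys k" shows "(\<lambda>y. P (y + v) - P y) \<in> polys (k - 1)"
  using assms
proof (induction rule: polys_induct)
  case (mon \<alpha> c)
  define R where "R = (\<lambda>k f. f \<in> polys k \<and> (\<lambda>y. f (y + v) - f y) \<in> polys (k - 1))"
  have "R (int (\<Sum>i\<in>UNIV. \<alpha> i)) (\<lambda>y. \<Prod>i\<in>UNIV. (of_real (y $ i) :: complex) ^ \<alpha> i)"
  proof (rule prod_graded_induct)
    show "R 0 (\<lambda>y. 1)" by (simp add: R_def polys_0 polys_const)
    show "R 1 (\<lambda>y. of_real (y $ i))" for i by (simp add: R_def polys_coord polys_const)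
    fix f g a b assume "R a f" "R b g"
    then have f: "f \<in> polys a" "(\<lambda>y. f (y + v) - f y) \<in> polys (a - 1)"
      and g: "g \<in> polys b" "(\<lambda>y. g (y + v) - g y) \<in> polys (b - 1)" by (auto simp: R_def)
    have "(\<lambda>y. (f (y + v) - f y) * g (y + v) + f y * (g (y + v) - g y)) \<in> polys (a + b - 1)"
      using polys_mult[OF f(2) polys_translate[OF g(1), of v]] polys_mult[OF f(1) g(2)]
      by (intro polys_add) (simp_all add: add_diff_eq add.commute diff_add_eq)
    then show "R (a + b) (\<lambda>y. f y * g y)" using polys_mult[OF f(1) g(1)] by (simp add: R_def algebra_simps)
  qed simp
  then have "(\<lambda>y. mon \<alpha> (y + v) - mon \<alpha> y) \<in> polys (int (\<Sum>i\<in>UNIV. \<alpha> i) - 1)"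
    by (simp add: R_def mon_of_real)
  from polys_scale[OF polys_mono[OF this], of "k - 1" c] mon show ?case by (simp add: algebra_simps)
next
  case (add f g)
  from polys_add[OF this] show ?case by (simp add: algebra_simps)
qed (simp add: polys_0)

lemma polys_continuous: "P \<in> polys k \<Longrightarrow> continuous_on A P"
  unfolding polys_iff mon_def by (auto intro!: continuous_intros)

lemma polys_borel: "P \<in> polys k \<Longrightarrow> P \<in> borel_measurable borel"
  by (rule borel_measurable_continuous_onI) (rule polys_continuous)

lemma polys_measurable: "P \<in> polys k \<Longrightarrow> P \<in> borel_measurable lebesgue"
  by (intro measurable_completion) (simp add: polys_borel)

section \<open>Homogeneous components, truncation of the degree and extrapolation\<close>

lemma polys_homogeneous:
  assumes "P \<in> polys (int k)"
  obtains H where "\<And>d. H d \<in> polys (int d)" "\<And>d t y. H d (t *\<^sub>R y) = of_real t ^ d * H d y"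
    "\<And>y. P y = (\<Sum>d\<le>k. H d y)"
proof -
  have "\<exists>H. (\<forall>d. H d \<in> polys (int d)) \<and> (\<forall>d t y. H d (t *\<^sub>R y) = of_real t ^ d * H d y) \<and>
      (\<forall>y. P y = (\<Sum>d\<le>k. H d y))"
    using assms
  proof (induction rule: polys_induct)
    case zero
    show ?case by (rule exI[of _ "\<lambda>_ _. 0"]) (simp add: polys_0)
  next
    case (mon \<alpha> c)
    let ?D = "\<Sum>i\<in>UNIV. \<alpha> i"
    have "mon \<alpha> (t *\<^sub>R y) = of_real t ^ ?D * mon \<alpha> y" for t y
      by (simp add: mon_of_real power_mult_distrib prod.distrib power_sum)
    moreover have "(\<lambda>y. if d = ?D then c * mon \<alpha> y else 0) \<in> polys (int d)" for d
      by (cases "d = ?D") (auto simp: polys_0 simp del: of_nat_sum intro!: polys_scale polys_mon)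
    moreover have "?D \<le> k" using mon by linarith
    ultimately show ?case
      by (intro exI[of _ "\<lambda>d y. if d = ?D then c * mon \<alpha> y else 0"]) auto
  next
    case (add f g)
    then obtain H G where
      H: "\<And>d. H d \<in> polys (int d)" "\<And>d t y. H d (t *\<^sub>R y) = of_real t ^ d * H d y"
        "\<And>y. f y = (\<Sum>d\<le>k. H d y)" and
      G: "\<And>d. G d \<in> polys (int d)" "\<And>d t y. G d (t *\<^sub>R y) = of_real t ^ d * G d y"
        "\<And>y. g y = (\<Sum>d\<le>k. G d y)" by metis
    show ?case
      by (rule exI[of _ "\<lambda>d y. H d y + G d y"]) (auto simp: H G sum.distrib distrib_left polys_add)
  qed
  then show ?thesis using that by blast
qed

text \<open>Subtracting the sum at the halved argument costs the factor \<open>1 + 2 ^ Suc k\<close>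
  on the lower components. The top component is the whole sum minus k + 1 lower ones, which gives
  the first two summands. The last summand makes the domination over the bound for the lower
  components immediate.\<close>

primrec hom_const :: "nat \<Rightarrow> real"
  where "hom_const 0 = 1"
  | "hom_const (Suc k) = 1 + (real k + 1) * (hom_const k * (1 + 2 ^ Suc k)) + hom_const k * (1 + 2 ^ Suc k)"

lemma hom_const_ge: "hom_const k \<ge> 1"
  by (induction k) (auto simp: add_nonneg_nonneg)

text \<open>The combination \<open>P(y) - 2^(k+1) P(y/2)\<close> kills the top degree component.\<close>

lemma hom_bound:
  fixes H :: "nat \<Rightarrow> 'a::real_vector \<Rightarrow> complex"
  assumes "\<And>d t y. H d (t *\<^sub>R y) = of_real t ^ d * H d y"
    and "\<And>y t. y \<in> S \<Longrightarrow> 0 \<le> t \<Longrightarrow> t \<le> 1 \<Longrightarrow> t *\<^sub>R y \<in> S"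
    and "\<And>y. y \<in> S \<Longrightarrow> cmod (\<Sum>d\<le>k. H d y) \<le> lam"
    and "y \<in> S" "d \<le> k"
  shows "cmod (H d y) \<le> hom_const k * lam"
  using assms(1,3-)
proof (induction k arbitrary: H lam y d)
  case (Suc k)
  have lam: "0 \<le> lam" using Suc.prems(2)[OF Suc.prems(3)] norm_ge_zero order_trans by blast
  \<comment> \<open>Components of the sum minus \<open>2 ^ Suc k\<close> times the sum at y/2:
    degree d is multiplied by \<open>1 - 2 ^ (Suc k - d)\<close>, which vanishes at d = Suc
    k.\<close>
  define G where "G = (\<lambda>d y. of_real (1 - 2 ^ (Suc k - d)) * H d y)"
  have low: "cmod (H d y) \<le> hom_const k * ((1 + 2 ^ Suc k) * lam)" if d: "d \<le> k" and y: "y \<in> S" for d y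
  proof -
    have "cmod (G d y) \<le> hom_const k * ((1 + 2 ^ Suc k) * lam)"
    proof (rule Suc.IH[of G, OF _ _ y d])
      fix y assume y: "y \<in> S"
      have half: "(1/2) *\<^sub>R y \<in> S" using assms(2)[OF y, of "1/2"] by simp
      have "(\<Sum>d\<le>k. G d y) = (\<Sum>d\<le>Suc k. G d y)" by (simp add: G_def)
      also have "\<dots> = (\<Sum>d\<le>Suc k. H d y) - 2 ^ Suc k * (\<Sum>d\<le>Suc k. H d ((1/2) *\<^sub>R y))"
        unfolding sum_distrib_left sum_subtractf[symmetric]
      proof (rule sum.cong)
        fix d assume "d \<in> {..Suc k}"
        then have "(2::complex) ^ (Suc k - d) = 2 ^ Suc k * (1/2) ^ d"
          by (simp add: power_diff power_divide)
        then show "G d y = H d y - 2 ^ Suc k * H d ((1/2) *\<^sub>R y)"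
          unfolding G_def Suc.prems(1)[of d "1/2" y] by (simp add: algebra_simps)
      qed simp
      finally have "cmod (\<Sum>d\<le>k. G d y) \<le> cmod (\<Sum>d\<le>Suc k. H d y)
          + cmod (2 ^ Suc k * (\<Sum>d\<le>Suc k. H d ((1/2) *\<^sub>R y)))" by (metis norm_triangle_ineq4)
      also have "\<dots> \<le> lam + 2 ^ Suc k * lam"
        unfolding norm_mult norm_power using Suc.prems(2)[OF y] Suc.prems(2)[OF half]
        by (intro add_mono mult_mono) (simp_all del: sum.atMost_Suc)
      finally show "cmod (\<Sum>d\<le>k. G d y) \<le> (1 + 2 ^ Suc k) * lam" by (simp add: algebra_simps)
    qed (simp add: G_def Suc.prems(1))
    \<comment> \<open>For d <= k the factor \<open>1 - 2 ^ (Suc k - d)\<close> has modulus at least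
      1, so a bound for \<open>G\<close> is also one for \<open>H\<close>.\<close>
    moreover have "cmod (H d y) \<le> cmod (G d y)"
    proof -
      have "(2::real) ^ 1 \<le> 2 ^ (Suc k - d)" using d by (intro power_increasing) auto
      then have "1 \<le> \<bar>1 - (2::real) ^ (Suc k - d)\<bar>" by simp
      then show ?thesis unfolding G_def norm_mult norm_of_real
        using mult_right_mono[of 1 "\<bar>1 - (2::real) ^ (Suc k - d)\<bar>" "cmod (H d y)"] by simp
    qed
    ultimately show ?thesis by linarith
  qed
  let ?c = "hom_const k * (1 + 2 ^ Suc k)"
  have c: "0 \<le> ?c" using hom_const_ge[of k] by simp
  show ?case
  proof (cases "d \<le> k")
    case True
    from low[OF this Suc.prems(3)] have "cmod (H d y) \<le> ?c * lam" by (simp add: mult.assoc)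
    also have "\<dots> \<le> hom_const (Suc k) * lam"
    proof (rule mult_right_mono[OF _ lam])
      have "0 \<le> (real k + 1) * ?c" using c by simp
      then show "?c \<le> hom_const (Suc k)" by simp
    qed
    finally show ?thesis .
  next
    case False
    then have d: "d = Suc k" using Suc.prems(4) by simp
    have "H d y = (\<Sum>d\<le>Suc k. H d y) - (\<Sum>d\<le>k. H d y)" by (simp add: d)
    then have "cmod (H d y) \<le> cmod (\<Sum>d\<le>Suc k. H d y) + cmod (\<Sum>d\<le>k. H d y)"
      by (metis norm_triangle_ineq4)
    also have "cmod (\<Sum>d\<le>k. H d y) \<le> (\<Sum>d\<le>k. ?c * lam)"
      using low[OF _ Suc.prems(3)] by (intro sum_norm_le) (simp add: mult.assoc)
    also have "\<dots> = (real k + 1) * ?c * lam" by simp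
    finally have "cmod (H d y) \<le> lam + (real k + 1) * ?c * lam" using Suc.prems(2)[OF Suc.prems(3)] by linarith
    also have "\<dots> = (1 + (real k + 1) * ?c) * lam" by (simp only: distrib_right mult_1)
    also have "\<dots> \<le> hom_const (Suc k) * lam" using c by (intro mult_right_mono[OF _ lam]) simp
    finally show ?thesis .
  qed
qed simp

text \<open>In the expansion about x, a component of degree d is multiplied by \<mu>^d under
  contraction by \<mu> towards x, and the dropped components have d >= k' + 1. Each component is
  bounded on the star-shaped set by \<open>hom_bound\<close>. The same \<open>T\<close> serves every
  \<mu>, which is what Taylor estimates at all radii require.\<close>

lemma polys_truncate:
  assumes P: "P \<in> polys (int k)" and k': "-1 \<le> k'"
    and star: "\<And>y t. y \<in> S \<Longrightarrow> 0 \<le> t \<Longrightarrow> t \<le> 1 \<Longrightarrow> x + t *\<^sub>R (y - x) \<in> S"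
    and bd: "\<And>y. y \<in> S \<Longrightarrow> cmod (P y) \<le> lam"
  shows "\<exists>T\<in>polys k'. \<forall>y \<mu>. 0 < \<mu> \<longrightarrow> \<mu> \<le> 1 \<longrightarrow> x + (1 / \<mu>) *\<^sub>R (y - x) \<in> S \<longrightarrow>
    cmod (P y - T y) \<le> (real k + 1) * hom_const k * lam * \<mu> powr (real_of_int k' + 1)"
proof -
  have "(\<lambda>y. P (x + y)) \<in> polys (int k)" using polys_affine[OF P, of x 1] by simp
  then obtain H where H: "\<And>d. H d \<in> polys (int d)" "\<And>d t y. H d (t *\<^sub>R y) = of_real t ^ d * H d y"
    "\<And>y. P (x + y) = (\<Sum>d\<le>k. H d y)" by (rule polys_homogeneous) blast
  define T where "T y = (\<Sum>d\<in>{d. d \<le> k \<and> int d \<le> k'}. H d (y - x))" for y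
  have "T \<in> polys k'" unfolding T_def
  proof (rule polys_sum)
    fix d assume "d \<in> {d. d \<le> k \<and> int d \<le> k'}"
    then have "H d \<in> polys k'" using polys_mono[OF H(1)] by simp
    from polys_translate[OF this, of "-x"] show "(\<lambda>y. H d (y - x)) \<in> polys k'" by simp
  qed
  moreover have "cmod (P y - T y) \<le> (real k + 1) * hom_const k * lam * \<mu> powr (real_of_int k' + 1)"
    if mu: "0 < \<mu>" "\<mu> \<le> 1" and S: "x + (1 / \<mu>) *\<^sub>R (y - x) \<in> S" for y \<mu>
  proof -
    have lam: "0 \<le> lam" using bd[OF S] norm_ge_zero order_trans by blast
    have "P y = (\<Sum>d\<le>k. H d (y - x))" using H(3)[of "y - x"] by simp
    also have "\<dots> = T y + (\<Sum>d\<in>{d. d \<le> k \<and> k' < int d}. H d (y - x))"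
      unfolding T_def by (subst sum.union_disjoint[symmetric]) (auto intro!: sum.cong)
    finally have eq: "P y - T y = (\<Sum>d\<in>{d. d \<le> k \<and> k' < int d}. H d (y - x))" by simp
    have "cmod (P y - T y) \<le> (\<Sum>d\<in>{d. d \<le> k \<and> k' < int d}. hom_const k * lam * \<mu> powr (real_of_int k' + 1))"
      unfolding eq
    proof (rule sum_norm_le)
      fix d assume "d \<in> {d. d \<le> k \<and> k' < int d}"
      then have d: "d \<le> k" "k' + 1 \<le> int d" by auto
      let ?z = "(1 / \<mu>) *\<^sub>R (y - x)"
      have z: "cmod (H d ?z) \<le> hom_const k * lam"
      proof (rule hom_bound[where S = "(\<lambda>z. z - x) ` S"])
        show "?z \<in> (\<lambda>z. z - x) ` S" using S by (intro image_eqI[of _ _ "x + ?z"]) auto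
      next
        fix y t assume "y \<in> (\<lambda>z. z - x) ` S" "0 \<le> t" "(t::real) \<le> 1"
        then obtain w where "w \<in> S" "y = w - x" by auto
        then show "t *\<^sub>R y \<in> (\<lambda>z. z - x) ` S"
          using star[OF \<open>w \<in> S\<close> \<open>0 \<le> t\<close> \<open>t \<le> 1\<close>] by (intro image_eqI[of _ _ "x + t *\<^sub>R (w - x)"]) auto
      next
        fix y assume "y \<in> (\<lambda>z. z - x) ` S"
        then show "cmod (\<Sum>d\<le>k. H d y) \<le> lam" using bd H(3) by (auto simp flip: H(3))
      qed (use H d in auto)
      have "H d (y - x) = H d (\<mu> *\<^sub>R ?z)" using mu by simp
      then have "cmod (H d (y - x)) = \<mu> ^ d * cmod (H d ?z)"
        unfolding H(2)[of d \<mu>] using mu by (simp add: norm_mult norm_power)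
      also have "\<dots> \<le> \<mu> powr (real_of_int k' + 1) * (hom_const k * lam)"
      proof (rule mult_mono)
        have "\<mu> ^ d = \<mu> powr (real d)" using mu by (simp add: powr_realpow)
        also have "\<dots> \<le> \<mu> powr (real_of_int k' + 1)" using mu d(2) by (intro powr_mono') linarith+
        finally show "\<mu> ^ d \<le> \<mu> powr (real_of_int k' + 1)" .
      qed (use z in auto)
      finally show "cmod (H d (y - x)) \<le> hom_const k * lam * \<mu> powr (real_of_int k' + 1)" by (simp add: mult_ac)
    qed
    also have "\<dots> = real (card {d. d \<le> k \<and> k' < int d}) * (hom_const k * lam * \<mu> powr (real_of_int k' + 1))" by simp
    also have "\<dots> \<le> (real k + 1) * (hom_const k * lam * \<mu> powr (real_of_int k' + 1))"
    proof (rule mult_right_mono)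
      have "card {d. d \<le> k \<and> k' < int d} \<le> card {..k}" by (rule card_mono) auto
      then show "real (card {d. d \<le> k \<and> k' < int d}) \<le> real k + 1" by simp
      show "0 \<le> hom_const k * lam * \<mu> powr (real_of_int k' + 1)" using lam hom_const_ge[of k] by simp
    qed
    finally show ?thesis by (simp add: mult_ac)
  qed
  ultimately show ?thesis by blast
qed

text \<open>Iterating \<open>P(x) = P(x + v) - (P(x + v) - P(x))\<close> extrapolates from \<open>x + v, x + 2 v, \<dots>\<close> to \<open>x\<close>.\<close>

lemma polys_extrapolate:
  assumes "P \<in> polys (int k)" and "\<And>j. 1 \<le> j \<Longrightarrow> j \<le> Suc k \<Longrightarrow> cmod (P (x + real j *\<^sub>R v)) \<le> lam"
  shows "cmod (P x) \<le> (2 ^ Suc k - 1) * lam"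
  using assms
proof (induction k arbitrary: P lam)
  case 0
  have "(\<lambda>y. P (y + v) - P y) = (\<lambda>y. 0)" using polys_neg[OF polys_difference[OF 0(1)]] by simp
  then have "P (x + v) = P x" by (metis eq_iff_diff_eq_0)
  then show ?case using 0(2)[of 1] by simp
next
  case (Suc k)
  \<comment> \<open>The difference has lower degree and obeys the bound \<open>2 * lam\<close> at
    the points needed. The constants therefore follow c(k + 1) = 1 + 2 c(k).\<close>
  have "(\<lambda>y. P (y + v) - P y) \<in> polys (int k)" using polys_difference[OF Suc.prems(1), of v] by simp
  then have "cmod (P (x + v) - P x) \<le> (2 ^ Suc k - 1) * (2 * lam)"
  proof (rule Suc.IH)
    fix j assume j: "1 \<le> j" "j \<le> Suc k"
    have "x + real j *\<^sub>R v + v = x + real (Suc j) *\<^sub>R v" by (simp add: algebra_simps)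
    then have "cmod (P (x + real j *\<^sub>R v + v) - P (x + real j *\<^sub>R v))
        \<le> cmod (P (x + real (Suc j) *\<^sub>R v)) + cmod (P (x + real j *\<^sub>R v))"
      by (simp only: norm_triangle_ineq4)
    also have "\<dots> \<le> 2 * lam" using Suc.prems(2)[of j] Suc.prems(2)[of "Suc j"] j by simp
    finally show "cmod (P (x + real j *\<^sub>R v + v) - P (x + real j *\<^sub>R v)) \<le> 2 * lam" .
  qed
  moreover have "cmod (P (x + v)) \<le> lam" using Suc.prems(2)[of 1] by simp
  moreover have "cmod (P x) \<le> cmod (P (x + v)) + cmod (P (x + v) - P x)"
    using norm_triangle_ineq4[of "P (x + v)" "P (x + v) - P x"] by simp
  ultimately have "cmod (P x) \<le> lam + (2 ^ Suc k - 1) * (2 * lam)" by linarith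
  then show ?case by (simp add: algebra_simps)
qed

subsection \<open>Cubes and local integrals\<close>

text \<open>Half-open, so that the dyadic children partition a cube exactly and no boundary null
  sets occur.\<close>

definition cube :: "real ^ 'n \<Rightarrow> real \<Rightarrow> (real ^ 'n::finite) set"
  where "cube x l = {y. \<forall>i. x $ i \<le> y $ i \<and> y $ i < x $ i + l}"

lemma borel_imp_lebesgue: "A \<in> sets borel \<Longrightarrow> A \<in> sets lebesgue"
  by (simp add: sets_completionI_sets)

lemma cube_borel [measurable]: "cube x l \<in> sets borel"
proof -
  have "cube x l = (\<Inter>i. {y. x $ i \<le> y $ i} \<inter> {y. y $ i < x $ i + l})" by (auto simp: cube_def)
  also have "\<dots> \<in> sets borel"
    by (intro sets.countable_INT'' sets.Int borel_closed borel_open)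
      (auto intro: closed_halfspace_component_ge_cart open_halfspace_component_lt_cart)
  finally show ?thesis .
qed

lemma cube_lebesgue [measurable, simp]: "cube x l \<in> sets lebesgue"
  by (rule borel_imp_lebesgue) (rule cube_borel)

lemma emeasure_cube:
  fixes x :: "real ^ 'n::finite"
  assumes "0 \<le> l" shows "emeasure lebesgue (cube x l) = ennreal (l ^ CARD('n))"
proof (cases "l = 0")
  case True
  then have "cube x l = {}" by (auto simp: cube_def)
  then show ?thesis using True by simp
next
  case False
  then have l: "0 < l" using assms by simp
  let ?b = "x + (\<chi> i. l)"
  have sub: "box x ?b \<subseteq> cube x l" "cube x l \<subseteq> cbox x ?b"
    by (auto simp: cube_def mem_box_cart less_imp_le)
  have "cbox x ?b \<noteq> {}" using l by (auto simp: cbox_interval interval_ne_empty_cart less_eq_vec_def)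
  from content_cbox_cart[OF this] have c: "measure lborel (cbox x ?b) = l ^ CARD('n)" by simp
  have cb: "emeasure lebesgue (cbox x ?b) = ennreal (l ^ CARD('n))"
    using c emeasure_eq_ennreal_measure[of lborel "cbox x ?b"] emeasure_lborel_cbox_finite[of x ?b] by auto
  have "emeasure lebesgue (box x ?b) = emeasure lebesgue (cbox x ?b)"
    by (simp add: emeasure_lborel_box_eq emeasure_lborel_cbox_eq)
  moreover have "emeasure lebesgue (box x ?b) \<le> emeasure lebesgue (cube x l)"
    using sub by (intro emeasure_mono) auto
  moreover have "emeasure lebesgue (cube x l) \<le> emeasure lebesgue (cbox x ?b)"
    using sub by (intro emeasure_mono) auto
  ultimately show ?thesis using cb by simp
qed

lemma cube_segment:
  assumes "y \<in> cube x l" "z \<in> cube x l" "0 \<le> t" "t \<le> 1"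
  shows "z + t *\<^sub>R (y - z) \<in> cube x l"
  unfolding cube_def
proof safe
  fix i
  have y: "x $ i \<le> y $ i" "y $ i < x $ i + l" and z: "x $ i \<le> z $ i" "z $ i < x $ i + l"
    using assms by (auto simp: cube_def)
  have e: "(z + t *\<^sub>R (y - z)) $ i = (1 - t) * z $ i + t * y $ i" by (simp add: algebra_simps)
  have "(1 - t) * x $ i + t * x $ i \<le> (1 - t) * z $ i + t * y $ i"
    using y z assms by (intro add_mono mult_left_mono) auto
  then show "x $ i \<le> (z + t *\<^sub>R (y - z)) $ i" unfolding e by (simp add: algebra_simps)
  have "(1 - t) * z $ i + t * y $ i < (1 - t) * (x $ i + l) + t * (x $ i + l)"
  proof (cases "t = 0")
    case False
    then show ?thesis using y z assms by (intro add_le_less_mono mult_left_mono mult_strict_left_mono) auto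
  qed (use z in simp)
  then show "(z + t *\<^sub>R (y - z)) $ i < x $ i + l" unfolding e by (simp add: algebra_simps)
qed

lemma cube_corner: "0 < l \<Longrightarrow> x \<in> cube x l"
  by (simp add: cube_def)

lemma cube_subset: "(\<And>i. a $ i \<le> x $ i) \<Longrightarrow> (\<And>i. x $ i + l \<le> a $ i + m) \<Longrightarrow> cube x l \<subseteq> cube a m"
  unfolding cube_def by (auto intro: order_trans less_le_trans)

text \<open>Extended-real valued, in contrast to the Bochner integrals of
  \<open>campanato_norm\<close>, so estimates carry no integrability conditions. No p-th root is
  taken, which keeps it additive over disjoint cubes also for p < 1.\<close>

definition Lint :: "real \<Rightarrow> (real ^ 'n) set \<Rightarrow> (real ^ 'n::finite \<Rightarrow> complex) \<Rightarrow> ennreal"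
  where "Lint p Q f = (\<integral>\<^sup>+ y. ennreal (cmod (f y) powr p) * indicator Q y \<partial>lebesgue)"

lemma Lint_integrand_measurable [measurable]:
  assumes [measurable]: "f \<in> borel_measurable lebesgue" "Q \<in> sets lebesgue"
  shows "(\<lambda>y. ennreal (cmod (f y) powr p) * indicator Q y) \<in> borel_measurable lebesgue"
  by measurable

lemma Lint_subset: "Q \<subseteq> R \<Longrightarrow> Lint p Q f \<le> Lint p R f"
  unfolding Lint_def by (intro nn_integral_mono) (auto split: split_indicator)

lemma Lint_cong: "(\<And>y. y \<in> Q \<Longrightarrow> f y = g y) \<Longrightarrow> Lint p Q f = Lint p Q g"
  unfolding Lint_def by (rule nn_integral_cong) (auto split: split_indicator)

lemma Lint_bound:
  assumes "\<And>y. y \<in> Q \<Longrightarrow> cmod (f y) \<le> A" "0 < p" "Q \<in> sets lebesgue"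
  shows "Lint p Q f \<le> ennreal (A powr p) * emeasure lebesgue Q"
proof -
  have "Lint p Q f \<le> (\<integral>\<^sup>+ y. ennreal (A powr p) * indicator Q y \<partial>lebesgue)"
    unfolding Lint_def
  proof (rule nn_integral_mono)
    fix y
    show "ennreal (cmod (f y) powr p) * indicator Q y \<le> ennreal (A powr p) * indicator Q y"
      using assms(1)[of y] assms(2) by (cases "y \<in> Q") (auto intro!: ennreal_leI powr_mono2)
  qed
  also have "\<dots> = ennreal (A powr p) * emeasure lebesgue Q"
    using assms(3) by (rule nn_integral_cmult_indicator)
  finally show ?thesis .
qed

lemma Lint_cube_bound:
  fixes x :: "real ^ 'n::finite"
  assumes "\<And>y. y \<in> cube x l \<Longrightarrow> cmod (f y) \<le> A" "0 < p" "0 \<le> l"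
  shows "Lint p (cube x l) f \<le> ennreal (A powr p * l ^ CARD('n))"
proof -
  have "Lint p (cube x l) f \<le> ennreal (A powr p) * emeasure lebesgue (cube x l)"
    using assms by (intro Lint_bound) auto
  then show ?thesis unfolding emeasure_cube[OF assms(3)] using assms(3) by (simp add: ennreal_mult)
qed

section \<open>Quasi-triangle, covering and Markov estimates for local integrals\<close>

lemma powr_add_le:
  fixes a b :: real
  assumes "0 \<le> a" "0 \<le> b" "0 < p"
  shows "(a + b) powr p \<le> 2 powr p * (a powr p + b powr p)"
proof -
  have "(a + b) powr p \<le> (2 * max a b) powr p" using assms by (intro powr_mono2) auto
  also have "\<dots> = 2 powr p * (max a b) powr p" using assms by (simp add: powr_mult)
  also have "(max a b) powr p \<le> a powr p + b powr p" by (simp add: max_def)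
  finally show ?thesis by simp
qed

lemma Lint_add:
  assumes f: "f \<in> borel_measurable lebesgue" and g: "g \<in> borel_measurable lebesgue"
    and "0 < p" and Q: "Q \<in> sets lebesgue"
  shows "Lint p Q (\<lambda>y. f y + g y) \<le> ennreal (2 powr p) * (Lint p Q f + Lint p Q g)"
proof -
  have "Lint p Q (\<lambda>y. f y + g y) \<le> (\<integral>\<^sup>+ y. ennreal (2 powr p) *
      (ennreal (cmod (f y) powr p) * indicator Q y + ennreal (cmod (g y) powr p) * indicator Q y) \<partial>lebesgue)"
    unfolding Lint_def
  proof (rule nn_integral_mono)
    fix y
    have "cmod (f y + g y) powr p \<le> (cmod (f y) + cmod (g y)) powr p"
      using assms(3) by (intro powr_mono2 norm_triangle_ineq) auto
    also have "\<dots> \<le> 2 powr p * (cmod (f y) powr p + cmod (g y) powr p)"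
      using assms(3) by (intro powr_add_le) auto
    finally have "ennreal (cmod (f y + g y) powr p)
        \<le> ennreal (2 powr p) * (ennreal (cmod (f y) powr p) + ennreal (cmod (g y) powr p))"
      by (simp add: ennreal_leI flip: ennreal_mult ennreal_plus)
    then show "ennreal (cmod (f y + g y) powr p) * indicator Q y \<le> ennreal (2 powr p) *
      (ennreal (cmod (f y) powr p) * indicator Q y + ennreal (cmod (g y) powr p) * indicator Q y)"
      by (cases "y \<in> Q") auto
  qed
  also have "\<dots> = ennreal (2 powr p) * (Lint p Q f + Lint p Q g)"
    unfolding Lint_def using f g Q by (subst nn_integral_cmult, measurable) (simp add: nn_integral_add)
  finally show ?thesis .
qed

lemma Lint_add_le:
  assumes "f \<in> borel_measurable lebesgue" "g \<in> borel_measurable lebesgue" "0 < p" "Q \<in> sets lebesgue"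
    and "Lint p Q f \<le> ennreal a" "Lint p Q g \<le> ennreal b" "0 \<le> a" "0 \<le> b"
  shows "Lint p Q (\<lambda>y. f y + g y) \<le> ennreal (2 powr p * (a + b))"
proof -
  have "Lint p Q (\<lambda>y. f y + g y) \<le> ennreal (2 powr p) * (Lint p Q f + Lint p Q g)"
    using assms by (intro Lint_add)
  also have "\<dots> \<le> ennreal (2 powr p) * (ennreal a + ennreal b)"
    using assms by (intro mult_left_mono add_mono) auto
  also have "\<dots> = ennreal (2 powr p * (a + b))" using assms by (simp add: ennreal_mult)
  finally show ?thesis .
qed

lemma Lint_scale:
  assumes "f \<in> borel_measurable lebesgue" "Q \<in> sets lebesgue"
  shows "Lint p Q (\<lambda>y. c * f y) = ennreal (cmod c powr p) * Lint p Q f"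
proof -
  have "Lint p Q (\<lambda>y. c * f y) =
      (\<integral>\<^sup>+ y. ennreal (cmod c powr p) * (ennreal (cmod (f y) powr p) * indicator Q y) \<partial>lebesgue)"
    unfolding Lint_def by (rule nn_integral_cong) (simp add: norm_mult powr_mult ennreal_mult mult.assoc)
  then show ?thesis unfolding Lint_def using assms by (simp add: nn_integral_cmult)
qed

lemma Lint_minus_commute: "Lint p Q (\<lambda>y. f y - g y) = Lint p Q (\<lambda>y. g y - f y)"
  by (simp add: Lint_def norm_minus_commute)

lemma Lint_UN_le:
  assumes "finite I" "\<And>i. i \<in> I \<Longrightarrow> A i \<in> sets lebesgue" "f \<in> borel_measurable lebesgue" "Q \<subseteq> (\<Union>i\<in>I. A i)"
  shows "Lint p Q f \<le> (\<Sum>i\<in>I. Lint p (A i) f)"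
proof -
  have "Lint p Q f \<le> (\<integral>\<^sup>+ y. (\<Sum>i\<in>I. ennreal (cmod (f y) powr p) * indicator (A i) y) \<partial>lebesgue)"
    unfolding Lint_def
  proof (rule nn_integral_mono)
    fix y
    show "ennreal (cmod (f y) powr p) * indicator Q y
      \<le> (\<Sum>i\<in>I. ennreal (cmod (f y) powr p) * indicator (A i) y)"
    proof (cases "y \<in> Q")
      case True
      then obtain i where "i \<in> I" "y \<in> A i" using assms(4) by auto
      then have "ennreal (cmod (f y) powr p) * indicator Q y \<le> ennreal (cmod (f y) powr p) * indicator (A i) y"
        using True by simp
      also have "\<dots> \<le> (\<Sum>i\<in>I. ennreal (cmod (f y) powr p) * indicator (A i) y)"
        using \<open>i \<in> I\<close> assms(1) by (intro member_le_sum) auto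
      finally show ?thesis .
    qed simp
  qed
  also have "\<dots> = (\<Sum>i\<in>I. Lint p (A i) f)"
    unfolding Lint_def using assms by (intro nn_integral_sum) (auto intro: Lint_integrand_measurable)
  finally show ?thesis .
qed

lemma Lint_markov:
  assumes [measurable]: "f \<in> borel_measurable lebesgue" "Q \<in> sets lebesgue" and "0 < p" "0 \<le> lam"
  shows "ennreal (lam powr p) * emeasure lebesgue {y\<in>Q. lam < cmod (f y)} \<le> Lint p Q f"
proof -
  have [measurable]: "{y\<in>Q. lam < cmod (f y)} \<in> sets lebesgue" by measurable
  have "ennreal (lam powr p) * emeasure lebesgue {y\<in>Q. lam < cmod (f y)}
      = (\<integral>\<^sup>+ y. ennreal (lam powr p) * indicator {y\<in>Q. lam < cmod (f y)} y \<partial>lebesgue)"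
    by (simp add: nn_integral_cmult_indicator)
  also have "\<dots> \<le> Lint p Q f"
    unfolding Lint_def using assms(3,4)
    by (intro nn_integral_mono) (auto split: split_indicator intro!: ennreal_leI powr_mono2)
  finally show ?thesis .
qed

lemma measure_le_of_Lint:
  assumes "f \<in> borel_measurable lebesgue" "Q \<in> sets lebesgue" "0 < p" "0 < lam"
    and "Lint p Q f \<le> ennreal a"
  shows "emeasure lebesgue {y\<in>Q. lam < cmod (f y)} \<le> ennreal (a / lam powr p)"
proof -
  let ?e = "emeasure lebesgue {y\<in>Q. lam < cmod (f y)}"
  have l: "0 < lam powr p" using assms(4) by simp
  have "?e = ennreal (1 / lam powr p) * (ennreal (lam powr p) * ?e)"
    using l by (simp flip: mult.assoc ennreal_mult)
  also have "\<dots> \<le> ennreal (1 / lam powr p) * ennreal a"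
    using Lint_markov[OF assms(1-3), of lam] assms(4,5) by (intro mult_left_mono) auto
  also have "\<dots> = ennreal (a / lam powr p)"
    using l by (cases "0 \<le> a") (auto simp: ennreal_neg divide_nonpos_pos simp flip: ennreal_mult)
  finally show ?thesis .
qed

subsection \<open>Remez type estimates\<close>

text \<open>The admissible fraction of bad points: k + 1 preimages, each enlarged by at most (k +
  1)^n, then fill at most half of the cube.\<close>

definition remez :: "nat \<Rightarrow> 'n itself \<Rightarrow> real"
  where "remez k _ = 1 / (2 * (real k + 1) ^ (CARD('n) + 1))"

lemma remez_pos: "0 < remez k TYPE('n)"
  by (simp add: remez_def)

text \<open>The homotheties towards \<open>z\<close> with ratios \<open>j/(k+1)\<close> map most points of the cube into the set
  where \<open>P\<close> is small, so some ray from \<open>z\<close> carries \<open>k+1\<close> equidistant good points.\<close>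

lemma polys_remez:
  fixes x :: "real ^ 'n::finite"
  assumes P: "P \<in> polys (int k)" and l: "0 < l"
    and bad: "emeasure lebesgue {y \<in> cube x l. lam < cmod (P y)} \<le> ennreal (remez k TYPE('n) * l ^ CARD('n))"
    and z: "z \<in> cube x l"
  shows "cmod (P z) \<le> 2 ^ (k + 1) * lam"
proof -
  define N where "N = real k + 1"
  have N: "0 < N" by (simp add: N_def)
  let ?n = "CARD('n)"
  let ?B = "{y \<in> cube x l. lam < cmod (P y)}"
  have [measurable]: "P \<in> borel_measurable borel" using P by (rule polys_borel)
  have B: "?B \<in> sets borel" by measurable
  \<comment> \<open>The points y for which the j-th of the equidistant points on the segment from z
    to y is bad.\<close>
  define A where "A j = {y \<in> cube x l. z + (real j / N) *\<^sub>R (y - z) \<in> ?B}" for j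
  have A: "A j \<in> sets borel" for j
  proof -
    have [measurable]: "(\<lambda>y. z + (real j / N) *\<^sub>R (y - z)) \<in> borel_measurable borel"
      by (intro borel_measurable_continuous_onI continuous_intros)
    have "A j = cube x l \<inter> ((\<lambda>y. z + (real j / N) *\<^sub>R (y - z)) -` ?B \<inter> space borel)" by (auto simp: A_def)
    also have "\<dots> \<in> sets borel" using B by measurable
    finally show ?thesis .
  qed
  \<comment> \<open>The homothety of ratio j/N maps \<open>A j\<close> into the bad set, and its
    volume factor is at least N^(-n).\<close>
  have emA: "emeasure lebesgue (A j) \<le> ennreal (N ^ ?n) * emeasure lebesgue ?B" if "1 \<le> j" for j
  proof -
    let ?r = "real j / N"
    have r: "0 < ?r" using that N by simp
    have "(\<lambda>y. ?r *\<^sub>R y + (z - ?r *\<^sub>R z)) ` A j \<subseteq> ?B"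
      by (auto simp: A_def algebra_simps)
    then have "emeasure lebesgue ((\<lambda>y. ?r *\<^sub>R y + (z - ?r *\<^sub>R z)) ` A j) \<le> emeasure lebesgue ?B"
      using B by (intro emeasure_mono) (auto intro: borel_imp_lebesgue)
    then have "ennreal (?r ^ ?n) * emeasure lebesgue (A j) \<le> emeasure lebesgue ?B"
      unfolding emeasure_lebesgue_affine DIM_cart using r
      by (simp only: abs_of_pos DIM_real mult_1_right ennreal_power less_imp_le)
    then have "ennreal (N ^ ?n) * (ennreal (?r ^ ?n) * emeasure lebesgue (A j)) \<le> ennreal (N ^ ?n) * emeasure lebesgue ?B"
      by (rule mult_left_mono) simp
    moreover have "ennreal (N ^ ?n) * (ennreal (?r ^ ?n) * emeasure lebesgue (A j)) = ennreal (real j ^ ?n) * emeasure lebesgue (A j)"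
      using N by (simp add: power_divide flip: mult.assoc ennreal_mult)
    moreover have "1 * emeasure lebesgue (A j) \<le> ennreal (real j ^ ?n) * emeasure lebesgue (A j)"
      using that by (intro mult_right_mono) (auto simp: one_le_power)
    ultimately show ?thesis by simp
  qed
  have "emeasure lebesgue (\<Union>j\<in>{1..k+1}. A j) \<le> (\<Sum>j\<in>{1..k+1}. emeasure lebesgue (A j))"
    using A by (intro emeasure_subadditive_finite) (auto intro: borel_imp_lebesgue)
  also have "\<dots> \<le> (\<Sum>j\<in>{1..k+1}. ennreal (N ^ ?n) * ennreal (remez k TYPE('n) * l ^ ?n))"
    using bad by (intro sum_mono order_trans[OF emA] mult_left_mono) auto
  also have "\<dots> = ennreal N * (ennreal (N ^ ?n) * ennreal (remez k TYPE('n) * l ^ ?n))"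
    using ennreal_of_nat_eq_real_of_nat[of "k + 1"] by (simp add: N_def add.commute)
  also have "\<dots> = ennreal (l ^ ?n / 2)"
    using N l by (simp add: remez_def flip: ennreal_mult N_def)
  also have "\<dots> < ennreal (l ^ ?n)" using l by (simp add: ennreal_less_iff)
  also have "\<dots> = emeasure lebesgue (cube x l)" using l by (intro emeasure_cube[symmetric]) simp
  finally have "\<not> cube x l \<subseteq> (\<Union>j\<in>{1..k+1}. A j)"
    using A by (meson UN_I borel_imp_lebesgue emeasure_mono finite_atLeastAtMost not_le sets.finite_UN)
  then obtain y where y: "y \<in> cube x l" "\<And>j. 1 \<le> j \<Longrightarrow> j \<le> k + 1 \<Longrightarrow> y \<notin> A j"
    unfolding subset_iff by (metis UN_I atLeastAtMost_iff)
  have "cmod (P z) \<le> (2 ^ Suc k - 1) * lam"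
  proof (rule polys_extrapolate[OF P, where v = "(1 / N) *\<^sub>R (y - z)"])
    fix j assume j: "1 \<le> j" "j \<le> Suc k"
    then have "z + (real j / N) *\<^sub>R (y - z) \<in> cube x l"
      using y(1) z N by (intro cube_segment) (auto simp: N_def)
    moreover have "z + (real j / N) *\<^sub>R (y - z) \<notin> ?B" using y j by (auto simp: A_def)
    ultimately show "cmod (P (z + real j *\<^sub>R (1 / N) *\<^sub>R (y - z))) \<le> lam" by simp
  qed
  \<comment> \<open>The sign of \<open>lam\<close> is not assumed; it follows from the bound just
    obtained.\<close>
  moreover from this have "0 \<le> lam"
    using norm_ge_zero[of "P z"] order_trans
    by (smt (verit) mult_nonneg_nonpos one_le_power power_Suc zero_le_mult_iff one_less_power zero_less_Suc)
  ultimately show ?thesis by (simp add: algebra_simps)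
qed

definition sup_const :: "real \<Rightarrow> nat \<Rightarrow> 'n itself \<Rightarrow> real"
  where "sup_const p k t = 2 ^ (k + 1) * remez k t powr (- 1 / p)"

lemma sup_const_pos: "0 < sup_const p k TYPE('n)"
  using remez_pos[of k, where 'n = 'n] by (simp add: sup_const_def)

text \<open>At the level \<open>remez powr (- 1 / p) * A\<close>, Markov's inequality makes the
  exceptional set no larger than the Remez fraction of the cube. An L^p mean thus controls the
  supremum with a constant independent of the cube, for every p > 0.\<close>

lemma polys_sup_le:
  fixes x :: "real ^ 'n::finite"
  assumes P: "P \<in> polys (int k)" and l: "0 < l" and p: "0 < p" and A: "0 < A"
    and int: "Lint p (cube x l) P \<le> ennreal (A powr p * l ^ CARD('n))"
    and z: "z \<in> cube x l"
  shows "cmod (P z) \<le> sup_const p k TYPE('n) * A"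
proof -
  let ?d = "remez k TYPE('n)"
  define lam where "lam = ?d powr (- 1 / p) * A"
  have d: "0 < ?d" by (rule remez_pos)
  have lam: "0 < lam" using A d by (simp add: lam_def)
  have "lam powr p = A powr p / ?d"
    using d A p by (simp add: lam_def powr_mult powr_powr powr_minus_divide powr_divide)
  then have "A powr p * l ^ CARD('n) / lam powr p = ?d * l ^ CARD('n)" using A d by simp
  then have "emeasure lebesgue {y \<in> cube x l. lam < cmod (P y)} \<le> ennreal (?d * l ^ CARD('n))"
    using measure_le_of_Lint[OF polys_measurable[OF P] cube_lebesgue p lam int] by simp
  from polys_remez[OF P l this z] show ?thesis by (simp add: sup_const_def lam_def mult.assoc)
qed

definition compare_const :: "real \<Rightarrow> nat \<Rightarrow> real \<Rightarrow> 'n itself \<Rightarrow> real"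
  where "compare_const p k b t = sup_const p k t * (4 * b powr (CARD('n) / p)) * 4 powr (1 / p)"

lemma compare_const_pos: "0 < b \<Longrightarrow> 0 < compare_const p k b TYPE('n)"
  using sup_const_pos[of p k, where 'n = 'n] by (simp add: compare_const_def)

text \<open>Write \<open>P - P'\<close> as the sum of \<open>P - f\<close> and
  \<open>f - P'\<close>; restricting the second mean to the smaller cube costs the volume ratio b^n.
  Both polynomials only have to approximate the same f, so this replaces any canonical choice of a
  best approximation.\<close>

lemma polys_compare:
  fixes x :: "real ^ 'n::finite"
  assumes P: "P \<in> polys (int k)" and P': "P' \<in> polys (int k)" and f: "f \<in> borel_measurable lebesgue"
    and p: "0 < p" and l: "0 < l" and A: "0 < A" and sub: "cube x l \<subseteq> cube x' l'" and m: "0 \<le> l'" "l' \<le> b * l" "1 \<le> b"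
    and 1: "Lint p (cube x l) (\<lambda>y. f y - P y) \<le> ennreal (A powr p * l ^ CARD('n))"
    and 2: "Lint p (cube x' l') (\<lambda>y. f y - P' y) \<le> ennreal (A powr p * l' ^ CARD('n))"
    and z: "z \<in> cube x l"
  shows "cmod (P z - P' z) \<le> compare_const p k b TYPE('n) * A"
proof -
  let ?n = "CARD('n)"
  note [measurable] = polys_measurable[OF P] polys_measurable[OF P'] f
  have "Lint p (cube x l) (\<lambda>y. f y - P' y) \<le> ennreal (A powr p * l' ^ CARD('n))"
    using Lint_subset[OF sub] 2 order_trans by blast
  also have "\<dots> \<le> ennreal (A powr p * (b * l) ^ ?n)"
    using m l by (intro ennreal_leI mult_left_mono power_mono) auto
  finally have 3: "Lint p (cube x l) (\<lambda>y. f y - P' y) \<le> ennreal (A powr p * (b * l) ^ ?n)" .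
  have 4: "Lint p (cube x l) (\<lambda>y. P y - f y) \<le> ennreal (A powr p * l ^ ?n)"
    using 1 by (simp add: Lint_minus_commute[of p _ f P])
  have "Lint p (cube x l) (\<lambda>y. (P y - f y) + (f y - P' y)) \<le> ennreal (2 powr p * (A powr p * l ^ ?n + A powr p * (b * l) ^ ?n))"
    using 3 4 p A l m by (intro Lint_add_le) auto
  also have "\<dots> \<le> ennreal ((4 * b powr (?n / p) * A * 4 powr (1/p)) powr p * l ^ ?n)"
  proof (rule ennreal_leI)
    have b: "(b powr (?n / p)) powr p = b ^ ?n" using m p by (simp add: powr_powr powr_realpow)
    have "l ^ ?n \<le> (b * l) ^ ?n" using m(3) l mult_right_mono[of 1 b l] by (intro power_mono) auto
    then have "2 powr p * (A powr p * l ^ ?n + A powr p * (b * l) ^ ?n)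
      \<le> 2 powr p * (A powr p * (b * l) ^ ?n + A powr p * (b * l) ^ ?n)"
      by (intro mult_left_mono add_mono) auto
    also have "\<dots> = 2 * (2 powr p * A powr p * (b ^ ?n) * l ^ ?n)" by (simp add: power_mult_distrib)
    also have "\<dots> \<le> 4 * (4 powr p * A powr p * (b ^ ?n) * l ^ ?n)"
      using p m l A by (intro mult_mono powr_mono2) auto
    also have "\<dots> = (4 * b powr (?n / p) * A * 4 powr (1/p)) powr p * l ^ ?n"
      using p A m(3) by (simp add: powr_mult powr_powr powr_realpow)
    finally show "2 powr p * (A powr p * l ^ ?n + A powr p * (b * l) ^ ?n)
      \<le> (4 * b powr (?n / p) * A * 4 powr (1/p)) powr p * l ^ ?n" .
  qed
  finally have "Lint p (cube x l) (\<lambda>y. P y - P' y) \<le> ennreal ((4 * b powr (?n / p) * A * 4 powr (1/p)) powr p * l ^ ?n)"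
    by simp
  from polys_sup_le[OF polys_diff[OF P P'] l p _ this z] show ?thesis
    using A m by (simp add: compare_const_def mult_ac)
qed

subsection \<open>Campanato conditions on cubes\<close>

text \<open>The parameter s is the smoothness n (\<tau> - 1/p), and \<open>M * l powr s\<close>
  bounds the p-mean of f - P over a cube of side l. \<open>M\<close> plays the role of an upper
  bound for the quasi-norm, and the infimum over P is replaced by existence.\<close>

definition camp :: "real \<Rightarrow> real \<Rightarrow> int \<Rightarrow> real \<Rightarrow> (real ^ 'n::finite \<Rightarrow> complex) \<Rightarrow> bool"
  where "camp p s k M f \<longleftrightarrow> f \<in> borel_measurable lebesgue \<and>
    (\<forall>x. Lint p (cube x 1) f \<le> ennreal (M powr p)) \<and>
    (\<forall>x l. 0 < l \<longrightarrow> l \<le> 1 \<longrightarrow> (\<exists>P\<in>polys k.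
       Lint p (cube x l) (\<lambda>y. f y - P y) \<le> ennreal ((M * l powr s) powr p * l ^ CARD('n))))"

lemma campD:
  fixes f :: "real ^ 'n::finite \<Rightarrow> complex"
  assumes "camp p s k M f"
  shows "f \<in> borel_measurable lebesgue" "Lint p (cube x 1) f \<le> ennreal (M powr p)"
    and "0 < l \<Longrightarrow> l \<le> 1 \<Longrightarrow> \<exists>P\<in>polys k.
       Lint p (cube x l) (\<lambda>y. f y - P y) \<le> ennreal ((M * l powr s) powr p * l ^ CARD('n))"
  using assms by (auto simp: camp_def)

text \<open>Multiplicative constants in front of the integrals are absorbed into \<open>M\<close>.\<close>

lemma campI:
  fixes f :: "real ^ 'n::finite \<Rightarrow> complex"
  assumes "f \<in> borel_measurable lebesgue" "0 < p" "0 < M" "0 < B"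
    and "\<And>x. Lint p (cube x 1) f \<le> ennreal (B * M powr p)"
    and "\<And>x l. 0 < l \<Longrightarrow> l \<le> 1 \<Longrightarrow> \<exists>P\<in>polys k.
       Lint p (cube x l) (\<lambda>y. f y - P y) \<le> ennreal (B * ((M * l powr s) powr p * l ^ CARD('n)))"
  shows "camp p s k (B powr (1 / p) * M) f"
proof -
  have B: "(B powr (1 / p)) powr p = B" using assms(2,4) by (simp add: powr_powr)
  have "(B powr (1 / p) * M) powr p = B * M powr p"
    using assms(3) by (simp add: powr_mult B)
  moreover have "(B powr (1 / p) * M * l powr s) powr p = B * (M * l powr s) powr p" if "0 < l" for l
    using assms(3) that by (simp add: powr_mult B)
  ultimately show ?thesis
    using assms(1,5,6) unfolding camp_def by (simp add: mult.assoc)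
qed

section \<open>Independence of the degree of the approximating polynomials\<close>

lemma dyadic_scale:
  fixes l :: real
  assumes "0 < l" "l \<le> 1"
  obtains m :: nat where "2 powr (- real (Suc m)) < l" "l \<le> 2 powr (- real m)"
proof -
  define m where "m = nat \<lfloor>- log 2 l\<rfloor>"
  have "0 \<le> - log 2 l" using assms by simp
  then have m: "real m \<le> - log 2 l" "- log 2 l < real m + 1" unfolding m_def by linarith+
  have l: "2 powr (log 2 l) = l" using assms by simp
  have "2 powr (- real (Suc m)) < 2 powr (log 2 l)" using m by (intro powr_less_mono) auto
  moreover have "2 powr (log 2 l) \<le> 2 powr (- real m)" using m by (intro powr_mono) auto
  ultimately show ?thesis using that l by simp
qed

lemma powr_abs_le: "(1::real) \<le> a \<Longrightarrow> a powr s \<le> a powr \<bar>s\<bar>"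
  by (intro powr_mono) auto

lemma powr_scale_le:
  fixes l h :: real
  assumes "0 < l" "l \<le> h" "h \<le> 2 * l"
  shows "h powr s \<le> 2 powr \<bar>s\<bar> * l powr s"
proof -
  have "h powr s = (h / l) powr s * l powr s" using assms by (simp add: powr_divide)
  moreover have "(h / l) powr s \<le> 2 powr \<bar>s\<bar>"
  proof -
    have "(h / l) powr s \<le> (h / l) powr \<bar>s\<bar>" using assms by (intro powr_abs_le) auto
    also have "\<dots> \<le> 2 powr \<bar>s\<bar>" using assms by (intro powr_mono2) (auto simp: divide_simps)
    finally show ?thesis .
  qed
  ultimately show ?thesis by (simp add: mult_right_mono)
qed

lemma geometric_sum_le:
  fixes q :: real
  assumes "0 \<le> q" "q < 1" "finite A" "inj_on g A"
  shows "(\<Sum>j\<in>A. q ^ g j) \<le> 1 / (1 - q)"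
proof -
  have "(\<Sum>j\<in>A. q ^ g j) = (\<Sum>i\<in>g ` A. q ^ i)" using assms by (simp add: sum.reindex)
  also have "\<dots> \<le> (\<Sum>i. q ^ i)" using assms by (intro sum_le_suminf summable_geometric) auto
  also have "\<dots> = 1 / (1 - q)" using assms by (intro suminf_geometric) auto
  finally show ?thesis .
qed

lemma cube_scale: "0 < \<mu> \<Longrightarrow> x + (1 / \<mu>) *\<^sub>R (y - x) \<in> cube x l \<longleftrightarrow> y \<in> cube x (\<mu> * l)"
proof -
  assume m: "0 < \<mu>"
  have "(x + (1 / \<mu>) *\<^sub>R (y - x)) $ i < x $ i + l \<longleftrightarrow> y $ i < x $ i + \<mu> * l" for i
    using m by (simp add: pos_divide_less_eq algebra_simps)
  moreover have "x $ i \<le> (x + (1 / \<mu>) *\<^sub>R (y - x)) $ i \<longleftrightarrow> x $ i \<le> y $ i" for i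
    using m by (simp add: zero_le_divide_iff)
  ultimately show ?thesis by (simp add: cube_def)
qed

text \<open>The approximating polynomials on dyadic cubes are telescoped from scale 1 down; the parts of
  degree larger than \<open>s\<close> of the increments are dominated by a geometric series.\<close>

lemma camp_degree:
  assumes p: "0 < p" and k': "-1 \<le> k'" "s < real_of_int k' + 1"
  shows "\<exists>C>0. \<forall>(f :: real ^ 'n::finite \<Rightarrow> complex) M. 0 < M \<longrightarrow> camp p s k M f \<longrightarrow> camp p s k' (C * M) f"
proof -
  let ?n = "CARD('n)"
  \<comment> \<open>For negative k the only polynomial is 0, so a natural number bounds the degree
    in every case.\<close>
  define K where "K = nat k"
  define c1 where "c1 = compare_const p K 2 TYPE('n) * 2 powr \<bar>s\<bar>"
  define c2 where "c2 = (real K + 1) * hom_const K * c1 * 2 powr (real_of_int k' + 1)"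
  define q where "q = 2 powr (s - (real_of_int k' + 1))"
  define c3 where "c3 = c2 * (1 / (1 - q))"
  \<comment> \<open>Collects the quasi-triangle inequality at the dyadic side \<open>h m\<close> and
    the passage from \<open>h m\<close> to l, which costs 2^n in volume and 2^|s| in the
    power.\<close>
  define B where "B = 2 powr p * (1 + c3 powr p) * (2 powr \<bar>s\<bar>) powr p * 2 ^ ?n + 1"
  have c1: "0 < c1" using compare_const_pos[of 2 p K, where 'n = 'n] by (simp add: c1_def)
  have c2: "0 < c2" using c1 hom_const_ge[of K] by (simp add: c2_def)
  have q: "0 < q" "q < 1" using k' powr_less_mono[of "s - (real_of_int k' + 1)" 0 2] by (auto simp: q_def)
  have c3: "0 < c3" using c2 q by (simp add: c3_def)
  have B: "1 \<le> B" by (simp add: B_def)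
  have main: "camp p s k' (B powr (1 / p) * M) f" if M: "0 < M" and f: "camp p s k M f"
    for M and f :: "real ^ 'n \<Rightarrow> complex"
  proof (rule campI)
    show fm [measurable]: "f \<in> borel_measurable lebesgue" using f by (rule campD)
    show "Lint p (cube x 1) f \<le> ennreal (B * M powr p)" for x
      using campD(2)[OF f, of x] B mult_right_mono[OF B, of "M powr p"]
      by (elim order_trans) (auto intro!: ennreal_leI)
    fix x :: "real ^ 'n" and l :: real assume l: "0 < l" "l \<le> 1"
    define h where "h j = 2 powr (- real j)" for j
    have h: "0 < h j" "h j \<le> 1" "h 0 = 1" "h j = 2 * h (Suc j)" for j
    proof -
      show "h j \<le> 1" using powr_mono[of "- real j" 0 2] by (simp add: h_def)
      show "h j = 2 * h (Suc j)" using powr_add[of 2 1 "- 1 - real j"] by (simp add: h_def)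
    qed (auto simp: h_def)
    obtain m where m: "h (Suc m) < l" "l \<le> h m" using dyadic_scale[OF l] unfolding h_def by blast
    \<comment> \<open>At side 1 the bound over unit cubes makes the zero polynomial admissible, so
      the telescoping sum starts at 0.\<close>
    have "\<forall>j. \<exists>P. P \<in> polys (int K) \<and> (j = 0 \<longrightarrow> P = (\<lambda>_. 0)) \<and>
        Lint p (cube x (h j)) (\<lambda>y. f y - P y) \<le> ennreal ((M * h j powr s) powr p * h j ^ ?n)"
    proof
      fix j
      show "\<exists>P. P \<in> polys (int K) \<and> (j = 0 \<longrightarrow> P = (\<lambda>_. 0)) \<and>
        Lint p (cube x (h j)) (\<lambda>y. f y - P y) \<le> ennreal ((M * h j powr s) powr p * h j ^ ?n)"
      proof (cases "j = 0")
        case True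
        then show ?thesis using campD(2)[OF f, of x] by (intro exI[of _ "\<lambda>_. 0"]) (simp add: h(3) polys_0)
      next
        case False
        obtain P where P: "P \<in> polys k"
          "Lint p (cube x (h j)) (\<lambda>y. f y - P y) \<le> ennreal ((M * h j powr s) powr p * h j ^ ?n)"
          using campD(3)[OF f, of "h j" x] h(1,2) by blast
        then show ?thesis using False polys_mono[OF P(1), of "int K"] by (auto simp: K_def)
      qed
    qed
    then obtain P where P: "\<And>j. P j \<in> polys (int K)" "P 0 = (\<lambda>_. 0)"
      "\<And>j. Lint p (cube x (h j)) (\<lambda>y. f y - P j y) \<le> ennreal ((M * h j powr s) powr p * h j ^ ?n)" by metis
    have D: "cmod (P (Suc j) z - P j z) \<le> c1 * (M * h j powr s)" if z: "z \<in> cube x (h (Suc j))" for j z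
    proof -
      define A where "A = M * (2 powr \<bar>s\<bar> * h j powr s)"
      have A: "0 < A" using M h(1)[of j] by (simp add: A_def)
      have "cmod (P (Suc j) z - P j z) \<le> compare_const p K 2 TYPE('n) * A"
      proof (rule polys_compare[OF P(1) P(1) fm p h(1) A])
        show "cube x (h (Suc j)) \<subseteq> cube x (h j)" using h(4)[of j] h(1)[of "Suc j"] by (intro cube_subset) auto
        have "h (Suc j) powr s = h j powr s * 2 powr (- s)"
          by (simp add: h_def powr_powr algebra_simps flip: powr_add)
        also have "\<dots> \<le> h j powr s * 2 powr \<bar>s\<bar>" by (intro mult_left_mono powr_mono) auto
        finally have "(M * h (Suc j) powr s) powr p \<le> A powr p"
          unfolding A_def using M p by (intro powr_mono2 mult_left_mono) (auto simp: mult.commute)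
        then show "Lint p (cube x (h (Suc j))) (\<lambda>y. f y - P (Suc j) y) \<le> ennreal (A powr p * h (Suc j) ^ ?n)"
          using h(1)[of "Suc j"] by (intro order_trans[OF P(3)] ennreal_leI mult_right_mono) auto
        have "(1::real) \<le> 2 powr \<bar>s\<bar>" by (simp add: ge_one_powr_ge_zero)
        then have "1 * h j powr s \<le> 2 powr \<bar>s\<bar> * h j powr s" by (intro mult_right_mono) auto
        then have "(M * h j powr s) powr p \<le> A powr p"
          unfolding A_def using M p by (intro powr_mono2 mult_left_mono) auto
        then show "Lint p (cube x (h j)) (\<lambda>y. f y - P j y) \<le> ennreal (A powr p * h j ^ ?n)"
          using h(1)[of j] by (intro order_trans[OF P(3)] ennreal_leI mult_right_mono) auto
        show "0 \<le> h j" using h(1)[of j] by simp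
        show "h j \<le> 2 * h (Suc j)" using h(4)[of j] by simp
      qed (use z in auto)
      then show ?thesis by (simp add: A_def c1_def mult_ac)
    qed
    \<comment> \<open>Of each increment only the part of degree at most k' in the expansion about
      the corner x is kept.\<close>
    have "\<exists>T\<in>polys k'. \<forall>y \<mu>. 0 < \<mu> \<longrightarrow> \<mu> \<le> 1 \<longrightarrow> x + (1 / \<mu>) *\<^sub>R (y - x) \<in> cube x (h (Suc j)) \<longrightarrow>
      cmod (P (Suc j) y - P j y - T y) \<le> (real K + 1) * hom_const K * (c1 * (M * h j powr s)) * \<mu> powr (real_of_int k' + 1)" for j
    proof (rule polys_truncate[OF polys_diff[OF P(1) P(1)] k'(1)])
      show "x + t *\<^sub>R (y - x) \<in> cube x (h (Suc j))" if "y \<in> cube x (h (Suc j))" "0 \<le> t" "t \<le> 1" for y t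
        using that h(1) by (intro cube_segment cube_corner)
    qed (use D in auto)
    then obtain T where T: "\<And>j. T j \<in> polys k'"
      "\<And>j y \<mu>. 0 < \<mu> \<Longrightarrow> \<mu> \<le> 1 \<Longrightarrow> x + (1 / \<mu>) *\<^sub>R (y - x) \<in> cube x (h (Suc j)) \<Longrightarrow>
      cmod (P (Suc j) y - P j y - T j y) \<le> (real K + 1) * hom_const K * (c1 * (M * h j powr s)) * \<mu> powr (real_of_int k' + 1)"
      by metis
    \<comment> \<open>From level j to level m the discarded part shrinks with the power k' + 1 of
      the ratio of sides, while \<open>h j powr s\<close> equals \<open>h m powr s\<close> times
      2^((m - j) s). The product decays like \<open>q ^ (m - j)\<close>, and q < 1 because s < k' +
      1.\<close>
    have DT: "cmod (P (Suc j) y - P j y - T j y) \<le> c2 * (M * h m powr s) * q ^ (m - j)"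
      if y: "y \<in> cube x (h m)" and j: "j < m" for y j
    proof -
      let ?mu = "2 powr (- real (m - Suc j))"
      have hm: "h m = ?mu * h (Suc j)" using j by (simp add: h_def of_nat_diff flip: powr_add)
      have "x + (1 / ?mu) *\<^sub>R (y - x) \<in> cube x (h (Suc j))"
        using y unfolding hm by (subst cube_scale) auto
      moreover have "?mu \<le> 1" using powr_mono[of "- real (m - Suc j)" 0 2] by simp
      ultimately have "cmod (P (Suc j) y - P j y - T j y)
          \<le> (real K + 1) * hom_const K * (c1 * (M * h j powr s)) * ?mu powr (real_of_int k' + 1)"
        by (intro T(2)) auto
      also have "\<dots> = (real K + 1) * hom_const K * c1 * M * (h j powr s * ?mu powr (real_of_int k' + 1))" by simp
      also have "h j powr s * ?mu powr (real_of_int k' + 1) = 2 powr (real_of_int k' + 1) * (h m powr s * q ^ (m - j))"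
      proof -
        have "q ^ (m - j) = 2 powr ((s - (real_of_int k' + 1)) * real (m - j))"
          by (simp add: q_def powr_powr flip: powr_realpow)
        then show ?thesis unfolding h_def
          using j by (simp add: powr_powr of_nat_diff algebra_simps flip: powr_add)
      qed
      finally show ?thesis by (simp add: c2_def mult_ac)
    qed
    define S where "S y = (\<Sum>j<m. T j y)" for y
    have S: "S \<in> polys k'" unfolding S_def by (intro polys_sum T)
    have PS: "cmod (P m y - S y) \<le> c3 * (M * h m powr s)" if y: "y \<in> cube x (h m)" for y
    proof -
      have "(\<Sum>j<m. P (Suc j) y - P j y) = P m y" using P(2) by (subst sum_lessThan_telescope) simp
      then have "P m y - S y = (\<Sum>j<m. P (Suc j) y - P j y - T j y)" by (simp add: S_def sum_subtractf)
      then have "cmod (P m y - S y) \<le> (\<Sum>j<m. c2 * (M * h m powr s) * q ^ (m - j))"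
        using DT[OF y] by (auto intro!: sum_norm_le)
      also have "\<dots> = c2 * (M * h m powr s) * (\<Sum>j<m. q ^ (m - j))" by (simp add: sum_distrib_left)
      also have "\<dots> \<le> c2 * (M * h m powr s) * (1 / (1 - q))"
        using q c2 M by (intro mult_left_mono geometric_sum_le) (auto simp: inj_on_def)
      finally show ?thesis by (simp add: c3_def mult_ac)
    qed
    have "Lint p (cube x l) (\<lambda>y. f y - S y) \<le> Lint p (cube x (h m)) (\<lambda>y. (f y - P m y) + (P m y - S y))"
      using m by (simp add: Lint_subset cube_subset)
    also have "\<dots> \<le> ennreal (2 powr p * ((M * h m powr s) powr p * h m ^ ?n + (c3 * (M * h m powr s)) powr p * h m ^ ?n))"
    proof (rule Lint_add_le)
      show "Lint p (cube x (h m)) (\<lambda>y. P m y - S y) \<le> ennreal ((c3 * (M * h m powr s)) powr p * h m ^ ?n)"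
        using PS p h(1)[of m] by (intro Lint_cube_bound) auto
    qed (use P(3)[of m] p h(1)[of m] polys_measurable[OF P(1)[of m]] polys_measurable[OF S] in \<open>auto simp: less_imp_le\<close>)
    also have "2 powr p * ((M * h m powr s) powr p * h m ^ ?n + (c3 * (M * h m powr s)) powr p * h m ^ ?n)
        = 2 powr p * (1 + c3 powr p) * ((M * h m powr s) powr p * h m ^ ?n)"
      using c3 M by (simp add: powr_mult algebra_simps)
    also have "\<dots> \<le> 2 powr p * (1 + c3 powr p) * (((2 powr \<bar>s\<bar>) * (M * l powr s)) powr p * (2 * l) ^ ?n)"
    proof -
      have hl: "h m \<le> 2 * l" using m(1) h(4)[of m] by simp
      then have "M * h m powr s \<le> M * (2 powr \<bar>s\<bar> * l powr s)" using M l m(2) by (intro mult_left_mono powr_scale_le) auto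
      then have "(M * h m powr s) powr p \<le> ((2 powr \<bar>s\<bar>) * (M * l powr s)) powr p"
        using M p by (intro powr_mono2) (auto simp: mult_ac)
      then show ?thesis using hl h(1)[of m] by (intro mult_left_mono mult_mono power_mono) (auto simp: less_imp_le)
    qed
    also have "\<dots> = 2 powr p * (1 + c3 powr p) * (2 powr \<bar>s\<bar>) powr p * 2 ^ ?n * ((M * l powr s) powr p * l ^ ?n)"
      using M by (simp add: powr_mult power_mult_distrib)
    also have "\<dots> \<le> B * ((M * l powr s) powr p * l ^ ?n)"
      unfolding B_def using l by (intro mult_right_mono) auto
    finally have "Lint p (cube x l) (\<lambda>y. f y - S y) \<le> ennreal (B * ((M * l powr s) powr p * l ^ ?n))"
      by (auto intro: ennreal_leI)
    with S show "\<exists>P\<in>polys k'. Lint p (cube x l) (\<lambda>y. f y - P y) \<le> ennreal (B * ((M * l powr s) powr p * l ^ ?n))" by blast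
  qed (use p M B in auto)
  have "0 < B powr (1 / p)" using B by simp
  with main show ?thesis by blast
qed

subsection \<open>Balls versus cubes\<close>

text \<open>If the integral is infinite, the Bochner integral and \<open>enn2real\<close> both take
  the value 0; measurability alone therefore suffices.\<close>

lemma LINT_eq_Lint:
  assumes [measurable]: "f \<in> borel_measurable lebesgue" "Q \<in> sets lebesgue"
  shows "(LINT y:Q|lebesgue. cmod (f y) powr p) = enn2real (Lint p Q f)"
proof -
  have "(LINT y:Q|lebesgue. cmod (f y) powr p) = (\<integral>y. indicator Q y * cmod (f y) powr p \<partial>lebesgue)"
    by (simp add: set_lebesgue_integral_def)
  also have "\<dots> = enn2real (\<integral>\<^sup>+y. ennreal (indicator Q y * cmod (f y) powr p) \<partial>lebesgue)"
    by (rule integral_eq_nn_integral) auto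
  also have "(\<integral>\<^sup>+y. ennreal (indicator Q y * cmod (f y) powr p) \<partial>lebesgue) = Lint p Q f"
    unfolding Lint_def by (rule nn_integral_cong) (simp split: split_indicator)
  finally show ?thesis .
qed

lemma set_integrable_iff_Lint:
  assumes [measurable]: "f \<in> borel_measurable lebesgue" "Q \<in> sets lebesgue"
  shows "set_integrable lebesgue Q (\<lambda>y. cmod (f y) powr p) \<longleftrightarrow> Lint p Q f < \<infinity>"
proof -
  have "(\<integral>\<^sup>+y. ennreal (norm (indicator Q y *\<^sub>R cmod (f y) powr p)) \<partial>lebesgue) = Lint p Q f"
    unfolding Lint_def by (rule nn_integral_cong) (simp split: split_indicator)
  then show ?thesis
    unfolding set_integrable_def integrable_iff_bounded by auto
qed

lemma ball_lebesgue [simp, measurable]: "ball x r \<in> sets lebesgue"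
  by (rule borel_imp_lebesgue) simp

lemma cube_subset_ball:
  fixes x :: "real ^ 'n::finite"
  shows "cube x l \<subseteq> ball x (real CARD('n) * l)"
proof
  fix y assume y: "y \<in> cube x l"
  have "norm (y - x) \<le> (\<Sum>i\<in>UNIV. \<bar>(y - x) $ i\<bar>)" by (rule norm_le_l1_cart)
  also have "\<dots> < (\<Sum>i\<in>(UNIV::'n set). l)"
  proof (rule sum_strict_mono)
    show "\<bar>(y - x) $ i\<bar> < l" for i using y unfolding cube_def by (auto dest!: spec[of _ i])
  qed auto
  finally show "y \<in> ball x (real CARD('n) * l)" by (simp add: dist_norm norm_minus_commute)
qed

lemma ball_subset_cube:
  fixes x :: "real ^ 'n::finite"
  shows "ball x r \<subseteq> cube (x - (\<chi> i. r)) (2 * r)"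
proof
  fix y assume "y \<in> ball x r"
  then have "\<bar>(y - x) $ i\<bar> < r" for i
    using component_le_norm_cart[of "y - x" i] by (simp add: dist_norm norm_minus_commute)
  then have "\<bar>y $ i - x $ i\<bar> < r" for i by simp
  then show "y \<in> cube (x - (\<chi> i. r)) (2 * r)"
    unfolding cube_def by (auto simp: abs_less_iff) (smt (verit))+
qed

text \<open>Compactness covers one unit cube by unit balls and one unit ball by unit cubes.
  Translating these two covers makes their number independent of the position.\<close>

lemma unit_covers:
  obtains N :: nat where "1 \<le> N"
    "\<And>x :: real ^ 'n::finite. \<exists>T. finite T \<and> card T \<le> N \<and> cube x 1 \<subseteq> (\<Union>c\<in>T. ball c 1)"
    "\<And>x :: real ^ 'n::finite. \<exists>T. finite T \<and> card T \<le> N \<and> ball x 1 \<subseteq> (\<Union>c\<in>T. cube c 1)"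
proof -
  have 1: "cbox 0 (\<chi> i. 1) \<subseteq> (\<Union>c\<in>(UNIV :: (real ^ 'n) set). ball c 1)"
  proof
    fix y :: "real ^ 'n"
    have "y \<in> ball y 1" by simp
    then show "y \<in> (\<Union>c\<in>UNIV. ball c 1)" by blast
  qed
  obtain T where T: "finite T" "cbox 0 (\<chi> i. 1) \<subseteq> (\<Union>c\<in>T. ball (c :: real ^ 'n) 1)"
    by (rule compactE_image[OF compact_cbox _ 1]) auto
  have 2: "cball 0 1 \<subseteq> (\<Union>c\<in>(UNIV :: (real ^ 'n) set). box c (c + (\<chi> i. 1)))"
  proof
    fix y :: "real ^ 'n"
    have "y \<in> box (y - (\<chi> i. 1/2)) (y - (\<chi> i. 1/2) + (\<chi> i. 1))" by (simp add: mem_box_cart)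
    then show "y \<in> (\<Union>c\<in>UNIV. box c (c + (\<chi> i. 1)))" by blast
  qed
  obtain U where U: "finite U" "cball 0 1 \<subseteq> (\<Union>c\<in>U. box (c :: real ^ 'n) (c + (\<chi> i. 1)))"
    by (rule compactE_image[OF compact_cball _ 2]) auto
  show ?thesis
  proof
    show "1 \<le> Suc (max (card T) (card U))" by simp
    fix x :: "real ^ 'n"
    have "cube x 1 \<subseteq> (\<Union>c\<in>(+) x ` T. ball c 1)"
    proof
      fix y assume "y \<in> cube x 1"
      then have "y - x \<in> cbox 0 (\<chi> i. 1)" by (auto simp: cube_def mem_box_cart algebra_simps less_imp_le)
      then obtain c where "c \<in> T" "y - x \<in> ball c 1" using T by auto
      then have "y \<in> ball (x + c) 1" by (simp add: dist_norm algebra_simps)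
      then show "y \<in> (\<Union>c\<in>(+) x ` T. ball c 1)" using \<open>c \<in> T\<close> by blast
    qed
    moreover have "card ((+) x ` T) \<le> Suc (max (card T) (card U))"
      using card_image_le[OF T(1), of "(+) x"] by simp
    ultimately show "\<exists>T'. finite T' \<and> card T' \<le> Suc (max (card T) (card U)) \<and> cube x 1 \<subseteq> (\<Union>c\<in>T'. ball c 1)"
      using T(1) by blast
    have "ball x 1 \<subseteq> (\<Union>c\<in>(+) x ` U. cube c 1)"
    proof
      fix y assume "y \<in> ball x 1"
      then have "y - x \<in> cball 0 1" by (simp add: dist_norm norm_minus_commute)
      then obtain c where "c \<in> U" "y - x \<in> box c (c + (\<chi> i. 1))" using U by auto
      then have "x $ i + c $ i \<le> y $ i \<and> y $ i < x $ i + c $ i + 1" for i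
      proof -
        have "c $ i < (y - x) $ i \<and> (y - x) $ i < (c + (\<chi> i. 1)) $ i"
          using \<open>y - x \<in> box c (c + (\<chi> i. 1))\<close> unfolding mem_box_cart by blast
        then show ?thesis by (simp add: algebra_simps)
      qed
      then have "y \<in> cube (x + c) 1" by (simp add: cube_def)
      then show "y \<in> (\<Union>c\<in>(+) x ` U. cube c 1)" using \<open>c \<in> U\<close> by blast
    qed
    moreover have "card ((+) x ` U) \<le> Suc (max (card T) (card U))"
      using card_image_le[OF U(1), of "(+) x"] by simp
    ultimately show "\<exists>T'. finite T' \<and> card T' \<le> Suc (max (card T) (card U)) \<and> ball x 1 \<subseteq> (\<Union>c\<in>T'. cube c 1)"
      using U(1) by blast
  qed
qed

lemma Lint_cover_le:
  assumes "finite T" "card T \<le> N" "\<And>c. c \<in> T \<Longrightarrow> A c \<in> sets lebesgue" "f \<in> borel_measurable lebesgue"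
    and "Q \<subseteq> (\<Union>c\<in>T. A c)" "\<And>c. c \<in> T \<Longrightarrow> Lint p (A c) f \<le> ennreal a" "0 \<le> a"
  shows "Lint p Q f \<le> ennreal (real N * a)"
proof -
  have "Lint p Q f \<le> (\<Sum>c\<in>T. Lint p (A c) f)" using assms by (intro Lint_UN_le)
  also have "\<dots> \<le> (\<Sum>c\<in>T. ennreal a)" using assms by (intro sum_mono)
  also have "\<dots> = ennreal (real (card T) * a)"
    using assms(7) by (simp add: ennreal_of_nat_eq_real_of_nat ennreal_mult)
  also have "\<dots> \<le> ennreal (real N * a)" using assms by (intro ennreal_leI mult_right_mono) auto
  finally show ?thesis .
qed

lemma carrier_campanatoD:
  assumes "f \<in> carrier (campanato \<tau> p k)"
  shows "f \<in> borel_measurable lebesgue" "Lint p (ball x r) f < \<infinity>" "Lint p (cube x l) f < \<infinity>"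
proof -
  show f: "f \<in> borel_measurable lebesgue" using assms by (simp add: campanato_def)
  have K: "Lint p K f < \<infinity>" if "compact K" for K
    using assms that by (simp add: campanato_def set_integrable_iff_Lint[OF f] lmeasurable_compact fmeasurableD)
  show "Lint p (ball x r) f < \<infinity>"
    using K[of "cball x r"] Lint_subset[of "ball x r" "cball x r" p f] by (simp add: ball_subset_cball order_le_less_trans)
  have "cube x l \<subseteq> cball x (real CARD('a) * l)" using cube_subset_ball[of x l] ball_subset_cball by blast
  then show "Lint p (cube x l) f < \<infinity>"
    using K[of "cball x (real CARD('a) * l)"] Lint_subset[of "cube x l" "cball x (real CARD('a) * l)" p f]
    by (simp add: order_le_less_trans)
qed

lemma polys_bounded_ball: "P \<in> polys k \<Longrightarrow> \<exists>B. \<forall>y\<in>ball x r. cmod (P y) \<le> B"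
proof -
  assume P: "P \<in> polys k"
  have "bounded (P ` cball x r)"
    by (intro compact_imp_bounded compact_continuous_image polys_continuous[OF P] compact_cball)
  then obtain B where "\<forall>y\<in>cball x r. cmod (P y) \<le> B" by (auto simp: bounded_iff)
  then show ?thesis using ball_subset_cball by blast
qed

lemma Lint_diff_polys_finite:
  assumes f: "f \<in> borel_measurable lebesgue" and "0 < p" and P: "P \<in> polys k" and "Lint p (ball x r) f < \<infinity>"
  shows "Lint p (ball x r) (\<lambda>y. f y - P y) < \<infinity>"
proof -
  obtain B where B: "\<forall>y\<in>ball x r. cmod (P y) \<le> B" using polys_bounded_ball[OF P] by blast
  have "Lint p (ball x r) (\<lambda>y. - P y) \<le> ennreal (B powr p) * emeasure lebesgue (ball x r)"
    using B assms by (intro Lint_bound) auto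
  also have "\<dots> < \<infinity>" using emeasure_lborel_ball_finite[of x r] by (simp add: ennreal_mult_less_top less_top)
  finally have 2: "Lint p (ball x r) (\<lambda>y. - P y) < \<infinity>" .
  have "Lint p (ball x r) (\<lambda>y. f y + - P y) \<le> ennreal (2 powr p) * (Lint p (ball x r) f + Lint p (ball x r) (\<lambda>y. - P y))"
    using f assms(2) polys_measurable[OF P] by (intro Lint_add) auto
  also have "\<dots> < \<infinity>" using 2 assms(4) by (simp add: ennreal_mult_less_top)
  finally show ?thesis by simp
qed

lemma LINT_powr_nonneg: "0 \<le> (LINT y:Q|M. cmod (g y) powr p)"
  unfolding set_lebesgue_integral_def by (rule integral_nonneg_AE) simp

lemma powr_inverse_le:
  fixes a b p :: real
  assumes "0 < p" "0 \<le> a" "0 \<le> b" shows "a powr (1 / p) \<le> b \<longleftrightarrow> a \<le> b powr p"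
proof
  assume "a powr (1 / p) \<le> b"
  then have "(a powr (1 / p)) powr p \<le> b powr p" using assms by (intro powr_mono2) auto
  then show "a \<le> b powr p" using assms by (simp add: powr_powr)
next
  assume "a \<le> b powr p"
  then have "a powr (1 / p) \<le> (b powr p) powr (1 / p)" using assms by (intro powr_mono2) auto
  then show "a powr (1 / p) \<le> b" using assms by (simp add: powr_powr)
qed

lemma powr_power_collect:
  fixes M l s p e :: real
  assumes "0 < M" "0 < l" "s * p + real n = e"
  shows "(M * l powr s) powr p * l ^ n = M powr p * l powr e"
proof -
  have "l ^ n = l powr real n" using assms by (simp add: powr_realpow)
  then show ?thesis using assms by (simp add: powr_mult powr_powr flip: powr_add)
qed

lemma powr_minus_mult_le:
  fixes m :: real
  assumes "0 < m" "m powr (- t) * a \<le> M" shows "a \<le> M * m powr t"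
proof -
  have "a = m powr t * (m powr (- t) * a)" using assms(1) by (simp add: powr_minus)
  also have "\<dots> \<le> m powr t * M" using assms by (intro mult_left_mono) auto
  finally show ?thesis by (simp add: mult.commute)
qed

definition unit_ball_vol :: "'n::finite itself \<Rightarrow> real"
  where "unit_ball_vol _ = measure lebesgue (ball (0 :: real ^ 'n) 1)"

lemma unit_ball_vol_pos: "0 < unit_ball_vol TYPE('n::finite)"
  unfolding unit_ball_vol_def using content_ball_pos[of 1 "0 :: real ^ 'n"] by simp

lemma measure_ball_eq:
  fixes x :: "real ^ 'n::finite"
  assumes "0 < r" shows "measure lebesgue (ball x r) = unit_ball_vol TYPE('n) * r ^ CARD('n)"
proof -
  have "ball x r = (\<lambda>y. r *\<^sub>R y + x) ` ball 0 1"
  proof -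
    have "(\<lambda>y. r *\<^sub>R y + x) ` ball 0 1 = (+) x ` ((*\<^sub>R) r ` ball 0 1)" by (auto simp: image_image add.commute)
    also have "(*\<^sub>R) r ` ball 0 1 = ball (0 :: real ^ 'n) r" using assms ball_scale[of r 0 1] by simp
    finally show ?thesis by (simp add: image_add_ball)
  qed
  then show ?thesis using assms by (simp add: measure_lebesgue_affine unit_ball_vol_def del: measure_completion)
qed

text \<open>A cube of side l lies in the ball of radius n l about its corner, and |B|^(\<tau> p) is
  l^(n \<tau> p) up to a constant. This is the power occurring in \<open>camp\<close>, because s p +
  n = n \<tau> p.\<close>

lemma campanato_imp_camp:
  fixes p \<tau> :: real
  assumes p: "0 < p" and s: "s = real CARD('n) * (\<tau> - 1 / p)" and t: "0 \<le> \<tau>"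
  shows "\<exists>C>0. \<forall>(f :: real ^ 'n::finite \<Rightarrow> complex) M. 0 < M \<longrightarrow> f \<in> carrier (campanato \<tau> p k) \<longrightarrow>
    campanato_norm \<tau> p k f \<le> ennreal M \<longrightarrow> camp p s k (C * M) f"
proof -
  let ?n = "CARD('n)"
  let ?v = "unit_ball_vol TYPE('n)"
  obtain N :: nat where N: "1 \<le> N"
    "\<And>x :: real ^ 'n. \<exists>T. finite T \<and> card T \<le> N \<and> cube x 1 \<subseteq> (\<Union>c\<in>T. ball c 1)"
    using unit_covers[where 'n = 'n] by metis
  define E where "E = 2 * (?v * real ?n ^ ?n) powr (\<tau> * p)"
  define G where "G = real N * real ?n powr (real ?n * \<tau> * p)"
  define B where "B = real N + E + G"
  have v: "0 < ?v" by (rule unit_ball_vol_pos)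
  have E: "0 \<le> E" and G: "0 \<le> G" by (auto simp: E_def G_def)
  have B: "0 < B" using N(1) E G by (simp add: B_def)
  have "camp p s k (B powr (1 / p) * M) f"
    if M: "0 < M" and fc: "f \<in> carrier (campanato \<tau> p k)" and fn: "campanato_norm \<tau> p k f \<le> ennreal M"
    for f :: "real ^ 'n \<Rightarrow> complex" and M
  proof -
    have fm [measurable]: "f \<in> borel_measurable lebesgue" using fc by (rule carrier_campanatoD)
    define S1 where "S1 x r = ennreal ((LINT y:ball x r|lebesgue. cmod (f y) powr p) powr (1 / p))" for x r
    define S2 where "S2 x r = ennreal (measure lebesgue (ball x r) powr (- \<tau>) *
         (INF P\<in>polys k. LINT y:ball x r|lebesgue. cmod (f y - P y) powr p) powr (1 / p))" for x r
    have S: "S1 x r \<le> ennreal M" "S2 x r \<le> ennreal M" if "0 < r" "r \<le> 1" for x r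
    proof -
      have "S1 x r \<le> (SUP x. SUP r\<in>{0<..1}. S1 x r)"
        by (rule SUP_upper2[of x], simp, rule SUP_upper) (use that in auto)
      also have "\<dots> \<le> campanato_norm \<tau> p k f" by (simp add: campanato_norm_def S1_def)
      finally show "S1 x r \<le> ennreal M" using fn order_trans by blast
      have "S2 x r \<le> (SUP x. SUP r\<in>{0<..1}. S2 x r)"
        by (rule SUP_upper2[of x], simp, rule SUP_upper) (use that in auto)
      also have "\<dots> \<le> campanato_norm \<tau> p k f" by (simp add: campanato_norm_def S2_def)
      finally show "S2 x r \<le> ennreal M" using fn order_trans by blast
    qed
    have 1: "Lint p (ball x r) f \<le> ennreal (M powr p)" if r: "0 < r" "r \<le> 1" for x r
    proof -
      have "(LINT y:ball x r|lebesgue. cmod (f y) powr p) powr (1 / p) \<le> M"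
        using S(1)[OF r, of x] M by (simp add: S1_def ennreal_le_iff)
      then have "enn2real (Lint p (ball x r) f) \<le> M powr p"
        using M p by (subst (asm) powr_inverse_le) (auto simp: LINT_eq_Lint)
      then show ?thesis using carrier_campanatoD(2)[OF fc, of x r]
        by (metis ennreal_enn2real ennreal_leI infinity_ennreal_def)
    qed
    have 2: "\<exists>P\<in>polys k. Lint p (ball x r) (\<lambda>y. f y - P y) \<le> ennreal (2 * (M * (?v * r ^ ?n) powr \<tau>) powr p)"
      if r: "0 < r" "r \<le> 1" for x r
    proof -
      let ?m = "?v * r ^ ?n"
      let ?I = "INF P\<in>polys k. LINT y:ball x r|lebesgue. cmod (f y - P y) powr p"
      have m: "0 < ?m" using v r by simp
      have I: "0 \<le> ?I" using polys_0[of k]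
        by (intro cINF_greatest) (auto intro: LINT_powr_nonneg)
      have "?m powr (- \<tau>) * ?I powr (1 / p) \<le> M"
        using S(2)[OF r, of x] M unfolding S2_def measure_ball_eq[OF r(1)] by (simp add: ennreal_le_iff)
      then have "?I powr (1 / p) \<le> M * ?m powr \<tau>" using powr_minus_mult_le[OF m] by blast
      then have "?I \<le> (M * ?m powr \<tau>) powr p" using M p I by (subst (asm) powr_inverse_le) auto
      \<comment> \<open>The infimum over polynomials need not be attained. Doubling makes the
        inequality strict and so provides an actual polynomial.\<close>
      also have "\<dots> < 2 * (M * ?m powr \<tau>) powr p" using M v r by simp
      finally have less: "?I < 2 * (M * ?m powr \<tau>) powr p" .
      have "\<exists>P\<in>polys k. (LINT y:ball x r|lebesgue. cmod (f y - P y) powr p) < 2 * (M * ?m powr \<tau>) powr p"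
      proof (rule ccontr)
        assume "\<not> ?thesis"
        then have "2 * (M * ?m powr \<tau>) powr p \<le> ?I"
          using polys_0[of k] by (intro cINF_greatest) (auto simp: not_less)
        with less show False by simp
      qed
      then obtain P where P: "P \<in> polys k"
        "(LINT y:ball x r|lebesgue. cmod (f y - P y) powr p) < 2 * (M * ?m powr \<tau>) powr p" by blast
      have "Lint p (ball x r) (\<lambda>y. f y - P y) < \<infinity>"
        using carrier_campanatoD(2)[OF fc] by (intro Lint_diff_polys_finite[OF fm p P(1)])
      moreover have "enn2real (Lint p (ball x r) (\<lambda>y. f y - P y)) \<le> 2 * (M * ?m powr \<tau>) powr p"
        using P polys_measurable[OF P(1)] by (simp add: LINT_eq_Lint)
      ultimately show ?thesis using P(1)
        by (metis ennreal_enn2real ennreal_leI infinity_ennreal_def)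
    qed
    have u: "Lint p (cube x 1) f \<le> ennreal (real N * M powr p)" for x
    proof -
      obtain T where "finite T" "card T \<le> N" "cube x 1 \<subseteq> (\<Union>c\<in>T. ball c 1)" using N(2) by blast
      then show ?thesis using 1 by (intro Lint_cover_le[of T N "\<lambda>c. ball c 1"]) auto
    qed
    show ?thesis
    proof (rule campI)
      show "Lint p (cube x 1) f \<le> ennreal (B * M powr p)" for x
        using E G by (intro order_trans[OF u] ennreal_leI mult_right_mono) (auto simp: B_def)
      fix x :: "real ^ 'n" and l :: real assume l: "0 < l" "l \<le> 1"
      have key: "(M * l powr s) powr p * l ^ ?n = M powr p * l powr (real ?n * \<tau> * p)"
        using M l p by (intro powr_power_collect) (auto simp: s field_simps)
      show "\<exists>P\<in>polys k. Lint p (cube x l) (\<lambda>y. f y - P y) \<le> ennreal (B * ((M * l powr s) powr p * l ^ ?n))"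
      proof (cases "real ?n * l \<le> 1")
        case True
        have "0 < real ?n * l" using l by simp
        from 2[OF this True, of x] obtain P where P: "P \<in> polys k"
          "Lint p (ball x (real ?n * l)) (\<lambda>y. f y - P y) \<le> ennreal (2 * (M * (?v * (real ?n * l) ^ ?n) powr \<tau>) powr p)" by blast
        have "(?v * (real ?n * l) ^ ?n) powr (\<tau> * p) = (?v * real ?n ^ ?n) powr (\<tau> * p) * (l ^ ?n) powr (\<tau> * p)"
          using v l by (simp add: power_mult_distrib powr_mult mult.assoc)
        also have "(l ^ ?n) powr (\<tau> * p) = l powr (real ?n * \<tau> * p)"
          using l by (simp add: powr_powr mult.assoc flip: powr_realpow)
        finally have "2 * (M * (?v * (real ?n * l) ^ ?n) powr \<tau>) powr p = E * (M powr p * l powr (real ?n * \<tau> * p))"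
          using M v l by (simp add: powr_mult powr_powr E_def)
        also have "\<dots> \<le> B * (M powr p * l powr (real ?n * \<tau> * p))"
          unfolding B_def using G by (intro mult_right_mono) auto
        finally have "Lint p (ball x (real ?n * l)) (\<lambda>y. f y - P y) \<le> ennreal (B * ((M * l powr s) powr p * l ^ ?n))"
          unfolding key using P(2) ennreal_leI order_trans by blast
        then have "Lint p (cube x l) (\<lambda>y. f y - P y) \<le> ennreal (B * ((M * l powr s) powr p * l ^ ?n))"
          using Lint_subset[OF cube_subset_ball] order_trans by blast
        with P(1) show ?thesis by blast
      next
        \<comment> \<open>The ball would have radius greater than 1. But then l is bounded below,
          and since \<tau> >= 0 the bound over unit cubes suffices with the zero polynomial.\<close>
        case False
        have "Lint p (cube x l) f \<le> Lint p (cube x 1) f" using l by (intro Lint_subset cube_subset) auto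
        also have "\<dots> \<le> ennreal (real N * M powr p)" by (rule u)
        also have "\<dots> \<le> ennreal (B * (M powr p * l powr (real ?n * \<tau> * p)))"
        proof (rule ennreal_leI)
          let ?e = "real ?n * \<tau> * p"
          have "1 \<le> (real ?n * l) powr ?e" using False t p by (intro ge_one_powr_ge_zero) auto
          also have "\<dots> = real ?n powr ?e * l powr ?e" using l by (simp add: powr_mult)
          finally have "real N * M powr p * 1 \<le> real N * M powr p * (real ?n powr ?e * l powr ?e)"
            by (intro mult_left_mono) auto
          also have "\<dots> = G * (M powr p * l powr ?e)" by (simp add: G_def)
          also have "\<dots> \<le> B * (M powr p * l powr ?e)" unfolding B_def using E by (intro mult_right_mono) auto
          finally show "real N * M powr p \<le> B * (M powr p * l powr ?e)" by simp
        qed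
        finally show ?thesis using polys_0[of k] unfolding key by (intro bexI[of _ "\<lambda>_. 0"]) simp_all
      qed
    qed (use fm p M B in auto)
  qed
  moreover have "0 < B powr (1 / p)" using B by simp
  ultimately show ?thesis by blast
qed

text \<open>A ball of radius r lies in a cube of side 2 r. If 2 r > 1, \<open>camp\<close> says
  nothing about that cube, but the bound on unit balls, obtained from a finite cover, is enough
  because \<tau> >= 0.\<close>

lemma camp_imp_campanato:
  fixes p \<tau> :: real
  assumes p: "0 < p" and s: "s = real CARD('n) * (\<tau> - 1 / p)" and t: "0 \<le> \<tau>"
  shows "\<exists>C>0. \<forall>(f :: real ^ 'n::finite \<Rightarrow> complex) M. 0 < M \<longrightarrow> camp p s k M f \<longrightarrow>
    f \<in> carrier (campanato \<tau> p k) \<and> campanato_norm \<tau> p k f \<le> ennreal (C * M)"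
proof -
  let ?n = "CARD('n)"
  let ?v = "unit_ball_vol TYPE('n)"
  have v: "0 < ?v" by (rule unit_ball_vol_pos)
  obtain N :: nat where N: "1 \<le> N"
    "\<And>x :: real ^ 'n. \<exists>T. finite T \<and> card T \<le> N \<and> ball x 1 \<subseteq> (\<Union>c\<in>T. cube c 1)"
    using unit_covers[where 'n = 'n] by metis
  define C1 where "C1 = real N powr (1 / p)"
  define C2 where "C2 = ?v powr (- \<tau>) * (real N * 2 powr (real ?n * \<tau> * p)) powr (1 / p)"
  have N0: "0 < real N" using N(1) by simp
  have C: "0 < C1" "0 < C2" using N0 v by (auto simp: C1_def C2_def)
  have "f \<in> carrier (campanato \<tau> p k) \<and> campanato_norm \<tau> p k f \<le> ennreal ((C1 + C2) * M)"
    if M: "0 < M" and f: "camp p s k M f" for f :: "real ^ 'n \<Rightarrow> complex" and M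
  proof -
    have fm [measurable]: "f \<in> borel_measurable lebesgue" using f by (rule campD)
    have u: "Lint p (ball x 1) f \<le> ennreal (real N * M powr p)" for x
    proof -
      obtain T where "finite T" "card T \<le> N" "ball x 1 \<subseteq> (\<Union>c\<in>T. cube c 1)" using N(2) by blast
      then show ?thesis using campD(2)[OF f] by (intro Lint_cover_le[of T N "\<lambda>c. cube c 1"]) auto
    qed
    have 1: "(LINT y:ball x r|lebesgue. cmod (f y) powr p) powr (1 / p) \<le> C1 * M" if r: "0 < r" "r \<le> 1" for x r
    proof -
      have "Lint p (ball x r) f \<le> ennreal (real N * M powr p)"
        using Lint_subset[of "ball x r" "ball x 1" p f] u[of x] r by (meson order_trans subset_ball)
      then have "(LINT y:ball x r|lebesgue. cmod (f y) powr p) \<le> real N * M powr p"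
        by (simp add: LINT_eq_Lint enn2real_leI)
      also have "\<dots> = (C1 * M) powr p" using M p N0 by (simp add: C1_def powr_mult powr_powr)
      finally show ?thesis using M C p by (subst powr_inverse_le) (auto simp: LINT_eq_Lint)
    qed
    have 2: "measure lebesgue (ball x r) powr (- \<tau>) *
         (INF P\<in>polys k. LINT y:ball x r|lebesgue. cmod (f y - P y) powr p) powr (1 / p) \<le> C2 * M" if r: "0 < r" "r \<le> 1" for x r
    proof -
      let ?I = "INF P\<in>polys k. LINT y:ball x r|lebesgue. cmod (f y - P y) powr p"
      let ?e = "real ?n * \<tau> * p"
      have I: "0 \<le> ?I" using polys_0[of k]
        by (intro cINF_greatest) (auto intro: LINT_powr_nonneg)
      have "\<exists>P\<in>polys k. Lint p (ball x r) (\<lambda>y. f y - P y) \<le> ennreal (real N * M powr p * (2 * r) powr ?e)"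
      proof (cases "2 * r \<le> 1")
        case True
        obtain P where P: "P \<in> polys k" "Lint p (cube (x - (\<chi> i. r)) (2 * r)) (\<lambda>y. f y - P y)
            \<le> ennreal ((M * (2 * r) powr s) powr p * (2 * r) ^ ?n)"
          using campD(3)[OF f _ True] r by (metis mult_pos_pos zero_less_numeral)
        have "s * p + real ?n = ?e" using p by (simp add: s field_simps)
        then have "(M * (2 * r) powr s) powr p * (2 * r) ^ ?n = M powr p * (2 * r) powr ?e"
          using M r by (intro powr_power_collect) auto
        also have "\<dots> \<le> real N * (M powr p * (2 * r) powr ?e)"
          using N(1) mult_right_mono[of 1 "real N" "M powr p * (2 * r) powr ?e"] by simp
        finally have e: "(M * (2 * r) powr s) powr p * (2 * r) ^ ?n \<le> real N * M powr p * (2 * r) powr ?e"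
          by (simp only: mult.assoc)
        have "Lint p (ball x r) (\<lambda>y. f y - P y) \<le> Lint p (cube (x - (\<chi> i. r)) (2 * r)) (\<lambda>y. f y - P y)"
          by (rule Lint_subset[OF ball_subset_cube])
        also note P(2)
        also note ennreal_leI[OF e]
        finally have "Lint p (ball x r) (\<lambda>y. f y - P y) \<le> ennreal (real N * M powr p * (2 * r) powr ?e)" .
        with P(1) show ?thesis by blast
      next
        case False
        have "Lint p (ball x r) f \<le> ennreal (real N * M powr p)"
          using Lint_subset[of "ball x r" "ball x 1" p f] u[of x] r by (meson order_trans subset_ball)
        also have "\<dots> \<le> ennreal (real N * M powr p * (2 * r) powr ?e)"
        proof (rule ennreal_leI)
          have "1 \<le> (2 * r) powr ?e" using False t p by (intro ge_one_powr_ge_zero) auto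
          then show "real N * M powr p \<le> real N * M powr p * (2 * r) powr ?e"
            using mult_left_mono[of 1 "(2 * r) powr ?e" "real N * M powr p"] by simp
        qed
        finally show ?thesis using polys_0[of k] by (intro bexI[of _ "\<lambda>_. 0"]) simp_all
      qed
      then obtain P where P: "P \<in> polys k"
        "Lint p (ball x r) (\<lambda>y. f y - P y) \<le> ennreal (real N * M powr p * (2 * r) powr ?e)" by blast
      have "?I \<le> (LINT y:ball x r|lebesgue. cmod (f y - P y) powr p)"
        using P(1) by (intro cINF_lower) (auto intro!: bdd_belowI[of _ 0] LINT_powr_nonneg)
      also have "\<dots> \<le> real N * M powr p * (2 * r) powr ?e"
        using P(2) polys_measurable[OF P(1)] by (simp add: LINT_eq_Lint enn2real_leI)
      finally have "?I powr (1 / p) \<le> (real N * M powr p * (2 * r) powr ?e) powr (1 / p)"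
        using I p by (intro powr_mono2) auto
      also have "\<dots> = (real N * 2 powr ?e) powr (1 / p) * M * r powr (real ?n * \<tau>)"
        using M p r N0 by (simp add: powr_mult powr_powr)
      finally have "(?v * r ^ ?n) powr (- \<tau>) * ?I powr (1 / p)
          \<le> (?v * r ^ ?n) powr (- \<tau>) * ((real N * 2 powr ?e) powr (1 / p) * M * r powr (real ?n * \<tau>))"
        by (intro mult_left_mono) auto
      also have "\<dots> = C2 * M * (r powr (- real ?n * \<tau>) * r powr (real ?n * \<tau>))"
        using v r by (simp add: C2_def powr_mult powr_powr flip: powr_realpow)
      also have "r powr (- real ?n * \<tau>) * r powr (real ?n * \<tau>) = 1" using r by (simp flip: powr_add)
      finally show ?thesis unfolding measure_ball_eq[OF r(1)] by simp
    qed
    have norm: "campanato_norm \<tau> p k f \<le> ennreal ((C1 + C2) * M)"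
    proof -
      have "campanato_norm \<tau> p k f \<le> ennreal (C1 * M) + ennreal (C2 * M)"
        unfolding campanato_norm_def using 1 2 by (intro add_mono SUP_least ennreal_leI) auto
      then show ?thesis using C M by (simp add: distrib_right ennreal_plus)
    qed
    have "Lint p K f < \<infinity>" if K: "compact K" for K
    proof -
      have 1: "K \<subseteq> (\<Union>c\<in>UNIV. ball c 1)" using centre_in_ball[of _ 1] by fastforce
      obtain T where T: "finite T" "K \<subseteq> (\<Union>c\<in>T. ball c 1)"
        by (rule compactE_image[OF K _ 1]) auto
      have "Lint p K f \<le> (\<Sum>c\<in>T. Lint p (ball c 1) f)" using T by (intro Lint_UN_le) auto
      also have "\<dots> < \<infinity>" using u T by (auto simp: less_top[symmetric] top_unique) (metis ennreal_neq_top neq_top_trans)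
      finally show ?thesis .
    qed
    then have "f \<in> carrier (campanato \<tau> p k)"
      using norm by (auto simp: campanato_def set_integrable_iff_Lint lmeasurable_compact fmeasurableD
          intro: order_le_less_trans)
    with norm show ?thesis by blast
  qed
  moreover have "0 < C1 + C2" using C by simp
  ultimately show ?thesis by blast
qed

subsection \<open>Dyadic subdivision\<close>

definition corner :: "real ^ 'n \<Rightarrow> real \<Rightarrow> ('n::finite \<Rightarrow> bool) \<Rightarrow> real ^ 'n"
  where "corner x h e = (\<chi> i. if e i then x $ i + h else x $ i)"

text \<open>Every point lies in exactly one child: the Boolean vector \<open>e0\<close> records in
  which coordinates it belongs to the upper half.\<close>

lemma indicator_cube_children:
  assumes h: "0 < h"
  shows "(indicator (cube x (2 * h)) y :: ennreal) = (\<Sum>e\<in>UNIV. indicator (cube (corner x h e) h) y)"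
proof -
  define e0 where "e0 i \<longleftrightarrow> x $ i + h \<le> y $ i" for i
  have "y \<in> cube (corner x h e) h \<longleftrightarrow> e = e0 \<and> y \<in> cube x (2 * h)" for e
  proof
    assume y: "y \<in> cube (corner x h e) h"
    have "e i = e0 i \<and> x $ i \<le> y $ i \<and> y $ i < x $ i + 2 * h" for i
      using y h unfolding cube_def corner_def e0_def by (auto dest!: spec[of _ i] split: if_splits)
    then show "e = e0 \<and> y \<in> cube x (2 * h)" by (auto simp: cube_def)
  next
    assume y: "e = e0 \<and> y \<in> cube x (2 * h)"
    show "y \<in> cube (corner x h e) h"
      unfolding cube_def
    proof safe
      fix i
      have "x $ i \<le> y $ i" "y $ i < x $ i + 2 * h" using y by (auto simp: cube_def)
      then show "corner x h e $ i \<le> y $ i" "y $ i < corner x h e $ i + h"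
        using y by (auto simp: corner_def e0_def)
    qed
  qed
  then have "(\<Sum>e\<in>UNIV. indicator (cube (corner x h e) h) y)
      = (\<Sum>e\<in>UNIV. if e = e0 then indicator (cube x (2 * h)) y else (0::ennreal))"
    by (intro sum.cong) (auto simp: indicator_def)
  then show ?thesis by simp
qed

lemma emeasure_Int_cube:
  assumes "A \<in> sets lebesgue"
  shows "emeasure lebesgue (A \<inter> cube x l) = (\<integral>\<^sup>+y. indicator A y * indicator (cube x l) y \<partial>lebesgue)"
proof -
  have "emeasure lebesgue (A \<inter> cube x l) = (\<integral>\<^sup>+y. indicator (A \<inter> cube x l) y \<partial>lebesgue)"
    using assms by (intro nn_integral_indicator[symmetric]) auto
  then show ?thesis by (simp only: indicator_inter_arith)
qed

lemma emeasure_cube_children: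
  assumes "0 < h" and A: "A \<in> sets lebesgue"
  shows "emeasure lebesgue (A \<inter> cube x (2 * h)) = (\<Sum>e\<in>UNIV. emeasure lebesgue (A \<inter> cube (corner x h e) h))"
proof -
  have "emeasure lebesgue (A \<inter> cube x (2 * h)) = (\<integral>\<^sup>+y. indicator A y * indicator (cube x (2 * h)) y \<partial>lebesgue)"
    using A by (rule emeasure_Int_cube)
  also have "\<dots> = (\<integral>\<^sup>+y. (\<Sum>e\<in>UNIV. indicator A y * indicator (cube (corner x h e) h) y) \<partial>lebesgue)"
    unfolding indicator_cube_children[OF assms(1)] sum_distrib_left ..
  also have "\<dots> = (\<Sum>e\<in>UNIV. \<integral>\<^sup>+y. indicator A y * indicator (cube (corner x h e) h) y \<partial>lebesgue)"
    using A by (intro nn_integral_sum) auto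
  also have "\<dots> = (\<Sum>e\<in>UNIV. emeasure lebesgue (A \<inter> cube (corner x h e) h))"
    using A by (simp only: emeasure_Int_cube)
  finally show ?thesis .
qed

lemma Lint_cube_children:
  assumes "0 < h" and f: "f \<in> borel_measurable lebesgue"
  shows "Lint p (cube x (2 * h)) f = (\<Sum>e\<in>UNIV. Lint p (cube (corner x h e) h) f)"
  unfolding Lint_def indicator_cube_children[OF assms(1)] sum_distrib_left
  using f by (intro nn_integral_sum) (auto intro!: Lint_integrand_measurable)

subsection \<open>Density of continuous functions\<close>

lemma Lint_dominated:
  fixes u :: "nat \<Rightarrow> real ^ 'n::finite \<Rightarrow> complex"
  assumes [measurable]: "\<And>n. u n \<in> borel_measurable lebesgue" "Q \<in> sets lebesgue" "w \<in> borel_measurable lebesgue"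
    and lim: "AE y in lebesgue. (\<lambda>n. u n y) \<longlonglongrightarrow> 0" and dom: "\<And>n y. y \<in> Q \<Longrightarrow> cmod (u n y) \<le> cmod (w y)"
    and fin: "Lint p Q w < \<infinity>" and p: "0 < p"
  shows "(\<lambda>n. Lint p Q (u n)) \<longlonglongrightarrow> 0"
proof -
  have "(\<lambda>n. Lint p Q (u n)) \<longlonglongrightarrow> (\<integral>\<^sup>+y. 0 \<partial>(lebesgue :: (real ^ 'n) measure))"
    unfolding Lint_def
  proof (rule nn_integral_dominated_convergence)
    show "AE y in lebesgue. ennreal (cmod (u n y) powr p) * indicator Q y \<le> ennreal (cmod (w y) powr p) * indicator Q y" for n
      using dom p by (intro AE_I2) (auto split: split_indicator intro!: ennreal_leI powr_mono2)
    show "(\<integral>\<^sup>+y. ennreal (cmod (w y) powr p) * indicator Q y \<partial>lebesgue) < \<infinity>"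
      using fin by (simp add: Lint_def)
    show "AE y in lebesgue. (\<lambda>n. ennreal (cmod (u n y) powr p) * indicator Q y) \<longlonglongrightarrow> 0"
      using lim
    proof eventually_elim
      case (elim y)
      have "(\<lambda>n. cmod (u n y) powr p) \<longlonglongrightarrow> 0 powr p"
        using tendsto_norm_zero[OF elim] p
        by (intro tendsto_powr2 tendsto_const) auto
      then have "(\<lambda>n. ennreal (cmod (u n y) powr p) * indicator Q y) \<longlonglongrightarrow> ennreal (0 powr p) * indicator Q y"
        by (intro tendsto_mult_ennreal tendsto_ennrealI tendsto_const) (auto simp: indicator_def)
      then show ?case by simp
    qed
  qed auto
  then show ?thesis by simp
qed

definition clip :: "real \<Rightarrow> complex \<Rightarrow> complex"
  where "clip r z = (r / max r (cmod z)) *\<^sub>R z"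

lemma clip_bound: "0 < r \<Longrightarrow> cmod (clip r z) \<le> r"
  by (simp add: clip_def divide_simps max_def)

lemma clip_eq: "0 < r \<Longrightarrow> cmod z \<le> r \<Longrightarrow> clip r z = z"
  by (simp add: clip_def)

lemma clip_diff: "0 < r \<Longrightarrow> cmod (z - clip r z) \<le> cmod z"
proof -
  assume r: "0 < r"
  have "z - clip r z = (1 - r / max r (cmod z)) *\<^sub>R z" by (simp add: clip_def algebra_simps)
  moreover have "\<bar>1 - r / max r (cmod z)\<bar> \<le> 1" using r by (simp add: abs_if divide_simps max_def)
  ultimately show ?thesis using mult_right_mono[of "\<bar>1 - r / max r (cmod z)\<bar>" 1 "cmod z"] by simp
qed

lemma clip_continuous: "0 < r \<Longrightarrow> continuous_on A g \<Longrightarrow> continuous_on A (\<lambda>y. clip r (g y))"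
  unfolding clip_def by (intro continuous_intros continuous_on_max) (auto simp: max_def)

text \<open>A measurable function is an almost everywhere limit of continuous ones. Truncating both
  sides at a common height r makes this convergence dominated on the cube, and truncating f itself
  is harmless because |f| dominates the error. The argument works for every p > 0.\<close>

lemma Lint_dense:
  fixes f :: "real ^ 'n::finite \<Rightarrow> complex"
  assumes f [measurable]: "f \<in> borel_measurable lebesgue" and p: "0 < p" and l: "0 \<le> l"
    and fin: "Lint p (cube x l) f < \<infinity>" and eps: "0 < \<epsilon>"
  obtains g where "continuous_on UNIV g" "Lint p (cube x l) (\<lambda>y. f y - g y) \<le> ennreal \<epsilon>"
proof -
  let ?Q = "cube x l"
  obtain N F where N: "negligible N" and F: "\<And>n. continuous_on UNIV (F n)"
    and lim: "\<And>y. y \<notin> N \<Longrightarrow> (\<lambda>n. F n y) \<longlonglongrightarrow> f y"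
    using measurable_on_iff_borel_measurable[of UNIV f] f unfolding measurable_on_def by auto
  have Fm [measurable]: "F n \<in> borel_measurable lebesgue" for n
    using borel_measurable_continuous_onI[OF F] by (intro measurable_completion) simp
  have cm [measurable]: "(\<lambda>y. clip r (h y)) \<in> borel_measurable lebesgue" if [measurable]: "h \<in> borel_measurable lebesgue" for r h
    unfolding clip_def by measurable
  define \<delta> where "\<delta> = \<epsilon> / (2 * 2 powr p)"
  have d: "0 < \<delta>" using eps by (simp add: \<delta>_def)
  have AEN: "AE y in lebesgue. y \<notin> N"
    using N by (intro AE_not_in) (simp add: negligible_iff_null_sets)
  have "(\<lambda>R. Lint p ?Q (\<lambda>y. f y - clip (real (Suc R)) (f y))) \<longlonglongrightarrow> 0"
  proof (rule Lint_dominated[OF _ _ f])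
    show "AE y in lebesgue. (\<lambda>R. f y - clip (real (Suc R)) (f y)) \<longlonglongrightarrow> 0"
    proof (rule AE_I2)
      fix y
      have "\<forall>R\<ge>nat \<lceil>cmod (f y)\<rceil>. f y - clip (real (Suc R)) (f y) = 0"
      proof safe
        fix R assume "nat \<lceil>cmod (f y)\<rceil> \<le> R"
        then have "cmod (f y) \<le> real (Suc R)" by linarith
        then show "f y - clip (real (Suc R)) (f y) = 0" by (simp add: clip_eq)
      qed
      then have "eventually (\<lambda>R. f y - clip (real (Suc R)) (f y) = 0) sequentially"
        unfolding eventually_sequentially by blast
      then show "(\<lambda>R. f y - clip (real (Suc R)) (f y)) \<longlonglongrightarrow> 0"
        by (rule tendsto_eventually)
    qed
  qed (use fin p clip_diff in auto)
  then have "eventually (\<lambda>R. Lint p ?Q (\<lambda>y. f y - clip (real (Suc R)) (f y)) < ennreal \<delta>) sequentially"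
    using d by (intro order_tendstoD) auto
  then obtain R where R: "Lint p ?Q (\<lambda>y. f y - clip (real (Suc R)) (f y)) < ennreal \<delta>"
    by (auto simp: eventually_sequentially)
  define r where "r = real (Suc R)"
  have r: "0 < r" by (simp add: r_def)
  have "(\<lambda>n. Lint p ?Q (\<lambda>y. clip r (f y) - clip r (F n y))) \<longlonglongrightarrow> 0"
  proof (rule Lint_dominated[where w = "\<lambda>_. of_real (2 * r)"])
    show "AE y in lebesgue. (\<lambda>n. clip r (f y) - clip r (F n y)) \<longlonglongrightarrow> 0"
      using AEN
    proof eventually_elim
      case (elim y)
      have "isCont (clip r) (f y)"
        using clip_continuous[OF r, of UNIV "\<lambda>z. z"] by (simp add: continuous_on_eq_continuous_at)
      then have "(\<lambda>n. clip r (F n y)) \<longlonglongrightarrow> clip r (f y)"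
        using lim[OF elim] by (rule isCont_tendsto_compose)
      then have "(\<lambda>n. clip r (f y) - clip r (F n y)) \<longlonglongrightarrow> clip r (f y) - clip r (f y)"
        by (intro tendsto_diff tendsto_const)
      then show ?case by simp
    qed
    show "cmod (clip r (f y) - clip r (F n y)) \<le> cmod (of_real (2 * r))" for n y
      using norm_triangle_ineq4[of "clip r (f y)" "clip r (F n y)"] clip_bound[OF r, of "f y"] clip_bound[OF r, of "F n y"] r
      by (simp add: norm_mult)
    have "Lint p ?Q (\<lambda>_. of_real (2 * r)) \<le> ennreal ((2 * r) powr p * l ^ CARD('n))"
      using r p l by (intro Lint_cube_bound) (auto simp: norm_mult)
    then show "Lint p ?Q (\<lambda>_. of_real (2 * r)) < \<infinity>" by (simp add: order_le_less_trans)
  qed (use p in auto)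
  then have "eventually (\<lambda>n. Lint p ?Q (\<lambda>y. clip r (f y) - clip r (F n y)) < ennreal \<delta>) sequentially"
    using d by (intro order_tendstoD) auto
  then obtain n where n: "Lint p ?Q (\<lambda>y. clip r (f y) - clip r (F n y)) < ennreal \<delta>"
    by (auto simp: eventually_sequentially)
  have "Lint p ?Q (\<lambda>y. (f y - clip r (f y)) + (clip r (f y) - clip r (F n y))) \<le> ennreal (2 powr p * (\<delta> + \<delta>))"
    using R n d p by (intro Lint_add_le) (auto simp: r_def less_imp_le)
  also have "2 powr p * (\<delta> + \<delta>) = \<epsilon>" by (simp add: \<delta>_def)
  finally have "Lint p ?Q (\<lambda>y. f y - clip r (F n y)) \<le> ennreal \<epsilon>" by simp
  moreover have "continuous_on UNIV (\<lambda>y. clip r (F n y))" using r F by (rule clip_continuous)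
  ultimately show ?thesis using that by blast
qed

subsection \<open>The John--Nirenberg inequality\<close>

text \<open>Height gained per stopping generation: the threshold at which a cube is stopped, plus
  the possible overshoot when the polynomial of a cube is replaced by that of a child.\<close>

definition jn_step :: "real \<Rightarrow> nat \<Rightarrow> 'n itself \<Rightarrow> real"
  where "jn_step p k t = 2 ^ (k + 1) * ((2 / remez k t) powr (1 / p) + (4 / remez k t) powr (1 / p))
    + compare_const p k 2 t"

text \<open>A layer-cake sum: the level set above j times the step plus 1 has relative measure at
  most 2^(-j), and the leading 1 accounts for the values not exceeding 1.\<close>

definition jn_const :: "real \<Rightarrow> real \<Rightarrow> nat \<Rightarrow> 'n itself \<Rightarrow> real"
  where "jn_const q p k t = 1 + (\<Sum>j. ((real j + 1) * jn_step p k t + 1) powr q * (1/2) ^ j)"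

text \<open>The function is normalised so that the oscillation is at most 1 at all dyadic scales.
  The condition \<open>osc\<close> alone does not make the approximations converge to f, since its
  bound does not decrease with the scale; for this \<open>near\<close> compares them with constants,
  up to an error vanishing with the scale.\<close>

locale dyadic_approx =
  fixes f :: "real ^ 'n::finite \<Rightarrow> complex" and p a :: real and k :: nat
    and Pl :: "real ^ 'n \<Rightarrow> nat \<Rightarrow> real ^ 'n \<Rightarrow> complex"
  assumes f [measurable]: "f \<in> borel_measurable lebesgue" and p: "0 < p" and a: "0 < a"
    and Pl: "Pl x m \<in> polys (int k)"
    and osc: "Lint p (cube x (a / 2 ^ m)) (\<lambda>y. f y - Pl x m y) \<le> ennreal ((a / 2 ^ m) ^ CARD('n))"
    and near: "Lint p (cube x (a / 2 ^ m)) (\<lambda>y. f y - Pl x m y)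
      \<le> Lint p (cube x (a / 2 ^ m)) (\<lambda>y. f y - c) + ennreal (1 / 2 ^ m * (a / 2 ^ m) ^ CARD('n))"
    and fin: "Lint p (cube x (a / 2 ^ m)) f < \<infinity>"
begin

definition sd :: "nat \<Rightarrow> real" where "sd m = a / 2 ^ m"

lemma sd: "0 < sd m" "sd m = 2 * sd (Suc m)"
  using a by (auto simp: sd_def)

lemma Pl_meas [measurable]: "Pl x m \<in> borel_measurable lebesgue"
  by (rule polys_measurable[OF Pl])

definition child :: "real ^ 'n \<Rightarrow> nat \<Rightarrow> real ^ 'n \<Rightarrow> real ^ 'n"
  where "child x m y = corner x (sd (Suc m)) (\<lambda>i. x $ i + sd (Suc m) \<le> y $ i)"

text \<open>The approximating polynomial of that descendant, N generations below the cube
  \<open>(x, m)\<close>, which contains y.\<close>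

primrec FN :: "nat \<Rightarrow> real ^ 'n \<Rightarrow> nat \<Rightarrow> real ^ 'n \<Rightarrow> complex"
  where "FN 0 x m y = Pl x m y"
  | "FN (Suc N) x m y = FN N (child x m y) (Suc m) y"

lemma child_eq: "y \<in> cube (corner x (sd (Suc m)) e) (sd (Suc m)) \<Longrightarrow> child x m y = corner x (sd (Suc m)) e"
proof -
  assume y: "y \<in> cube (corner x (sd (Suc m)) e) (sd (Suc m))"
  have "(x $ i + sd (Suc m) \<le> y $ i) = e i" for i
    using y unfolding cube_def corner_def by (auto dest!: spec[of _ i] split: if_splits)
  then show ?thesis by (simp add: child_def)
qed

lemma FN_meas [measurable]: "FN N x m \<in> borel_measurable lebesgue"
proof (induction N arbitrary: x m)
  case 0
  then show ?case using Pl_meas[of x m] by simp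
next
  case (Suc N)
  let ?h = "sd (Suc m)"
  define E where "E e = (\<Inter>i. {y. e i \<longleftrightarrow> x $ i + ?h \<le> y $ i})" for e
  have eq: "FN (Suc N) x m = (\<lambda>y. \<Sum>e\<in>UNIV. indicator (E e) y * FN N (corner x ?h e) (Suc m) y)"
  proof
    fix y
    have "(\<Sum>e\<in>UNIV. indicator (E e) y * FN N (corner x ?h e) (Suc m) y)
      = (\<Sum>e\<in>UNIV. if e = (\<lambda>i. x $ i + ?h \<le> y $ i) then FN N (corner x ?h e) (Suc m) y else 0)"
      by (intro sum.cong) (auto simp: E_def indicator_def)
    then show "FN (Suc N) x m y = (\<Sum>e\<in>UNIV. indicator (E e) y * FN N (corner x ?h e) (Suc m) y)"
      by (simp add: child_def)
  qed
  have E: "E e \<in> sets lebesgue" for e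
  proof -
    have "{y. e i \<longleftrightarrow> x $ i + ?h \<le> y $ i} \<in> sets borel" for i
    proof (cases "e i")
      case True
      then show ?thesis by (auto intro!: borel_closed closed_halfspace_component_ge_cart)
    next
      case False
      then show ?thesis by (auto simp: not_le intro!: borel_open open_halfspace_component_lt_cart)
    qed
    then show ?thesis unfolding E_def by (intro borel_imp_lebesgue sets.countable_INT'') auto
  qed
  show ?case
    unfolding eq by (intro borel_measurable_sum borel_measurable_times borel_measurable_indicator Suc E)
qed

text \<open>Since \<mu>^p = 2/\<delta>, f is farther than \<mu> from its polynomial on at most half
  a Remez fraction \<delta>. Since \<nu>^p = 4/\<delta>, distance \<nu> is exceeded on at most
  \<delta>/4 of the cube, so that one stopping generation gains the factor (2/\<delta>) (\<delta>/4)
  = 1/2.\<close>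

definition "\<delta> = remez k TYPE('n)"
definition "\<mu> = (2 / \<delta>) powr (1 / p)"
definition "\<nu> = (4 / \<delta>) powr (1 / p)"
definition "L1 = 2 ^ (k + 1) * (\<mu> + \<nu>)"
definition "\<kappa> = compare_const p k 2 TYPE('n)"
definition "L = L1 + \<kappa>"

lemma cpos: "0 < \<delta>" "0 < \<mu>" "0 < \<nu>" "0 < L1" "0 < \<kappa>" "0 < L"
proof -
  show d: "0 < \<delta>" by (simp add: \<delta>_def remez_pos)
  then show 1: "0 < \<mu>" "0 < \<nu>" by (auto simp: \<mu>_def \<nu>_def)
  then show 2: "0 < L1" by (simp add: L1_def)
  show "0 < \<kappa>" by (simp add: \<kappa>_def compare_const_pos)
  with 2 show "0 < L" by (simp add: L_def)
qed

lemma em_cube: "emeasure lebesgue (cube (x :: real ^ 'n) (sd m)) = ennreal (sd m ^ CARD('n))"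
  using sd(1)[of m] by (intro emeasure_cube) simp

text \<open>If \<open>Pl x m - P0\<close> exceeds L1 at a single point, the Remez estimate forces it
  to exceed \<mu> + \<nu> on a fraction \<delta> of the cube. On at most half of that fraction f is
  farther than \<mu> from \<open>Pl x m\<close>; on the rest f is farther than \<nu> from
  \<open>P0\<close>.\<close>

lemma stop:
  assumes P0 [measurable]: "P0 \<in> polys (int k)" and z: "z \<in> cube x (sd m)" "L1 < cmod (Pl x m z - P0 z)"
  shows "ennreal (sd m ^ CARD('n)) \<le> ennreal (2 / \<delta>) * emeasure lebesgue {y \<in> cube x (sd m). \<nu> < cmod (f y - P0 y)}"
proof -
  let ?R = "cube x (sd m)"
  let ?lam = "\<mu> + \<nu>"
  have P0m [measurable]: "P0 \<in> borel_measurable lebesgue" by (rule polys_measurable[OF P0])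
  let ?A = "{y \<in> ?R. ?lam < cmod (Pl x m y - P0 y)}"
  let ?B = "{y \<in> ?R. \<mu> < cmod (f y - Pl x m y)}"
  let ?C = "{y \<in> ?R. \<nu> < cmod (f y - P0 y)}"
  have ABC [measurable]: "?A \<in> sets lebesgue" "?B \<in> sets lebesgue" "?C \<in> sets lebesgue" by measurable
  have s: "0 < sd m ^ CARD('n)" using sd(1)[of m] by simp
  have "\<not> emeasure lebesgue ?A \<le> ennreal (\<delta> * sd m ^ CARD('n))"
  proof
    assume "emeasure lebesgue ?A \<le> ennreal (\<delta> * sd m ^ CARD('n))"
    then have "cmod (Pl x m z - P0 z) \<le> 2 ^ (k + 1) * ?lam"
      using polys_remez[OF polys_diff[OF Pl P0] sd(1) _ z(1)] by (simp add: \<delta>_def)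
    with z(2) show False by (simp add: L1_def)
  qed
  then have A: "ennreal (\<delta> * sd m ^ CARD('n)) \<le> emeasure lebesgue ?A" by simp
  have "emeasure lebesgue ?B \<le> ennreal (sd m ^ CARD('n) / \<mu> powr p)"
    using osc[of x m] cpos p by (intro measure_le_of_Lint) (auto simp: sd_def)
  also have "sd m ^ CARD('n) / \<mu> powr p = \<delta> / 2 * sd m ^ CARD('n)"
    using cpos p by (simp add: \<mu>_def powr_powr)
  finally have B: "emeasure lebesgue ?B \<le> ennreal (\<delta> / 2 * sd m ^ CARD('n))" .
  have "?A \<subseteq> ?B \<union> ?C"
  proof
    fix y assume y: "y \<in> ?A"
    have "cmod (Pl x m y - P0 y) \<le> cmod (f y - Pl x m y) + cmod (f y - P0 y)"
      using norm_triangle_ineq4[of "f y - P0 y" "f y - Pl x m y"] by simp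
    then show "y \<in> ?B \<union> ?C" using y by auto
  qed
  then have "emeasure lebesgue ?A \<le> emeasure lebesgue (?B \<union> ?C)" using ABC by (intro emeasure_mono) auto
  also have "\<dots> \<le> emeasure lebesgue ?B + emeasure lebesgue ?C" using ABC by (intro emeasure_subadditive)
  also have "\<dots> \<le> ennreal (\<delta> / 2 * sd m ^ CARD('n)) + emeasure lebesgue ?C" using B by (intro add_right_mono)
  finally have "ennreal (\<delta> / 2 * sd m ^ CARD('n)) + ennreal (\<delta> / 2 * sd m ^ CARD('n)) \<le> ennreal (\<delta> / 2 * sd m ^ CARD('n)) + emeasure lebesgue ?C"
    using A cpos s by (simp flip: ennreal_plus)
  then have "ennreal (\<delta> / 2 * sd m ^ CARD('n)) \<le> emeasure lebesgue ?C"
    unfolding ennreal_add_left_cancel_le by simp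
  then have "ennreal (2 / \<delta>) * ennreal (\<delta> / 2 * sd m ^ CARD('n)) \<le> ennreal (2 / \<delta>) * emeasure lebesgue ?C"
    by (rule mult_left_mono) simp
  then show ?thesis using cpos s by (simp flip: ennreal_mult)
qed

lemma step:
  assumes "z \<in> cube (corner x (sd (Suc m)) e) (sd (Suc m))"
  shows "cmod (Pl (corner x (sd (Suc m)) e) (Suc m) z - Pl x m z) \<le> \<kappa>"
proof -
  have "cmod (Pl (corner x (sd (Suc m)) e) (Suc m) z - Pl x m z) \<le> compare_const p k 2 TYPE('n) * 1"
  proof (rule polys_compare[OF Pl Pl f p sd(1)])
    show "cube (corner x (sd (Suc m)) e) (sd (Suc m)) \<subseteq> cube x (sd m)"
      using sd[of m] sd(1)[of "Suc m"] by (intro cube_subset) (auto simp: corner_def)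
    show "Lint p (cube (corner x (sd (Suc m)) e) (sd (Suc m))) (\<lambda>y. f y - Pl (corner x (sd (Suc m)) e) (Suc m) y)
      \<le> ennreal (1 powr p * sd (Suc m) ^ CARD('n))" using osc[of _ "Suc m"] by (simp add: sd_def)
    show "Lint p (cube x (sd m)) (\<lambda>y. f y - Pl x m y) \<le> ennreal (1 powr p * sd m ^ CARD('n))"
      using osc[of _ m] by (simp add: sd_def)
    show "0 \<le> sd m" using sd(1)[of m] by simp
    show "sd m \<le> 2 * sd (Suc m)" using sd(2)[of m] by simp
  qed (use assms in auto)
  then show ?thesis by (simp add: \<kappa>_def)
qed

text \<open>The inner induction descends to the first cubes on which the approximating polynomial has
  moved by more than \<open>L1\<close>; on these \<open>f - P0\<close> is large on a fixed fraction, and the outer induction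
  applies below them.\<close>

lemma level_sets:
  "emeasure lebesgue {y \<in> cube x (sd m). real j * L < cmod (FN N x m y - Pl x m y)} \<le> ennreal ((1/2) ^ j * sd m ^ CARD('n))"
proof (induction N arbitrary: x m j rule: less_induct)
  case (less N)
  show ?case
  proof (cases j)
    case 0
    have "emeasure lebesgue {y \<in> cube x (sd m). real j * L < cmod (FN N x m y - Pl x m y)} \<le> emeasure lebesgue (cube x (sd m))"
      by (intro emeasure_mono) auto
    then show ?thesis using 0 em_cube[of x m] by simp
  next
    case (Suc i)
    let ?P0 = "Pl x m"
    let ?c = "ennreal ((1/2) ^ i * (2 / \<delta>))"
    \<comment> \<open>On a stopped cube its own polynomial is within L of \<open>?P0\<close>.
      Exceeding \<open>j * L\<close> relative to \<open>?P0\<close> therefore means exceeding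
      \<open>i * L\<close> relative to its own polynomial, to which the outer induction applies;
      \<open>stop\<close> pays for the volume of the cube.\<close>
    have stopcase: "emeasure lebesgue {y \<in> cube x' (sd m'). real j * L < cmod (FN d x' m' y - ?P0 y)}
        \<le> ?c * emeasure lebesgue {y \<in> cube x' (sd m'). \<nu> < cmod (f y - ?P0 y)}"
      if d: "d < N" and z: "z \<in> cube x' (sd m')" "L1 < cmod (Pl x' m' z - ?P0 z)"
        and b: "\<forall>z\<in>cube x' (sd m'). cmod (Pl x' m' z - ?P0 z) \<le> L" for d x' m' z
    proof -
      have "{y \<in> cube x' (sd m'). real j * L < cmod (FN d x' m' y - ?P0 y)}
        \<subseteq> {y \<in> cube x' (sd m'). real i * L < cmod (FN d x' m' y - Pl x' m' y)}"
      proof safe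
        fix y assume y: "y \<in> cube x' (sd m')" "real j * L < cmod (FN d x' m' y - ?P0 y)"
        have "cmod (FN d x' m' y - ?P0 y) \<le> cmod (FN d x' m' y - Pl x' m' y) + cmod (Pl x' m' y - ?P0 y)"
          using norm_triangle_ineq[of "FN d x' m' y - Pl x' m' y" "Pl x' m' y - ?P0 y"] by simp
        moreover have "cmod (Pl x' m' y - ?P0 y) \<le> L" using b y by blast
        moreover have "real j * L = real i * L + L" by (simp add: Suc algebra_simps)
        ultimately show "real i * L < cmod (FN d x' m' y - Pl x' m' y)" using y(2) by linarith
      qed
      then have "emeasure lebesgue {y \<in> cube x' (sd m'). real j * L < cmod (FN d x' m' y - ?P0 y)}
        \<le> emeasure lebesgue {y \<in> cube x' (sd m'). real i * L < cmod (FN d x' m' y - Pl x' m' y)}"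
        by (intro emeasure_mono) auto
      also have "\<dots> \<le> ennreal ((1/2) ^ i * sd m' ^ CARD('n))" by (rule less[OF d])
      also have "\<dots> = ennreal ((1/2) ^ i) * ennreal (sd m' ^ CARD('n))"
        using sd(1)[of m'] by (simp add: ennreal_mult)
      also have "\<dots> \<le> ennreal ((1/2) ^ i) * (ennreal (2 / \<delta>) * emeasure lebesgue {y \<in> cube x' (sd m'). \<nu> < cmod (f y - ?P0 y)})"
        using stop[OF Pl z] by (intro mult_left_mono) auto
      also have "\<dots> = ?c * emeasure lebesgue {y \<in> cube x' (sd m'). \<nu> < cmod (f y - ?P0 y)}"
        unfolding mult.assoc[symmetric] using cpos by (subst ennreal_mult) auto
      finally show ?thesis .
    qed
    \<comment> \<open>The last hypothesis is the overshoot bound inherited from the parent, which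
      has not been stopped; at the root the difference is 0.\<close>
    have S: "emeasure lebesgue {y \<in> cube x' (sd m'). real j * L < cmod (FN d x' m' y - ?P0 y)}
        \<le> ?c * emeasure lebesgue {y \<in> cube x' (sd m'). \<nu> < cmod (f y - ?P0 y)}"
      if "d \<le> N" "d < N \<or> x' = x \<and> m' = m" "\<forall>z\<in>cube x' (sd m'). cmod (Pl x' m' z - ?P0 z) \<le> L" for d x' m'
      using that
    proof (induction d arbitrary: x' m')
      case (0 x' m')
      show ?case
      proof (cases "\<exists>z\<in>cube x' (sd m'). L1 < cmod (Pl x' m' z - ?P0 z)")
        case True
        then obtain z where z: "z \<in> cube x' (sd m')" "L1 < cmod (Pl x' m' z - ?P0 z)" by blast
        \<comment> \<open>The root is never a stopped cube, because there \<open>Pl x' m'\<close>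
          and \<open>?P0\<close> coincide.\<close>
        then have "0 < N" using 0(2) cpos by auto
        from stopcase[OF this z 0(3)] show ?thesis .
      next
        case False
        have "L1 \<le> real j * L"
        proof -
          have "0 \<le> real i * L" using cpos by simp
          then show ?thesis using cpos by (simp add: Suc L_def algebra_simps)
        qed
        with False have e: "{y \<in> cube x' (sd m'). real j * L < cmod (FN 0 x' m' y - ?P0 y)} = {}"
          by (auto simp: not_less)
        show ?thesis unfolding e by simp
      qed
    next
      case (Suc d x' m')
      show ?case
      proof (cases "\<exists>z\<in>cube x' (sd m'). L1 < cmod (Pl x' m' z - ?P0 z)")
        case True
        then obtain z where z: "z \<in> cube x' (sd m')" "L1 < cmod (Pl x' m' z - ?P0 z)" by blast
        then have "Suc d < N" using Suc.prems(2) cpos by auto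
        from stopcase[OF this z Suc.prems(3)] show ?thesis .
      next
        \<comment> \<open>The cube is not stopped, so by \<open>step\<close> its children have
          overshoot at most L. The estimates for the children add up because they partition the
          cube.\<close>
        case False
        let ?h = "sd (Suc m')"
        have h: "sd m' = 2 * ?h" "0 < ?h" by (rule sd)+
        define A where "A = {y \<in> UNIV. real j * L < cmod (FN (Suc d) x' m' y - ?P0 y)}"
        define B where "B = {y \<in> UNIV. \<nu> < cmod (f y - ?P0 y)}"
        have A: "A \<in> sets lebesgue" and B: "B \<in> sets lebesgue"
          unfolding A_def B_def using FN_meas[of "Suc d" x' m'] Pl_meas[of x m] f
          by (measurable; simp)+
        have ch: "emeasure lebesgue (A \<inter> cube (corner x' ?h e) ?h) \<le> ?c * emeasure lebesgue (B \<inter> cube (corner x' ?h e) ?h)" for e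
        proof -
          let ?R = "cube (corner x' ?h e) ?h"
          have sub: "?R \<subseteq> cube x' (sd m')"
            using h by (intro cube_subset) (auto simp: corner_def)
          have "A \<inter> ?R = {y \<in> ?R. real j * L < cmod (FN d (corner x' ?h e) (Suc m') y - ?P0 y)}"
            by (auto simp: A_def child_eq)
          moreover have "B \<inter> ?R = {y \<in> ?R. \<nu> < cmod (f y - ?P0 y)}" by (auto simp: B_def)
          moreover have "\<forall>z\<in>?R. cmod (Pl (corner x' ?h e) (Suc m') z - ?P0 z) \<le> L"
          proof
            fix z assume z: "z \<in> ?R"
            have "cmod (Pl (corner x' ?h e) (Suc m') z - ?P0 z)
              \<le> cmod (Pl (corner x' ?h e) (Suc m') z - Pl x' m' z) + cmod (Pl x' m' z - ?P0 z)"
              using norm_triangle_ineq[of "Pl (corner x' ?h e) (Suc m') z - Pl x' m' z" "Pl x' m' z - ?P0 z"] by simp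
            also have "\<dots> \<le> \<kappa> + L1" using step[OF z] False sub z by (intro add_mono) (auto simp: not_less)
            finally show "cmod (Pl (corner x' ?h e) (Suc m') z - ?P0 z) \<le> L" by (simp add: L_def)
          qed
          ultimately show ?thesis using Suc.IH[of "corner x' ?h e" "Suc m'"] Suc.prems(1) by simp
        qed
        have "emeasure lebesgue (A \<inter> cube x' (sd m')) \<le> (\<Sum>e\<in>UNIV. ?c * emeasure lebesgue (B \<inter> cube (corner x' ?h e) ?h))"
          unfolding h(1) emeasure_cube_children[OF h(2) A] by (intro sum_mono ch)
        also have "\<dots> = ?c * emeasure lebesgue (B \<inter> cube x' (sd m'))"
          unfolding h(1) emeasure_cube_children[OF h(2) B] by (rule sum_distrib_left[symmetric])
        finally show ?thesis by (simp add: A_def B_def Int_def conj_commute del: FN.simps emeasure_completion)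
      qed
    qed
    have "emeasure lebesgue {y \<in> cube x (sd m). real j * L < cmod (FN N x m y - ?P0 y)}
        \<le> ?c * emeasure lebesgue {y \<in> cube x (sd m). \<nu> < cmod (f y - ?P0 y)}"
      using cpos by (intro S) auto
    also have "\<dots> \<le> ?c * ennreal (sd m ^ CARD('n) / \<nu> powr p)"
      using osc[of x m] cpos p by (intro mult_left_mono measure_le_of_Lint) (auto simp: sd_def)
    also have "\<nu> powr p = 4 / \<delta>" using cpos p by (simp add: \<nu>_def powr_powr)
    also have "?c * ennreal (sd m ^ CARD('n) / (4 / \<delta>)) = ennreal ((1/2) ^ j * sd m ^ CARD('n))"
      using cpos sd(1)[of m] by (simp add: Suc flip: ennreal_mult)
    finally show ?thesis .
  qed
qed

text \<open>On a cube of the last generation \<open>near\<close> compares the polynomial with the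
  constant given by the value of g at the corner, and g is within \<eta> of that constant. The
  errors are proportional to volume, hence additive over children; the sum m + N, the scale of the
  last generation, stays fixed in the induction.\<close>

lemma FN_approx:
  assumes g: "continuous_on UNIV g"
  shows "cube x (sd m) \<subseteq> Q \<Longrightarrow>
    (\<And>y z. y \<in> Q \<Longrightarrow> z \<in> Q \<Longrightarrow> (\<And>i. \<bar>y $ i - z $ i\<bar> \<le> sd (m + N)) \<Longrightarrow> cmod (g y - g z) \<le> \<eta>) \<Longrightarrow>
    Lint p (cube x (sd m)) (\<lambda>y. f y - FN N x m y)
      \<le> ennreal (2 powr p) * (Lint p (cube x (sd m)) (\<lambda>y. f y - g y) + ennreal (\<eta> powr p * sd m ^ CARD('n)))
        + ennreal (1 / 2 ^ (m + N) * sd m ^ CARD('n))"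
proof (induction N arbitrary: x m)
  case (0 x m)
  let ?R = "cube x (sd m)"
  have gm [measurable]: "g \<in> borel_measurable lebesgue"
    using borel_measurable_continuous_onI[OF g] by (intro measurable_completion) simp
  have x: "x \<in> ?R" using sd(1) by (rule cube_corner)
  have "Lint p ?R (\<lambda>y. g y - g x) \<le> ennreal (\<eta> powr p * sd m ^ CARD('n))"
  proof (rule Lint_cube_bound)
    fix y assume y: "y \<in> ?R"
    show "cmod (g y - g x) \<le> \<eta>"
    proof (rule 0(2))
      show "\<bar>y $ i - x $ i\<bar> \<le> sd (m + 0)" for i
        using y unfolding cube_def by (auto dest!: spec[of _ i])
    qed (use x y 0(1) in auto)
  qed (use p sd(1)[of m] in auto)
  moreover have "Lint p ?R (\<lambda>y. (f y - g y) + (g y - g x)) \<le> ennreal (2 powr p) * (Lint p ?R (\<lambda>y. f y - g y) + Lint p ?R (\<lambda>y. g y - g x))"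
    using p by (intro Lint_add) auto
  ultimately have "Lint p ?R (\<lambda>y. f y - g x) \<le> ennreal (2 powr p) * (Lint p ?R (\<lambda>y. f y - g y) + ennreal (\<eta> powr p * sd m ^ CARD('n)))"
    by (simp, elim order_trans, intro mult_left_mono add_left_mono) auto
  then have "Lint p ?R (\<lambda>y. f y - g x) + ennreal (1 / 2 ^ m * sd m ^ CARD('n))
      \<le> ennreal (2 powr p) * (Lint p ?R (\<lambda>y. f y - g y) + ennreal (\<eta> powr p * sd m ^ CARD('n))) + ennreal (1 / 2 ^ m * sd m ^ CARD('n))"
    by (rule add_right_mono)
  from order_trans[OF near[of x m "g x", folded sd_def] this] show ?case by simp
next
  case (Suc N x m)
  let ?h = "sd (Suc m)"
  have h: "sd m = 2 * ?h" "0 < ?h" by (rule sd)+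
  have gm [measurable]: "g \<in> borel_measurable lebesgue"
    using borel_measurable_continuous_onI[OF g] by (intro measurable_completion) simp
  have ch: "Lint p (cube (corner x ?h e) ?h) (\<lambda>y. f y - FN (Suc N) x m y)
    \<le> ennreal (2 powr p) * (Lint p (cube (corner x ?h e) ?h) (\<lambda>y. f y - g y) + ennreal (\<eta> powr p * ?h ^ CARD('n)))
        + ennreal (1 / 2 ^ (m + Suc N) * ?h ^ CARD('n))" for e
  proof -
    have "Lint p (cube (corner x ?h e) ?h) (\<lambda>y. f y - FN (Suc N) x m y)
      = Lint p (cube (corner x ?h e) ?h) (\<lambda>y. f y - FN N (corner x ?h e) (Suc m) y)"
      by (intro Lint_cong) (simp add: child_eq)
    also have "\<dots> \<le> ennreal (2 powr p) * (Lint p (cube (corner x ?h e) ?h) (\<lambda>y. f y - g y) + ennreal (\<eta> powr p * ?h ^ CARD('n)))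
        + ennreal (1 / 2 ^ (Suc m + N) * ?h ^ CARD('n))"
    proof (rule Suc.IH)
      have "cube (corner x ?h e) ?h \<subseteq> cube x (sd m)"
        using h by (intro cube_subset) (auto simp: corner_def)
      with Suc.prems(1) show "cube (corner x ?h e) ?h \<subseteq> Q" by blast
    qed (use Suc.prems(2) in simp)
    finally show ?thesis by simp
  qed
  have card: "real (CARD('n \<Rightarrow> bool)) = 2 ^ CARD('n)" by (simp add: card_fun)
  have "Lint p (cube x (sd m)) (\<lambda>y. f y - FN (Suc N) x m y)
    \<le> (\<Sum>e\<in>UNIV. ennreal (2 powr p) * (Lint p (cube (corner x ?h e) ?h) (\<lambda>y. f y - g y) + ennreal (\<eta> powr p * ?h ^ CARD('n)))
        + ennreal (1 / 2 ^ (m + Suc N) * ?h ^ CARD('n)))"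
  proof -
    have meas: "(\<lambda>y. f y - FN (Suc N) x m y) \<in> borel_measurable lebesgue"
      using f FN_meas[of "Suc N" x m] by (rule borel_measurable_diff)
    show ?thesis unfolding h(1) Lint_cube_children[OF h(2) meas] by (intro sum_mono ch)
  qed
  also have "\<dots> = ennreal (2 powr p) * ((\<Sum>e\<in>UNIV. Lint p (cube (corner x ?h e) ?h) (\<lambda>y. f y - g y))
      + of_nat (CARD('n \<Rightarrow> bool)) * ennreal (\<eta> powr p * ?h ^ CARD('n))) + of_nat (CARD('n \<Rightarrow> bool)) * ennreal (1 / 2 ^ (m + Suc N) * ?h ^ CARD('n))"
    by (simp add: sum.distrib flip: sum_distrib_left)
  also have "of_nat (CARD('n \<Rightarrow> bool)) * ennreal (\<eta> powr p * ?h ^ CARD('n)) = ennreal (\<eta> powr p * sd m ^ CARD('n))"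
    unfolding ennreal_of_nat_eq_real_of_nat card h(1) using h(2) by (simp add: power_mult_distrib mult_ac flip: ennreal_mult)
  also have "of_nat (CARD('n \<Rightarrow> bool)) * ennreal (1 / 2 ^ (m + Suc N) * ?h ^ CARD('n)) = ennreal (1 / 2 ^ (m + Suc N) * sd m ^ CARD('n))"
    unfolding ennreal_of_nat_eq_real_of_nat card h(1) using h(2) by (simp add: power_mult_distrib mult_ac flip: ennreal_mult)
  also have "(\<Sum>e\<in>UNIV. Lint p (cube (corner x ?h e) ?h) (\<lambda>y. f y - g y)) = Lint p (cube x (sd m)) (\<lambda>y. f y - g y)"
    unfolding h(1) using f gm by (intro Lint_cube_children[OF h(2), symmetric]) auto
  finally show ?case .
qed

lemma FN_tendsto:
  fixes \<epsilon> :: real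
  assumes eps: "0 < \<epsilon>"
  shows "\<exists>N. Lint p (cube x (sd m)) (\<lambda>y. f y - FN N x m y) \<le> ennreal \<epsilon>"
proof -
  let ?Q = "cube x (sd m)"
  have s: "0 < sd m" "0 < sd m ^ CARD('n)" using sd(1)[of m] by auto
  \<comment> \<open>Chosen to solve 2^p (e1 + e1) + e1 = \<epsilon>, the total produced by
    \<open>FN_approx\<close>.\<close>
  define e1 where "e1 = \<epsilon> / (2 powr p * 2 + 1)"
  have den: "0 < 2 powr p * 2 + (1::real)" by (simp add: add_pos_pos)
  have "e1 * (2 powr p * 2 + 1) = \<epsilon>" using den by (simp add: e1_def)
  then have e1: "2 powr p * (e1 + e1) + e1 = \<epsilon>" by (simp add: algebra_simps)
  have e1_pos: "0 < e1" using eps den by (simp add: e1_def)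
  obtain g where g: "continuous_on UNIV g" "Lint p ?Q (\<lambda>y. f y - g y) \<le> ennreal e1"
    using Lint_dense[OF f p _ _ e1_pos, of "sd m" x] fin[of x m] s by (auto simp: sd_def)
  \<comment> \<open>The modulus of continuity for which the constant-approximation error over the
    whole cube is exactly \<open>e1\<close>.\<close>
  define \<eta> where "\<eta> = (e1 / sd m ^ CARD('n)) powr (1 / p)"
  have eta: "0 < \<eta>" "\<eta> powr p * sd m ^ CARD('n) = e1" using e1_pos s p by (auto simp: \<eta>_def powr_powr)
  let ?K = "cbox x (x + (\<chi> i. sd m))"
  have QK: "?Q \<subseteq> ?K" by (auto simp: cube_def mem_box_cart less_imp_le)
  have "uniformly_continuous_on ?K g"
    using g(1) by (intro compact_uniformly_continuous) (auto intro: continuous_on_subset)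
  then obtain d where d: "0 < d" "\<And>y z. y \<in> ?K \<Longrightarrow> z \<in> ?K \<Longrightarrow> dist z y < d \<Longrightarrow> dist (g z) (g y) < \<eta>"
    unfolding uniformly_continuous_on_def using eta(1) by metis
  have "(\<lambda>N. real CARD('n) * (sd m * (1/2) ^ N)) \<longlonglongrightarrow> real CARD('n) * (sd m * 0)"
    by (intro tendsto_intros LIMSEQ_realpow_zero) auto
  then have ev1: "eventually (\<lambda>N. real CARD('n) * (sd m * (1/2) ^ N) < d) sequentially"
    using d(1) by (intro order_tendstoD(2)) auto
  have "(\<lambda>N. (1/2) ^ N * (1 / 2 ^ m * sd m ^ CARD('n))) \<longlonglongrightarrow> 0 * (1 / 2 ^ m * sd m ^ CARD('n))"
    by (intro tendsto_intros LIMSEQ_realpow_zero) auto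
  then have ev2: "eventually (\<lambda>N. (1/2) ^ N * (1 / 2 ^ m * sd m ^ CARD('n)) < e1) sequentially"
    using e1_pos by (intro order_tendstoD(2)) auto
  obtain N where N: "real CARD('n) * (sd m * (1/2) ^ N) < d" "(1/2) ^ N * (1 / 2 ^ m * sd m ^ CARD('n)) < e1"
    using eventually_happens[OF eventually_conj[OF ev1 ev2]] by auto
  have "Lint p ?Q (\<lambda>y. f y - FN N x m y)
      \<le> ennreal (2 powr p) * (Lint p ?Q (\<lambda>y. f y - g y) + ennreal (\<eta> powr p * sd m ^ CARD('n))) + ennreal (1 / 2 ^ (m + N) * sd m ^ CARD('n))"
  proof (rule FN_approx[OF g(1) order_refl])
    fix y z assume y: "y \<in> ?Q" and z: "z \<in> ?Q" and yz: "\<And>i. \<bar>y $ i - z $ i\<bar> \<le> sd (m + N)"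
    have "dist y z \<le> (\<Sum>i\<in>UNIV. \<bar>(y - z) $ i\<bar>)" unfolding dist_norm by (rule norm_le_l1_cart)
    also have "\<dots> \<le> (\<Sum>i\<in>(UNIV :: 'n set). sd (m + N))" using yz by (intro sum_mono) simp
    also have "\<dots> = real CARD('n) * (sd m * (1/2) ^ N)" by (simp add: sd_def power_add power_divide)
    also note N(1)
    finally have "dist (g y) (g z) < \<eta>" using d(2) y z QK by blast
    then show "cmod (g y - g z) \<le> \<eta>" by (simp add: dist_norm)
  qed
  also have "\<dots> \<le> ennreal (2 powr p) * (ennreal e1 + ennreal e1) + ennreal e1"
    using g(2) N(2) eta(2)
    by (intro add_mono mult_left_mono ennreal_leI) (auto simp: power_add power_divide mult.commute)
  also have "\<dots> = ennreal \<epsilon>" using e1 e1_pos by (simp flip: ennreal_plus ennreal_mult)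
  finally show ?thesis by blast
qed

text \<open>By Markov's inequality f differs from \<open>FN N x m\<close> by more than 1 only on a
  set of measure at most \<epsilon>. This explains the additional 1 in the level, and \<epsilon> is
  arbitrary.\<close>

lemma level_sets_f:
  "emeasure lebesgue {y \<in> cube x (sd m). real j * L + 1 < cmod (f y - Pl x m y)} \<le> ennreal ((1/2) ^ j * sd m ^ CARD('n))"
proof (rule ennreal_le_epsilon)
  fix \<epsilon> :: real assume "0 < \<epsilon>"
  then obtain N where N: "Lint p (cube x (sd m)) (\<lambda>y. f y - FN N x m y) \<le> ennreal \<epsilon>" using FN_tendsto by blast
  let ?A = "{y \<in> cube x (sd m). real j * L + 1 < cmod (f y - Pl x m y)}"
  let ?B = "{y \<in> cube x (sd m). real j * L < cmod (FN N x m y - Pl x m y)}"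
  let ?C = "{y \<in> cube x (sd m). 1 < cmod (f y - FN N x m y)}"
  have [measurable]: "?A \<in> sets lebesgue" "?B \<in> sets lebesgue" "?C \<in> sets lebesgue" by measurable
  have "?A \<subseteq> ?B \<union> ?C"
  proof
    fix y assume y: "y \<in> ?A"
    have "cmod (f y - Pl x m y) \<le> cmod (f y - FN N x m y) + cmod (FN N x m y - Pl x m y)"
      using norm_triangle_ineq[of "f y - FN N x m y" "FN N x m y - Pl x m y"] by simp
    then show "y \<in> ?B \<union> ?C" using y by auto
  qed
  then have "emeasure lebesgue ?A \<le> emeasure lebesgue (?B \<union> ?C)" by (intro emeasure_mono) auto
  also have "\<dots> \<le> emeasure lebesgue ?B + emeasure lebesgue ?C" by (intro emeasure_subadditive) auto
  also have "\<dots> \<le> ennreal ((1/2) ^ j * sd m ^ CARD('n)) + ennreal (\<epsilon> / 1 powr p)"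
    using N p by (intro add_mono level_sets measure_le_of_Lint) auto
  finally show "emeasure lebesgue ?A \<le> ennreal ((1/2) ^ j * sd m ^ CARD('n)) + ennreal \<epsilon>" by simp
qed

lemma L_eq: "L = jn_step p k TYPE('n)"
  by (simp add: L_def jn_step_def L1_def \<mu>_def \<nu>_def \<delta>_def \<kappa>_def)

lemma summable_jn: "summable (\<lambda>j. ((real j + 1) * L + 1) powr q * (1/2) ^ j)"
proof (rule summable_comparison_test_ev)
  define b where "b = L + 1"
  have b: "0 < b" using cpos by (simp add: b_def)
  \<comment> \<open>Split the ratio 1/2 as (2/3) (3/4): the first factor absorbs the power growth
    and the second leaves a geometric majorant.\<close>
  have "(\<lambda>j. ((real j + 1) * b + 1) powr \<bar>q\<bar> * (2/3) ^ j) \<longlonglongrightarrow> 0"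
    using b by real_asymp
  then have "eventually (\<lambda>j. ((real j + 1) * b + 1) powr \<bar>q\<bar> * (2/3) ^ j < 1) sequentially"
    by (intro order_tendstoD(2)) auto
  then show "eventually (\<lambda>j. norm (((real j + 1) * L + 1) powr q * (1/2) ^ j) \<le> (3/4) ^ j) sequentially"
  proof eventually_elim
    case (elim j)
    have pos: "0 \<le> (real j + 1) * L" using cpos by simp
    have "((real j + 1) * L + 1) powr q \<le> ((real j + 1) * L + 1) powr \<bar>q\<bar>"
      using pos by (intro powr_abs_le) simp
    also have "\<dots> \<le> ((real j + 1) * b + 1) powr \<bar>q\<bar>"
      using pos cpos by (intro powr_mono2) (auto simp: b_def mult_left_mono)
    finally have "((real j + 1) * L + 1) powr q * (1/2) ^ j \<le> ((real j + 1) * b + 1) powr \<bar>q\<bar> * ((2/3) ^ j * (3/4) ^ j)"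
      by (intro mult_mono) (auto simp flip: power_mult_distrib)
    also have "\<dots> \<le> 1 * (3/4) ^ j"
      unfolding mult.assoc[symmetric] using elim by (intro mult_right_mono) auto
    finally show ?case by simp
  qed
  show "summable (\<lambda>j. (3/4 :: real) ^ j)" by (rule summable_geometric) simp
qed

lemma Lint_jn:
  assumes q: "0 < q"
  shows "Lint q (cube x (sd m)) (\<lambda>y. f y - Pl x m y) \<le> ennreal (jn_const q p k TYPE('n) * sd m ^ CARD('n))"
proof -
  let ?Q = "cube x (sd m)"
  have s: "0 < sd m ^ CARD('n)" using sd(1)[of m] by simp
  define c where "c j = ((real j + 1) * L + 1) powr q" for j :: nat
  define E where "E j = {y \<in> ?Q. real j * L + 1 < cmod (f y - Pl x m y)}" for j
  have [measurable]: "E j \<in> sets lebesgue" for j unfolding E_def by measurable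
  have "Lint q ?Q (\<lambda>y. f y - Pl x m y) \<le> (\<integral>\<^sup>+y. indicator ?Q y + (\<Sum>j. ennreal (c j) * indicator (E j) y) \<partial>lebesgue)"
    unfolding Lint_def
  proof (rule nn_integral_mono)
    fix y
    let ?v = "cmod (f y - Pl x m y)"
    show "ennreal (?v powr q) * indicator ?Q y \<le> indicator ?Q y + (\<Sum>j. ennreal (c j) * indicator (E j) y)"
    proof (cases "y \<in> ?Q")
      case True
      show ?thesis
      proof (cases "?v \<le> 1")
        case le: True
        then have "?v powr q \<le> 1" using q powr_mono2[of q ?v 1] by simp
        then have "ennreal (?v powr q) \<le> 1" by (simp add: ennreal_le_1)
        then show ?thesis using True by (simp add: add_increasing2)
      next
        case False
        \<comment> \<open>The layer of the value: j times L plus 1 lies strictly below it and (j +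
          1) times L plus 1 does not; the ceiling makes the first inequality strict, as
          \<open>E\<close> requires.\<close>
        define j where "j = nat (\<lceil>(?v - 1) / L\<rceil> - 1)"
        have "0 < (?v - 1) / L" using False cpos by simp
        then have j: "real j < (?v - 1) / L" "(?v - 1) / L \<le> real j + 1" unfolding j_def by linarith+
        have "real j * L + 1 < ?v" using j(1) cpos by (simp add: pos_less_divide_eq)
        then have E: "y \<in> E j" using True by (simp add: E_def)
        have "?v \<le> (real j + 1) * L + 1" using j(2) cpos by (simp add: pos_divide_le_eq)
        then have "ennreal (?v powr q) \<le> ennreal (c j) * indicator (E j) y"
          using E q by (auto simp: c_def intro!: ennreal_leI powr_mono2)
        also have "\<dots> \<le> (\<Sum>j. ennreal (c j) * indicator (E j) y)"
          using sum_le_suminf[OF summableI, of "{j}" "\<lambda>j. ennreal (c j) * indicator (E j) y"]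
          by (simp only: finite.intros sum.insert sum.empty empty_iff add_0_right zero_le simp_thms)
        finally show ?thesis using True by (simp add: add_increasing)
      qed
    qed simp
  qed
  also have "\<dots> = emeasure lebesgue ?Q + (\<Sum>j. ennreal (c j) * emeasure lebesgue (E j))"
    by (subst nn_integral_add, measurable, subst nn_integral_suminf, measurable)
      (simp add: nn_integral_cmult_indicator del: emeasure_completion)
  also have "\<dots> \<le> ennreal (sd m ^ CARD('n)) + (\<Sum>j. ennreal (c j * (1/2) ^ j * sd m ^ CARD('n)))"
  proof (intro add_mono suminf_le)
    show "emeasure lebesgue ?Q \<le> ennreal (sd m ^ CARD('n))" by (simp only: em_cube order_refl)
    show "ennreal (c j) * emeasure lebesgue (E j) \<le> ennreal (c j * (1/2) ^ j * sd m ^ CARD('n))" for j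
    proof -
      have "ennreal (c j) * emeasure lebesgue (E j) \<le> ennreal (c j) * ennreal ((1/2) ^ j * sd m ^ CARD('n))"
        unfolding E_def by (intro mult_left_mono level_sets_f) simp
      then show ?thesis using s by (simp add: c_def mult.assoc flip: ennreal_mult)
    qed
  qed auto
  also have "(\<Sum>j. ennreal (c j * (1/2) ^ j * sd m ^ CARD('n))) = ennreal (\<Sum>j. c j * (1/2) ^ j * sd m ^ CARD('n))"
    using summable_mult2[OF summable_jn[of q], of "sd m ^ CARD('n)"] s by (intro suminf_ennreal2) (auto simp: c_def)
  also have "(\<Sum>j. c j * (1/2) ^ j * sd m ^ CARD('n)) = (\<Sum>j. c j * (1/2) ^ j) * sd m ^ CARD('n)"
    using suminf_mult2[OF summable_jn[of q], of "sd m ^ CARD('n)"] by (simp add: c_def)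
  also have "ennreal (sd m ^ CARD('n)) + ennreal ((\<Sum>j. c j * (1/2) ^ j) * sd m ^ CARD('n)) = ennreal (jn_const q p k TYPE('n) * sd m ^ CARD('n))"
  proof -
    have "0 \<le> (\<Sum>j. c j * (1/2) ^ j)" using summable_jn[of q] by (intro suminf_nonneg) (auto simp: c_def)
    then show ?thesis using s by (simp add: jn_const_def c_def L_eq distrib_right flip: ennreal_plus)
  qed
  finally show ?thesis .
qed

lemma jn_const_ge: "1 \<le> jn_const q p k TYPE('n)"
  using suminf_nonneg[OF summable_jn[of q]] by (simp add: jn_const_def L_eq)

end

text \<open>For s >= 0 the bound (l / 2^m)^s is at most l^s, so after division by a multiple of
  \<open>M * l powr s\<close> all dyadic subcubes satisfy the normalisation of
  \<open>dyadic_approx\<close>. Its exponential tail bounds then give every exponent q with the same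
  polynomial.\<close>

lemma camp_jn:
  fixes p q s :: real
  assumes p: "0 < p" and q: "0 < q" and s: "0 \<le> s"
  shows "\<exists>C>0. \<forall>M>0. \<forall>f :: real ^ 'n::finite \<Rightarrow> complex. camp p s (int k) M f \<longrightarrow> camp q s (int k) (C * M) f"
proof -
  let ?n = "CARD('n)"
  define J where "J = jn_const q p k TYPE('n)"
  define cc where "cc = compare_const p k 1 TYPE('n)"
  define B where "B = 2 powr q * 2 powr (q / p) * (\<bar>J\<bar> + cc powr q)"
  have cc: "0 < cc" by (simp add: cc_def compare_const_pos)
  have B: "0 < B" using cc by (simp add: B_def add_nonneg_pos)
  have key: "\<exists>P\<in>polys (int k). 1 \<le> J \<and>
      Lint p (cube x l) (\<lambda>y. f y - P y) \<le> ennreal ((2 powr (1/p) * M * l powr s) powr p * l ^ ?n) \<and>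
      Lint q (cube x l) (\<lambda>y. f y - P y) \<le> ennreal (J * (2 powr (1/p) * M * l powr s) powr q * l ^ ?n)"
    if M: "0 < M" and f: "camp p s (int k) M f" and l: "0 < l" "l \<le> 1" for M l x and f :: "real ^ 'n \<Rightarrow> complex"
  proof -
    have fm [measurable]: "f \<in> borel_measurable lebesgue" using f by (rule campD)
    \<comment> \<open>The factor 2^(1/p) halves the normalised minimal oscillation, leaving room for
      a polynomial that is only nearly minimal.\<close>
    define A where "A = 2 powr (1/p) * M * l powr s"
    have A: "0 < A" using M l by (simp add: A_def)
    define g where "g y = of_real (1 / A) * f y" for y
    have gm [measurable]: "g \<in> borel_measurable lebesgue" unfolding g_def by measurable
    have scale: "Lint r Q (\<lambda>y. g y - P y) = ennreal ((1 / A) powr r) * Lint r Q (\<lambda>y. f y - of_real A * P y)"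
      if "P \<in> borel_measurable lebesgue" "Q \<in> sets lebesgue" for r Q P
    proof -
      have "(\<lambda>y. g y - P y) = (\<lambda>y. of_real (1 / A) * (f y - of_real A * P y))"
        using A by (auto simp: g_def algebra_simps)
      then have "Lint r Q (\<lambda>y. g y - P y) = ennreal (cmod (of_real (1 / A)) powr r) * Lint r Q (\<lambda>y. f y - of_real A * P y)"
        using that by (simp only:) (intro Lint_scale, auto)
      then show ?thesis using A by (simp add: norm_divide)
    qed
    have r: "0 < l / 2 ^ m" "l / 2 ^ m \<le> l" "l / 2 ^ m \<le> 1" for m
    proof -
      show "0 < l / 2 ^ m" using l by simp
      have "l * 1 \<le> l * 2 ^ m" using l by (intro mult_left_mono) auto
      then show "l / 2 ^ m \<le> l" by (simp add: divide_simps)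
      then show "l / 2 ^ m \<le> 1" using l(2) by (rule order_trans)
    qed
    define good where "good z m P \<longleftrightarrow> P \<in> polys (int k) \<and>
      Lint p (cube z (l / 2 ^ m)) (\<lambda>y. g y - P y) \<le> ennreal ((l / 2 ^ m) ^ ?n) \<and>
      (\<forall>c. Lint p (cube z (l / 2 ^ m)) (\<lambda>y. g y - P y) \<le> Lint p (cube z (l / 2 ^ m)) (\<lambda>y. g y - c)
          + ennreal (1 / 2 ^ m * (l / 2 ^ m) ^ ?n))" for z m P
    have ex: "\<exists>P. good z m P" for z m
    proof -
      let ?r = "l / 2 ^ m"
      let ?Q = "cube z ?r"
      define I where "I = (INF P\<in>polys (int k). Lint p ?Q (\<lambda>y. g y - P y))"
      have rn: "0 < ?r ^ ?n" using r(1) by (rule zero_less_power)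
      obtain P0 where P0: "P0 \<in> polys (int k)"
        "Lint p ?Q (\<lambda>y. f y - P0 y) \<le> ennreal ((M * ?r powr s) powr p * ?r ^ ?n)"
        using campD(3)[OF f r(1) r(3)] by blast
      have "M * ?r powr s \<le> M * l powr s" using M s r(1,2)[of m] by (intro mult_left_mono powr_mono2) auto
      then have "(M * ?r powr s) powr p \<le> (M * l powr s) powr p" using M p by (intro powr_mono2) auto
      also have "\<dots> = A powr p / 2" using M p by (simp add: A_def powr_mult powr_powr)
      finally have le: "(M * ?r powr s) powr p * ?r ^ ?n \<le> A powr p / 2 * ?r ^ ?n" using rn by (intro mult_right_mono) auto
      define P1 where "P1 y = of_real (1 / A) * P0 y" for y
      have P1: "P1 \<in> polys (int k)" unfolding P1_def by (rule polys_scale[OF P0(1)])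
      have "Lint p ?Q (\<lambda>y. g y - P1 y) = ennreal ((1 / A) powr p) * Lint p ?Q (\<lambda>y. f y - P0 y)"
      proof -
        have "(\<lambda>y. f y - of_real A * P1 y) = (\<lambda>y. f y - P0 y)" using A by (auto simp: P1_def)
        then show ?thesis using scale[OF polys_measurable[OF P1] cube_lebesgue] by simp
      qed
      also have "\<dots> \<le> ennreal ((1 / A) powr p) * ennreal (A powr p / 2 * ?r ^ ?n)"
        by (intro mult_left_mono order_trans[OF P0(2) ennreal_leI[OF le]]) simp
      also have "\<dots> = ennreal (?r ^ ?n / 2)"
        using A rn by (simp add: powr_divide flip: ennreal_mult)
      finally have I: "I \<le> ennreal (?r ^ ?n / 2)" unfolding I_def using P1 by (intro INF_lower2)
      \<comment> \<open>A slack small enough for both demands: half the volume for the oscillation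
        bound, and the tolerance 2^(-m) times the volume for near-minimality.\<close>
      define e where "e = 1 / 2 * (1 / 2 ^ m * ?r ^ ?n)"
      have e: "0 < e" using rn by (simp add: e_def)
      have e_le: "e \<le> ?r ^ ?n / 2" "e \<le> 1 / 2 ^ m * ?r ^ ?n"
      proof -
        have "1 / 2 ^ m * ?r ^ ?n \<le> 1 * ?r ^ ?n" using rn by (intro mult_right_mono) auto
        then show "e \<le> ?r ^ ?n / 2" by (simp add: e_def)
        have "0 \<le> 1 / 2 ^ m * ?r ^ ?n" using rn by simp
        then show "e \<le> 1 / 2 ^ m * ?r ^ ?n" unfolding e_def by linarith
      qed
      have "I < I + ennreal e"
      proof (cases I)
        case (real i)
        then show ?thesis using e by (simp add: ennreal_less_iff flip: ennreal_plus)
      qed (use I in \<open>simp add: top_unique\<close>)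
      then obtain P where P: "P \<in> polys (int k)" "Lint p ?Q (\<lambda>y. g y - P y) < I + ennreal e"
        unfolding I_def INF_less_iff by blast
      have "Lint p ?Q (\<lambda>y. g y - P y) \<le> ennreal (?r ^ ?n / 2) + ennreal (?r ^ ?n / 2)"
        using I e_le by (intro order_trans[OF less_imp_le[OF P(2)]] add_mono ennreal_leI) auto
      then have 1: "Lint p ?Q (\<lambda>y. g y - P y) \<le> ennreal (?r ^ ?n)" using rn by (simp flip: ennreal_plus)
      have "Lint p ?Q (\<lambda>y. g y - P y) \<le> Lint p ?Q (\<lambda>y. g y - c) + ennreal (1 / 2 ^ m * ?r ^ ?n)" for c
      proof -
        have "I \<le> Lint p ?Q (\<lambda>y. g y - c)" unfolding I_def by (rule INF_lower2[OF polys_const]) auto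
        then show ?thesis using e_le by (intro order_trans[OF less_imp_le[OF P(2)]] add_mono ennreal_leI) auto
      qed
      with P(1) 1 show ?thesis unfolding good_def by blast
    qed
    then obtain Pl where "\<And>z m. good z m (Pl z m)" by metis
    then have Pl: "\<And>z m. Pl z m \<in> polys (int k)"
      "\<And>z m. Lint p (cube z (l / 2 ^ m)) (\<lambda>y. g y - Pl z m y) \<le> ennreal ((l / 2 ^ m) ^ ?n)"
      "\<And>z m c. Lint p (cube z (l / 2 ^ m)) (\<lambda>y. g y - Pl z m y) \<le> Lint p (cube z (l / 2 ^ m)) (\<lambda>y. g y - c)
          + ennreal (1 / 2 ^ m * (l / 2 ^ m) ^ ?n)" unfolding good_def by blast+
    interpret D: dyadic_approx g p l k Pl
    proof
      fix z m
      have "Lint p (cube z (l / 2 ^ m)) f \<le> Lint p (cube z 1) f" using r(3) by (intro Lint_subset cube_subset) auto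
      also have "\<dots> \<le> ennreal (M powr p)" by (rule campD(2)[OF f])
      finally have "Lint p (cube z (l / 2 ^ m)) f < \<infinity>" by (simp add: order_le_less_trans)
      then show "Lint p (cube z (l / 2 ^ m)) g < \<infinity>"
        unfolding g_def by (subst Lint_scale) (auto simp: ennreal_mult_less_top)
    qed (fact gm p l(1) Pl)+
    have sd0: "D.sd 0 = l" by (simp add: D.sd_def)
    let ?P = "\<lambda>y. of_real A * Pl x 0 y"
    have P: "?P \<in> polys (int k)" by (rule polys_scale[OF Pl(1)])
    have up: "Lint r (cube x l) (\<lambda>y. f y - ?P y) \<le> ennreal (K * A powr r * l ^ ?n)"
      if "Lint r (cube x l) (\<lambda>y. g y - Pl x 0 y) \<le> ennreal (K * l ^ ?n)" "0 \<le> K" for r K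
    proof -
      have "(1 / A) powr r * A powr r = 1" using A by (simp add: powr_divide)
      then have "ennreal (A powr r) * Lint r (cube x l) (\<lambda>y. g y - Pl x 0 y) = Lint r (cube x l) (\<lambda>y. f y - ?P y)"
        by (subst scale) (auto simp: polys_measurable[OF Pl(1)] mult.commute simp flip: mult.assoc ennreal_mult)
      moreover have "ennreal (A powr r) * Lint r (cube x l) (\<lambda>y. g y - Pl x 0 y) \<le> ennreal (A powr r) * ennreal (K * l ^ ?n)"
        using that by (intro mult_left_mono) auto
      moreover have "ennreal (A powr r) * ennreal (K * l ^ ?n) = ennreal (K * A powr r * l ^ ?n)"
        using that l by (simp add: mult_ac flip: ennreal_mult)
      ultimately show ?thesis by simp
    qed
    have J1: "1 \<le> J" unfolding J_def by (rule D.jn_const_ge)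
    have "Lint p (cube x l) (\<lambda>y. f y - ?P y) \<le> ennreal (1 * A powr p * l ^ ?n)"
      using D.osc[of x 0] by (intro up) auto
    moreover have "Lint q (cube x l) (\<lambda>y. f y - ?P y) \<le> ennreal (J * A powr q * l ^ ?n)"
      using D.Lint_jn[OF q, of x 0] J1 by (intro up) (auto simp: sd0 J_def)
    ultimately show ?thesis using P J1 unfolding A_def[symmetric] by (intro bexI[of _ ?P]) (simp_all only: mult_1)
  qed
  have "camp q s (int k) (B powr (1 / q) * M) f" if M: "0 < M" and f: "camp p s (int k) M f"
    for M and f :: "real ^ 'n \<Rightarrow> complex"
  proof (rule campI)
    show fm [measurable]: "f \<in> borel_measurable lebesgue" using f by (rule campD)
    fix x :: "real ^ 'n"
    obtain P where P: "P \<in> polys (int k)" "1 \<le> J"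
      "Lint p (cube x 1) (\<lambda>y. f y - P y) \<le> ennreal ((2 powr (1/p) * M) powr p)"
      "Lint q (cube x 1) (\<lambda>y. f y - P y) \<le> ennreal (J * (2 powr (1/p) * M) powr q)"
      using key[OF M f, of 1 x] by auto
    let ?A = "2 powr (1/p) * M"
    have A: "0 < ?A" using M by simp
    have "M powr p \<le> ?A powr p"
      using M p mult_right_mono[of 1 "2 powr (1/p)" M] by (intro powr_mono2) (auto simp: ge_one_powr_ge_zero)
    then have f1: "Lint p (cube x 1) f \<le> ennreal (?A powr p)"
      using campD(2)[OF f, of x] by (meson ennreal_leI order_trans)
    \<comment> \<open>On a unit cube 0 also approximates f, by the bound for f itself; comparing P
      with 0 bounds P pointwise, so its integral with exponent q is controlled too.\<close>
    have "cmod (P z) \<le> cc * ?A" if "z \<in> cube x 1" for z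
      using polys_compare[OF P(1) polys_0 fm p zero_less_one A order_refl zero_le_one _ _ _ _ that, of 1] P(3) f1
      by (simp add: cc_def)
    then have "Lint q (cube x 1) P \<le> ennreal ((cc * ?A) powr q * 1 ^ ?n)"
      using q by (intro Lint_cube_bound) auto
    then have "Lint q (cube x 1) (\<lambda>y. (f y - P y) + P y) \<le> ennreal (2 powr q * (J * ?A powr q + (cc * ?A) powr q))"
      using P polys_measurable[OF P(1)] q by (intro Lint_add_le) auto
    also have "2 powr q * (J * ?A powr q + (cc * ?A) powr q) = B * M powr q"
      using P(2) M cc q by (simp add: B_def powr_mult powr_powr algebra_simps)
    finally show "Lint q (cube x 1) f \<le> ennreal (B * M powr q)" by simp
  next
    fix x :: "real ^ 'n" and l :: real assume l: "0 < l" "l \<le> 1"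
    obtain P where P: "P \<in> polys (int k)" "1 \<le> J"
      "Lint q (cube x l) (\<lambda>y. f y - P y) \<le> ennreal (J * (2 powr (1/p) * M * l powr s) powr q * l ^ ?n)"
      using key[OF M f l, of x] by auto
    have "J * (2 powr (1/p) * M * l powr s) powr q * l ^ ?n = J * 2 powr (q / p) * ((M * l powr s) powr q * l ^ ?n)"
      using M by (simp add: powr_mult powr_powr)
    also have "\<dots> \<le> B * ((M * l powr s) powr q * l ^ ?n)"
    proof (rule mult_right_mono)
      have "J \<le> \<bar>J\<bar> + cc powr q" using powr_ge_zero[of cc q] by linarith
      then have "J * 2 powr (q / p) \<le> (\<bar>J\<bar> + cc powr q) * 2 powr (q / p)" by (rule mult_right_mono) simp
      also have "\<dots> \<le> 2 powr q * ((\<bar>J\<bar> + cc powr q) * 2 powr (q / p))"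
        using q mult_right_mono[of 1 "2 powr q" "(\<bar>J\<bar> + cc powr q) * 2 powr (q / p)"]
        by (simp add: ge_one_powr_ge_zero)
      finally show "J * 2 powr (q / p) \<le> B" by (simp add: B_def mult_ac)
      show "0 \<le> (M * l powr s) powr q * l ^ ?n" using l by simp
    qed
    finally have "Lint q (cube x l) (\<lambda>y. f y - P y) \<le> ennreal (B * ((M * l powr s) powr q * l ^ ?n))"
      by (intro order_trans[OF P(3) ennreal_leI])
    with P(1) show "\<exists>P\<in>polys (int k). Lint q (cube x l) (\<lambda>y. f y - P y) \<le> ennreal (B * ((M * l powr s) powr q * l ^ ?n))"
      by blast
  qed (use q M B in auto)
  moreover have "0 < B powr (1 / q)" using B by simp
  ultimately show ?thesis by blast
qed

subsection \<open>Equivalence of quasi-norms\<close>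

text \<open>An inequality between quasi-norms up to a constant, phrased through upper bounds M. This
  also covers predicates such as \<open>camp\<close>, which do not come from a function-valued
  norm.\<close>

definition dominated :: "(real \<Rightarrow> 'f \<Rightarrow> bool) \<Rightarrow> (real \<Rightarrow> 'f \<Rightarrow> bool) \<Rightarrow> bool"
  where "dominated P Q \<longleftrightarrow> (\<exists>C>0. \<forall>M>0. \<forall>f. P M f \<longrightarrow> Q (C * M) f)"

lemma dominated_trans: "dominated P Q \<Longrightarrow> dominated Q R \<Longrightarrow> dominated P R"
  unfolding dominated_def
  apply safe
  subgoal for C D by (rule exI[of _ "D * C"]) (auto simp: mult.assoc)
  done

definition inball :: "'a quasi_space \<Rightarrow> real \<Rightarrow> ('a \<Rightarrow> complex) \<Rightarrow> bool"
  where "inball X M f \<longleftrightarrow> f \<in> carrier X \<and> qnorm X f \<le> ennreal M"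

text \<open>Upper bounds are required to be positive, so y = 0 is reached only in the limit; this is
  why an arbitrary e > 0 is added.\<close>

lemma ennreal_le_mult_of_bounds:
  assumes C: "0 < C" and "\<And>M. 0 < M \<Longrightarrow> y \<le> ennreal M \<Longrightarrow> x \<le> ennreal (C * M)"
  shows "x \<le> ennreal C * y"
proof (cases y)
  case (real r)
  have "x \<le> ennreal (C * r)"
  proof (rule ennreal_le_epsilon)
    fix e :: real assume e: "0 < e"
    then have "x \<le> ennreal (C * (r + e / C))" using C real by (intro assms) (auto intro: add_nonneg_pos ennreal_leI)
    also have "C * (r + e / C) = C * r + e" using C by (simp add: field_simps)
    finally show "x \<le> ennreal (C * r) + ennreal e" using real C e by (simp add: ennreal_plus)
  qed
  then show ?thesis using real C by (simp add: ennreal_mult)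
next
  case top
  then show ?thesis using C by (simp add: ennreal_mult_top)
qed

lemma quasi_space_eqI:
  assumes XY: "dominated (inball X) (inball Y)" and YX: "dominated (inball Y) (inball X)"
    and fin: "\<And>f. f \<in> carrier X \<Longrightarrow> qnorm X f < \<infinity>" "\<And>f. f \<in> carrier Y \<Longrightarrow> qnorm Y f < \<infinity>"
  shows "quasi_space_eq X Y"
proof -
  obtain C where C: "0 < C" "\<And>M f. 0 < M \<Longrightarrow> inball X M f \<Longrightarrow> inball Y (C * M) f"
    using XY unfolding dominated_def by blast
  obtain D where D: "0 < D" "\<And>M f. 0 < M \<Longrightarrow> inball Y M f \<Longrightarrow> inball X (D * M) f"
    using YX unfolding dominated_def by blast
  have ex: "\<exists>M>0. a \<le> ennreal M" if "a < \<infinity>" for a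
  proof -
    have "a \<le> ennreal (enn2real a + 1)" using that by (cases a) (auto intro: ennreal_leI)
    then show ?thesis by (intro exI[of _ "enn2real a + 1"]) (auto simp: add_nonneg_pos)
  qed
  have "carrier X = carrier Y"
  proof safe
    fix f assume "f \<in> carrier X"
    then show "f \<in> carrier Y" using ex[OF fin(1)] C(2) unfolding inball_def by blast
  next
    fix f assume "f \<in> carrier Y"
    then show "f \<in> carrier X" using ex[OF fin(2)] D(2) unfolding inball_def by blast
  qed
  moreover have "ennreal (1 / D) * qnorm X f \<le> qnorm Y f \<and> qnorm Y f \<le> ennreal C * qnorm X f"
    if f: "f \<in> carrier X" for f
  proof
    show "qnorm Y f \<le> ennreal C * qnorm X f"
      using C f by (intro ennreal_le_mult_of_bounds) (auto simp: inball_def)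
    have "qnorm X f \<le> ennreal D * qnorm Y f"
      using D f \<open>carrier X = carrier Y\<close> by (intro ennreal_le_mult_of_bounds) (auto simp: inball_def)
    then have "ennreal (1 / D) * qnorm X f \<le> ennreal (1 / D) * (ennreal D * qnorm Y f)"
      by (rule mult_left_mono) simp
    also have "\<dots> = qnorm Y f" using D(1) by (simp flip: mult.assoc ennreal_mult)
    finally show "ennreal (1 / D) * qnorm X f \<le> qnorm Y f" .
  qed
  ultimately show ?thesis unfolding quasi_space_eq_def
    using C(1) D(1) by (intro conjI exI[of _ "1 / D"] exI[of _ C]) auto
qed

definition equivalent :: "'a quasi_space \<Rightarrow> (real \<Rightarrow> ('a \<Rightarrow> complex) \<Rightarrow> bool) \<Rightarrow> bool"
  where "equivalent X P \<longleftrightarrow> dominated (inball X) P \<and> dominated P (inball X)"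

lemma campanato_equivalent:
  fixes p \<tau> :: real and k K :: int
  assumes p: "0 < p" and \<tau>: "0 \<le> \<tau>" and s: "s = real CARD('n) * (\<tau> - 1 / p)"
    and k: "-1 \<le> k" "s < real_of_int k + 1" and K: "-1 \<le> K" "s < real_of_int K + 1"
  shows "equivalent (campanato \<tau> p k :: (real ^ 'n::finite) quasi_space) (camp p s K)"
proof -
  have 1: "dominated (inball (campanato \<tau> p k)) (camp p s k :: real \<Rightarrow> (real ^ 'n \<Rightarrow> complex) \<Rightarrow> bool)"
    using campanato_imp_camp[OF p s \<tau>, of k] unfolding dominated_def inball_def by (auto simp: campanato_def)
  have 2: "dominated (camp p s k :: real \<Rightarrow> (real ^ 'n \<Rightarrow> complex) \<Rightarrow> bool) (inball (campanato \<tau> p k))"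
    using camp_imp_campanato[OF p s \<tau>, of k] unfolding dominated_def inball_def by (auto simp: campanato_def)
  have 3: "dominated (camp p s k :: real \<Rightarrow> (real ^ 'n \<Rightarrow> complex) \<Rightarrow> bool) (camp p s K)"
    using camp_degree[OF p K, of k] unfolding dominated_def by blast
  have 4: "dominated (camp p s K :: real \<Rightarrow> (real ^ 'n \<Rightarrow> complex) \<Rightarrow> bool) (camp p s k)"
    using camp_degree[OF p k, of K] unfolding dominated_def by blast
  show ?thesis unfolding equivalent_def using dominated_trans[OF 1 3] dominated_trans[OF 4 2] by blast
qed

lemma campanato_equivalent_jn:
  fixes p q \<tau> :: real and k :: int
  assumes p: "0 < p" and \<tau>: "0 \<le> \<tau>" and s: "s = real CARD('n) * (\<tau> - 1 / p)" "0 \<le> s"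
    and k: "-1 \<le> k" "s < real_of_int k + 1" and K: "s < real K + 1" and q: "0 < q"
  shows "equivalent (campanato \<tau> p k :: (real ^ 'n::finite) quasi_space) (camp q s (int K))"
proof -
  have 1: "equivalent (campanato \<tau> p k :: (real ^ 'n) quasi_space) (camp p s (int K))"
    using assms by (intro campanato_equivalent) auto
  have 2: "dominated (camp p s (int K) :: real \<Rightarrow> (real ^ 'n \<Rightarrow> complex) \<Rightarrow> bool) (camp q s (int K))"
    using camp_jn[OF p q s(2)] unfolding dominated_def by blast
  have 3: "dominated (camp q s (int K) :: real \<Rightarrow> (real ^ 'n \<Rightarrow> complex) \<Rightarrow> bool) (camp p s (int K))"
    using camp_jn[OF q p s(2)] unfolding dominated_def by blast
  show ?thesis using 1 2 3 unfolding equivalent_def by (blast intro: dominated_trans)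
qed

subsection \<open>The plus-minus conditions\<close>

definition in_pm :: "'a quasi_space \<Rightarrow> 'a quasi_space \<Rightarrow> real \<Rightarrow> real \<Rightarrow> ('a \<Rightarrow> complex) \<Rightarrow> bool"
  where "in_pm X0 X1 \<Theta> M a \<longleftrightarrow> a \<in> carrier (sum_space X0 X1) \<and> pm_admissible X0 X1 \<Theta> a M"

lemma bdd_above_cmod:
  fixes \<epsilon> :: "int \<Rightarrow> complex"
  assumes "bounded (range \<epsilon>)" shows "bdd_above (range (\<lambda>i. cmod (\<epsilon> i)))"
proof -
  obtain B where "\<And>i. cmod (\<epsilon> i) \<le> B" using assms by (auto simp: bounded_iff)
  then show ?thesis by (rule bdd_aboveI2)
qed

lemma pm_bound_mono: "pm_bound X t a C \<Longrightarrow> C \<le> C' \<Longrightarrow> pm_bound X t a C'"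
  unfolding pm_bound_def
proof (intro allI impI)
  fix F :: "int set" and \<epsilon> :: "int \<Rightarrow> complex"
  assume b: "\<forall>F \<epsilon>. finite F \<longrightarrow> bounded (range \<epsilon>) \<longrightarrow>
       qnorm X (\<lambda>y. \<Sum>i\<in>F. \<epsilon> i * of_real (2 powr (of_int i * t)) * a i y) \<le> ennreal (C * (SUP i. cmod (\<epsilon> i)))"
    and C: "C \<le> C'" and F: "finite F" "bounded (range \<epsilon>)"
  have "0 \<le> (SUP i. cmod (\<epsilon> i))"
    using bdd_above_cmod[OF F(2)] by (intro cSUP_upper2[of _ _ 0]) auto
  then have "C * (SUP i. cmod (\<epsilon> i)) \<le> C' * (SUP i. cmod (\<epsilon> i))" using C by (intro mult_right_mono)
  then show "qnorm X (\<lambda>y. \<Sum>i\<in>F. \<epsilon> i * of_real (2 powr (of_int i * t)) * a i y) \<le> ennreal (C' * (SUP i. cmod (\<epsilon> i)))"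
    using b F ennreal_leI order_trans by blast
qed

lemma pm_admissible_mono: "pm_admissible X0 X1 \<Theta> a C \<Longrightarrow> C \<le> C' \<Longrightarrow> pm_admissible X0 X1 \<Theta> a C'"
  unfolding pm_admissible_def
  by (elim conjE exE, intro conjI exI) (assumption | erule pm_bound_mono | linarith)+

lemma dominated_inball_pm: "dominated (inball (pm_interpolation X0 X1 \<Theta>)) (in_pm X0 X1 \<Theta>)"
  unfolding dominated_def
\<comment> \<open>The infimum over admissible constants need not be attained; the factor 2 makes the
  inequality strict for M > 0.\<close>
proof (intro exI[of _ 2] conjI allI impI)
  fix M :: real and f assume M: "0 < M" and f: "inball (pm_interpolation X0 X1 \<Theta>) M f"
  have "ennreal M < ennreal (2 * M)" using M by (intro ennreal_lessI) auto
  then have "(INF C\<in>{C. pm_admissible X0 X1 \<Theta> f C}. ennreal C) < ennreal (2 * M)"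
    using f by (auto simp: inball_def pm_interpolation_def)
  then obtain C where C: "pm_admissible X0 X1 \<Theta> f C" "ennreal C < ennreal (2 * M)"
    unfolding INF_less_iff by blast
  then have "C \<le> 2 * M" by (simp add: ennreal_less_iff pm_admissible_def)
  with C f show "in_pm X0 X1 \<Theta> (2 * M) f"
    by (auto simp: in_pm_def inball_def pm_interpolation_def intro: pm_admissible_mono)
qed simp

lemma dominated_pm_inball: "dominated (in_pm X0 X1 \<Theta>) (inball (pm_interpolation X0 X1 \<Theta>))"
  unfolding dominated_def
proof (intro exI[of _ 1] conjI allI impI)
  fix M :: real and f assume "in_pm X0 X1 \<Theta> M f"
  then have f: "f \<in> carrier (sum_space X0 X1)" "pm_admissible X0 X1 \<Theta> f M" by (auto simp: in_pm_def)
  then have "(INF C\<in>{C. pm_admissible X0 X1 \<Theta> f C}. ennreal C) \<le> ennreal M" by (intro INF_lower) simp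
  with f show "inball (pm_interpolation X0 X1 \<Theta>) (1 * M) f"
    unfolding inball_def pm_interpolation_def by auto
qed simp

lemma pm_interpolation_eq:
  assumes X: "equivalent X P" and "dominated (in_pm X0 X1 \<Theta>) P" "dominated P (in_pm X0 X1 \<Theta>)"
    and fin: "\<And>f. f \<in> carrier X \<Longrightarrow> qnorm X f < \<infinity>"
  shows "quasi_space_eq (pm_interpolation X0 X1 \<Theta>) X"
proof (rule quasi_space_eqI)
  show "dominated (inball (pm_interpolation X0 X1 \<Theta>)) (inball X)"
    using dominated_inball_pm assms(2) X unfolding equivalent_def by (blast intro: dominated_trans)
  show "dominated (inball X) (inball (pm_interpolation X0 X1 \<Theta>))"
    using dominated_pm_inball assms(3) X unfolding equivalent_def by (blast intro: dominated_trans)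
  fix f assume "f \<in> carrier (pm_interpolation X0 X1 \<Theta>)"
  then obtain C where "pm_admissible X0 X1 \<Theta> f C" by (auto simp: pm_interpolation_def)
  then have "qnorm (pm_interpolation X0 X1 \<Theta>) f \<le> ennreal C"
    by (auto simp: pm_interpolation_def intro: INF_lower)
  then show "qnorm (pm_interpolation X0 X1 \<Theta>) f < \<infinity>" by (simp add: order_le_less_trans)
qed (use fin in auto)

text \<open>The plus-minus condition bounds only the value of the quasi-norm. Membership in the
  carrier needs local integrability of the finite sum in addition, which follows from the
  quasi-triangle inequality; a finite value alone would not give it, as Bochner integrals default to
  0.\<close>

lemma pm_bound_inball:
  assumes b: "pm_bound (campanato \<tau> p k) t a C" and p: "0 < p" and C: "0 \<le> C"
    and a: "\<And>i. a i \<in> carrier (campanato \<tau> p k)" and F: "finite F" and eps: "\<And>i. cmod (\<epsilon> i) \<le> 1"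
  shows "inball (campanato \<tau> p k) C (\<lambda>y. \<Sum>i\<in>F. \<epsilon> i * of_real (2 powr (of_int i * t)) * a i y)"
proof -
  let ?g = "\<lambda>G y. \<Sum>i\<in>G. \<epsilon> i * of_real (2 powr (of_int i * t)) * a i y"
  have am [measurable]: "a i \<in> borel_measurable lebesgue" for i using carrier_campanatoD(1)[OF a] .
  have gm [measurable]: "?g G \<in> borel_measurable lebesgue" for G by measurable
  have fin: "Lint p K (?g G) < \<infinity>" if "finite G" and K: "compact K" for K G
    using that(1)
  proof (induction G rule: finite_induct)
    case empty
    then show ?case using p by (simp add: Lint_def)
  next
    case (insert i G)
    have Km [measurable]: "K \<in> sets lebesgue" using K by (simp add: lmeasurable_compact fmeasurableD)
    have "set_integrable lebesgue K (\<lambda>y. cmod (a i y) powr p)"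
      using a[of i] K by (simp add: campanato_def)
    then have "Lint p K (a i) < \<infinity>" by (simp only: set_integrable_iff_Lint[OF am Km])
    then have 1: "Lint p K (\<lambda>y. (\<epsilon> i * of_real (2 powr (of_int i * t))) * a i y) < \<infinity>"
      by (subst Lint_scale) (auto simp: ennreal_mult_less_top)
    have "Lint p K (\<lambda>y. (\<epsilon> i * of_real (2 powr (of_int i * t))) * a i y + ?g G y)
      \<le> ennreal (2 powr p) * (Lint p K (\<lambda>y. (\<epsilon> i * of_real (2 powr (of_int i * t))) * a i y) + Lint p K (?g G))"
      using p by (intro Lint_add) auto
    also have "\<dots> < \<infinity>" using 1 insert.IH by (simp add: ennreal_mult_less_top)
    finally show ?case using insert.hyps by simp
  qed
  have "bounded (range \<epsilon>)" using eps by (auto simp: bounded_iff)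
  then have "qnorm (campanato \<tau> p k) (?g F) \<le> ennreal (C * (SUP i. cmod (\<epsilon> i)))"
    using b F unfolding pm_bound_def by blast
  also have "\<dots> \<le> ennreal C"
  proof (rule ennreal_leI)
    have "(SUP i. cmod (\<epsilon> i)) \<le> 1" using eps by (intro cSUP_least) auto
    then show "C * (SUP i. cmod (\<epsilon> i)) \<le> C" using C mult_left_mono[of _ 1 C] by simp
  qed
  finally have "qnorm (campanato \<tau> p k) (?g F) \<le> ennreal C" .
  moreover from this have "?g F \<in> carrier (campanato \<tau> p k)"
    using fin[OF F] by (auto simp: campanato_def set_integrable_iff_Lint lmeasurable_compact fmeasurableD order_le_less_trans)
  ultimately show ?thesis by (simp add: inball_def)
qed

text \<open>The supremum of the multipliers may be 0, whereas the predicates are controlled for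
  positive constants only. The multipliers are therefore bounded by a number slightly above the
  supremum, and the excess tends to 0.\<close>

lemma pm_boundI:
  assumes X: "\<And>M f. 0 < M \<Longrightarrow> P M f \<Longrightarrow> inball X (C * M) f" and C: "0 < C" and M: "0 < M"
    and P: "\<And>F \<epsilon> E. finite F \<Longrightarrow> 0 < E \<Longrightarrow> (\<And>i. cmod (\<epsilon> i) \<le> E) \<Longrightarrow>
      P (M * E) (\<lambda>y. \<Sum>i\<in>F. \<epsilon> i * of_real (2 powr (of_int i * t)) * a i y)"
  shows "pm_bound X t a (C * M)"
  unfolding pm_bound_def
proof (intro allI impI)
  fix F :: "int set" and \<epsilon> :: "int \<Rightarrow> complex" assume F: "finite F" and b: "bounded (range \<epsilon>)"
  let ?S = "SUP i. cmod (\<epsilon> i)"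
  let ?g = "\<lambda>y. \<Sum>i\<in>F. \<epsilon> i * of_real (2 powr (of_int i * t)) * a i y"
  have bdd: "bdd_above (range (\<lambda>i. cmod (\<epsilon> i)))" using b by (rule bdd_above_cmod)
  have le: "cmod (\<epsilon> i) \<le> ?S" for i using bdd by (intro cSUP_upper) auto
  have S: "0 \<le> ?S" using le[of 0] norm_ge_zero order_trans by blast
  show "qnorm X ?g \<le> ennreal (C * M * ?S)"
  proof (rule ennreal_le_epsilon)
    fix e :: real assume e: "0 < e"
    let ?E = "?S + e / (C * M)"
    have E: "0 < ?E" using S e C M by (simp add: add_nonneg_pos)
    have "cmod (\<epsilon> i) \<le> ?E" for i using le[of i] e C M by (simp add: add_increasing2)
    then have "inball X (C * (M * ?E)) ?g" using F E M by (intro X P) auto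
    then have "qnorm X ?g \<le> ennreal (C * (M * ?E))" by (simp add: inball_def)
    also have "C * (M * ?E) = C * M * ?S + e" using C M by (simp add: field_simps)
    finally show "qnorm X ?g \<le> ennreal (C * M * ?S) + ennreal e" using C M S e by (simp add: ennreal_plus)
  qed
qed

subsection \<open>Limits of plus-minus series\<close>

lemma sum_space_inball:
  assumes "inball X0 A b" "inball X1 B c" "a = (\<lambda>y. b y + c y)" "0 \<le> A" "0 \<le> B"
  shows "a \<in> carrier (sum_space X0 X1)" "qnorm (sum_space X0 X1) a \<le> ennreal (A + B)"
proof -
  show "a \<in> carrier (sum_space X0 X1)" using assms unfolding sum_space_def inball_def by auto
  have "qnorm (sum_space X0 X1) a \<le> qnorm X0 b + qnorm X1 c"
    unfolding sum_space_def snd_conv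
    by (rule INF_lower2[of "(b, c)"]) (use assms in \<open>auto simp: inball_def\<close>)
  also have "\<dots> \<le> ennreal A + ennreal B" using assms by (intro add_mono) (auto simp: inball_def)
  also have "\<dots> = ennreal (A + B)" using assms by simp
  finally show "qnorm (sum_space X0 X1) a \<le> ennreal (A + B)" .
qed

lemma pm_limit:
  assumes "((\<lambda>F. qnorm (sum_space X0 X1) (\<lambda>y. a y - (\<Sum>i\<in>F. s i y))) \<longlongrightarrow> 0) (finite_subsets_at_top (UNIV :: int set))"
    and e: "0 < e"
  shows "\<exists>F b c. finite F \<and> inball X0 e b \<and> inball X1 e c \<and> (\<forall>y. a y = (\<Sum>i\<in>F. s i y) + b y + c y)"
proof -
  have "eventually (\<lambda>F. qnorm (sum_space X0 X1) (\<lambda>y. a y - (\<Sum>i\<in>F. s i y)) < ennreal e) (finite_subsets_at_top UNIV)"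
    using assms(1) by (rule order_tendstoD) (use e in simp)
  then obtain F where F: "finite F" "qnorm (sum_space X0 X1) (\<lambda>y. a y - (\<Sum>i\<in>F. s i y)) < ennreal e"
    unfolding eventually_finite_subsets_at_top by blast
  then obtain b c where bc: "b \<in> carrier X0" "c \<in> carrier X1" "(\<lambda>y. a y - (\<Sum>i\<in>F. s i y)) = (\<lambda>y. b y + c y)"
    "qnorm X0 b + qnorm X1 c < ennreal e"
    unfolding sum_space_def snd_conv INF_less_iff by auto
  have "qnorm X0 b \<le> qnorm X0 b + qnorm X1 c" "qnorm X1 c \<le> qnorm X0 b + qnorm X1 c"
    by (auto intro: add_increasing add_increasing2)
  from this[THEN order_trans[OF _ less_imp_le[OF bc(4)]]]
  have "qnorm X0 b \<le> ennreal e" "qnorm X1 c \<le> ennreal e" .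
  moreover have "a y = (\<Sum>i\<in>F. s i y) + b y + c y" for y
    using fun_cong[OF bc(3), of y] by (simp add: algebra_simps)
  ultimately show ?thesis using F(1) bc(1,2) unfolding inball_def by blast
qed

lemma pm_tendstoI:
  assumes "\<delta> \<longlonglongrightarrow> 0" and "\<And>N F. finite F \<Longrightarrow> {- int N..int N} \<subseteq> F \<Longrightarrow>
    qnorm (sum_space X0 X1) (\<lambda>y. a y - (\<Sum>i\<in>F. s i y)) \<le> ennreal (\<delta> N)"
  shows "((\<lambda>F. qnorm (sum_space X0 X1) (\<lambda>y. a y - (\<Sum>i\<in>F. s i y))) \<longlongrightarrow> 0) (finite_subsets_at_top (UNIV :: int set))"
proof (rule order_tendstoI)
  fix e :: ennreal assume e: "0 < e"
  have "(\<lambda>N. ennreal (\<delta> N)) \<longlonglongrightarrow> ennreal 0" by (intro tendsto_ennrealI assms)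
  then have "eventually (\<lambda>N. ennreal (\<delta> N) < e) sequentially" using e by (intro order_tendstoD) auto
  then obtain N where N: "ennreal (\<delta> N) < e" by (auto simp: eventually_sequentially)
  show "eventually (\<lambda>F. qnorm (sum_space X0 X1) (\<lambda>y. a y - (\<Sum>i\<in>F. s i y)) < e) (finite_subsets_at_top UNIV)"
    unfolding eventually_finite_subsets_at_top
    using N assms(2)[of _ N] by (intro exI[of _ "{- int N..int N}"]) (auto intro: order_le_less_trans)
qed (simp add: not_less)

text \<open>Summability of the integrals makes the series of |g k|^p finite almost everywhere, so
  its terms tend to 0.\<close>

lemma AE_tendsto_of_Lint:
  assumes [measurable]: "\<And>k. g k \<in> borel_measurable lebesgue" "Q \<in> sets lebesgue"
    and "(\<Sum>k. Lint p Q (g k)) < \<infinity>" and p: "0 < p"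
  shows "AE y in lebesgue. y \<in> Q \<longrightarrow> (\<lambda>k. g k y) \<longlonglongrightarrow> 0"
proof -
  let ?h = "\<lambda>k y. ennreal (cmod (g k y) powr p) * indicator Q y"
  have "(\<integral>\<^sup>+y. (\<Sum>k. ?h k y) \<partial>lebesgue) = (\<Sum>k. Lint p Q (g k))"
    unfolding Lint_def by (intro nn_integral_suminf) measurable
  then have "AE y in lebesgue. (\<Sum>k. ?h k y) \<noteq> \<infinity>"
    using assms(3) by (intro nn_integral_PInf_AE) auto
  then show ?thesis
  proof eventually_elim
    case (elim y)
    show ?case
    proof
      assume y: "y \<in> Q"
      have "summable (\<lambda>k. cmod (g k y) powr p)"
        using elim y by (intro summable_suminf_not_top) auto
      then have "(\<lambda>k. cmod (g k y) powr p) \<longlonglongrightarrow> 0" by (rule summable_LIMSEQ_zero)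
      then have "(\<lambda>k. (cmod (g k y) powr p) powr (1 / p)) \<longlonglongrightarrow> 0 powr (1 / p)"
        using p by (intro tendsto_powr2 tendsto_const) auto
      then have "(\<lambda>k. cmod (g k y)) \<longlonglongrightarrow> 0" using p by (simp add: powr_powr)
      then show "(\<lambda>k. g k y) \<longlonglongrightarrow> 0" by (rule tendsto_norm_zero_cancel)
    qed
  qed
qed

lemma Lint_fatou:
  assumes [measurable]: "\<And>k. g k \<in> borel_measurable lebesgue" "Q \<in> sets lebesgue"
    and lim: "AE y in lebesgue. y \<in> Q \<longrightarrow> (\<lambda>k. g k y) \<longlonglongrightarrow> a y"
    and B: "\<And>k. Lint p Q (g k) \<le> B" and p: "0 < p"
  shows "Lint p Q a \<le> B"
proof -
  let ?h = "\<lambda>k y. ennreal (cmod (g k y) powr p) * indicator Q y"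
  have "Lint p Q a \<le> (\<integral>\<^sup>+y. liminf (\<lambda>k. ?h k y) \<partial>lebesgue)"
    unfolding Lint_def
  proof (rule nn_integral_mono_AE)
    show "AE y in lebesgue. ennreal (cmod (a y) powr p) * indicator Q y \<le> liminf (\<lambda>k. ?h k y)"
      using lim
    proof eventually_elim
      case (elim y)
      show ?case
      proof (cases "y \<in> Q")
        case True
        with elim have "(\<lambda>k. cmod (g k y)) \<longlonglongrightarrow> cmod (a y)" by (intro tendsto_norm) simp
        then have "(\<lambda>k. cmod (g k y) powr p) \<longlonglongrightarrow> cmod (a y) powr p"
          using p by (intro tendsto_powr2 tendsto_const) auto
        then have "(\<lambda>k. ennreal (cmod (g k y) powr p)) \<longlonglongrightarrow> ennreal (cmod (a y) powr p)"
          by (rule tendsto_ennrealI)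
        then have "liminf (\<lambda>k. ennreal (cmod (g k y) powr p)) = ennreal (cmod (a y) powr p)"
          by (intro lim_imp_Liminf) auto
        then show ?thesis using True by simp
      qed simp
    qed
  qed
  also have "\<dots> \<le> liminf (\<lambda>k. \<integral>\<^sup>+y. ?h k y \<partial>lebesgue)" by (intro nn_integral_liminf) measurable
  also have "\<dots> \<le> B"
    using B unfolding Lint_def by (intro Liminf_le) (auto intro!: always_eventually)
  finally show ?thesis .
qed

text \<open>Finite partial sums are chosen with remainders at most 2^(-k) in both end spaces. Their
  local integrals, possibly with different exponents, are summable, so the partial sums converge to
  a almost everywhere on the cube. Fatou's lemma then transfers every uniform bound on finite
  partial sums to a, without continuity of the quasi-norm.\<close>

lemma pm_fatou:
  fixes a :: "real ^ 'n::finite \<Rightarrow> complex"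
  assumes X0: "dominated (inball X0) (camp p0 s0 k0)" and X1: "dominated (inball X1) (camp p1 s1 k1)"
    and p: "0 < p0" "0 < p1" "0 < p"
    and lim: "((\<lambda>F. qnorm (sum_space X0 X1) (\<lambda>y. a y - (\<Sum>i\<in>F. s i y))) \<longlongrightarrow> 0) (finite_subsets_at_top (UNIV :: int set))"
    and s: "\<And>i. s i \<in> borel_measurable lebesgue"
    and l: "l \<le> 1" and P: "\<And>F. finite F \<Longrightarrow> Lint p (cube x l) (\<lambda>y. \<Sum>i\<in>F. s i y) \<le> B"
  shows "Lint p (cube x l) a \<le> B"
proof -
  have "\<exists>F b c. finite F \<and> inball X0 ((1/2) ^ k) b \<and> inball X1 ((1/2) ^ k) c \<and> (\<forall>y. a y = (\<Sum>i\<in>F. s i y) + b y + c y)" for k :: nat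
    by (rule pm_limit[OF lim]) simp
  then obtain F b c where F: "\<And>k. finite (F k)" and b: "\<And>k. inball X0 ((1/2) ^ k) (b k)" and c: "\<And>k. inball X1 ((1/2) ^ k) (c k)"
    and a: "\<And>k y. a y = (\<Sum>i\<in>F k. s i y) + b k y + c k y" by metis
  have small: "AE y in lebesgue. y \<in> cube x l \<longrightarrow> (\<lambda>k. g k y) \<longlonglongrightarrow> 0"
    if X: "dominated (inball X) (camp q t j)" and q: "0 < q" and g: "\<And>k. inball X ((1/2) ^ k) (g k)" for X q t j and g :: "nat \<Rightarrow> real ^ 'n \<Rightarrow> complex"
  proof -
    obtain C where C: "0 < C" "\<And>M f. 0 < M \<Longrightarrow> inball X M f \<Longrightarrow> camp q t j (C * M) f"
      using X unfolding dominated_def by blast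
    have gk: "camp q t j (C * (1/2) ^ k) (g k)" for k using C(2)[OF _ g] by simp
    have pw: "(C * (1/2) ^ k) powr q = C powr q * ((1/2) powr q) ^ k" for k
      using C(1) by (simp add: powr_mult powr_powr mult.commute flip: powr_realpow)
    have r: "(1/2 :: real) powr q < 1" using q powr_less_mono2[of q "1/2" 1] by simp
    have "(\<Sum>k. Lint q (cube x l) (g k)) \<le> (\<Sum>k. ennreal (C powr q * ((1/2) powr q) ^ k))"
    proof (rule suminf_le)
      fix k
      have "Lint q (cube x l) (g k) \<le> Lint q (cube x 1) (g k)" using l by (intro Lint_subset cube_subset) auto
      then show "Lint q (cube x l) (g k) \<le> ennreal (C powr q * ((1/2) powr q) ^ k)"
        using campD(2)[OF gk[of k], of x] unfolding pw by (rule order_trans)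
    qed auto
    also have "\<dots> = ennreal (\<Sum>k. C powr q * ((1/2) powr q) ^ k)"
      using r by (intro suminf_ennreal2) (auto intro!: summable_mult summable_geometric)
    also have "\<dots> < \<infinity>" by simp
    finally show ?thesis
      using q campD(1)[OF gk] by (intro AE_tendsto_of_Lint) auto
  qed
  show ?thesis
  proof (rule Lint_fatou[OF _ _ _ _ p(3)])
    show "AE y in lebesgue. y \<in> cube x l \<longrightarrow> (\<lambda>k. \<Sum>i\<in>F k. s i y) \<longlonglongrightarrow> a y"
      using small[OF X0 p(1) b] small[OF X1 p(2) c]
    proof eventually_elim
      case (elim y)
      show ?case
      proof
        assume "y \<in> cube x l"
        then have "(\<lambda>k. a y - b k y - c k y) \<longlonglongrightarrow> a y - 0 - 0"
          using elim by (intro tendsto_diff tendsto_const) auto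
        moreover have "(\<lambda>k. a y - b k y - c k y) = (\<lambda>k. \<Sum>i\<in>F k. s i y)"
          using a[of y] by (auto simp: algebra_simps)
        ultimately show "(\<lambda>k. \<Sum>i\<in>F k. s i y) \<longlonglongrightarrow> a y" by simp
      qed
    qed
    show "(\<lambda>y. \<Sum>i\<in>F k. s i y) \<in> borel_measurable lebesgue" for k using s by measurable
    show "Lint p (cube x l) (\<lambda>y. \<Sum>i\<in>F k. s i y) \<le> B" for k by (rule P[OF F])
  qed simp
qed

lemma carrier_sum_measurable:
  assumes "dominated (inball X0) (camp p0 s0 k0)" "dominated (inball X1) (camp p1 s1 k1)"
    and "\<And>f. f \<in> carrier X0 \<Longrightarrow> qnorm X0 f < \<infinity>" "\<And>f. f \<in> carrier X1 \<Longrightarrow> qnorm X1 f < \<infinity>"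
    and "a \<in> carrier (sum_space X0 X1)"
  shows "a \<in> borel_measurable lebesgue"
proof -
  have m: "f \<in> borel_measurable lebesgue"
    if X: "dominated (inball X) (camp q t j)" and "\<And>f. f \<in> carrier X \<Longrightarrow> qnorm X f < \<infinity>" "f \<in> carrier X"
    for X q t j and f :: "real ^ 'b::finite \<Rightarrow> complex"
  proof -
    obtain C where C: "0 < C" "\<And>M f. 0 < M \<Longrightarrow> inball X M f \<Longrightarrow> camp q t j (C * M) f"
      using X unfolding dominated_def by blast
    have "qnorm X f \<le> ennreal (enn2real (qnorm X f) + 1)"
      using that(2)[OF that(3)] by (cases "qnorm X f") (auto intro: ennreal_leI)
    then have "inball X (enn2real (qnorm X f) + 1) f" using that(3) by (simp add: inball_def)
    then show ?thesis using C(2)[of "enn2real (qnorm X f) + 1" f] campD(1) by (auto simp: add_nonneg_pos)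
  qed
  obtain b c where "b \<in> carrier X0" "c \<in> carrier X1" "a = (\<lambda>y. b y + c y)"
    using assms(5) unfolding sum_space_def by auto
  then show ?thesis using m[OF assms(1,3)] m[OF assms(2,4)] by auto
qed

subsection \<open>The Morrey case\<close>

lemma camp_morrey:
  fixes f :: "real ^ 'n::finite \<Rightarrow> complex"
  shows "camp p s (-1) M f \<longleftrightarrow> f \<in> borel_measurable lebesgue \<and>
    (\<forall>x l. 0 < l \<longrightarrow> l \<le> 1 \<longrightarrow> Lint p (cube x l) f \<le> ennreal ((M * l powr s) powr p * l ^ CARD('n)))"
proof -
  have "P \<in> polys (-1) \<longleftrightarrow> P = (\<lambda>y. 0)" for P :: "real ^ 'n \<Rightarrow> complex"
    using polys_neg[of P "-1"] polys_0[of "-1"] by auto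
  then have e: "(\<exists>P\<in>polys (-1). Lint p Q (\<lambda>y. f y - P y) \<le> B) \<longleftrightarrow> Lint p Q f \<le> B" for Q B by simp
  have "Lint p (cube x 1) f \<le> ennreal (M powr p)"
    if "\<forall>x l. 0 < l \<longrightarrow> l \<le> 1 \<longrightarrow> Lint p (cube x l) f \<le> ennreal ((M * l powr s) powr p * l ^ CARD('n))" for x
    using that[rule_format, of 1 x] by simp
  then show ?thesis unfolding camp_def e by blast
qed

text \<open>The sums over A and over A with j toggled differ by u j up to sign. Averaging over all
  subsets recovers the single term, at the price of the constant in the quasi-triangle inequality
  and for every q > 0.\<close>

lemma toggle_sum_bound:
  fixes u :: "int \<Rightarrow> complex"
  assumes F: "finite F" and j: "j \<in> F" and q: "0 < q"
  shows "cmod (u j) powr q \<le> 2 * 2 powr q / 2 ^ card F * (\<Sum>A\<in>Pow F. cmod (\<Sum>i\<in>A. u i) powr q)"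
proof -
  define S where "S A = cmod (\<Sum>i\<in>A. u i)" for A
  \<comment> \<open>An involution of the power set of F, so it permutes the sum over all
    subsets.\<close>
  define tog where "tog A = (if j \<in> A then A - {j} else insert j A)" for A
  have 1: "cmod (u j) powr q \<le> 2 powr q * (S A powr q + S (tog A) powr q)" if A: "A \<in> Pow F" for A
  proof -
    have fA: "finite A" using A F finite_subset by blast
    have "cmod (u j) \<le> S A + S (tog A)"
    proof (cases "j \<in> A")
      case True
      then have "(\<Sum>i\<in>A. u i) = u j + (\<Sum>i\<in>A - {j}. u i)" using fA by (simp add: sum.remove)
      then show ?thesis using True norm_triangle_ineq4[of "\<Sum>i\<in>A. u i" "\<Sum>i\<in>A - {j}. u i"]
        by (simp add: S_def tog_def)
    next
      case False
      then have "(\<Sum>i\<in>insert j A. u i) = u j + (\<Sum>i\<in>A. u i)" using fA by simp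
      then show ?thesis using False norm_triangle_ineq4[of "\<Sum>i\<in>insert j A. u i" "\<Sum>i\<in>A. u i"]
        by (simp add: S_def tog_def)
    qed
    then have "cmod (u j) powr q \<le> (S A + S (tog A)) powr q" using q by (intro powr_mono2) auto
    also have "\<dots> \<le> 2 powr q * (S A powr q + S (tog A) powr q)"
      using q by (intro powr_add_le) (auto simp: S_def)
    finally show ?thesis .
  qed
  have "2 ^ card F * cmod (u j) powr q = (\<Sum>A\<in>Pow F. cmod (u j) powr q)" using F by (simp add: card_Pow)
  also have "\<dots> \<le> (\<Sum>A\<in>Pow F. 2 powr q * (S A powr q + S (tog A) powr q))" by (intro sum_mono 1)
  also have "\<dots> = 2 powr q * ((\<Sum>A\<in>Pow F. S A powr q) + (\<Sum>A\<in>Pow F. S (tog A) powr q))"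
    by (simp add: sum.distrib flip: sum_distrib_left)
  also have "(\<Sum>A\<in>Pow F. S (tog A) powr q) = (\<Sum>A\<in>Pow F. S A powr q)"
    using j by (intro sum.reindex_bij_witness[of _ tog tog]) (auto simp: tog_def)
  finally show ?thesis by (simp add: S_def divide_simps mult_ac)
qed

definition geo_const :: "real \<Rightarrow> real"
  where "geo_const \<Theta> = 4 / (1 - max (2 powr (- \<Theta>)) (2 powr (- (1 - \<Theta>))))"

text \<open>The two majorants cross at j = log 2 (a1 / a0), where both equal a0^(1 - \<Theta>)
  a1^\<Theta>. The first decays to the left of this point and the second to the right, so both
  halves are geometric sums.\<close>

lemma two_sided_geometric:
  fixes a0 a1 :: real and v :: "int \<Rightarrow> real"
  assumes T: "0 < \<Theta>" "\<Theta> < 1" and a: "0 \<le> a0" "0 \<le> a1" and F: "finite F"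
    and v: "\<And>j. j \<in> F \<Longrightarrow> v j \<le> 2 powr (of_int j * \<Theta>) * a0" "\<And>j. j \<in> F \<Longrightarrow> v j \<le> 2 powr (- of_int j * (1 - \<Theta>)) * a1"
  shows "(\<Sum>j\<in>F. v j) \<le> geo_const \<Theta> * (a0 powr (1 - \<Theta>) * a1 powr \<Theta>)"
proof (cases "a0 = 0 \<or> a1 = 0")
  case True
  then have "(\<Sum>j\<in>F. v j) \<le> 0" using v by (intro sum_nonpos) force
  then show ?thesis using True by auto
next
  case False
  then have pos: "0 < a0" "0 < a1" using a by auto
  define q where "q = max (2 powr (- \<Theta>)) (2 powr (- (1 - \<Theta>)) :: real)"
  have q: "0 < q" "q < 1"
    using T powr_less_mono[of "- \<Theta>" 0 2] powr_less_mono[of "- (1 - \<Theta>)" 0 2] by (auto simp: q_def less_max_iff_disj)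
  define G where "G = a0 powr (1 - \<Theta>) * a1 powr \<Theta>"
  have G: "0 < G" using pos by (simp add: G_def)
  define j0 where "j0 = \<lfloor>log 2 (a1 / a0)\<rfloor>"
  have j0: "of_int j0 \<le> log 2 (a1 / a0)" "log 2 (a1 / a0) < of_int j0 + 1" unfolding j0_def by linarith+
  define R where "R = log 2 (a1 / a0)"
  have a1: "a1 = 2 powr R * a0" using pos by (simp add: R_def)
  have G0: "2 powr (R * \<Theta>) * a0 = G"
  proof -
    have "G = a0 powr (1 - \<Theta>) * (2 powr R * a0) powr \<Theta>" unfolding G_def by (simp add: a1)
    also have "\<dots> = 2 powr (R * \<Theta>) * (a0 powr (1 - \<Theta>) * a0 powr \<Theta>)" using pos by (simp add: powr_mult powr_powr)
    also have "a0 powr (1 - \<Theta>) * a0 powr \<Theta> = a0" using pos by (simp flip: powr_add)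
    finally show ?thesis by simp
  qed
  have G1: "2 powr (- R * (1 - \<Theta>)) * a1 = G"
  proof -
    have "2 powr (- R * (1 - \<Theta>)) * 2 powr R = 2 powr (R * \<Theta>)"
      by (simp add: algebra_simps flip: powr_add)
    then show ?thesis unfolding a1 mult.assoc[symmetric] using G0 by simp
  qed
  have le: "v j \<le> 2 * G * q ^ nat \<bar>j - j0\<bar>" if j: "j \<in> F" for j
  proof (cases "j \<le> j0")
    case True
    have "v j \<le> 2 powr (of_int j * \<Theta>) * a0" by (rule v(1)[OF j])
    also have "2 powr (of_int j * \<Theta>) = 2 powr ((of_int j - R) * \<Theta>) * 2 powr (R * \<Theta>)"
      by (simp add: algebra_simps flip: powr_add)
    also have "\<dots> * a0 = 2 powr ((of_int j - R) * \<Theta>) * G" using G0 by simp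
    also have "2 powr ((of_int j - R) * \<Theta>) \<le> (2 powr (- \<Theta>)) powr real (nat \<bar>j - j0\<bar>)"
    proof -
      have "(of_int j - R) * \<Theta> \<le> - (of_int j0 - of_int j) * \<Theta>" using j0 T by (intro mult_right_mono) (auto simp: R_def)
      then show ?thesis using True by (simp add: powr_powr algebra_simps)
    qed
    also have "\<dots> \<le> q ^ nat \<bar>j - j0\<bar>" unfolding q_def by (subst powr_realpow) (auto intro!: power_mono)
    finally have "v j \<le> q ^ nat \<bar>j - j0\<bar> * G" using G by (simp add: mult_right_mono)
    also have "\<dots> \<le> 2 * G * q ^ nat \<bar>j - j0\<bar>" using G q by simp
    finally show ?thesis .
  next
    case False
    have "v j \<le> 2 powr (- of_int j * (1 - \<Theta>)) * a1" by (rule v(2)[OF j])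
    also have "2 powr (- of_int j * (1 - \<Theta>)) = 2 powr ((R - of_int j) * (1 - \<Theta>)) * 2 powr (- R * (1 - \<Theta>))"
      by (simp add: algebra_simps flip: powr_add)
    also have "\<dots> * a1 = 2 powr ((R - of_int j) * (1 - \<Theta>)) * G" using G1 by simp
    \<comment> \<open>The factor 2 pays for rounding the crossing point down to the integer
      \<open>j0\<close>.\<close>
    also have "2 powr ((R - of_int j) * (1 - \<Theta>)) \<le> 2 * (2 powr (- (1 - \<Theta>))) powr real (nat \<bar>j - j0\<bar>)"
    proof -
      have "(R - of_int j) * (1 - \<Theta>) \<le> (of_int j0 + 1 - of_int j) * (1 - \<Theta>)" using j0 T by (intro mult_right_mono) (auto simp: R_def)
      also have "\<dots> \<le> 1 + - (1 - \<Theta>) * real (nat \<bar>j - j0\<bar>)" using False T by (simp add: algebra_simps)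
      finally have "2 powr ((R - of_int j) * (1 - \<Theta>)) \<le> 2 powr (1 + - (1 - \<Theta>) * real (nat \<bar>j - j0\<bar>))" by (intro powr_mono) auto
      also have "\<dots> = 2 * (2 powr (- (1 - \<Theta>))) powr real (nat \<bar>j - j0\<bar>)" unfolding powr_add powr_powr by simp
      finally show ?thesis .
    qed
    also have "(2 powr (- (1 - \<Theta>))) powr real (nat \<bar>j - j0\<bar>) \<le> q ^ nat \<bar>j - j0\<bar>"
      unfolding q_def by (subst powr_realpow) (auto intro!: power_mono)
    finally show ?thesis using G by (simp add: mult_right_mono mult_ac)
  qed
  have "(\<Sum>j\<in>F. v j) \<le> (\<Sum>j\<in>F. 2 * G * q ^ nat \<bar>j - j0\<bar>)" by (intro sum_mono le)
  also have "\<dots> = 2 * G * ((\<Sum>j\<in>F \<inter> {..j0}. q ^ nat \<bar>j - j0\<bar>) + (\<Sum>j\<in>F - {..j0}. q ^ nat \<bar>j - j0\<bar>))"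
    using F by (simp add: sum_distrib_left[symmetric] sum.Int_Diff[of F _ "{..j0}"])
  also have "\<dots> \<le> 2 * G * (1 / (1 - q) + 1 / (1 - q))"
    using G q F by (intro mult_left_mono add_mono geometric_sum_le) (auto simp: inj_on_def)
  also have "\<dots> = geo_const \<Theta> * G" by (simp add: geo_const_def q_def)
  finally show ?thesis by (simp add: G_def)
qed

section \<open>Hoelder interpolation of Morrey bounds\<close>

lemma nn_integral_lincomb:
  fixes h0 h1 :: "'a \<Rightarrow> ennreal"
  assumes "h0 \<in> borel_measurable N" "h1 \<in> borel_measurable N"
  shows "(\<integral>\<^sup>+y. a * h0 y + b * h1 y \<partial>N) = a * (\<integral>\<^sup>+y. h0 y \<partial>N) + b * (\<integral>\<^sup>+y. h1 y \<partial>N)"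
  using assms by (simp add: nn_integral_add nn_integral_cmult)

lemma le_mult_of_inverse:
  fixes a t x w :: real
  assumes "t * x \<le> w" "a * t = 1" "0 \<le> a" shows "x \<le> a * w"
proof -
  have "x = a * (t * x)" using assms(2) by (simp flip: mult.assoc)
  also have "\<dots> \<le> a * w" by (rule mult_left_mono[OF assms(1,3)])
  finally show ?thesis .
qed

text \<open>Pointwise control of single pieces is needed, but the hypotheses only bound finite sums.
  Averages over subsets of F supply functions \<open>W0\<close> and \<open>W1\<close> that dominate
  all weighted pieces at once, with integrals bounded independently of F. Their geometric mean
  dominates the sum, and \<open>pm_fatou\<close> removes the restriction to finite F.\<close>

lemma pm_subset_morrey:
  fixes X0 X1 :: "(real ^ 'n::finite) quasi_space"
  assumes T: "0 < \<Theta>" "\<Theta> < 1" and p: "0 < p0" "0 < p1" "0 < p" and pp: "1 / p = (1 - \<Theta>) / p0 + \<Theta> / p1"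
    and s: "p0 * s0 = p * s" "p1 * s1 = p * s"
    and X0: "X0 = campanato \<tau>0 p0 k0" "dominated (inball X0) (camp p0 s0 (-1))"
    and X1: "X1 = campanato \<tau>1 p1 k1" "dominated (inball X1) (camp p1 s1 (-1))"
  shows "dominated (in_pm X0 X1 \<Theta>) (camp p s (-1))"
proof -
  let ?n = "CARD('n)"
  obtain C0 where C0: "0 < C0" "\<And>M f. 0 < M \<Longrightarrow> inball X0 M f \<Longrightarrow> camp p0 s0 (-1) (C0 * M) f"
    using X0(2) unfolding dominated_def by blast
  obtain C1 where C1: "0 < C1" "\<And>M f. 0 < M \<Longrightarrow> inball X1 M f \<Longrightarrow> camp p1 s1 (-1) (C1 * M) f"
    using X1(2) unfolding dominated_def by blast
  \<comment> \<open>The Hoelder weights of the two end spaces; they add up to 1 by the relation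
    between the integrability exponents.\<close>
  define \<alpha> where "\<alpha> = (1 - \<Theta>) * p / p0"
  define \<beta> where "\<beta> = \<Theta> * p / p1"
  have ab: "0 < \<alpha>" "0 < \<beta>" "\<alpha> + \<beta> = 1"
  proof -
    show "0 < \<alpha>" "0 < \<beta>" using T p by (auto simp: \<alpha>_def \<beta>_def)
    have "\<alpha> + \<beta> = p * ((1 - \<Theta>) / p0 + \<Theta> / p1)" by (simp add: \<alpha>_def \<beta>_def distrib_left mult.commute)
    also have "\<dots> = 1" using p by (simp flip: pp)
    finally show "\<alpha> + \<beta> = 1" .
  qed
  define D0 where "D0 = 2 * 2 powr p0 * C0 powr p0"
  define D1 where "D1 = 2 * 2 powr p1 * C1 powr p1"
  have D: "0 < D0" "0 < D1" using C0 C1 by (auto simp: D0_def D1_def)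
  define K where "K = geo_const \<Theta> powr p * (D0 powr \<alpha> * D1 powr \<beta>)"
  have gc: "0 < geo_const \<Theta>"
    using T powr_less_mono[of "- \<Theta>" 0 2] powr_less_mono[of "- (1 - \<Theta>)" 0 2] by (simp add: geo_const_def)
  have K: "0 < K" using gc D by (simp add: K_def)
  have "camp p s (-1) (K powr (1 / p) * M) a" if M: "0 < M" and a: "in_pm X0 X1 \<Theta> M a" for M a
  proof -
    obtain u where u: "\<And>i. u i \<in> carrier X0" "\<And>i. u i \<in> carrier X1"
      and lim: "((\<lambda>F. qnorm (sum_space X0 X1) (\<lambda>y. a y - (\<Sum>i\<in>F. u i y))) \<longlongrightarrow> 0) (finite_subsets_at_top UNIV)"
      and b0: "pm_bound X0 (0 - \<Theta>) u M" and b1: "pm_bound X1 (1 - \<Theta>) u M"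
      using a unfolding in_pm_def pm_admissible_def by blast
    have um [measurable]: "u i \<in> borel_measurable lebesgue" for i
      using u(1)[of i] unfolding X0(1) by (rule carrier_campanatoD)
    have bound: "Lint p (cube x l) (\<lambda>y. \<Sum>i\<in>F. u i y) \<le> ennreal (K * ((M * l powr s) powr p * l ^ ?n))"
      if l: "0 < l" "l \<le> 1" and F: "finite F" for x l F
    proof -
      let ?Q = "cube x l"
      define S0 where "S0 A y = (\<Sum>i\<in>A. of_real (2 powr (of_int i * (0 - \<Theta>))) * u i y)" for A y
      define S1 where "S1 A y = (\<Sum>i\<in>A. of_real (2 powr (of_int i * (1 - \<Theta>))) * u i y)" for A y
      have Sm [measurable]: "S0 A \<in> borel_measurable lebesgue" "S1 A \<in> borel_measurable lebesgue" for A
        unfolding S0_def S1_def by measurable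
      define B where "B = M powr p * l powr (p * s + real ?n)"
      have B: "0 < B" using M l by (simp add: B_def)
      \<comment> \<open>Because \<open>p0 * s0\<close> and \<open>p1 * s1\<close> both equal
        \<open>p * s\<close>, the same power of l arises for all three exponents.\<close>
      have L0: "Lint p0 ?Q (S0 A) \<le> ennreal ((C0 * M) powr p0 * l powr (p * s + real ?n))" if "A \<in> Pow F" for A
      proof -
        have "finite A" using that F finite_subset by blast
        then have "inball X0 M (S0 A)"
          using pm_bound_inball[OF b0[unfolded X0(1)] p(1) less_imp_le[OF M], of A "\<lambda>_. 1"] u(1)
          unfolding X0(1) S0_def by simp
        then have "camp p0 s0 (-1) (C0 * M) (S0 A)" using C0(2) M by blast
        then have "Lint p0 ?Q (S0 A) \<le> ennreal ((C0 * M * l powr s0) powr p0 * l ^ ?n)"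
          using l unfolding camp_morrey by blast
        moreover have "s0 * p0 + real ?n = p * s + real ?n" using s by (simp add: mult.commute)
        ultimately show ?thesis using powr_power_collect[of "C0 * M" l s0 p0 ?n] C0 M l by simp
      qed
      have L1: "Lint p1 ?Q (S1 A) \<le> ennreal ((C1 * M) powr p1 * l powr (p * s + real ?n))" if "A \<in> Pow F" for A
      proof -
        have "finite A" using that F finite_subset by blast
        then have "inball X1 M (S1 A)"
          using pm_bound_inball[OF b1[unfolded X1(1)] p(2) less_imp_le[OF M], of A "\<lambda>_. 1"] u(2)
          unfolding X1(1) S1_def by simp
        then have "camp p1 s1 (-1) (C1 * M) (S1 A)" using C1(2) M by blast
        then have "Lint p1 ?Q (S1 A) \<le> ennreal ((C1 * M * l powr s1) powr p1 * l ^ ?n)"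
          using l unfolding camp_morrey by blast
        moreover have "s1 * p1 + real ?n = p * s + real ?n" using s by (simp add: mult.commute)
        ultimately show ?thesis using powr_power_collect[of "C1 * M" l s1 p1 ?n] C1 M l by simp
      qed
      let ?c = "2 ^ card F :: real"
      define N0 where "N0 = D0 * M powr p0 * l powr (p * s + real ?n)"
      define N1 where "N1 = D1 * M powr p1 * l powr (p * s + real ?n)"
      have N: "0 < N0" "0 < N1" using D M l by (auto simp: N0_def N1_def)
      \<comment> \<open>The subset average from \<open>toggle_sum_bound\<close>; division by the
        number of subsets makes its integral independent of F.\<close>
      define W0 where "W0 y = 2 * 2 powr p0 / ?c * (\<Sum>A\<in>Pow F. cmod (S0 A y) powr p0)" for y
      define W1 where "W1 y = 2 * 2 powr p1 / ?c * (\<Sum>A\<in>Pow F. cmod (S1 A y) powr p1)" for y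
      have W: "0 \<le> W0 y" "0 \<le> W1 y" for y by (auto simp: W0_def W1_def intro!: divide_nonneg_nonneg mult_nonneg_nonneg sum_nonneg)
      have Wm [measurable]: "W0 \<in> borel_measurable lebesgue" "W1 \<in> borel_measurable lebesgue"
        unfolding W0_def W1_def by measurable
      have int: "(\<integral>\<^sup>+y. ennreal (2 * 2 powr q / ?c * (\<Sum>A\<in>Pow F. cmod (S A y) powr q)) * indicator ?Q y \<partial>lebesgue)
          \<le> ennreal (2 * 2 powr q * b)"
        if [measurable]: "\<And>A. S A \<in> borel_measurable lebesgue" and b: "\<And>A. A \<in> Pow F \<Longrightarrow> Lint q ?Q (S A) \<le> ennreal b" "0 \<le> b"
        for q b and S :: "int set \<Rightarrow> real ^ 'n \<Rightarrow> complex"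
      proof -
        have "(\<integral>\<^sup>+y. ennreal (2 * 2 powr q / ?c * (\<Sum>A\<in>Pow F. cmod (S A y) powr q)) * indicator ?Q y \<partial>lebesgue)
          = (\<integral>\<^sup>+y. ennreal (2 * 2 powr q / ?c) * (\<Sum>A\<in>Pow F. ennreal (cmod (S A y) powr q) * indicator ?Q y) \<partial>lebesgue)"
        proof (rule nn_integral_cong)
          fix y
          have "ennreal (\<Sum>A\<in>Pow F. cmod (S A y) powr q) = (\<Sum>A\<in>Pow F. ennreal (cmod (S A y) powr q))"
            by (subst sum_ennreal) auto
          then show "ennreal (2 * 2 powr q / ?c * (\<Sum>A\<in>Pow F. cmod (S A y) powr q)) * indicator ?Q y
            = ennreal (2 * 2 powr q / ?c) * (\<Sum>A\<in>Pow F. ennreal (cmod (S A y) powr q) * indicator ?Q y)"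
            by (subst ennreal_mult) (auto simp: sum_nonneg sum_distrib_right mult.assoc simp del: sum_ennreal)
        qed
        also have "\<dots> = ennreal (2 * 2 powr q / ?c) * (\<Sum>A\<in>Pow F. Lint q ?Q (S A))"
          unfolding Lint_def by (subst nn_integral_cmult, measurable) (subst nn_integral_sum, auto)
        also have "\<dots> \<le> ennreal (2 * 2 powr q / ?c) * (\<Sum>A\<in>Pow F. ennreal b)"
          by (intro mult_left_mono sum_mono b) auto
        also have "(\<Sum>A\<in>Pow F. ennreal b) = ennreal (?c * b)"
          using b(2) F by (simp add: card_Pow ennreal_mult flip: ennreal_power)
        also have "ennreal (2 * 2 powr q / ?c) * ennreal (?c * b) = ennreal (2 * 2 powr q * b)"
          using b(2) by (simp flip: ennreal_mult)
        finally show ?thesis .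
      qed
      have I0: "(\<integral>\<^sup>+y. ennreal (W0 y) * indicator ?Q y \<partial>lebesgue) \<le> ennreal N0"
        using int[of S0 p0 "(C0 * M) powr p0 * l powr (p * s + real ?n)"] L0 Sm C0 M
        by (simp add: W0_def N0_def D0_def powr_mult mult_ac)
      have I1: "(\<integral>\<^sup>+y. ennreal (W1 y) * indicator ?Q y \<partial>lebesgue) \<le> ennreal N1"
        using int[of S1 p1 "(C1 * M) powr p1 * l powr (p * s + real ?n)"] L1 Sm C1 M
        by (simp add: W1_def N1_def D1_def powr_mult mult_ac)
      let ?G = "geo_const \<Theta> powr p * (N0 powr \<alpha> * N1 powr \<beta>)"
      have pt: "cmod (\<Sum>i\<in>F. u i y) powr p \<le> ?G * (\<alpha> / N0 * W0 y + \<beta> / N1 * W1 y)" for y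
      proof -
        have u0: "cmod (u j y) \<le> 2 powr (of_int j * \<Theta>) * W0 y powr (1 / p0)" if j: "j \<in> F" for j
        proof -
          let ?t = "2 powr (of_int j * (0 - \<Theta>)) :: real"
          have "cmod (of_real ?t * u j y) powr p0 \<le> W0 y"
            using toggle_sum_bound[OF F j p(1), of "\<lambda>i. of_real (2 powr (of_int i * (0 - \<Theta>))) * u i y"]
            by (simp add: W0_def S0_def)
          then have "(cmod (of_real ?t * u j y) powr p0) powr (1 / p0) \<le> W0 y powr (1 / p0)"
            using p by (intro powr_mono2) auto
          then have "?t * cmod (u j y) \<le> W0 y powr (1 / p0)" using p by (simp add: powr_powr norm_mult)
          moreover have "2 powr (of_int j * \<Theta>) * ?t = 1" by (simp flip: powr_add)
          ultimately show ?thesis by (intro le_mult_of_inverse) auto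
        qed
        have u1: "cmod (u j y) \<le> 2 powr (- of_int j * (1 - \<Theta>)) * W1 y powr (1 / p1)" if j: "j \<in> F" for j
        proof -
          let ?t = "2 powr (of_int j * (1 - \<Theta>)) :: real"
          have "cmod (of_real ?t * u j y) powr p1 \<le> W1 y"
            using toggle_sum_bound[OF F j p(2), of "\<lambda>i. of_real (2 powr (of_int i * (1 - \<Theta>))) * u i y"]
            by (simp add: W1_def S1_def)
          then have "(cmod (of_real ?t * u j y) powr p1) powr (1 / p1) \<le> W1 y powr (1 / p1)"
            using p by (intro powr_mono2) auto
          then have "?t * cmod (u j y) \<le> W1 y powr (1 / p1)" using p by (simp add: powr_powr norm_mult)
          moreover have "2 powr (- of_int j * (1 - \<Theta>)) * ?t = 1" by (simp flip: powr_add)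
          ultimately show ?thesis by (intro le_mult_of_inverse) auto
        qed
        have "cmod (\<Sum>i\<in>F. u i y) \<le> (\<Sum>i\<in>F. cmod (u i y))" by (rule norm_sum)
        also have "\<dots> \<le> geo_const \<Theta> * ((W0 y powr (1 / p0)) powr (1 - \<Theta>) * (W1 y powr (1 / p1)) powr \<Theta>)"
          using u0 u1 T F by (intro two_sided_geometric) auto
        finally have "cmod (\<Sum>i\<in>F. u i y) powr p \<le> (geo_const \<Theta> * ((W0 y powr (1 / p0)) powr (1 - \<Theta>) * (W1 y powr (1 / p1)) powr \<Theta>)) powr p"
          using p by (intro powr_mono2) auto
        also have "\<dots> = geo_const \<Theta> powr p * (W0 y powr \<alpha> * W1 y powr \<beta>)"
          using gc by (simp add: powr_mult powr_powr \<alpha>_def \<beta>_def)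
        \<comment> \<open>Hoelder's inequality in Young's form: after division by the bounds
          \<open>N0\<close> and \<open>N1\<close> of the integrals, the right-hand side integrates
          to at most the prefactor times \<alpha> + \<beta> = 1.\<close>
        also have "W0 y powr \<alpha> * W1 y powr \<beta> \<le> N0 powr \<alpha> * N1 powr \<beta> * (\<alpha> / N0 * W0 y + \<beta> / N1 * W1 y)"
        proof (cases "W0 y = 0 \<or> W1 y = 0")
          case True
          then have "W0 y powr \<alpha> * W1 y powr \<beta> = 0" by auto
          also have "\<dots> \<le> N0 powr \<alpha> * N1 powr \<beta> * (\<alpha> / N0 * W0 y + \<beta> / N1 * W1 y)"
            using N ab W[of y] by (intro mult_nonneg_nonneg add_nonneg_nonneg) auto
          finally show ?thesis .
        next
          case False
          then have "0 < W0 y" "0 < W1 y" using W[of y] by auto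
          then have "(W0 y / N0) powr \<alpha> * (W1 y / N1) powr \<beta> \<le> \<alpha> * (W0 y / N0) + \<beta> * (W1 y / N1)"
            using ab N by (intro Youngs_inequality_0) auto
          then have "N0 powr \<alpha> * N1 powr \<beta> * ((W0 y / N0) powr \<alpha> * (W1 y / N1) powr \<beta>)
              \<le> N0 powr \<alpha> * N1 powr \<beta> * (\<alpha> * (W0 y / N0) + \<beta> * (W1 y / N1))"
            by (intro mult_left_mono) auto
          moreover have "N0 powr \<alpha> * N1 powr \<beta> * ((W0 y / N0) powr \<alpha> * (W1 y / N1) powr \<beta>) = W0 y powr \<alpha> * W1 y powr \<beta>"
            using N W[of y] by (simp add: powr_divide)
          ultimately show ?thesis by simp
        qed
        finally show ?thesis by (simp add: mult.assoc mult_left_mono)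
      qed
      have "Lint p ?Q (\<lambda>y. \<Sum>i\<in>F. u i y)
        \<le> (\<integral>\<^sup>+y. ennreal (?G * (\<alpha> / N0)) * (ennreal (W0 y) * indicator ?Q y) + ennreal (?G * (\<beta> / N1)) * (ennreal (W1 y) * indicator ?Q y) \<partial>lebesgue)"
        unfolding Lint_def
      proof (rule nn_integral_mono)
        fix y
        have "?G * (\<alpha> / N0 * W0 y + \<beta> / N1 * W1 y) = ?G * (\<alpha> / N0) * W0 y + ?G * (\<beta> / N1) * W1 y"
          by (simp only: distrib_left mult.assoc)
        then have "ennreal (cmod (\<Sum>i\<in>F. u i y) powr p) \<le> ennreal (?G * (\<alpha> / N0) * W0 y + ?G * (\<beta> / N1) * W1 y)"
          using pt[of y] by (intro ennreal_leI) simp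
        also have "\<dots> = ennreal (?G * (\<alpha> / N0)) * ennreal (W0 y) + ennreal (?G * (\<beta> / N1)) * ennreal (W1 y)"
        proof -
          have "0 \<le> ?G * (\<alpha> / N0)" "0 \<le> ?G * (\<beta> / N1)" using N ab by auto
          then show ?thesis using W[of y] by (simp only: ennreal_plus ennreal_mult mult_nonneg_nonneg)
        qed
        finally show "ennreal (cmod (\<Sum>i\<in>F. u i y) powr p) * indicator ?Q y
          \<le> ennreal (?G * (\<alpha> / N0)) * (ennreal (W0 y) * indicator ?Q y) + ennreal (?G * (\<beta> / N1)) * (ennreal (W1 y) * indicator ?Q y)"
          by (cases "y \<in> ?Q") auto
      qed
      also have "\<dots> = ennreal (?G * (\<alpha> / N0)) * (\<integral>\<^sup>+y. ennreal (W0 y) * indicator ?Q y \<partial>lebesgue)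
          + ennreal (?G * (\<beta> / N1)) * (\<integral>\<^sup>+y. ennreal (W1 y) * indicator ?Q y \<partial>lebesgue)"
        by (intro nn_integral_lincomb) measurable
      also have "\<dots> \<le> ennreal (?G * (\<alpha> / N0)) * ennreal N0 + ennreal (?G * (\<beta> / N1)) * ennreal N1"
        by (intro add_mono mult_left_mono I0 I1) auto
      also have "\<dots> = ennreal (?G * (\<alpha> / N0) * N0 + ?G * (\<beta> / N1) * N1)"
      proof -
        have "0 \<le> ?G * (\<alpha> / N0)" "0 \<le> ?G * (\<beta> / N1)" using N ab by auto
        then show ?thesis using N by (simp only: ennreal_plus ennreal_mult mult_nonneg_nonneg less_imp_le)
      qed
      also have "?G * (\<alpha> / N0) * N0 + ?G * (\<beta> / N1) * N1 = ?G * (\<alpha> + \<beta>)"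
        using N by (simp add: algebra_simps)
      also have "\<dots> = K * ((M * l powr s) powr p * l ^ ?n)"
      proof -
        let ?e = "p * s + real ?n"
        have "N0 powr \<alpha> * N1 powr \<beta> = D0 powr \<alpha> * D1 powr \<beta> * (M powr (p0 * \<alpha>) * M powr (p1 * \<beta>)) * (l powr (?e * \<alpha>) * l powr (?e * \<beta>))"
          unfolding N0_def N1_def using D M by (simp add: powr_mult powr_powr)
        also have "M powr (p0 * \<alpha>) * M powr (p1 * \<beta>) = M powr p"
        proof -
          have "p0 * \<alpha> = (1 - \<Theta>) * p" "p1 * \<beta> = \<Theta> * p" using p by (simp_all add: \<alpha>_def \<beta>_def)
          then have "p0 * \<alpha> + p1 * \<beta> = p" by (simp add: algebra_simps)
          then show ?thesis by (simp flip: powr_add)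
        qed
        also have "l powr (?e * \<alpha>) * l powr (?e * \<beta>) = l powr ?e"
          unfolding powr_add[symmetric] distrib_left[symmetric] ab(3) by simp
        also have "D0 powr \<alpha> * D1 powr \<beta> * M powr p * l powr ?e = D0 powr \<alpha> * D1 powr \<beta> * ((M * l powr s) powr p * l ^ ?n)"
          using powr_power_collect[OF M l(1), of s p ?n ?e] by (simp add: mult_ac)
        finally show ?thesis using ab(3) by (simp add: K_def mult.assoc)
      qed
      finally show ?thesis .
    qed
    have L: "Lint p (cube x l) a \<le> ennreal (K * ((M * l powr s) powr p * l ^ ?n))" if "0 < l" "l \<le> 1" for x l
      using bound[OF that] by (intro pm_fatou[OF X0(2) X1(2) p lim um that(2)]) auto
    have am: "a \<in> borel_measurable lebesgue"
      using a X0 X1 by (intro carrier_sum_measurable[OF X0(2) X1(2)]) (auto simp: in_pm_def campanato_def)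
    show ?thesis
    proof (rule campI[OF am p(3) M K])
      show "Lint p (cube x 1) a \<le> ennreal (K * M powr p)" for x using L[of 1 x] by simp
      show "\<exists>P\<in>polys (-1). Lint p (cube x l) (\<lambda>y. a y - P y) \<le> ennreal (K * ((M * l powr s) powr p * l ^ ?n))"
        if "0 < l" "l \<le> 1" for x l using L[OF that, of x] polys_0 by (intro bexI[of _ "\<lambda>_. 0"]) auto
    qed
  qed
  moreover have "0 < K powr (1 / p)" using K by simp
  ultimately show ?thesis unfolding dominated_def by blast
qed

text \<open>The integrand |g|^q is at most a multiple of |f|^p, and q r = p s turns one power of l
  into the other. Normalising |f| by M makes A the constant of the result.\<close>

lemma morrey_power:
  fixes f g :: "real ^ 'n::finite \<Rightarrow> complex"
  assumes f: "camp p s (-1) M f" and M: "0 < M" and p: "0 < p" and q: "0 < q" and s: "q * r = p * s" and A: "0 < A"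
    and g: "g \<in> borel_measurable lebesgue" "\<And>y. cmod (g y) \<le> A * (cmod (f y) / M) powr (p / q)"
  shows "camp q r (-1) A g"
  unfolding camp_morrey
proof (intro conjI allI impI g(1))
  fix x :: "real ^ 'n" and l :: real assume l: "0 < l" "l \<le> 1"
  let ?c = "A powr q / M powr p"
  have fm: "f \<in> borel_measurable lebesgue" using f by (rule campD)
  have "Lint q (cube x l) g \<le> (\<integral>\<^sup>+y. ennreal ?c * (ennreal (cmod (f y) powr p) * indicator (cube x l) y) \<partial>lebesgue)"
    unfolding Lint_def
  proof (rule nn_integral_mono)
    fix y
    have "cmod (g y) powr q \<le> (A * (cmod (f y) / M) powr (p / q)) powr q"
      using g(2)[of y] q by (intro powr_mono2) auto
    also have "\<dots> = ?c * cmod (f y) powr p" using A M q by (simp add: powr_mult powr_powr powr_divide)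
    finally have "ennreal (cmod (g y) powr q) \<le> ennreal (?c * cmod (f y) powr p)" by (rule ennreal_leI)
    also have "\<dots> = ennreal ?c * ennreal (cmod (f y) powr p)" by (rule ennreal_mult) auto
    finally show "ennreal (cmod (g y) powr q) * indicator (cube x l) y
      \<le> ennreal ?c * (ennreal (cmod (f y) powr p) * indicator (cube x l) y)"
      by (cases "y \<in> cube x l") auto
  qed
  also have "\<dots> = ennreal ?c * Lint p (cube x l) f"
    unfolding Lint_def using Lint_integrand_measurable[OF fm cube_lebesgue, of p x l] by (rule nn_integral_cmult)
  also have "\<dots> \<le> ennreal ?c * ennreal ((M * l powr s) powr p * l ^ CARD('n))"
    using f l unfolding camp_morrey by (intro mult_left_mono) auto
  also have "\<dots> = ennreal (?c * ((M * l powr s) powr p * l ^ CARD('n)))"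
    using l by (intro ennreal_mult[symmetric]) auto
  also have "?c * ((M * l powr s) powr p * l ^ CARD('n)) = (A * l powr r) powr q * l ^ CARD('n)"
  proof -
    have "l powr (s * p) = l powr (r * q)" using s by (simp add: mult.commute)
    then show ?thesis using M A l by (simp add: powr_mult powr_powr)
  qed
  finally show "Lint q (cube x l) g \<le> ennreal ((A * l powr r) powr q * l ^ CARD('n))" .
qed

text \<open>On the i-th piece 2^i is comparable to t^g with t = |f| / M, so the two weighted
  versions of |f| are comparable to M t^(p / p0) and M t^(p / p1), which \<open>morrey_power\<close>
  places in the end spaces. Bounded multipliers preserve such pointwise bounds.\<close>

lemma pm_superset_morrey:
  fixes X0 X1 :: "(real ^ 'n::finite) quasi_space"
  assumes T: "0 < \<Theta>" "\<Theta> < 1" and p: "0 < p0" "0 < p1" "0 < p" and pp: "1 / p = (1 - \<Theta>) / p0 + \<Theta> / p1"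
    and s: "p0 * s0 = p * s" "p1 * s1 = p * s"
    and X0: "dominated (camp p0 s0 (-1)) (inball X0)" and X1: "dominated (camp p1 s1 (-1)) (inball X1)"
  shows "dominated (camp p s (-1)) (in_pm X0 X1 \<Theta>)"
proof -
  obtain C0 where C0: "0 < C0" "\<And>M f. 0 < M \<Longrightarrow> camp p0 s0 (-1) M f \<Longrightarrow> inball X0 (C0 * M) f"
    using X0 unfolding dominated_def by blast
  obtain C1 where C1: "0 < C1" "\<And>M f. 0 < M \<Longrightarrow> camp p1 s1 (-1) M f \<Longrightarrow> inball X1 (C1 * M) f"
    using X1 unfolding dominated_def by blast
  define a0 where "a0 = p / p0"
  define a1 where "a1 = p / p1"
  define g where "g = a1 - a0"
  have "p * ((1 - \<Theta>) / p0 + \<Theta> / p1) = 1" using p by (simp flip: pp)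
  moreover have "p * ((1 - \<Theta>) / p0 + \<Theta> / p1) = (1 - \<Theta>) * a0 + \<Theta> * a1"
    by (simp add: a0_def a1_def distrib_left mult.commute)
  ultimately have one: "(1 - \<Theta>) * a0 + \<Theta> * a1 = 1" by simp
  \<comment> \<open>This fixes g: multiplying t by t^(- \<Theta> g) or t^((1 - \<Theta>) g) must
    produce the powers p / p0 and p / p1, and the relation between the exponents makes both demands
    compatible.\<close>
  have e0: "1 - \<Theta> * g = p / p0" and e1: "1 + (1 - \<Theta>) * g = p / p1"
    unfolding g_def a0_def[symmetric] a1_def[symmetric] using one by (simp_all add: algebra_simps)
  define C where "C = max (C0 * 2) (C1 * 2)"
  have C: "0 < C" using C0 by (simp add: C_def)
  have "in_pm X0 X1 \<Theta> (C * M) f" if M: "0 < M" and f: "camp p s (-1) M f" for M f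
  proof -
    have fm [measurable]: "f \<in> borel_measurable lebesgue" using f by (rule campD)
    define t where "t y = cmod (f y) / M" for y
    define ix where "ix y = \<lfloor>g * log 2 (t y)\<rfloor>" for y
    \<comment> \<open>Zeros of f have no meaningful logarithm and belong to no piece.\<close>
    define u where "u i y = (if f y \<noteq> 0 \<and> ix y = i then f y else 0)" for i :: int and y
    have ixm [measurable]: "ix \<in> lebesgue \<rightarrow>\<^sub>M count_space UNIV" unfolding ix_def t_def by measurable
    have w: "2 powr (of_int (ix y) * (0 - \<Theta>)) * cmod (f y) \<le> 2 * M * t y powr (p / p0)"
      "2 powr (of_int (ix y) * (1 - \<Theta>)) * cmod (f y) \<le> 2 * M * t y powr (p / p1)" if "f y \<noteq> 0" for y
    proof -
      have ty: "0 < t y" using that M by (simp add: t_def)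
      have fy: "cmod (f y) = M * 2 powr (log 2 (t y))" using ty M by (simp add: t_def)
      have ix: "of_int (ix y) \<le> g * log 2 (t y)" "g * log 2 (t y) < of_int (ix y) + 1" unfolding ix_def by linarith+
      have tp: "t y powr a = 2 powr (log 2 (t y) * a)" for a
        using ty by (simp flip: powr_powr)
      have "of_int (ix y) * (0 - \<Theta>) \<le> (g * log 2 (t y) - 1) * (0 - \<Theta>)"
        using ix T by (intro mult_right_mono_neg) auto
      also have "\<dots> \<le> 1 - \<Theta> * g * log 2 (t y)" using T by (simp add: algebra_simps)
      finally have "of_int (ix y) * (0 - \<Theta>) + log 2 (t y) \<le> 1 + log 2 (t y) * (p / p0)"
        unfolding e0[symmetric] by (simp add: algebra_simps)
      then have "2 powr (of_int (ix y) * (0 - \<Theta>) + log 2 (t y)) \<le> 2 powr (1 + log 2 (t y) * (p / p0))"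
        by (intro powr_mono) auto
      then have "M * (2 powr (of_int (ix y) * (0 - \<Theta>)) * 2 powr (log 2 (t y))) \<le> M * (2 * t y powr (p / p0))"
        unfolding powr_add tp using M by (intro mult_left_mono) auto
      then show "2 powr (of_int (ix y) * (0 - \<Theta>)) * cmod (f y) \<le> 2 * M * t y powr (p / p0)"
        unfolding fy by (simp only: mult_ac)
      have "of_int (ix y) * (1 - \<Theta>) \<le> g * log 2 (t y) * (1 - \<Theta>)"
        using ix T by (intro mult_right_mono) auto
      then have "of_int (ix y) * (1 - \<Theta>) + log 2 (t y) \<le> 1 + log 2 (t y) * (p / p1)"
        unfolding e1[symmetric] by (simp add: algebra_simps)
      then have "2 powr (of_int (ix y) * (1 - \<Theta>) + log 2 (t y)) \<le> 2 powr (1 + log 2 (t y) * (p / p1))"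
        by (intro powr_mono) auto
      then have "M * (2 powr (of_int (ix y) * (1 - \<Theta>)) * 2 powr (log 2 (t y))) \<le> M * (2 * t y powr (p / p1))"
        unfolding powr_add tp using M by (intro mult_left_mono) auto
      then show "2 powr (of_int (ix y) * (1 - \<Theta>)) * cmod (f y) \<le> 2 * M * t y powr (p / p1)"
        unfolding fy by (simp only: mult_ac)
    qed
    have um [measurable]: "u i \<in> borel_measurable lebesgue" for i unfolding u_def by measurable
    have sum_u: "(\<Sum>i\<in>F. c i * u i y) = (if f y \<noteq> 0 \<and> ix y \<in> F then c (ix y) * f y else 0)" if F: "finite F" for F c y
    proof -
      have "(\<Sum>i\<in>F. c i * u i y) = (\<Sum>i\<in>F. if i = ix y then (if f y \<noteq> 0 then c i * f y else 0) else 0)"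
        by (intro sum.cong) (auto simp: u_def)
      then show ?thesis using F by (simp add: sum.delta)
    qed
    \<comment> \<open>Single pieces, finite sums with multipliers and remainders all have this form,
      so one estimate serves all of them.\<close>
    have A0: "camp p0 s0 (-1) (2 * M * E) (\<lambda>y. if f y \<noteq> 0 \<and> ix y \<in> G then c (ix y) * f y else 0)"
      if E: "0 < E" "\<And>i. i \<in> G \<Longrightarrow> cmod (c i) \<le> E * 2 powr (of_int i * (0 - \<Theta>))" for E G and c :: "int \<Rightarrow> complex"
    proof (rule morrey_power[OF f M p(3,1) s(1)])
      show "0 < 2 * M * E" using M E by simp
      show "(\<lambda>y. if f y \<noteq> 0 \<and> ix y \<in> G then c (ix y) * f y else 0) \<in> borel_measurable lebesgue" by measurable
      fix y
      show "cmod (if f y \<noteq> 0 \<and> ix y \<in> G then c (ix y) * f y else 0) \<le> 2 * M * E * (cmod (f y) / M) powr (p / p0)"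
      proof (cases "f y \<noteq> 0 \<and> ix y \<in> G")
        case True
        then have "cmod (c (ix y) * f y) \<le> E * 2 powr (of_int (ix y) * (0 - \<Theta>)) * cmod (f y)"
          unfolding norm_mult using E(2) by (intro mult_right_mono) auto
        also have "\<dots> \<le> E * (2 * M * t y powr (p / p0))"
          unfolding mult.assoc using w(1)[of y] True E by (intro mult_left_mono) (auto simp: mult.assoc)
        finally show ?thesis using True by (simp add: t_def mult_ac)
      qed (use M E in auto)
    qed
    have A1: "camp p1 s1 (-1) (2 * M * E) (\<lambda>y. if f y \<noteq> 0 \<and> ix y \<in> G then c (ix y) * f y else 0)"
      if E: "0 < E" "\<And>i. i \<in> G \<Longrightarrow> cmod (c i) \<le> E * 2 powr (of_int i * (1 - \<Theta>))" for E G and c :: "int \<Rightarrow> complex"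
    proof (rule morrey_power[OF f M p(3,2) s(2)])
      show "0 < 2 * M * E" using M E by simp
      show "(\<lambda>y. if f y \<noteq> 0 \<and> ix y \<in> G then c (ix y) * f y else 0) \<in> borel_measurable lebesgue" by measurable
      fix y
      show "cmod (if f y \<noteq> 0 \<and> ix y \<in> G then c (ix y) * f y else 0) \<le> 2 * M * E * (cmod (f y) / M) powr (p / p1)"
      proof (cases "f y \<noteq> 0 \<and> ix y \<in> G")
        case True
        then have "cmod (c (ix y) * f y) \<le> E * 2 powr (of_int (ix y) * (1 - \<Theta>)) * cmod (f y)"
          unfolding norm_mult using E(2) by (intro mult_right_mono) auto
        also have "\<dots> \<le> E * (2 * M * t y powr (p / p1))"
          unfolding mult.assoc using w(2)[of y] True E by (intro mult_left_mono) (auto simp: mult.assoc)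
        finally show ?thesis using True by (simp add: t_def mult_ac)
      qed (use M E in auto)
    qed
    have u_eq: "u i = (\<lambda>y. if f y \<noteq> 0 \<and> ix y \<in> {i} then 1 * f y else 0)" for i by (auto simp: u_def)
    have u0: "u i \<in> carrier X0" for i
      using C0(2)[OF _ A0[of "2 powr (of_int i * \<Theta>)" "{i}" "\<lambda>_. 1"]] M
      unfolding u_eq inball_def by (simp flip: powr_add)
    have u1: "u i \<in> carrier X1" for i
      using C1(2)[OF _ A1[of "2 powr (- of_int i * (1 - \<Theta>))" "{i}" "\<lambda>_. 1"]] M
      unfolding u_eq inball_def by (simp flip: powr_add)
    have b0: "pm_bound X0 (0 - \<Theta>) u (C0 * (2 * M))"
    proof (rule pm_boundI[OF C0(2) C0(1)])
      fix F :: "int set" and \<epsilon> :: "int \<Rightarrow> complex" and E :: real assume F: "finite F" "0 < E" "\<And>i. cmod (\<epsilon> i) \<le> E"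
      show "camp p0 s0 (-1) (2 * M * E) (\<lambda>y. \<Sum>i\<in>F. \<epsilon> i * of_real (2 powr (of_int i * (0 - \<Theta>))) * u i y)"
        unfolding sum_u[OF F(1)] using F by (intro A0) (auto simp: norm_mult)
    qed (use M in auto)
    have b1: "pm_bound X1 (1 - \<Theta>) u (C1 * (2 * M))"
    proof (rule pm_boundI[OF C1(2) C1(1)])
      fix F :: "int set" and \<epsilon> :: "int \<Rightarrow> complex" and E :: real assume F: "finite F" "0 < E" "\<And>i. cmod (\<epsilon> i) \<le> E"
      show "camp p1 s1 (-1) (2 * M * E) (\<lambda>y. \<Sum>i\<in>F. \<epsilon> i * of_real (2 powr (of_int i * (1 - \<Theta>))) * u i y)"
        unfolding sum_u[OF F(1)] using F by (intro A1) (auto simp: norm_mult)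
    qed (use M in auto)
    define R0 where "R0 N = C0 * (2 * M * 2 powr (- real N * \<Theta>))" for N
    define R1 where "R1 N = C1 * (2 * M * 2 powr (- real N * (1 - \<Theta>)))" for N
    \<comment> \<open>The interval is open so that N = 0 imposes nothing: with \<open>F = {}\<close>
      this places f itself in the sum space.\<close>
    have tail: "(\<lambda>y. f y - (\<Sum>i\<in>F. u i y)) \<in> carrier (sum_space X0 X1)"
      "qnorm (sum_space X0 X1) (\<lambda>y. f y - (\<Sum>i\<in>F. u i y)) \<le> ennreal (R0 N + R1 N)"
      if F: "finite F" "{- int N<..<int N} \<subseteq> F" for F N
    proof -
      \<comment> \<open>Very negative indices are small in \<open>X0\<close> because of the weight
        2^(- i \<Theta>), and large indices in \<open>X1\<close> because of 2^(i (1 -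
        \<Theta>)).\<close>
      let ?b = "\<lambda>y. if f y \<noteq> 0 \<and> ix y \<in> {i. i \<notin> F \<and> i \<le> - int N} then 1 * f y else 0"
      let ?c = "\<lambda>y. if f y \<noteq> 0 \<and> ix y \<in> {i. i \<notin> F \<and> - int N < i} then 1 * f y else 0"
      have "inball X0 (R0 N) ?b" unfolding R0_def
      proof (rule C0(2))
        show "camp p0 s0 (-1) (2 * M * 2 powr (- real N * \<Theta>)) ?b"
        proof (rule A0[where c = "\<lambda>_. 1"])
          fix i assume "i \<in> {i. i \<notin> F \<and> i \<le> - int N}"
          then have "(of_int i :: real) \<le> of_int (- int N)" by (simp only: of_int_le_iff mem_Collect_eq)
          then have "(of_int i :: real) \<le> - real N" by simp
          then have "0 \<le> - real N * \<Theta> + of_int i * (0 - \<Theta>)" using T mult_right_mono[of "of_int i" "- real N" \<Theta>] by simp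
          then have "2 powr 0 \<le> 2 powr (- real N * \<Theta>) * 2 powr (of_int i * (0 - \<Theta>))"
            unfolding powr_add[symmetric] by (intro powr_mono) auto
          then show "cmod 1 \<le> 2 powr (- real N * \<Theta>) * 2 powr (of_int i * (0 - \<Theta>))" by simp
        qed simp
      qed (use M in simp)
      moreover have "inball X1 (R1 N) ?c" unfolding R1_def
      proof (rule C1(2))
        show "camp p1 s1 (-1) (2 * M * 2 powr (- real N * (1 - \<Theta>))) ?c"
        proof (rule A1[where c = "\<lambda>_. 1"])
          fix i assume "i \<in> {i. i \<notin> F \<and> - int N < i}"
          then have "int N \<le> i" using F(2) by force
          then have "real_of_int (int N) \<le> of_int i" by (simp only: of_int_le_iff)
          then have "real N \<le> of_int i" by simp
          then have "0 \<le> - real N * (1 - \<Theta>) + of_int i * (1 - \<Theta>)" using T mult_right_mono[of "real N" "of_int i" "1 - \<Theta>"] by simp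
          then have "2 powr 0 \<le> 2 powr (- real N * (1 - \<Theta>)) * 2 powr (of_int i * (1 - \<Theta>))"
            unfolding powr_add[symmetric] by (intro powr_mono) auto
          then show "cmod 1 \<le> 2 powr (- real N * (1 - \<Theta>)) * 2 powr (of_int i * (1 - \<Theta>))" by simp
        qed simp
      qed (use M in simp)
      moreover have "(\<lambda>y. f y - (\<Sum>i\<in>F. u i y)) = (\<lambda>y. ?b y + ?c y)"
      proof
        fix y
        have "(\<Sum>i\<in>F. u i y) = (if f y \<noteq> 0 \<and> ix y \<in> F then f y else 0)" using sum_u[OF F(1), of "\<lambda>_. 1" y] by simp
        then show "f y - (\<Sum>i\<in>F. u i y) = ?b y + ?c y" by auto
      qed
      moreover have "0 \<le> R0 N" "0 \<le> R1 N" using C0(1) C1(1) M by (auto simp: R0_def R1_def)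
      ultimately show "(\<lambda>y. f y - (\<Sum>i\<in>F. u i y)) \<in> carrier (sum_space X0 X1)"
        "qnorm (sum_space X0 X1) (\<lambda>y. f y - (\<Sum>i\<in>F. u i y)) \<le> ennreal (R0 N + R1 N)"
        by (rule sum_space_inball)+
    qed
    have "f \<in> carrier (sum_space X0 X1)" using tail(1)[of "{}" 0] by simp
    moreover have "((\<lambda>F. qnorm (sum_space X0 X1) (\<lambda>y. f y - (\<Sum>i\<in>F. u i y))) \<longlongrightarrow> 0) (finite_subsets_at_top UNIV)"
    proof (rule pm_tendstoI)
      have pw: "2 powr (- real N * c) = (2 powr (- c)) ^ N" for c :: real and N
        by (simp add: powr_powr mult.commute flip: powr_realpow)
      have "2 powr (- \<Theta>) < (1::real)" "2 powr (- (1 - \<Theta>)) < (1::real)"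
        using T powr_less_mono[of "- \<Theta>" 0 2] powr_less_mono[of "- (1 - \<Theta>)" 0 2] by auto
      then have "(\<lambda>N. R0 N + R1 N) \<longlonglongrightarrow> C0 * (2 * M * 0) + C1 * (2 * M * 0)"
        unfolding R0_def R1_def pw by (intro tendsto_intros LIMSEQ_realpow_zero) auto
      then show "(\<lambda>N. R0 N + R1 N) \<longlonglongrightarrow> 0" by simp
      show "qnorm (sum_space X0 X1) (\<lambda>y. f y - (\<Sum>i\<in>F. u i y)) \<le> ennreal (R0 N + R1 N)"
        if "finite F" "{- int N..int N} \<subseteq> F" for N F
        using that by (intro tail) auto
    qed
    moreover have "C0 * (2 * M) \<le> C * M" "C1 * (2 * M) \<le> C * M"
      using M by (auto simp: C_def max_mult_distrib_right)
    moreover have "0 \<le> C * M" using M C by simp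
    ultimately show ?thesis
      unfolding in_pm_def pm_admissible_def using u0 u1 pm_bound_mono[OF b0] pm_bound_mono[OF b1]
      by (intro conjI exI[of _ u]) auto
  qed
  then show ?thesis using C unfolding dominated_def by blast
qed

subsection \<open>Spaces of nonnegative smoothness\<close>

lemma camp_scale:
  fixes f :: "real ^ 'n::finite \<Rightarrow> complex"
  assumes f: "camp p s k M f" and p: "0 < p" and E: "cmod c \<le> E" and M: "0 < M"
  shows "camp p s k (E * M) (\<lambda>y. c * f y)"
  unfolding camp_def
proof (intro conjI allI impI)
  have E0: "0 \<le> E" using E norm_ge_zero order_trans by blast
  have fm [measurable]: "f \<in> borel_measurable lebesgue" using f by (rule campD)
  show "(\<lambda>y. c * f y) \<in> borel_measurable lebesgue" by measurable
  have sc: "Lint p Q (\<lambda>y. c * g y) \<le> ennreal ((E * A) powr p * b)"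
    if "g \<in> borel_measurable lebesgue" "Q \<in> sets lebesgue" "Lint p Q g \<le> ennreal (A powr p * b)" "0 \<le> A" "0 \<le> b" for g Q A b
  proof -
    have "Lint p Q (\<lambda>y. c * g y) = ennreal (cmod c powr p) * Lint p Q g" using that by (intro Lint_scale)
    also have "\<dots> \<le> ennreal (E powr p) * ennreal (A powr p * b)"
      using that E p by (intro mult_mono ennreal_leI powr_mono2) auto
    also have "\<dots> = ennreal ((E * A) powr p * b)"
      using that E0 by (simp add: powr_mult mult.assoc flip: ennreal_mult)
    finally show ?thesis .
  qed
  show "Lint p (cube x 1) (\<lambda>y. c * f y) \<le> ennreal ((E * M) powr p)" for x
    using sc[OF fm, of "cube x 1" M 1] campD(2)[OF f, of x] M by simp
  fix x :: "real ^ 'n" and l :: real assume l: "0 < l" "l \<le> 1"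
  obtain P where P: "P \<in> polys k" "Lint p (cube x l) (\<lambda>y. f y - P y) \<le> ennreal ((M * l powr s) powr p * l ^ CARD('n))"
    using campD(3)[OF f l] by blast
  have "Lint p (cube x l) (\<lambda>y. c * (f y - P y)) \<le> ennreal ((E * (M * l powr s)) powr p * l ^ CARD('n))"
    using M l by (intro sc P(2) borel_measurable_diff fm polys_measurable[OF P(1)]) auto
  then show "\<exists>P\<in>polys k. Lint p (cube x l) (\<lambda>y. c * f y - P y) \<le> ennreal ((E * M * l powr s) powr p * l ^ CARD('n))"
    using polys_scale[OF P(1), of c] by (intro bexI[of _ "\<lambda>y. c * P y"]) (auto simp: right_diff_distrib mult.assoc)
qed

text \<open>The function alone at index 0, where both weights are 1, is a decomposition. This covers
  coinciding end spaces, in particular smoothness 0, where dyadic pieces would have no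
  decay.\<close>

lemma pm_superset_trivial:
  fixes X0 X1 :: "(real ^ 'n::finite) quasi_space"
  assumes p: "0 < p" and X0: "dominated (camp p s k) (inball X0)" and X1: "dominated (camp p s k) (inball X1)"
  shows "dominated (camp p s k) (in_pm X0 X1 \<Theta>)"
proof -
  obtain C0 where C0: "0 < C0" "\<And>M f. 0 < M \<Longrightarrow> camp p s k M f \<Longrightarrow> inball X0 (C0 * M) f"
    using X0 unfolding dominated_def by blast
  obtain C1 where C1: "0 < C1" "\<And>M f. 0 < M \<Longrightarrow> camp p s k M f \<Longrightarrow> inball X1 (C1 * M) f"
    using X1 unfolding dominated_def by blast
  have "in_pm X0 X1 \<Theta> ((C0 + C1) * M) f" if M: "0 < M" and f: "camp p s k M f" for M f
  proof -
    have cf: "camp p s k (M * E) (\<lambda>y. c * f y)" if "cmod c \<le> E" for c E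
      using camp_scale[OF f p that M] by (simp add: mult.commute)
    have zero: "camp p s k e (\<lambda>y :: real ^ 'n. 0)" if "0 < e" for e
      using cf[of 0 "e / M"] M that by simp
    define u where "u i y = (if i = 0 then f y else 0)" for i :: int and y
    have u_eq: "u i = (\<lambda>y. (if i = 0 then 1 else 0) * f y)" for i by (auto simp: u_def)
    have cu: "camp p s k (M * 1) (u i)" for i unfolding u_eq by (rule cf) auto
    have u0: "u i \<in> carrier X0" for i using C0(2)[OF _ cu] M by (simp add: inball_def)
    have u1: "u i \<in> carrier X1" for i using C1(2)[OF _ cu] M by (simp add: inball_def)
    have sum_u: "(\<lambda>y. \<Sum>i\<in>F. c i * u i y) = (\<lambda>y. (if 0 \<in> F then c 0 else 0) * f y)" if "finite F" for F c
    proof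
      fix y
      have "(\<Sum>i\<in>F. c i * u i y) = (\<Sum>i\<in>F. if i = 0 then c i * f y else 0)" by (intro sum.cong) (auto simp: u_def)
      then show "(\<Sum>i\<in>F. c i * u i y) = (if 0 \<in> F then c 0 else 0) * f y" using that by (simp add: sum.delta)
    qed
    have b: "camp p s k (M * E) (\<lambda>y. \<Sum>i\<in>F. \<epsilon> i * of_real (2 powr (of_int i * t)) * u i y)"
      if "finite F" "0 < E" "\<And>i. cmod (\<epsilon> i) \<le> E" for F \<epsilon> E t
      unfolding sum_u[OF that(1)] using that by (intro cf) auto
    have b0: "pm_bound X0 (0 - \<Theta>) u (C0 * M)" by (rule pm_boundI[where P = "camp p s k", OF C0(2) C0(1) M b])
    have b1: "pm_bound X1 (1 - \<Theta>) u (C1 * M)" by (rule pm_boundI[where P = "camp p s k", OF C1(2) C1(1) M b])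
    have "f \<in> carrier (sum_space X0 X1)"
      using sum_space_inball(1)[OF C0(2)[OF M f] C1(2)[OF zero_less_one zero[OF zero_less_one]], of f] C0 C1 M by simp
    moreover have "((\<lambda>F. qnorm (sum_space X0 X1) (\<lambda>y. f y - (\<Sum>i\<in>F. u i y))) \<longlongrightarrow> 0) (finite_subsets_at_top UNIV)"
    proof (rule pm_tendstoI)
      have "(\<lambda>N. C0 * (1/2) ^ N + C1 * (1/2) ^ N) \<longlonglongrightarrow> C0 * 0 + C1 * 0"
        by (intro tendsto_intros LIMSEQ_realpow_zero) auto
      then show "(\<lambda>N. C0 * (1/2) ^ N + C1 * (1/2) ^ N) \<longlonglongrightarrow> 0" by simp
      fix N :: nat and F :: "int set" assume F: "finite F" "{- int N..int N} \<subseteq> F"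
      then have "0 \<in> F" by auto
      then have "(\<lambda>y. f y - (\<Sum>i\<in>F. u i y)) = (\<lambda>y. 0 + 0)" using sum_u[OF F(1), of "\<lambda>_. 1"] by (auto simp: fun_eq_iff)
      then show "qnorm (sum_space X0 X1) (\<lambda>y. f y - (\<Sum>i\<in>F. u i y)) \<le> ennreal (C0 * (1/2) ^ N + C1 * (1/2) ^ N)"
        using C0(1) C1(1) by (intro sum_space_inball(2)[OF C0(2)[OF _ zero] C1(2)[OF _ zero]]) auto
    qed
    moreover have "C0 * M \<le> (C0 + C1) * M" "C1 * M \<le> (C0 + C1) * M" "0 \<le> (C0 + C1) * M"
      using M C0 C1 by auto
    ultimately show ?thesis
      unfolding in_pm_def pm_admissible_def using u0 u1 pm_bound_mono[OF b0] pm_bound_mono[OF b1]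
      by (intro conjI exI[of _ u]) auto
  qed
  moreover have "0 < C0 + C1" using C0 C1 by simp
  ultimately show ?thesis unfolding dominated_def by blast
qed

text \<open>Choosing \<open>\<epsilon>\<^sub>i = 2 powr ((i - m) \<Theta>)\<close> for \<open>i \<le> m\<close> and \<open>\<epsilon>\<^sub>i = 2 powr (- (i - m) (1 - \<Theta>))\<close> for
  \<open>i > m\<close> in the plus-minus condition bounds the two partial sums, as in the K-method.\<close>

lemma pm_splitting:
  fixes X0 X1 :: "(real ^ 'n::finite) quasi_space"
  assumes T: "0 < \<Theta>" "\<Theta> < 1" and q: "0 < q" "0 < p0" "0 < p1"
    and X0: "X0 = campanato \<tau>0 p0 k0" and X1: "X1 = campanato \<tau>1 p1 k1"
    and C0: "\<forall>M>0. \<forall>f. inball X0 M f \<longrightarrow> camp q s0 k (C0 * M) f" "0 < C0"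
    and C1: "\<forall>M>0. \<forall>f. inball X1 M f \<longrightarrow> camp q s1 k (C1 * M) f" "0 < C1"
    and M: "0 < M" and a: "pm_admissible X0 X1 \<Theta> a M" and e: "0 < e"
  shows "\<exists>b g0 g1 c. a = (\<lambda>y. (g0 y + g1 y) + (b y + c y)) \<and> camp q s0 k (C0 * e) b \<and> camp q s1 k (C1 * e) c \<and>
    camp q s0 k (2 powr (of_int m * \<Theta>) * (C0 * M)) g0 \<and> camp q s1 k (2 powr (- of_int m * (1 - \<Theta>)) * (C1 * M)) g1"
proof -
  obtain u where u: "\<And>i. u i \<in> carrier X0" "\<And>i. u i \<in> carrier X1"
    and lim: "((\<lambda>F. qnorm (sum_space X0 X1) (\<lambda>y. a y - (\<Sum>i\<in>F. u i y))) \<longlongrightarrow> 0) (finite_subsets_at_top UNIV)"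
    and b0: "pm_bound X0 (0 - \<Theta>) u M" and b1: "pm_bound X1 (1 - \<Theta>) u M"
    using a unfolding pm_admissible_def by blast
  obtain F b c where F: "finite F" and b: "inball X0 e b" and c: "inball X1 e c"
    and a_eq: "\<And>y. a y = (\<Sum>i\<in>F. u i y) + b y + c y" using pm_limit[OF lim e] by blast
  define g0 where "g0 y = (\<Sum>i\<in>F \<inter> {..m}. u i y)" for y
  define g1 where "g1 y = (\<Sum>i\<in>F - {..m}. u i y)" for y
  have "a = (\<lambda>y. (g0 y + g1 y) + (b y + c y))"
    using a_eq F by (auto simp: g0_def g1_def sum.Int_Diff[of F _ "{..m}"] add.assoc)
  moreover have "camp q s0 k (C0 * e) b" "camp q s1 k (C1 * e) c" using C0 C1 e b c by auto
  moreover have "camp q s0 k (2 powr (of_int m * \<Theta>) * (C0 * M)) g0"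
  proof -
    define \<epsilon> where "\<epsilon> i = (if i \<le> m then of_real (2 powr (of_int (i - m) * \<Theta>)) else 0 :: complex)" for i
    have eps: "cmod (\<epsilon> i) \<le> 1" for i
      using T powr_mono[of "of_int (i - m) * \<Theta>" 0 2] by (auto simp: \<epsilon>_def mult_nonpos_nonneg)
    have "inball X0 M (\<lambda>y. \<Sum>i\<in>F \<inter> {..m}. \<epsilon> i * of_real (2 powr (of_int i * (0 - \<Theta>))) * u i y)"
      using b0 u(1) F eps M q unfolding X0 by (intro pm_bound_inball) auto
    then have "camp q s0 k (2 powr (of_int m * \<Theta>) * (C0 * M)) (\<lambda>y. of_real (2 powr (of_int m * \<Theta>)) *
        (\<Sum>i\<in>F \<inter> {..m}. \<epsilon> i * of_real (2 powr (of_int i * (0 - \<Theta>))) * u i y))"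
      using C0 M q by (intro camp_scale) auto
    also have "(\<lambda>y. of_real (2 powr (of_int m * \<Theta>)) * (\<Sum>i\<in>F \<inter> {..m}. \<epsilon> i * of_real (2 powr (of_int i * (0 - \<Theta>))) * u i y)) = g0"
    proof
      fix y
      have "of_real (2 powr (of_int m * \<Theta>)) * (\<epsilon> i * of_real (2 powr (of_int i * (0 - \<Theta>)))) = (1 :: complex)" if "i \<le> m" for i
        using that by (simp add: \<epsilon>_def algebra_simps flip: of_real_mult powr_add)
      then show "of_real (2 powr (of_int m * \<Theta>)) * (\<Sum>i\<in>F \<inter> {..m}. \<epsilon> i * of_real (2 powr (of_int i * (0 - \<Theta>))) * u i y) = g0 y"
        unfolding g0_def sum_distrib_left by (intro sum.cong) (auto simp flip: mult.assoc)
    qed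
    finally show ?thesis .
  qed
  moreover have "camp q s1 k (2 powr (- of_int m * (1 - \<Theta>)) * (C1 * M)) g1"
  proof -
    define \<epsilon> where "\<epsilon> i = (if m < i then of_real (2 powr (- of_int (i - m) * (1 - \<Theta>))) else 0 :: complex)" for i
    have eps: "cmod (\<epsilon> i) \<le> 1" for i
    proof (cases "m < i")
      case True
      then have "- real_of_int (i - m) * (1 - \<Theta>) \<le> 0" using T by (intro mult_nonpos_nonneg) auto
      then show ?thesis using True powr_mono[of "- real_of_int (i - m) * (1 - \<Theta>)" 0 2] by (simp add: \<epsilon>_def)
    qed (simp add: \<epsilon>_def)
    have "inball X1 M (\<lambda>y. \<Sum>i\<in>F - {..m}. \<epsilon> i * of_real (2 powr (of_int i * (1 - \<Theta>))) * u i y)"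
      using b1 u(2) F eps M q unfolding X1 by (intro pm_bound_inball) auto
    then have "camp q s1 k (2 powr (- of_int m * (1 - \<Theta>)) * (C1 * M)) (\<lambda>y. of_real (2 powr (- of_int m * (1 - \<Theta>))) *
        (\<Sum>i\<in>F - {..m}. \<epsilon> i * of_real (2 powr (of_int i * (1 - \<Theta>))) * u i y))"
      using C1 M q by (intro camp_scale) auto
    also have "(\<lambda>y. of_real (2 powr (- of_int m * (1 - \<Theta>))) * (\<Sum>i\<in>F - {..m}. \<epsilon> i * of_real (2 powr (of_int i * (1 - \<Theta>))) * u i y)) = g1"
    proof
      fix y
      have "of_real (2 powr (- of_int m * (1 - \<Theta>))) * (\<epsilon> i * of_real (2 powr (of_int i * (1 - \<Theta>)))) = (1 :: complex)" if "m < i" for i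
        using that by (simp add: \<epsilon>_def algebra_simps flip: of_real_mult powr_add)
      then show "of_real (2 powr (- of_int m * (1 - \<Theta>))) * (\<Sum>i\<in>F - {..m}. \<epsilon> i * of_real (2 powr (of_int i * (1 - \<Theta>))) * u i y) = g1 y"
        unfolding g1_def sum_distrib_left by (intro sum.cong) (auto simp flip: mult.assoc)
    qed
    finally show ?thesis .
  qed
  ultimately show ?thesis by blast
qed

text \<open>Splitting at m near (s1 - s0) log 2 l balances the two halves: both 2^(m \<Theta>) l^s0
  and 2^(- m (1 - \<Theta>)) l^s1 are of the order l^s. No lower bound for l is needed because m may
  be any integer.\<close>

lemma pm_subset_smooth:
  fixes X0 X1 :: "(real ^ 'n::finite) quasi_space"
  assumes T: "0 < \<Theta>" "\<Theta> < 1" and p: "0 < p0" "0 < p1"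
    and s: "0 \<le> s0" "0 \<le> s1" "s = (1 - \<Theta>) * s0 + \<Theta> * s1"
    and X0: "X0 = campanato \<tau>0 p0 k0" "dominated (inball X0) (camp 1 s0 k)"
    and X1: "X1 = campanato \<tau>1 p1 k1" "dominated (inball X1) (camp 1 s1 k)"
  shows "dominated (in_pm X0 X1 \<Theta>) (camp 1 s k)"
proof -
  let ?n = "CARD('n)"
  obtain C0 where C0: "0 < C0" "\<forall>M>0. \<forall>f. inball X0 M f \<longrightarrow> camp 1 s0 k (C0 * M) f"
    using X0(2) unfolding dominated_def by blast
  obtain C1 where C1: "0 < C1" "\<forall>M>0. \<forall>f. inball X1 M f \<longrightarrow> camp 1 s1 k (C1 * M) f"
    using X1(2) unfolding dominated_def by blast
  \<comment> \<open>The 4 comes from two nested quasi-triangle inequalities for four functions. Two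
    terms cost C0 each; rounding m doubles one of the C1 terms.\<close>
  define B where "B = 4 * (2 * C0 + 3 * C1)"
  have B: "0 < B" using C0 C1 by (simp add: B_def)
  have "camp 1 s k (B * M) a" if M: "0 < M" and aa: "in_pm X0 X1 \<Theta> M a" for M a
  proof -
    have adm: "pm_admissible X0 X1 \<Theta> a M" using aa by (simp add: in_pm_def)
    note split = pm_splitting[OF T zero_less_one p X0(1) X1(1) C0(2) C0(1) C1(2) C1(1) M adm]
    have am: "a \<in> borel_measurable lebesgue"
      using aa X0 X1 by (intro carrier_sum_measurable[OF X0(2) X1(2)]) (auto simp: in_pm_def campanato_def)
    have add4: "Lint 1 Q (\<lambda>y. (f0 y + f1 y) + (f2 y + f3 y)) \<le> ennreal (4 * (a0 + a1 + a2 + a3))"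
      if "f0 \<in> borel_measurable lebesgue" "f1 \<in> borel_measurable lebesgue" "f2 \<in> borel_measurable lebesgue" "f3 \<in> borel_measurable lebesgue"
        "Q \<in> sets lebesgue" "Lint 1 Q f0 \<le> ennreal a0" "Lint 1 Q f1 \<le> ennreal a1" "Lint 1 Q f2 \<le> ennreal a2" "Lint 1 Q f3 \<le> ennreal a3"
        "0 \<le> a0" "0 \<le> a1" "0 \<le> a2" "0 \<le> a3" for f0 f1 f2 f3 :: "real ^ 'n \<Rightarrow> complex" and Q a0 a1 a2 a3
    proof -
      have "Lint 1 Q (\<lambda>y. (f0 y + f1 y) + (f2 y + f3 y)) \<le> ennreal (2 powr 1 * (2 powr 1 * (a0 + a1) + 2 powr 1 * (a2 + a3)))"
        using that by (intro Lint_add_le) auto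
      then show ?thesis by (simp add: algebra_simps)
    qed
    have "camp 1 s k (B powr (1 / 1) * M) a"
    proof (rule campI[OF am zero_less_one M B])
      fix x :: "real ^ 'n"
      obtain b g0 g1 c where a: "a = (\<lambda>y. (g0 y + g1 y) + (b y + c y))" and b: "camp 1 s0 k (C0 * M) b" and c: "camp 1 s1 k (C1 * M) c"
        and g: "camp 1 s0 k (C0 * M) g0" "camp 1 s1 k (C1 * M) g1" using split[OF M, of 0] by auto
      have "Lint 1 (cube x 1) a \<le> ennreal (4 * (C0 * M + C1 * M + C0 * M + C1 * M))"
        unfolding a using b c g C0 C1 M campD(1)[OF b] campD(1)[OF c] campD(1)[OF g(1)] campD(1)[OF g(2)]
          campD(2)[OF b, of x] campD(2)[OF c, of x] campD(2)[OF g(1), of x] campD(2)[OF g(2), of x]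
        by (intro add4) auto
      also have "\<dots> \<le> ennreal (B * M powr 1)"
        using C0 C1 M by (intro ennreal_leI) (simp add: B_def algebra_simps)
      finally show "Lint 1 (cube x 1) a \<le> ennreal (B * M powr 1)" .
    next
      fix x :: "real ^ 'n" and l :: real assume l: "0 < l" "l \<le> 1"
      \<comment> \<open>The real number R gives exact balance; its integer part m keeps the first
        half exact and costs at most a factor 2 in the second.\<close>
      define R where "R = (s1 - s0) * log 2 l"
      define m where "m = \<lfloor>R\<rfloor>"
      have m: "of_int m \<le> R" "R < of_int m + 1" unfolding m_def by linarith+
      have lp: "l powr t = 2 powr (t * log 2 l)" for t
      proof -
        have "2 powr (t * log 2 l) = (2 powr (log 2 l)) powr t" by (simp only: powr_powr mult.commute)
        then show ?thesis using l by simp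
      qed
      \<comment> \<open>The remainder of the series is taken as small as the target bound at this l.
        It needs no further decay, since \<open>l powr s0\<close> and \<open>l powr s1\<close> are
        at most 1.\<close>
      define e where "e = M * l powr s"
      have e: "0 < e" using M l by (simp add: e_def)
      obtain b g0 g1 c where a: "a = (\<lambda>y. (g0 y + g1 y) + (b y + c y))" and b: "camp 1 s0 k (C0 * e) b" and c: "camp 1 s1 k (C1 * e) c"
        and g: "camp 1 s0 k (2 powr (of_int m * \<Theta>) * (C0 * M)) g0" "camp 1 s1 k (2 powr (- of_int m * (1 - \<Theta>)) * (C1 * M)) g1"
        using split[OF e, of m] by auto
      have l1: "l powr s0 \<le> 1" "l powr s1 \<le> 1" using l s powr_mono2[of _ l 1] by auto
      have osc: "\<exists>P\<in>polys k. Lint 1 (cube x l) (\<lambda>y. f y - P y) \<le> ennreal (A' * l ^ ?n)"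
        if f: "camp 1 t k A f" and A: "A * l powr t \<le> A'" "0 < A" for f t A A'
      proof -
        obtain P where P: "P \<in> polys k" "Lint 1 (cube x l) (\<lambda>y. f y - P y) \<le> ennreal ((A * l powr t) powr 1 * l ^ ?n)"
          using campD(3)[OF f l] by blast
        have "(A * l powr t) powr 1 * l ^ ?n \<le> A' * l ^ ?n" using A l by (intro mult_right_mono) auto
        then show ?thesis using P(1) order_trans[OF P(2) ennreal_leI] by blast
      qed
      have e01: "C0 * e * l powr s0 \<le> C0 * e" "C1 * e * l powr s1 \<le> C1 * e"
        using l1 C0 C1 e by (auto simp: mult_left_le)
      have m0: "2 powr (of_int m * \<Theta>) * (C0 * M) * l powr s0 \<le> C0 * e"
      proof -
        have "of_int m * \<Theta> + s0 * log 2 l \<le> R * \<Theta> + s0 * log 2 l" using m T by (intro add_right_mono mult_right_mono) auto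
        also have "\<dots> = s * log 2 l" by (simp add: R_def s algebra_simps)
        finally have "2 powr (of_int m * \<Theta>) * l powr s0 \<le> l powr s" unfolding lp powr_add[symmetric] by (intro powr_mono) auto
        then have "C0 * M * (2 powr (of_int m * \<Theta>) * l powr s0) \<le> C0 * M * l powr s" using C0 M by (intro mult_left_mono) auto
        then show ?thesis by (simp add: e_def mult_ac)
      qed
      have m1: "2 powr (- of_int m * (1 - \<Theta>)) * (C1 * M) * l powr s1 \<le> 2 * (C1 * e)"
      proof -
        have "- of_int m * (1 - \<Theta>) + s1 * log 2 l \<le> (1 - R) * (1 - \<Theta>) + s1 * log 2 l"
          using m T by (intro add_right_mono mult_right_mono) auto
        also have "\<dots> = (1 - \<Theta>) + s * log 2 l" by (simp add: R_def s algebra_simps)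
        also have "\<dots> \<le> 1 + s * log 2 l" using T by simp
        finally have "2 powr (- of_int m * (1 - \<Theta>)) * l powr s1 \<le> 2 powr (1 + s * log 2 l)"
          unfolding lp powr_add[symmetric] by (intro powr_mono) auto
        also have "\<dots> = 2 * l powr s" unfolding lp powr_add by simp
        finally have "C1 * M * (2 powr (- of_int m * (1 - \<Theta>)) * l powr s1) \<le> C1 * M * (2 * l powr s)" using C1 M by (intro mult_left_mono) auto
        then show ?thesis by (simp add: e_def mult_ac)
      qed
      obtain P0 where P0: "P0 \<in> polys k" "Lint 1 (cube x l) (\<lambda>y. g0 y - P0 y) \<le> ennreal (C0 * e * l ^ ?n)"
        using osc[OF g(1) m0] C0(1) M by auto
      obtain P1 where P1: "P1 \<in> polys k" "Lint 1 (cube x l) (\<lambda>y. g1 y - P1 y) \<le> ennreal (2 * (C1 * e) * l ^ ?n)"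
        using osc[OF g(2) m1] C1(1) M by auto
      obtain P2 where P2: "P2 \<in> polys k" "Lint 1 (cube x l) (\<lambda>y. b y - P2 y) \<le> ennreal (C0 * e * l ^ ?n)"
        using osc[OF b e01(1)] C0(1) e by auto
      obtain P3 where P3: "P3 \<in> polys k" "Lint 1 (cube x l) (\<lambda>y. c y - P3 y) \<le> ennreal (C1 * e * l ^ ?n)"
        using osc[OF c e01(2)] C1(1) e by auto
      note P = P0 P1 P2 P3
      let ?P = "\<lambda>y. (P0 y + P1 y) + (P2 y + P3 y)"
      have "Lint 1 (cube x l) (\<lambda>y. ((g0 y - P0 y) + (g1 y - P1 y)) + ((b y - P2 y) + (c y - P3 y)))
        \<le> ennreal (4 * (C0 * e * l ^ ?n + 2 * (C1 * e) * l ^ ?n + C0 * e * l ^ ?n + C1 * e * l ^ ?n))"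
        using P C0(1) C1(1) e l by (intro add4 borel_measurable_diff campD(1)[OF b] campD(1)[OF c] campD(1)[OF g(1)] campD(1)[OF g(2)] polys_measurable P) auto
      also have "(\<lambda>y. ((g0 y - P0 y) + (g1 y - P1 y)) + ((b y - P2 y) + (c y - P3 y))) = (\<lambda>y. a y - ?P y)"
        by (simp add: a algebra_simps)
      also have "4 * (C0 * e * l ^ ?n + 2 * (C1 * e) * l ^ ?n + C0 * e * l ^ ?n + C1 * e * l ^ ?n) = B * ((M * l powr s) powr 1 * l ^ ?n)"
        using M l by (simp add: B_def e_def algebra_simps)
      finally show "\<exists>P\<in>polys k. Lint 1 (cube x l) (\<lambda>y. a y - P y) \<le> ennreal (B * ((M * l powr s) powr 1 * l ^ ?n))"
        using P by (intro bexI[of _ ?P] polys_add) auto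
    qed
    then show ?thesis using B by simp
  qed
  then show ?thesis using B unfolding dominated_def by blast
qed

subsection \<open>Functions with uniform Taylor approximations\<close>

text \<open>A derivative-free form of C^(K,1) regularity at one point, at unit scale. One constant
  controls both the remainder and the polynomial, which keeps product estimates bilinear; r only has
  to dominate the distance, so the centre is included.\<close>

definition tay_at :: "nat \<Rightarrow> real \<Rightarrow> real ^ 'n::finite \<Rightarrow> (real ^ 'n \<Rightarrow> complex) \<Rightarrow> bool"
  where "tay_at K M x g \<longleftrightarrow> (\<exists>P\<in>polys (int K). \<forall>y r. 0 < r \<longrightarrow> r \<le> 1 \<longrightarrow> norm (y - x) \<le> r \<longrightarrow>
    cmod (g y - P y) \<le> M * r ^ Suc K \<and> cmod (P y) \<le> M)"

lemma tay_at_nonneg: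
  assumes "tay_at K M x g" shows "0 \<le> M"
proof -
  obtain P where "cmod (P x) \<le> M"
    using assms unfolding tay_at_def by (metis diff_self norm_zero order_refl zero_le_one zero_less_one)
  then show ?thesis using norm_ge_zero order_trans by blast
qed

lemma tay_at_bound:
  assumes "tay_at K M x g" "norm (y - x) \<le> 1" shows "cmod (g y) \<le> 2 * M"
proof -
  obtain P where P: "cmod (g y - P y) \<le> M * 1 ^ Suc K" "cmod (P y) \<le> M"
    using assms unfolding tay_at_def by (metis order_refl zero_less_one)
  have "cmod (g y) \<le> cmod (g y - P y) + cmod (P y)" using norm_triangle_ineq[of "g y - P y" "P y"] by simp
  then show ?thesis using P by simp
qed

lemma tay_at_mono: "tay_at K M x g \<Longrightarrow> M \<le> M' \<Longrightarrow> tay_at K M' x g"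
  unfolding tay_at_def
proof (elim bexE)
  fix P assume M: "M \<le> M'" and P: "P \<in> polys (int K)"
    "\<forall>y r. 0 < r \<longrightarrow> r \<le> 1 \<longrightarrow> norm (y - x) \<le> r \<longrightarrow> cmod (g y - P y) \<le> M * r ^ Suc K \<and> cmod (P y) \<le> M"
  show "\<exists>P\<in>polys (int K). \<forall>y r. 0 < r \<longrightarrow> r \<le> 1 \<longrightarrow> norm (y - x) \<le> r \<longrightarrow>
    cmod (g y - P y) \<le> M' * r ^ Suc K \<and> cmod (P y) \<le> M'"
  proof (intro bexI[OF _ P(1)] allI impI)
    fix y r assume r: "0 < r" "r \<le> 1" "norm (y - x) \<le> r"
    have "M * r ^ Suc K \<le> M' * r ^ Suc K" using M r by (intro mult_right_mono) auto
    then show "cmod (g y - P y) \<le> M' * r ^ Suc K \<and> cmod (P y) \<le> M'" using P(2) r M by (meson order_trans)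
  qed
qed

lemma tay_at_cong: "tay_at K M x g \<Longrightarrow> (\<And>y. norm (y - x) \<le> 1 \<Longrightarrow> g' y = g y) \<Longrightarrow> tay_at K M x g'"
  unfolding tay_at_def by (metis order_trans)

lemma tay_at_poly:
  assumes "P \<in> polys (int K)" "\<And>y. norm (y - x) \<le> 1 \<Longrightarrow> cmod (P y) \<le> M"
  shows "tay_at K M x P"
proof -
  have M: "0 \<le> M" using order_trans[OF norm_ge_zero assms(2)[of x]] by simp
  show ?thesis unfolding tay_at_def
  proof (intro bexI[OF _ assms(1)] allI impI conjI)
    fix y r assume "0 < r" "r \<le> 1" "norm (y - x) \<le> r"
    then show "cmod (P y - P y) \<le> M * r ^ Suc K" "cmod (P y) \<le> M" using M assms(2)[of y] by auto
  qed
qed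

lemma tay_at_add:
  assumes "tay_at K A x f" "tay_at K B x g" shows "tay_at K (A + B) x (\<lambda>y. f y + g y)"
proof -
  obtain P where P: "P \<in> polys (int K)"
    "\<And>y r. 0 < r \<Longrightarrow> r \<le> 1 \<Longrightarrow> norm (y - x) \<le> r \<Longrightarrow> cmod (f y - P y) \<le> A * r ^ Suc K \<and> cmod (P y) \<le> A"
    using assms(1) unfolding tay_at_def by blast
  obtain Q where Q: "Q \<in> polys (int K)"
    "\<And>y r. 0 < r \<Longrightarrow> r \<le> 1 \<Longrightarrow> norm (y - x) \<le> r \<Longrightarrow> cmod (g y - Q y) \<le> B * r ^ Suc K \<and> cmod (Q y) \<le> B"
    using assms(2) unfolding tay_at_def by blast
  show ?thesis unfolding tay_at_def
  proof (intro bexI[OF _ polys_add[OF P(1) Q(1)]] allI impI)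
    fix y r assume r: "0 < r" "r \<le> 1" "norm (y - x) \<le> r"
    have "f y + g y - (P y + Q y) = (f y - P y) + (g y - Q y)" by simp
    then have "cmod (f y + g y - (P y + Q y)) \<le> cmod (f y - P y) + cmod (g y - Q y)" by (metis norm_triangle_ineq)
    moreover have "cmod (P y + Q y) \<le> cmod (P y) + cmod (Q y)" by (rule norm_triangle_ineq)
    ultimately show "cmod (f y + g y - (P y + Q y)) \<le> (A + B) * r ^ Suc K \<and> cmod (P y + Q y) \<le> A + B"
      using P(2)[OF r] Q(2)[OF r] by (auto simp: distrib_right)
  qed
qed

definition prod_const :: "nat \<Rightarrow> real"
  where "prod_const K = 4 + (real (2 * K) + 1) * hom_const (2 * K)"

lemma prod_const_pos: "0 < prod_const K"
  using hom_const_ge[of "2 * K"] by (simp add: prod_const_def add_pos_nonneg)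

text \<open>The product of the two polynomials has degree 2 K, but its part above degree K is of
  order r^(K + 1) by \<open>polys_truncate\<close> and joins the remainder.\<close>

lemma tay_at_mult:
  assumes f: "tay_at K A x f" and g: "tay_at K B x g"
  shows "tay_at K (prod_const K * A * B) x (\<lambda>y. f y * g y)"
proof -
  have AB: "0 \<le> A" "0 \<le> B" using f g by (auto dest: tay_at_nonneg)
  obtain P where P: "P \<in> polys (int K)"
    "\<And>y r. 0 < r \<Longrightarrow> r \<le> 1 \<Longrightarrow> norm (y - x) \<le> r \<Longrightarrow> cmod (f y - P y) \<le> A * r ^ Suc K \<and> cmod (P y) \<le> A"
    using f unfolding tay_at_def by blast
  obtain Q where Q: "Q \<in> polys (int K)"
    "\<And>y r. 0 < r \<Longrightarrow> r \<le> 1 \<Longrightarrow> norm (y - x) \<le> r \<Longrightarrow> cmod (g y - Q y) \<le> B * r ^ Suc K \<and> cmod (Q y) \<le> B"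
    using g unfolding tay_at_def by blast
  define c where "c = (real (2 * K) + 1) * hom_const (2 * K)"
  have c: "0 \<le> c" using hom_const_ge[of "2 * K"] by (simp add: c_def)
  have PQ: "(\<lambda>y. P y * Q y) \<in> polys (int (2 * K))" using polys_mult[OF P(1) Q(1)] by simp
  have bd: "cmod (P y * Q y) \<le> A * B" if "norm (y - x) \<le> 1" for y
    unfolding norm_mult using P(2)[of 1 y] Q(2)[of 1 y] that AB by (intro mult_mono) auto
  have "\<exists>T\<in>polys (int K). \<forall>y \<mu>. 0 < \<mu> \<longrightarrow> \<mu> \<le> 1 \<longrightarrow> x + (1 / \<mu>) *\<^sub>R (y - x) \<in> cball x 1 \<longrightarrow>
    cmod (P y * Q y - T y) \<le> (real (2 * K) + 1) * hom_const (2 * K) * (A * B) * \<mu> powr (real_of_int (int K) + 1)"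
  proof (rule polys_truncate[OF PQ])
    fix y t assume "y \<in> cball x 1" "0 \<le> t" "(t::real) \<le> 1"
    then show "x + t *\<^sub>R (y - x) \<in> cball x 1"
      using mult_mono[of t 1 "norm (y - x)" 1] by (simp add: dist_norm norm_minus_commute)
  qed (use bd in \<open>auto simp: dist_norm norm_minus_commute\<close>)
  then obtain T where T: "T \<in> polys (int K)" "\<And>y \<mu>. 0 < \<mu> \<Longrightarrow> \<mu> \<le> 1 \<Longrightarrow> x + (1 / \<mu>) *\<^sub>R (y - x) \<in> cball x 1 \<Longrightarrow>
    cmod (P y * Q y - T y) \<le> c * (A * B) * \<mu> powr (real_of_int (int K) + 1)" unfolding c_def by blast
  show ?thesis unfolding tay_at_def
  proof (intro bexI[OF _ T(1)] allI impI)
    fix y r assume r: "0 < r" "r \<le> 1" "norm (y - x) \<le> r"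
    have "x + (1 / r) *\<^sub>R (y - x) \<in> cball x 1" using r by (simp add: dist_norm)
    from T(2)[OF r(1,2) this] have t: "cmod (P y * Q y - T y) \<le> c * (A * B) * r ^ Suc K"
      using powr_realpow[of r "Suc K"] r by (simp add: add.commute)
    have r1: "r ^ Suc K \<le> 1" using r by (intro power_le_one) auto
    have r0: "0 \<le> r ^ Suc K" using r by simp
    have y1: "norm (y - x) \<le> 1" using r by simp
    have g2: "cmod (g y) \<le> 2 * B" by (rule tay_at_bound[OF g y1])
    have fP: "cmod (f y - P y) \<le> A * r ^ Suc K" and gQ: "cmod (g y - Q y) \<le> B * r ^ Suc K" and Pb: "cmod (P y) \<le> A"
      using P(2)[OF r] Q(2)[OF r] by auto
    have "f y * g y - T y = (f y - P y) * g y + P y * (g y - Q y) + (P y * Q y - T y)" by (simp add: algebra_simps)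
    then have "cmod (f y * g y - T y) \<le> cmod ((f y - P y) * g y) + cmod (P y * (g y - Q y)) + cmod (P y * Q y - T y)"
      by (simp only:) (intro order_trans[OF norm_triangle_ineq] add_right_mono norm_triangle_ineq)
    also have "\<dots> \<le> (A * r ^ Suc K) * (2 * B) + A * (B * r ^ Suc K) + c * (A * B) * r ^ Suc K"
      unfolding norm_mult[of "f y - P y"] norm_mult[of "P y" "g y - Q y"] using t fP gQ Pb g2 AB r0
      by (intro add_mono mult_mono) auto
    also have "\<dots> = (3 + c) * A * B * r ^ Suc K" by (simp add: algebra_simps)
    also have "\<dots> \<le> prod_const K * A * B * r ^ Suc K"
      unfolding prod_const_def c_def[symmetric] using AB r0 by (intro mult_right_mono) auto
    finally have 1: "cmod (f y * g y - T y) \<le> prod_const K * A * B * r ^ Suc K" .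
    have "cmod (T y) \<le> cmod (P y * Q y) + cmod (P y * Q y - T y)"
      using norm_triangle_ineq4[of "P y * Q y" "P y * Q y - T y"] by simp
    also have "\<dots> \<le> A * B + c * (A * B) * 1"
      using bd[OF y1] t mult_left_mono[OF r1, of "c * (A * B)"] c AB by simp
    also have "\<dots> = (1 + c) * A * B" by (simp add: algebra_simps)
    also have "\<dots> \<le> prod_const K * A * B"
      unfolding prod_const_def c_def[symmetric] using AB by (intro mult_right_mono) auto
    finally show "cmod (f y * g y - T y) \<le> prod_const K * A * B * r ^ Suc K \<and> cmod (T y) \<le> prod_const K * A * B"
      using 1 by blast
  qed
qed

lemma tay_at_affine:
  assumes g: "tay_at K M (v + h *\<^sub>R x) g" and h: "0 < h" "h \<le> 1"
  shows "tay_at K M x (\<lambda>y. g (v + h *\<^sub>R y))"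
proof -
  obtain P where P: "P \<in> polys (int K)"
    "\<And>y r. 0 < r \<Longrightarrow> r \<le> 1 \<Longrightarrow> norm (y - (v + h *\<^sub>R x)) \<le> r \<Longrightarrow> cmod (g y - P y) \<le> M * r ^ Suc K \<and> cmod (P y) \<le> M"
    using g unfolding tay_at_def by blast
  show ?thesis unfolding tay_at_def
  proof (intro bexI[OF _ polys_affine[OF P(1), of v h]] allI impI)
    fix y r assume r: "0 < r" "r \<le> 1" "norm (y - x) \<le> r"
    have "norm ((v + h *\<^sub>R y) - (v + h *\<^sub>R x)) = h * norm (y - x)"
      using h by (simp flip: scaleR_diff_right)
    also have "\<dots> \<le> 1 * r" using h r by (intro mult_mono) auto
    finally show "cmod (g (v + h *\<^sub>R y) - P (v + h *\<^sub>R y)) \<le> M * r ^ Suc K \<and> cmod (P (v + h *\<^sub>R y)) \<le> M"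
      using P(2)[OF r(1,2)] by simp
  qed
qed

lemma tay_at_isCont:
  assumes "tay_at K M x g" shows "isCont g x"
proof -
  obtain P where P: "P \<in> polys (int K)"
    "\<And>y r. 0 < r \<Longrightarrow> r \<le> 1 \<Longrightarrow> norm (y - x) \<le> r \<Longrightarrow> cmod (g y - P y) \<le> M * r ^ Suc K"
    using assms unfolding tay_at_def by blast
  \<comment> \<open>Letting the radius tend to 0 at the centre itself shows that g and P agree
    there.\<close>
  have lim0: "((\<lambda>r. M * r ^ Suc K) \<longlongrightarrow> M * 0 ^ Suc K) (at_right 0)" by (intro tendsto_intros)
  have "cmod (g x - P x) \<le> M * 0 ^ Suc K"
  proof (rule tendsto_lowerbound[OF lim0])
    show "\<forall>\<^sub>F r in at_right 0. cmod (g x - P x) \<le> M * r ^ Suc K"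
      using P(2)[of _ x] by (intro eventually_at_rightI[of 0 1]) auto
  qed simp
  then have gx: "g x = P x" by simp
  have "isCont P x" using polys_continuous[OF P(1), of UNIV] by (simp add: continuous_on_eq_continuous_at)
  have "((\<lambda>y. g y - P y) \<longlongrightarrow> 0) (at x)"
  proof (rule Lim_null_comparison)
    show "\<forall>\<^sub>F y in at x. norm (g y - P y) \<le> M * norm (y - x) ^ Suc K"
      unfolding eventually_at
      by (intro exI[of _ 1]) (use P(2) in \<open>auto simp: dist_norm\<close>)
    have "((\<lambda>y. M * norm (y - x) ^ Suc K) \<longlongrightarrow> M * norm (x - x) ^ Suc K) (at x)" by (intro tendsto_intros)
    then show "((\<lambda>y. M * norm (y - x) ^ Suc K) \<longlongrightarrow> 0) (at x)" by simp
  qed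
  then have "((\<lambda>y. (g y - P y) + P y) \<longlongrightarrow> 0 + P x) (at x)"
    using \<open>isCont P x\<close> by (intro tendsto_add) (auto simp: isCont_def)
  then show ?thesis using gx by (simp add: isCont_def)
qed

definition taylor_on :: "nat \<Rightarrow> (real ^ 'n::finite) set \<Rightarrow> (real ^ 'n \<Rightarrow> complex) \<Rightarrow> bool"
  where "taylor_on K S g \<longleftrightarrow> (\<exists>M. \<forall>x\<in>S. tay_at K M x g)"

lemma taylor_on_add: "taylor_on K S f \<Longrightarrow> taylor_on K S g \<Longrightarrow> taylor_on K S (\<lambda>y. f y + g y)"
  unfolding taylor_on_def by (blast intro: tay_at_add)

lemma taylor_on_mult: "taylor_on K S f \<Longrightarrow> taylor_on K S g \<Longrightarrow> taylor_on K S (\<lambda>y. f y * g y)"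
  unfolding taylor_on_def by (blast intro: tay_at_mult)

lemma taylor_on_const: "taylor_on K S (\<lambda>y. c)"
  unfolding taylor_on_def by (intro exI[of _ "cmod c"] ballI tay_at_poly polys_const) auto

lemma taylor_on_sum: "(\<And>i. i \<in> A \<Longrightarrow> taylor_on K S (f i)) \<Longrightarrow> taylor_on K S (\<lambda>y. \<Sum>i\<in>A. f i y)"
  by (induction A rule: infinite_finite_induct) (auto intro: taylor_on_add taylor_on_const)

lemma taylor_on_prod: "(\<And>i. i \<in> A \<Longrightarrow> taylor_on K S (f i)) \<Longrightarrow> taylor_on K S (\<lambda>y. \<Prod>i\<in>A. f i y)"
  by (induction A rule: infinite_finite_induct) (auto intro: taylor_on_mult taylor_on_const)

lemma taylor_on_power: "taylor_on K S f \<Longrightarrow> taylor_on K S (\<lambda>y. f y ^ m)"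
  by (induction m) (auto intro: taylor_on_mult taylor_on_const)

lemma taylor_on_coord:
  assumes "1 \<le> K" and S: "\<And>x. x \<in> S \<Longrightarrow> \<bar>x $ i\<bar> \<le> b"
  shows "taylor_on K S (\<lambda>y. of_real (y $ i))"
  unfolding taylor_on_def
proof (intro exI[of _ "b + 1"] ballI tay_at_poly)
  show "(\<lambda>y. of_real (y $ i)) \<in> polys (int K)" using polys_mono[OF polys_coord, of "int K"] assms(1) by simp
  fix x y assume "x \<in> S" "norm (y - x) \<le> 1"
  then show "cmod (of_real (y $ i)) \<le> b + 1"
    using S[of x] component_le_norm_cart[of "y - x" i] by (simp add: norm_of_real)
qed

text \<open>Truncated powers: at a point on the positive side the approximation is the full power without
  its top order term, on the other side it is zero.\<close>

lemma taylor_on_truncated_power: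
  assumes S: "\<And>x. x \<in> S \<Longrightarrow> \<bar>x $ i\<bar> \<le> b"
  shows "taylor_on K S (\<lambda>y. of_real (max 0 (y $ i - a) ^ Suc K))"
  unfolding taylor_on_def
proof (intro exI[of _ "max 2 ((b + 1 + \<bar>a\<bar>) ^ Suc K + 1)"] ballI)
  fix x assume x: "x \<in> S"
  let ?B = "b + 1 + \<bar>a\<bar>"
  let ?M = "max 2 (?B ^ Suc K + 1)"
  have b: "0 \<le> b" using S[OF x] by (meson abs_ge_zero order_trans)
  have comp: "\<bar>y $ i - x $ i\<bar> \<le> r" if "norm (y - x) \<le> r" for y r
    using component_le_norm_cart[of "y - x" i] that by simp
  have pw: "\<bar>y $ i - x $ i\<bar> ^ Suc K \<le> r ^ Suc K" if "norm (y - x) \<le> r" for y r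
    using comp[OF that] by (intro power_mono) auto
  show "tay_at K ?M x (\<lambda>y. of_real (max 0 (y $ i - a) ^ Suc K))"
  proof (cases "x $ i \<le> a")
    case True
    show ?thesis unfolding tay_at_def
    proof (intro bexI[OF _ polys_0] allI impI conjI)
      fix y r assume r: "0 < r" "r \<le> 1" "norm (y - x) \<le> r"
      have "max 0 (y $ i - a) \<le> \<bar>y $ i - x $ i\<bar>" using True by auto
      then have "max 0 (y $ i - a) ^ Suc K \<le> \<bar>y $ i - x $ i\<bar> ^ Suc K" by (intro power_mono) auto
      also have "\<dots> \<le> r ^ Suc K" by (rule pw[OF r(3)])
      also have "\<dots> \<le> ?M * r ^ Suc K" using r mult_right_mono[of 1 ?M "r ^ Suc K"] by simp
      finally show "cmod (of_real (max 0 (y $ i - a) ^ Suc K) - 0) \<le> ?M * r ^ Suc K"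
        by (simp add: norm_power norm_mult)
    qed simp
  next
    case False
    define P :: "real ^ 'a \<Rightarrow> complex" where "P y = of_real ((y $ i - a) ^ Suc K - (y $ i - x $ i) ^ Suc K)" for y
    \<comment> \<open>Factoring the difference of the two powers exhibits degree at most K.\<close>
    have "P = (\<lambda>y. of_real (x $ i - a) * (\<Sum>j<Suc K. (of_real (y $ i) + - of_real (x $ i)) ^ (Suc K - Suc j) * (of_real (y $ i) + - of_real a) ^ j))"
    proof
      fix y
      have "(y $ i - a) ^ Suc K - (y $ i - x $ i) ^ Suc K
        = ((y $ i - a) - (y $ i - x $ i)) * (\<Sum>j<Suc K. (y $ i - x $ i) ^ (Suc K - Suc j) * (y $ i - a) ^ j)"
        by (rule power_diff_sumr2)
      then show "P y = of_real (x $ i - a) * (\<Sum>j<Suc K. (of_real (y $ i) + - of_real (x $ i)) ^ (Suc K - Suc j) * (of_real (y $ i) + - of_real a) ^ j)"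
        unfolding P_def by simp
    qed
    also have "\<dots> \<in> polys (int K)"
    proof (intro polys_scale polys_sum)
      fix j assume "j \<in> {..<Suc K}"
      have lin: "(\<lambda>y :: real ^ 'a. of_real (y $ i) + c) \<in> polys 1" for c :: complex by (intro polys_add polys_coord polys_const) simp
      have pow: "(\<lambda>y :: real ^ 'a. (of_real (y $ i) + c) ^ m) \<in> polys (int m)" for c :: complex and m
      proof (induction m)
        case (Suc m)
        from polys_mult[OF lin[of c] Suc] show ?case by simp
      qed (simp add: polys_const)
      have "int (Suc K - Suc j) + int j = int K" using \<open>j \<in> {..<Suc K}\<close> by auto
      then show "(\<lambda>y. (of_real (y $ i) + - of_real (x $ i)) ^ (Suc K - Suc j) * (of_real (y $ i) + - of_real a) ^ j) \<in> polys (int K)"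
        using polys_mult[OF pow pow, of "- of_real (x $ i)" "Suc K - Suc j" "- of_real a" j] by simp
    qed
    finally have P: "P \<in> polys (int K)" .
    show ?thesis unfolding tay_at_def
    proof (intro bexI[OF _ P] allI impI conjI)
      fix y r assume r: "0 < r" "r \<le> 1" "norm (y - x) \<le> r"
      have r1: "r ^ Suc K \<le> 1" using r by (intro power_le_one) auto
      have "\<bar>max 0 (y $ i - a) ^ Suc K - ((y $ i - a) ^ Suc K - (y $ i - x $ i) ^ Suc K)\<bar> \<le> 2 * r ^ Suc K"
      proof (cases "a \<le> y $ i")
        case True
        then have "\<bar>max 0 (y $ i - a) ^ Suc K - ((y $ i - a) ^ Suc K - (y $ i - x $ i) ^ Suc K)\<bar> = \<bar>y $ i - x $ i\<bar> ^ Suc K"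
          by (simp add: power_abs max_def abs_mult)
        then show ?thesis using pw[OF r(3)] r by simp
      next
        case ya: False
        have "\<bar>y $ i - a\<bar> ^ Suc K \<le> \<bar>y $ i - x $ i\<bar> ^ Suc K" using ya False by (intro power_mono) auto
        then have "\<bar>(y $ i - a) ^ Suc K\<bar> + \<bar>(y $ i - x $ i) ^ Suc K\<bar> \<le> 2 * r ^ Suc K"
          unfolding power_abs using pw[OF r(3)] by linarith
        moreover have "max 0 (y $ i - a) ^ Suc K = 0" using ya by (simp add: max_def)
        ultimately show ?thesis by linarith
      qed
      then have "cmod (of_real (max 0 (y $ i - a) ^ Suc K) - P y) \<le> 2 * r ^ Suc K"
        unfolding P_def of_real_diff[symmetric] norm_of_real .
      also have "\<dots> \<le> ?M * r ^ Suc K" using r by (intro mult_right_mono) auto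
      finally show "cmod (of_real (max 0 (y $ i - a) ^ Suc K) - P y) \<le> ?M * r ^ Suc K" .
      have "\<bar>y $ i - a\<bar> \<le> ?B" using comp[OF r(3)] S[OF x] r by auto
      then have "\<bar>y $ i - a\<bar> ^ Suc K \<le> ?B ^ Suc K" by (intro power_mono) auto
      moreover have "\<bar>y $ i - x $ i\<bar> ^ Suc K \<le> 1" using pw[OF r(3)] r1 by linarith
      ultimately have "\<bar>(y $ i - a) ^ Suc K - (y $ i - x $ i) ^ Suc K\<bar> \<le> ?B ^ Suc K + 1"
        unfolding power_abs[symmetric] by linarith
      then show "cmod (P y) \<le> ?M" unfolding P_def norm_of_real by simp
    qed
  qed
qed

subsection \<open>A smooth partition of unity\<close>

text \<open>On \<open>[0, 1]\<close> this is \<open>1 - (1 - t ^ (K + 1)) ^ (K + 1)\<close>, here as a combination of truncated powers.\<close>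

definition smoothstep :: "nat \<Rightarrow> real \<Rightarrow> real"
  where "smoothstep K t = max 0 t ^ Suc K * (\<Sum>j<Suc K. (1 - t ^ Suc K) ^ j)
    + (-1) ^ Suc K * max 0 (t - 1) ^ Suc K * (\<Sum>j<Suc K. t ^ j) ^ Suc K"

lemma smoothstep_0: "t \<le> 0 \<Longrightarrow> smoothstep K t = 0"
  by (simp add: smoothstep_def max_def)

text \<open>For t >= 1 both truncated powers are genuine powers. The factorisation of 1 - t^(K + 1)
  by 1 - t turns the second summand into (1 - t^(K + 1))^(K + 1), exactly what the first one lacks
  to 1.\<close>

lemma smoothstep_1:
  assumes t: "1 \<le> t" shows "smoothstep K t = 1"
proof -
  have "1 - (1 - t ^ Suc K) ^ Suc K = (1 - (1 - t ^ Suc K)) * (\<Sum>j<Suc K. (1 - t ^ Suc K) ^ j)"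
    by (rule one_diff_power_eq)
  then have 1: "t ^ Suc K * (\<Sum>j<Suc K. (1 - t ^ Suc K) ^ j) = 1 - (1 - t ^ Suc K) ^ Suc K" by simp
  have "1 - t ^ Suc K = (1 - t) * (\<Sum>j<Suc K. t ^ j)" by (rule one_diff_power_eq)
  then have "(1 - t ^ Suc K) ^ Suc K = (1 - t) ^ Suc K * (\<Sum>j<Suc K. t ^ j) ^ Suc K" by (simp only: power_mult_distrib)
  moreover have "(1 - t) ^ Suc K = (-1) ^ Suc K * (t - 1) ^ Suc K" by (metis minus_diff_eq mult_minus1 power_mult_distrib)
  ultimately have 2: "(-1) ^ Suc K * (t - 1) ^ Suc K * (\<Sum>j<Suc K. t ^ j) ^ Suc K = (1 - t ^ Suc K) ^ Suc K" by simp
  have "max 0 t = t" "max 0 (t - 1) = t - 1" using t by auto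
  then show ?thesis unfolding smoothstep_def by (simp only: 1 2)
qed

text \<open>The closure rules give a constant only where the coordinate is bounded. At centres
  beyond distance 2 the function is constant, 0 or 1, on the whole unit ball, so the constant
  becomes global.\<close>

lemma taylor_on_smoothstep:
  assumes K: "1 \<le> K"
  shows "taylor_on K UNIV (\<lambda>y :: real ^ 'n::finite. of_real (smoothstep K (y $ i)))"
proof -
  let ?S = "{x :: real ^ 'n. \<bar>x $ i\<bar> \<le> 2}"
  have "taylor_on K ?S (\<lambda>y. of_real (max 0 (y $ i - 0) ^ Suc K) * (\<Sum>j<Suc K. (1 + (- 1) * of_real (y $ i) ^ Suc K) ^ j)
    + (-1) ^ Suc K * of_real (max 0 (y $ i - 1) ^ Suc K) * (\<Sum>j<Suc K. of_real (y $ i) ^ j) ^ Suc K)"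
    using K by (intro taylor_on_add taylor_on_mult taylor_on_sum taylor_on_power taylor_on_const taylor_on_coord[of K _ i 2]
        taylor_on_truncated_power[of _ i 2]) auto
  also have "(\<lambda>y :: real ^ 'n. of_real (max 0 (y $ i - 0) ^ Suc K) * (\<Sum>j<Suc K. (1 + (- 1) * of_real (y $ i) ^ Suc K) ^ j)
    + (-1) ^ Suc K * of_real (max 0 (y $ i - 1) ^ Suc K) * (\<Sum>j<Suc K. of_real (y $ i) ^ j) ^ Suc K)
    = (\<lambda>y. complex_of_real (smoothstep K (y $ i)))"
    unfolding smoothstep_def by (simp del: power_Suc sum.lessThan_Suc)
  finally obtain M where M: "\<And>x. x \<in> ?S \<Longrightarrow> tay_at K M x (\<lambda>y. complex_of_real (smoothstep K (y $ i)))"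
    unfolding taylor_on_def by blast
  have "tay_at K (max M 1) x (\<lambda>y. complex_of_real (smoothstep K (y $ i)))" for x
  proof (cases "x \<in> ?S")
    case True
    from tay_at_mono[OF M[OF this]] show ?thesis by simp
  next
    case False
    have comp: "\<bar>y $ i - x $ i\<bar> \<le> 1" if "norm (y - x) \<le> 1" for y
      using component_le_norm_cart[of "y - x" i] that by simp
    show ?thesis
    proof (cases "x $ i \<le> 0")
      case True
      have "tay_at K (max M 1) x (\<lambda>y. 0)" by (intro tay_at_poly polys_0) auto
      then show ?thesis
      proof (rule tay_at_cong)
        fix y assume "norm (y - x) \<le> 1"
        then have "y $ i \<le> 0" using comp[of y] True False by auto
        then show "complex_of_real (smoothstep K (y $ i)) = 0" by (simp add: smoothstep_0)
      qed
    next
      case xi: False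
      have "tay_at K (max M 1) x (\<lambda>y. 1)" by (intro tay_at_poly polys_const) auto
      then show ?thesis
      proof (rule tay_at_cong)
        fix y assume "norm (y - x) \<le> 1"
        then have "1 \<le> y $ i" using comp[of y] xi False by auto
        then show "complex_of_real (smoothstep K (y $ i)) = 1" by (simp add: smoothstep_1)
      qed
    qed
  qed
  then show ?thesis unfolding taylor_on_def by blast
qed

text \<open>The difference of two shifts makes the integer translates telescope to 1, while the
  support stays within [-1, 1].\<close>

definition bump1 :: "nat \<Rightarrow> real \<Rightarrow> real"
  where "bump1 K t = smoothstep K (t + 1) - smoothstep K t"

lemma bump1_support: "1 \<le> \<bar>t\<bar> \<Longrightarrow> bump1 K t = 0"
  by (cases "0 \<le> t") (auto simp: bump1_def smoothstep_0 smoothstep_1)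

lemma bump1_sum:
  assumes "of_int a \<le> t" "t \<le> of_int b"
  shows "(\<Sum>l\<in>{a..b}. bump1 K (t - of_int l)) = 1"
proof -
  have "a \<le> b" using assms by linarith
  have "(\<Sum>l\<in>{a..b}. bump1 K (t - of_int l)) = smoothstep K (t - of_int a + 1) - smoothstep K (t - of_int b)"
    using \<open>a \<le> b\<close>
  proof (induction b rule: int_ge_induct)
    case base
    then show ?case by (simp add: bump1_def)
  next
    case (step b)
    have "{a..b + 1} = insert (b + 1) {a..b}" using step by auto
    then show ?case using step by (simp add: bump1_def)
  qed
  then show ?thesis using assms by (simp add: smoothstep_0 smoothstep_1)
qed

definition bump :: "nat \<Rightarrow> real ^ 'n::finite \<Rightarrow> complex"
  where "bump K y = of_real (\<Prod>i\<in>UNIV. bump1 K (y $ i))"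

lemma taylor_on_bump:
  assumes "1 \<le> K" shows "taylor_on K UNIV (bump K :: real ^ 'n::finite \<Rightarrow> complex)"
proof -
  have shift: "taylor_on K UNIV (\<lambda>y :: real ^ 'n. of_real (smoothstep K (y $ i + 1)))" for i
  proof -
    obtain M where M: "\<And>x. tay_at K M x (\<lambda>y :: real ^ 'n. complex_of_real (smoothstep K (y $ i)))"
      using taylor_on_smoothstep[OF assms, of i] unfolding taylor_on_def by blast
    have "tay_at K M x (\<lambda>y. complex_of_real (smoothstep K (((\<chi> i. 1) + 1 *\<^sub>R y) $ i)))" for x
      by (rule tay_at_affine[OF M]) auto
    then show ?thesis unfolding taylor_on_def by (auto simp: add.commute)
  qed
  have "taylor_on K UNIV (\<lambda>y :: real ^ 'n. \<Prod>i\<in>UNIV. complex_of_real (smoothstep K (y $ i + 1)) + (-1) * complex_of_real (smoothstep K (y $ i)))"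
    by (intro taylor_on_prod taylor_on_add taylor_on_mult taylor_on_const taylor_on_smoothstep shift assms)
  moreover have "(\<lambda>y :: real ^ 'n. \<Prod>i\<in>UNIV. complex_of_real (smoothstep K (y $ i + 1)) + (-1) * complex_of_real (smoothstep K (y $ i))) = bump K"
    by (simp add: bump_def bump1_def fun_eq_iff)
  ultimately show ?thesis by simp
qed

definition ivec :: "('n \<Rightarrow> int) \<Rightarrow> real ^ 'n::finite"
  where "ivec l = (\<chi> i. of_int (l i))"

text \<open>All lattice points whose bump can be nonzero somewhere within distance 1 of z in every
  coordinate. It is larger than needed at z alone, so that it can be kept fixed while the argument
  moves.\<close>

definition nbhd :: "real ^ 'n::finite \<Rightarrow> ('n \<Rightarrow> int) set"
  where "nbhd z = PiE UNIV (\<lambda>i. {\<lfloor>z $ i\<rfloor> - 1..\<lfloor>z $ i\<rfloor> + 2})"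

lemma nbhd: "finite (nbhd (z :: real ^ 'n::finite))" "card (nbhd z) = 4 ^ CARD('n)"
  unfolding nbhd_def by (auto intro: finite_PiE simp: card_PiE)

lemma nbhd_dist: "l \<in> nbhd z \<Longrightarrow> \<bar>z $ i - of_int (l i)\<bar> \<le> 2"
proof -
  assume "l \<in> nbhd z"
  then have "\<lfloor>z $ i\<rfloor> - 1 \<le> l i" "l i \<le> \<lfloor>z $ i\<rfloor> + 2" by (auto simp: nbhd_def PiE_def Pi_def)
  then show ?thesis by linarith
qed

lemma bump_support:
  assumes "bump K (w - ivec l) \<noteq> 0" "\<And>i. \<bar>w $ i - z $ i\<bar> \<le> 1"
  shows "l \<in> nbhd z"
proof -
  have "l i \<in> {\<lfloor>z $ i\<rfloor> - 1..\<lfloor>z $ i\<rfloor> + 2}" for i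
  proof -
    have "bump1 K (w $ i - of_int (l i)) \<noteq> 0" using assms(1) by (auto simp: bump_def ivec_def)
    then have "\<bar>w $ i - of_int (l i)\<bar> < 1" using bump1_support[of "w $ i - of_int (l i)" K] by linarith
    then have "\<bar>z $ i - of_int (l i)\<bar> < 2" using assms(2)[of i] by linarith
    then show ?thesis by (auto simp: abs_less_iff) linarith+
  qed
  then show ?thesis by (auto simp: nbhd_def)
qed

text \<open>Only lattice points with nonvanishing bump matter, and both index sets contain them.
  With the index set frozen at z the sum is a fixed finite combination near z, to which the rules
  for Taylor approximation apply.\<close>

lemma bump_sum_nbhd:
  assumes "\<And>i. \<bar>w $ i - z $ i\<bar> \<le> 1"
  shows "(\<Sum>l\<in>nbhd w. bump K (w - ivec l) * c l) = (\<Sum>l\<in>nbhd z. bump K (w - ivec l) * c l)"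
proof -
  let ?L = "{l. bump K (w - ivec l) \<noteq> 0}"
  have "?L \<subseteq> nbhd w" "?L \<subseteq> nbhd z" using assms by (auto intro!: bump_support)
  then have "(\<Sum>l\<in>?L. bump K (w - ivec l) * c l) = (\<Sum>l\<in>nbhd w. bump K (w - ivec l) * c l)"
    "(\<Sum>l\<in>?L. bump K (w - ivec l) * c l) = (\<Sum>l\<in>nbhd z. bump K (w - ivec l) * c l)"
    by (auto intro!: sum.mono_neutral_left nbhd(1))
  then show ?thesis by simp
qed

text \<open>Expand the product of the one-dimensional identities of \<open>bump1_sum\<close>; the
  index range reaches integers on both sides of each coordinate.\<close>

lemma bump_partition: "(\<Sum>l\<in>nbhd w. bump K (w - ivec l)) = 1"
proof -
  have "(\<Sum>l\<in>nbhd w. \<Prod>i\<in>UNIV. bump1 K (w $ i - of_int (l i)))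
    = (\<Prod>i\<in>UNIV. \<Sum>j\<in>{\<lfloor>w $ i\<rfloor> - 1..\<lfloor>w $ i\<rfloor> + 2}. bump1 K (w $ i - of_int j))"
    unfolding nbhd_def by (rule prod_sum_PiE[symmetric, of _ _ "\<lambda>i j. bump1 K (w $ i - of_int j)"]) auto
  also have "\<dots> = 1" by (intro prod.neutral ballI bump1_sum) linarith+
  finally have "of_real (\<Sum>l\<in>nbhd w. \<Prod>i\<in>UNIV. bump1 K (w $ i - of_int (l i))) = (1 :: complex)" by simp
  then show ?thesis by (simp add: bump_def ivec_def)
qed

subsection \<open>Decomposition into smooth dyadic pieces\<close>

lemma tay_at_minus: "tay_at K M x g \<Longrightarrow> tay_at K M x (\<lambda>y. - g y)"
  unfolding tay_at_def
proof (elim bexE)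
  fix P assume P: "P \<in> polys (int K)"
    "\<forall>y r. 0 < r \<longrightarrow> r \<le> 1 \<longrightarrow> norm (y - x) \<le> r \<longrightarrow> cmod (g y - P y) \<le> M * r ^ Suc K \<and> cmod (P y) \<le> M"
  have "cmod (- g y - - P y) = cmod (g y - P y)" for y by (simp add: norm_minus_commute)
  then show "\<exists>P\<in>polys (int K). \<forall>y r. 0 < r \<longrightarrow> r \<le> 1 \<longrightarrow> norm (y - x) \<le> r \<longrightarrow>
    cmod (- g y - P y) \<le> M * r ^ Suc K \<and> cmod (P y) \<le> M"
    using P(2) by (intro bexI[OF _ polys_minus[OF P(1)]]) simp
qed

lemma tay_at_sum:
  assumes "finite A" "\<And>i. i \<in> A \<Longrightarrow> tay_at K M x (f i)"
  shows "tay_at K (real (card A) * M) x (\<lambda>y. \<Sum>i\<in>A. f i y)"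
  using assms
proof (induction A rule: finite_induct)
  case empty
  then show ?case by (simp add: tay_at_poly polys_0)
next
  case (insert a A)
  then have "tay_at K (M + real (card A) * M) x (\<lambda>y. f a y + (\<Sum>i\<in>A. f i y))" by (intro tay_at_add) auto
  then show ?case using insert.hyps by (simp add: algebra_simps)
qed

lemma Lint_cube_dyadic:
  fixes g :: "real ^ 'n::finite \<Rightarrow> complex"
  assumes g: "g \<in> borel_measurable lebesgue" and B: "0 \<le> B"
    and small: "\<And>x. Lint p (cube x (1 / 2 ^ m)) g \<le> ennreal (B * (1 / 2 ^ m) ^ CARD('n))"
  shows "Lint p (cube x 1) g \<le> ennreal B"
proof -
  have "Lint p (cube x (1 / 2 ^ j)) g \<le> ennreal (B * (1 / 2 ^ j) ^ CARD('n))" if "j \<le> m" for j x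
    using that
  proof (induction j arbitrary: x rule: inc_induct)
    case (step j)
    let ?h = "1 / 2 ^ Suc j :: real"
    have h: "0 < ?h" "1 / 2 ^ j = 2 * ?h" by auto
    have "Lint p (cube x (2 * ?h)) g = (\<Sum>e\<in>UNIV. Lint p (cube (corner x ?h e) ?h) g)"
      by (rule Lint_cube_children[OF h(1) g])
    also have "\<dots> \<le> (\<Sum>e\<in>(UNIV :: ('n \<Rightarrow> bool) set). ennreal (B * ?h ^ CARD('n)))" by (intro sum_mono step.IH)
    also have "\<dots> = of_nat (CARD('n \<Rightarrow> bool)) * ennreal (B * ?h ^ CARD('n))" by simp
    also have "\<dots> = ennreal (2 ^ CARD('n) * (B * ?h ^ CARD('n)))"
      using B by (simp add: card_fun ennreal_of_nat_eq_real_of_nat flip: ennreal_mult)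
    also have "2 ^ CARD('n) * (B * ?h ^ CARD('n)) = B * (2 * ?h) ^ CARD('n)" by (simp only: power_mult_distrib mult_ac)
    finally show ?case unfolding h(2) .
  qed (rule small)
  from this[of 0 x] show ?thesis by simp
qed

text \<open>Level m lives on the grid of spacing 1 / (32 * 2^m). The factor 32 leaves room for all
  grid cubes that matter near a point, from two consecutive levels, inside one cube of side
  2^(-m).\<close>

definition smooth_pieces :: "nat \<Rightarrow> real \<Rightarrow> real \<Rightarrow> (real ^ 'n::finite \<Rightarrow> complex) \<Rightarrow> (nat \<Rightarrow> real ^ 'n \<Rightarrow> complex) \<Rightarrow> bool"
  where "smooth_pieces K A s f D \<longleftrightarrow>
    (\<forall>m. D m \<in> borel_measurable lebesgue) \<and>
    (\<forall>m y. cmod (D m y) \<le> A * 2 powr (- (real m * s))) \<and>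
    (\<forall>m x. \<exists>P\<in>polys (int K). \<forall>y r. 0 < r \<longrightarrow> 32 * 2 ^ m * r \<le> 1 \<longrightarrow> norm (y - x) \<le> r \<longrightarrow>
      cmod (D m y - P y) \<le> A * 2 powr (- (real m * s)) * (32 * 2 ^ m * r) ^ Suc K) \<and>
    (\<forall>x. AE y in lebesgue. y \<in> cube x 1 \<longrightarrow> (\<lambda>N. \<Sum>m<N. D m y) \<longlonglongrightarrow> f y)"

text \<open>The pieces are differences of the functions obtained by gluing near-optimal polynomials on
  dyadic cubes with the partition of unity. Cubes of side \<open>2\<^sup>-\<^sup>m\<close> contain all the cubes of the two
  levels that matter near a point, so each piece is locally a combination of small polynomials.\<close>

lemma smooth_decomposition:
  assumes s: "0 < s" and K: "1 \<le> K"
  shows "\<exists>C>0. \<forall>M>0. \<forall>f :: real ^ 'n::finite \<Rightarrow> complex. camp 1 s (int K) M f \<longrightarrow> (\<exists>D. smooth_pieces K (C * M) s f D)"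
proof -
  let ?n = "CARD('n)"
  obtain Mb where Mb: "\<And>x. tay_at K Mb x (bump K :: real ^ 'n \<Rightarrow> complex)"
    using taylor_on_bump[OF K] unfolding taylor_on_def by blast
  have Mb0: "0 \<le> Mb" by (rule tay_at_nonneg[OF Mb[of 0]])
  define c4 where "c4 = compare_const 1 K 4 TYPE('n)"
  have c4: "0 < c4" by (simp add: c4_def compare_const_pos)
  define c5 where "c5 = 4 ^ ?n * (prod_const K * Mb * c4)"
  have c5: "0 \<le> c5" using Mb0 c4 prod_const_pos[of K] by (simp add: c5_def)
  \<comment> \<open>One factor 2 comes from the difference of two glued functions, another from
    \<open>tay_at_bound\<close>; 2^s passes to the coarser of two levels.\<close>
  define C where "C = 4 * c5 * 2 powr s + 1"
  have C: "0 < C" using c5 by (simp add: C_def add_nonneg_pos)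
  have "\<exists>D. smooth_pieces K (C * M) s f D" if M: "0 < M" and f: "camp 1 s (int K) M f"
    for M and f :: "real ^ 'n \<Rightarrow> complex"
  proof -
    have fm [measurable]: "f \<in> borel_measurable lebesgue" using f by (rule campD)
    define lam where "lam m = (32 * 2 ^ m :: real)" for m :: nat
    have lam: "0 < lam m" "lam (Suc m) = 2 * lam m" for m by (auto simp: lam_def)
    \<comment> \<open>The oscillation bound at side 2^(1 - m), which dominates the bounds at both
      levels m - 1 and m.\<close>
    define A where "A m = M * 2 powr s * 2 powr (- (real m * s))" for m :: nat
    have A: "0 < A m" for m using M by (simp add: A_def)
    \<comment> \<open>\<open>Q m l\<close> is centred at the grid point and \<open>R m x\<close> at
      x. At level m - 1 the side of \<open>Q\<close> is 16 / lam m, so \<open>R m x\<close> still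
      contains it when the grid point is near x.\<close>
    define Q where "Q m l = cube ((1 / lam m) *\<^sub>R (ivec l - (\<chi> i. 4) :: real ^ 'n)) (8 / lam m)" for m l
    define R where "R m x = cube (x - (\<chi> i. 16 / lam m) :: real ^ 'n) (32 / lam m)" for m x
    have side: "8 / lam m = 1 / 4 * (1 / 2 ^ m)" "32 / lam m = 1 / 2 ^ m" for m by (auto simp: lam_def)
    have half: "1 / 2 ^ m \<le> (1 :: real)" for m :: nat by simp
    have pw: "(1 / 2 ^ m) powr s = 2 powr (- (real m * s))" for m :: nat
      by (simp add: powr_divide powr_powr powr_minus_divide flip: powr_realpow)
    have exP: "\<exists>P\<in>polys (int K). Lint 1 (cube x l) (\<lambda>y. f y - P y) \<le> ennreal ((M * 2 powr (- (real m * s))) powr 1 * l ^ ?n)"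
      if l: "0 < l" "l \<le> 1 / 2 ^ m" for x l m
    proof -
      have l1: "l \<le> 1" using l(2) half[of m] by linarith
      obtain P where P: "P \<in> polys (int K)" "Lint 1 (cube x l) (\<lambda>y. f y - P y) \<le> ennreal ((M * l powr s) powr 1 * l ^ ?n)"
        using campD(3)[OF f l(1) l1] by blast
      have "l powr s \<le> 2 powr (- (real m * s))" unfolding pw[symmetric] using l s by (intro powr_mono2) auto
      then have "(M * l powr s) powr 1 * l ^ ?n \<le> (M * 2 powr (- (real m * s))) powr 1 * l ^ ?n"
        using M l by (intro mult_right_mono powr_mono2 mult_left_mono) auto
      then show ?thesis using P(1) order_trans[OF P(2) ennreal_leI] by blast
    qed
    have "\<forall>m l. \<exists>P. P \<in> polys (int K) \<and> Lint 1 (Q m l) (\<lambda>y. f y - P y) \<le> ennreal ((M * 2 powr (- (real m * s))) powr 1 * (8 / lam m) ^ ?n)"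
    proof (intro allI)
      fix m l
      have "0 < 8 / lam m" "8 / lam m \<le> 1 / 2 ^ m" using lam(1)[of m] by (auto simp: lam_def divide_simps)
      from exP[OF this] show "\<exists>P. P \<in> polys (int K) \<and> Lint 1 (Q m l) (\<lambda>y. f y - P y) \<le> ennreal ((M * 2 powr (- (real m * s))) powr 1 * (8 / lam m) ^ ?n)"
        unfolding Q_def by blast
    qed
    then obtain Pm where Pm: "\<And>m l. Pm m l \<in> polys (int K)"
      "\<And>m l. Lint 1 (Q m l) (\<lambda>y. f y - Pm m l y) \<le> ennreal ((M * 2 powr (- (real m * s))) powr 1 * (8 / lam m) ^ ?n)"
      by metis
    \<comment> \<open>At level 0 the comparison polynomial is 0, so the first piece, which is not a
      difference, needs no correction.\<close>
    have "\<forall>m x. \<exists>P. P \<in> polys (int K) \<and> (m = 0 \<longrightarrow> P = (\<lambda>_. 0)) \<and>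
      Lint 1 (R m x) (\<lambda>y. f y - P y) \<le> ennreal ((M * 2 powr (- (real m * s))) powr 1 * (32 / lam m) ^ ?n)"
    proof (intro allI)
      fix m x
      show "\<exists>P. P \<in> polys (int K) \<and> (m = 0 \<longrightarrow> P = (\<lambda>_. 0)) \<and>
        Lint 1 (R m x) (\<lambda>y. f y - P y) \<le> ennreal ((M * 2 powr (- (real m * s))) powr 1 * (32 / lam m) ^ ?n)"
      proof (cases "m = 0")
        case True
        have "Lint 1 (R 0 x) f \<le> ennreal (M powr 1)" unfolding R_def side(2)[of 0] using campD(2)[OF f] by simp
        then show ?thesis using True by (intro exI[of _ "\<lambda>_. 0"]) (simp add: polys_0 side(2)[of 0])
      next
        case False
        have "0 < 32 / lam m" "32 / lam m \<le> 1 / 2 ^ m" using lam(1)[of m] by (auto simp: side)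
        from exP[OF this] False show ?thesis unfolding R_def by blast
      qed
    qed
    then obtain PR where "\<forall>m x. PR m x \<in> polys (int K) \<and> (m = 0 \<longrightarrow> PR m x = (\<lambda>_. 0)) \<and>
      Lint 1 (R m x) (\<lambda>y. f y - PR m x y) \<le> ennreal ((M * 2 powr (- (real m * s))) powr 1 * (32 / lam m) ^ ?n)"
      unfolding choice_iff by blast
    then have PR: "\<And>m x. PR m x \<in> polys (int K)" "\<And>x. PR 0 x = (\<lambda>_. 0)"
      "\<And>m x. Lint 1 (R m x) (\<lambda>y. f y - PR m x y) \<le> ennreal ((M * 2 powr (- (real m * s))) powr 1 * (32 / lam m) ^ ?n)"
      by blast+
    have AM: "M * 2 powr (- (real m * s)) \<le> A m" for m
    proof -
      have "1 \<le> 2 powr s" using s by (simp add: ge_one_powr_ge_zero)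
      then have "M * 2 powr (- (real m * s)) * 1 \<le> M * 2 powr (- (real m * s)) * 2 powr s" using M by (intro mult_left_mono) auto
      then show ?thesis by (simp add: A_def mult_ac)
    qed
    have AM': "M * 2 powr (- (real m * s)) = A (Suc m)" for m
      by (simp add: A_def algebra_simps flip: powr_add)
    have bigger: "Lint 1 S g \<le> ennreal (b' powr 1 * v)" if "Lint 1 S g \<le> ennreal (b powr 1 * v)" "b \<le> b'" "0 \<le> b" "0 \<le> v" for S g b b' v
      using that by (elim order_trans) (intro ennreal_leI mult_right_mono powr_mono2, auto)
    have PRA: "Lint 1 (R m x) (\<lambda>y. f y - PR m x y) \<le> ennreal (A m powr 1 * (32 / lam m) ^ ?n)" for m x
      using M lam(1)[of m] by (intro bigger[OF PR(3) AM]) auto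
    have Qmem: "y \<in> Q j l" if l: "l \<in> nbhd (lam j *\<^sub>R x)" and y: "\<And>i. lam j * \<bar>y $ i - x $ i\<bar> \<le> 1" for j l x y
    proof -
      have "(of_int (l i) - 4) / lam j \<le> y $ i \<and> y $ i < (of_int (l i) - 4) / lam j + 8 / lam j" for i
      proof -
        have "\<bar>lam j * x $ i - of_int (l i)\<bar> \<le> 2" using nbhd_dist[OF l, of i] by simp
        moreover have "\<bar>lam j * y $ i - lam j * x $ i\<bar> \<le> 1"
          using y[of i] lam(1)[of j] by (simp add: abs_mult right_diff_distrib[symmetric])
        ultimately have "of_int (l i) - 4 \<le> y $ i * lam j" "y $ i * lam j < of_int (l i) - 4 + 8"
          by (auto simp: abs_le_iff mult.commute)
        then show ?thesis using lam(1)[of j]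
          by (simp add: pos_divide_le_eq pos_less_divide_eq flip: add_divide_distrib)
      qed
      then show ?thesis unfolding Q_def cube_def ivec_def by simp
    qed
    have QR: "Q j l \<subseteq> R m x" if l: "l \<in> nbhd (lam j *\<^sub>R x)" and j: "m = j \<or> m = Suc j" for j l m x
      unfolding Q_def R_def
    proof (rule cube_subset)
      fix i
      have d: "\<bar>lam j * x $ i - of_int (l i)\<bar> \<le> 2" using nbhd_dist[OF l, of i] by simp
      have e: "6 / lam j \<le> 16 / lam m"
        using j lam(1)[of j] by (auto simp: lam(2) divide_simps)
      have "(lam j * x $ i - 6) / lam j \<le> (of_int (l i) - 4) / lam j"
        using d lam(1)[of j] by (intro divide_right_mono) (auto simp: abs_le_iff)
      then have lo: "x $ i - 6 / lam j \<le> (of_int (l i) - 4) / lam j" using lam(1)[of j] by (simp add: diff_divide_distrib)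
      then show "(x - (\<chi> i. 16 / lam m)) $ i \<le> ((1 / lam j) *\<^sub>R (ivec l - (\<chi> i. 4))) $ i"
        using e by (simp add: ivec_def)
      have "(of_int (l i) - 4 + 8) / lam j \<le> (lam j * x $ i + 6) / lam j"
        using d lam(1)[of j] by (intro divide_right_mono) (auto simp: abs_le_iff)
      then have "(of_int (l i) - 4) / lam j + 8 / lam j \<le> x $ i + 6 / lam j"
        using lam(1)[of j] by (simp add: add_divide_distrib diff_divide_distrib)
      then show "((1 / lam j) *\<^sub>R (ivec l - (\<chi> i. 4))) $ i + 8 / lam j \<le> (x - (\<chi> i. 16 / lam m)) $ i + 32 / lam m"
        using e by (simp add: ivec_def)
    qed
    have cmp: "cmod (Pm j l y - PR m x y) \<le> c4 * A m"
      if l: "l \<in> nbhd (lam j *\<^sub>R x)" and j: "m = j \<or> m = Suc j" and y: "\<And>i. lam j * \<bar>y $ i - x $ i\<bar> \<le> 1" for j l m x y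
      unfolding c4_def
    proof (rule polys_compare[OF Pm(1) PR(1) fm zero_less_one _ A])
      show "y \<in> cube ((1 / lam j) *\<^sub>R (ivec l - (\<chi> i. 4))) (8 / lam j)" using Qmem[OF l y] by (simp add: Q_def)
      show "cube ((1 / lam j) *\<^sub>R (ivec l - (\<chi> i. 4))) (8 / lam j) \<subseteq> cube (x - (\<chi> i. 16 / lam m)) (32 / lam m)"
        using QR[OF l j] by (simp add: Q_def R_def)
      have "M * 2 powr (- (real j * s)) \<le> A m" using j AM[of j] AM'[of j] by auto
      then show "Lint 1 (cube ((1 / lam j) *\<^sub>R (ivec l - (\<chi> i. 4))) (8 / lam j)) (\<lambda>y. f y - Pm j l y)
          \<le> ennreal (A m powr 1 * (8 / lam j) ^ ?n)"
        using M lam(1)[of j] unfolding Q_def[symmetric] by (intro bigger[OF Pm(2)]) auto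
      show "Lint 1 (cube (x - (\<chi> i. 16 / lam m)) (32 / lam m)) (\<lambda>y. f y - PR m x y) \<le> ennreal (A m powr 1 * (32 / lam m) ^ ?n)"
        using PRA by (simp add: R_def)
      show "0 < 8 / lam j" "0 \<le> 32 / lam m" using lam(1)[of j] lam(1)[of m] by auto
      show "32 / lam m \<le> 4 * (8 / lam j)" using j lam(1)[of j] by (auto simp: lam(2) divide_simps)
    qed simp
    define F where "F j y = (\<Sum>l\<in>nbhd (lam j *\<^sub>R y). bump K (lam j *\<^sub>R y - ivec l) * Pm j l y)" for j y
    \<comment> \<open>The bumps sum to 1, so one polynomial can be subtracted inside the sum; what
      remains are differences of polynomials, small by \<open>cmp\<close>.\<close>
    have F_eq: "F j y - PR m x y = (\<Sum>l\<in>nbhd (lam j *\<^sub>R x). bump K (lam j *\<^sub>R y - ivec l) * (Pm j l y - PR m x y))"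
      if y: "\<And>i. lam j * \<bar>y $ i - x $ i\<bar> \<le> 1" for j m x y
    proof -
      have near: "\<bar>(lam j *\<^sub>R y) $ i - (lam j *\<^sub>R x) $ i\<bar> \<le> 1" for i
        using y[of i] lam(1)[of j] by (simp add: abs_mult right_diff_distrib[symmetric])
      have "F j y = (\<Sum>l\<in>nbhd (lam j *\<^sub>R x). bump K (lam j *\<^sub>R y - ivec l) * Pm j l y)"
        unfolding F_def by (rule bump_sum_nbhd[OF near])
      moreover have "(\<Sum>l\<in>nbhd (lam j *\<^sub>R x). bump K (lam j *\<^sub>R y - ivec l)) = 1"
        using bump_sum_nbhd[OF near, of K "\<lambda>_. 1"] bump_partition[of K "lam j *\<^sub>R y"] by simp
      ultimately show ?thesis by (simp add: right_diff_distrib sum_subtractf flip: sum_distrib_right)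
    qed
    \<comment> \<open>The argument is rescaled by \<open>lam m\<close>, so that the unit ball of
      \<open>tay_at\<close> has radius 1 / lam m. Both levels j = m - 1 and j = m are compared with
      the same \<open>PR m x\<close>, which then cancels in their difference.\<close>
    have tayF: "tay_at K (c5 * A m) (lam m *\<^sub>R x) (\<lambda>w. F j ((1 / lam m) *\<^sub>R w) - PR m x ((1 / lam m) *\<^sub>R w))"
      if j: "m = j \<or> m = Suc j" for j m x
    proof -
      let ?h = "lam j / lam m"
      have h: "0 < ?h" "?h \<le> 1" using j lam(1)[of j] by (auto simp: lam(2))
      have near: "lam j * \<bar>((1 / lam m) *\<^sub>R w) $ i - x $ i\<bar> \<le> 1" if w: "norm (w - lam m *\<^sub>R x) \<le> 1" for w i
      proof -
        have "\<bar>w $ i - lam m * x $ i\<bar> \<le> 1" using component_le_norm_cart[of "w - lam m *\<^sub>R x" i] w by simp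
        then have "?h * \<bar>w $ i - lam m * x $ i\<bar> \<le> 1 * 1" using h by (intro mult_mono) auto
        moreover have "?h * \<bar>w $ i - lam m * x $ i\<bar> = lam j * \<bar>w $ i / lam m - x $ i\<bar>"
        proof -
          have "w $ i - lam m * x $ i = lam m * (w $ i / lam m - x $ i)" using lam(1)[of m] by (simp add: right_diff_distrib)
          then show ?thesis using lam(1)[of m] by (simp add: abs_mult)
        qed
        ultimately show ?thesis by simp
      qed
      have "tay_at K (real (card (nbhd (lam j *\<^sub>R x))) * (prod_const K * Mb * (c4 * A m))) (lam m *\<^sub>R x)
        (\<lambda>w. \<Sum>l\<in>nbhd (lam j *\<^sub>R x). bump K (- ivec l + ?h *\<^sub>R w) * (Pm j l (0 + (1 / lam m) *\<^sub>R w) - PR m x (0 + (1 / lam m) *\<^sub>R w)))"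
      proof (intro tay_at_sum tay_at_mult tay_at_affine[OF Mb h] tay_at_poly polys_diff polys_affine Pm(1) PR(1) nbhd(1))
        fix l w assume "l \<in> nbhd (lam j *\<^sub>R x)" "norm (w - lam m *\<^sub>R x) \<le> 1"
        then show "cmod (Pm j l (0 + (1 / lam m) *\<^sub>R w) - PR m x (0 + (1 / lam m) *\<^sub>R w)) \<le> c4 * A m"
          using near by (intro cmp[OF _ j]) auto
      qed
      then have "tay_at K (c5 * A m) (lam m *\<^sub>R x)
        (\<lambda>w. \<Sum>l\<in>nbhd (lam j *\<^sub>R x). bump K (- ivec l + ?h *\<^sub>R w) * (Pm j l (0 + (1 / lam m) *\<^sub>R w) - PR m x (0 + (1 / lam m) *\<^sub>R w)))"
        by (simp add: nbhd(2) c5_def mult.assoc)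
      then show ?thesis
      proof (rule tay_at_cong)
        fix w assume w: "norm (w - lam m *\<^sub>R x) \<le> 1"
        have "lam j *\<^sub>R (1 / lam m) *\<^sub>R w - ivec l = - ivec l + ?h *\<^sub>R w" for l by simp
        then show "F j ((1 / lam m) *\<^sub>R w) - PR m x ((1 / lam m) *\<^sub>R w)
          = (\<Sum>l\<in>nbhd (lam j *\<^sub>R x). bump K (- ivec l + ?h *\<^sub>R w) * (Pm j l (0 + (1 / lam m) *\<^sub>R w) - PR m x (0 + (1 / lam m) *\<^sub>R w)))"
          unfolding F_eq[OF near[OF w]] by simp
      qed
    qed
    define D where "D m = (case m of 0 \<Rightarrow> F 0 | Suc j \<Rightarrow> (\<lambda>y. F (Suc j) y - F j y))" for m
    have tayD: "tay_at K (2 * (c5 * A m)) (lam m *\<^sub>R x) (\<lambda>w. D m ((1 / lam m) *\<^sub>R w))" for m x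
    proof (cases m)
      case 0
      have "tay_at K (c5 * A m) (lam m *\<^sub>R x) (\<lambda>w. D m ((1 / lam m) *\<^sub>R w))"
        using tayF[of 0 0 x] by (simp add: 0 D_def PR(2))
      then show ?thesis by (rule tay_at_mono) (use c5 A[of m] in simp)
    next
      case (Suc j)
      have "tay_at K (c5 * A m + c5 * A m) (lam m *\<^sub>R x) (\<lambda>w. (F m ((1 / lam m) *\<^sub>R w) - PR m x ((1 / lam m) *\<^sub>R w))
          + - (F j ((1 / lam m) *\<^sub>R w) - PR m x ((1 / lam m) *\<^sub>R w)))"
        using Suc by (intro tay_at_add tay_at_minus tayF) auto
      then show ?thesis by (simp add: Suc D_def algebra_simps)
    qed
    have CA: "2 * (2 * (c5 * A m)) \<le> C * M * 2 powr (- (real m * s))" for m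
      using M by (simp add: C_def A_def algebra_simps)
    have CA': "2 * (c5 * A m) \<le> C * M * 2 powr (- (real m * s))" for m
    proof -
      have "0 \<le> c5 * A m" using c5 A[of m] by simp
      with CA[of m] show ?thesis by linarith
    qed
    have cont: "continuous_on UNIV (D m)" for m
      unfolding continuous_on_eq_continuous_at[OF open_UNIV]
    proof
      fix x :: "real ^ 'n"
      have "isCont (\<lambda>w. D m ((1 / lam m) *\<^sub>R w)) (lam m *\<^sub>R x)" by (rule tay_at_isCont[OF tayD])
      moreover have "isCont (\<lambda>y. lam m *\<^sub>R y) x" by (intro continuous_intros)
      ultimately have "isCont (\<lambda>y. D m ((1 / lam m) *\<^sub>R (lam m *\<^sub>R y))) x" by (rule isCont_o2[rotated])
      then show "isCont (D m) x" using lam(1)[of m] by simp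
    qed
    have Dm [measurable]: "D m \<in> borel_measurable lebesgue" for m
      using borel_measurable_continuous_onI[OF cont[of m]] by (intro measurable_completion) simp
    have Dsum: "(\<Sum>m<Suc N. D m y) = F N y" for N y by (induction N) (auto simp: D_def)
    have Fm [measurable]: "F N \<in> borel_measurable lebesgue" for N
    proof -
      have "(\<lambda>y. \<Sum>m<Suc N. D m y) \<in> borel_measurable lebesgue" by (intro borel_measurable_sum Dm)
      then show ?thesis unfolding Dsum .
    qed
    have Dbd: "cmod (D m y) \<le> C * M * 2 powr (- (real m * s))" for m y
    proof -
      have "cmod (D m ((1 / lam m) *\<^sub>R (lam m *\<^sub>R y))) \<le> 2 * (2 * (c5 * A m))"
        by (rule tay_at_bound[OF tayD[of m y]]) simp
      then have "cmod (D m y) \<le> 2 * (2 * (c5 * A m))" using lam(1)[of m] by simp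
      then show ?thesis using CA[of m] by linarith
    qed
    have Dtay: "\<exists>P\<in>polys (int K). \<forall>y r. 0 < r \<longrightarrow> 32 * 2 ^ m * r \<le> 1 \<longrightarrow> norm (y - x) \<le> r \<longrightarrow>
      cmod (D m y - P y) \<le> C * M * 2 powr (- (real m * s)) * (32 * 2 ^ m * r) ^ Suc K" for m x
    proof -
      obtain P where P: "P \<in> polys (int K)" "\<And>w r. 0 < r \<Longrightarrow> r \<le> 1 \<Longrightarrow> norm (w - lam m *\<^sub>R x) \<le> r \<Longrightarrow>
        cmod (D m ((1 / lam m) *\<^sub>R w) - P w) \<le> 2 * (c5 * A m) * r ^ Suc K"
        using tayD[of m x] unfolding tay_at_def by blast
      show ?thesis
      proof (intro bexI[OF _ polys_affine[OF P(1), of 0 "lam m"]] allI impI)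
        fix y r assume r: "0 < r" "32 * 2 ^ m * r \<le> 1" "norm (y - x) \<le> r"
        have lr: "0 < lam m * r" "lam m * r \<le> 1" using r lam(1)[of m] by (auto simp: lam_def)
        have "norm (lam m *\<^sub>R y - lam m *\<^sub>R x) \<le> lam m * r"
          using r(3) lam(1)[of m] by (simp flip: scaleR_diff_right)
        from P(2)[OF lr this] have "cmod (D m y - P (lam m *\<^sub>R y)) \<le> 2 * (c5 * A m) * (lam m * r) ^ Suc K"
          using lam(1)[of m] by simp
        also have "\<dots> \<le> C * M * 2 powr (- (real m * s)) * (lam m * r) ^ Suc K"
          using lr CA'[of m] by (intro mult_right_mono) auto
        finally show "cmod (D m y - P (0 + lam m *\<^sub>R y)) \<le> C * M * 2 powr (- (real m * s)) * (32 * 2 ^ m * r) ^ Suc K"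
          by (simp add: lam_def)
      qed
    qed
    define c6 where "c6 = 2 powr 1 * (32 ^ ?n + 4 ^ ?n * (2 * Mb * c4))"
    have c6: "0 \<le> c6" using Mb0 c4 by (simp add: c6_def)
    have loc: "Lint 1 (cube x (1 / lam m)) (\<lambda>y. f y - F m y) \<le> ennreal (c6 * A m * (1 / lam m) ^ ?n)" for m x
    proof -
      let ?Q = "cube x (1 / lam m)"
      have near: "lam m * \<bar>y $ i - x $ i\<bar> \<le> 1" if "y \<in> ?Q" for y i
      proof -
        have "x $ i \<le> y $ i" "y $ i < x $ i + 1 / lam m" using that by (auto simp: cube_def)
        then have "\<bar>y $ i - x $ i\<bar> \<le> 1 / lam m" by simp
        then show ?thesis using lam(1)[of m] by (simp add: pos_le_divide_eq mult.commute)
      qed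
      have "?Q \<subseteq> R m x" unfolding R_def using lam(1)[of m] by (intro cube_subset) (auto simp: divide_simps)
      then have "Lint 1 ?Q (\<lambda>y. f y - PR m x y) \<le> ennreal (A m powr 1 * (32 / lam m) ^ ?n)"
        using Lint_subset PRA order_trans by blast
      moreover have "Lint 1 ?Q (\<lambda>y. PR m x y - F m y) \<le> ennreal ((4 ^ ?n * (2 * Mb * (c4 * A m))) powr 1 * (1 / lam m) ^ ?n)"
      proof (rule Lint_cube_bound)
        fix y assume y: "y \<in> ?Q"
        have "cmod (PR m x y - F m y) = cmod (F m y - PR m x y)" by (rule norm_minus_commute)
        also have "\<dots> \<le> (\<Sum>l\<in>nbhd (lam m *\<^sub>R x). 2 * Mb * (c4 * A m))"
          unfolding F_eq[OF near[OF y]]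
        proof (rule sum_norm_le)
          fix l assume l: "l \<in> nbhd (lam m *\<^sub>R x)"
          have "cmod (bump K (lam m *\<^sub>R y - ivec l)) \<le> 2 * Mb"
            by (rule tay_at_bound[OF Mb[of "lam m *\<^sub>R y - ivec l"]]) simp
          then show "cmod (bump K (lam m *\<^sub>R y - ivec l) * (Pm m l y - PR m x y)) \<le> 2 * Mb * (c4 * A m)"
            unfolding norm_mult using cmp[OF l _ near[OF y], of m] Mb0 by (intro mult_mono) auto
        qed
        also have "\<dots> = 4 ^ ?n * (2 * Mb * (c4 * A m))" by (simp add: nbhd(2))
        finally show "cmod (PR m x y - F m y) \<le> 4 ^ ?n * (2 * Mb * (c4 * A m))" .
      qed (use lam(1)[of m] in auto)
      ultimately have "Lint 1 ?Q (\<lambda>y. (f y - PR m x y) + (PR m x y - F m y))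
        \<le> ennreal (2 powr 1 * (A m powr 1 * (32 / lam m) ^ ?n + (4 ^ ?n * (2 * Mb * (c4 * A m))) powr 1 * (1 / lam m) ^ ?n))"
        using polys_measurable[OF PR(1)[of m x]] lam(1)[of m] by (intro Lint_add_le) auto
      also have "2 powr 1 * (A m powr 1 * (32 / lam m) ^ ?n + (4 ^ ?n * (2 * Mb * (c4 * A m))) powr 1 * (1 / lam m) ^ ?n)
        = c6 * A m * (1 / lam m) ^ ?n"
        using A[of m] Mb0 c4 by (simp add: c6_def power_divide algebra_simps)
      finally show ?thesis by simp
    qed
    \<comment> \<open>Since 32 = 2^5, the local estimate is on cubes of side 2^(-(m + 5)); m + 5
      subdivisions lead from a unit cube to them.\<close>
    have glob: "Lint 1 (cube x 1) (\<lambda>y. f y - F m y) \<le> ennreal (c6 * A m)" for m x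
    proof (rule Lint_cube_dyadic[where m = "m + 5"])
      have "1 / lam m = 1 / 2 ^ (m + 5)" by (simp add: lam_def power_add)
      then show "Lint 1 (cube x (1 / 2 ^ (m + 5))) (\<lambda>y. f y - F m y) \<le> ennreal (c6 * A m * (1 / 2 ^ (m + 5)) ^ ?n)" for x
        using loc[of x m] by simp
      show "0 \<le> c6 * A m" using c6 A[of m] by simp
    qed measurable
    \<comment> \<open>Here s > 0 enters: the errors of the glued functions are summable over m,
      which gives convergence almost everywhere.\<close>
    have conv: "AE y in lebesgue. y \<in> cube x 1 \<longrightarrow> (\<lambda>N. \<Sum>m<N. D m y) \<longlonglongrightarrow> f y" for x
    proof -
      have q: "2 powr (- s) < (1::real)" using s powr_less_mono[of "- s" 0 2] by simp
      have geo: "c6 * A m = c6 * M * 2 powr s * (2 powr (- s)) ^ m" for m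
        by (simp add: A_def powr_powr mult.commute flip: powr_realpow)
      have "(\<Sum>m. Lint 1 (cube x 1) (\<lambda>y. f y - F m y)) \<le> (\<Sum>m. ennreal (c6 * A m))"
        by (intro suminf_le glob) auto
      also have "\<dots> = ennreal (\<Sum>m. c6 * A m)"
        using q c6 A unfolding geo by (intro suminf_ennreal2 summable_mult summable_geometric) (auto simp: M less_imp_le)
      also have "\<dots> < \<infinity>" by simp
      finally have "AE y in lebesgue. y \<in> cube x 1 \<longrightarrow> (\<lambda>m. f y - F m y) \<longlonglongrightarrow> 0"
        by (intro AE_tendsto_of_Lint[where p = 1]) auto
      then show ?thesis
      proof eventually_elim
        case (elim y)
        show ?case
        proof
          assume "y \<in> cube x 1"
          with elim have "(\<lambda>m. f y - F m y) \<longlonglongrightarrow> 0" by simp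
          then have "(\<lambda>m. f y - (f y - F m y)) \<longlonglongrightarrow> f y - 0" by (intro tendsto_diff tendsto_const)
          then have "(\<lambda>N. \<Sum>m<Suc N. D m y) \<longlonglongrightarrow> f y" unfolding Dsum by simp
          then show "(\<lambda>N. \<Sum>m<N. D m y) \<longlonglongrightarrow> f y" by (rule LIMSEQ_imp_Suc)
        qed
      qed
    qed
    show ?thesis unfolding smooth_pieces_def using Dm Dbd Dtay conv by blast
  qed
  then show ?thesis using C by blast
qed

section \<open>Resummation of the smooth pieces\<close>

lemma Lint_cube_bound_AE:
  fixes x :: "real ^ 'n::finite"
  assumes "AE y in lebesgue. y \<in> cube x l \<longrightarrow> cmod (f y) \<le> A" "0 < p" "0 \<le> l"
  shows "Lint p (cube x l) f \<le> ennreal (A powr p * l ^ CARD('n))"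
proof -
  have "Lint p (cube x l) f \<le> (\<integral>\<^sup>+ y. ennreal (A powr p) * indicator (cube x l) y \<partial>lebesgue)"
    unfolding Lint_def
  proof (rule nn_integral_mono_AE)
    show "AE y in lebesgue. ennreal (cmod (f y) powr p) * indicator (cube x l) y \<le> ennreal (A powr p) * indicator (cube x l) y"
      using assms(1)
    proof eventually_elim
      case (elim y)
      then show ?case using assms(2) by (cases "y \<in> cube x l") (auto intro!: ennreal_leI powr_mono2)
    qed
  qed
  also have "\<dots> = ennreal (A powr p) * emeasure lebesgue (cube x l)" by (intro nn_integral_cmult_indicator) simp
  also have "\<dots> = ennreal (A powr p * l ^ CARD('n))"
    unfolding emeasure_cube[OF assms(3)] using assms(3) by (simp add: ennreal_mult)
  finally show ?thesis .
qed

text \<open>The ratio 2^(-(K + 1 - t)) belongs to the levels handled by Taylor polynomials and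
  2^(-t) to those estimated by size; the last summand is the bound on unit cubes.\<close>

definition series_const :: "nat \<Rightarrow> real \<Rightarrow> 'n itself \<Rightarrow> real"
  where "series_const K t _ = (32 * real CARD('n)) powr t * (1 / (1 - 2 powr (- (real K + 1 - t))) + 1 / (1 - 2 powr (- t)))
    + 1 / (1 - 2 powr (- t))"

lemma series_const_pos: "0 < t \<Longrightarrow> t < real K + 1 \<Longrightarrow> 0 < series_const K t TYPE('n::finite)"
  using powr_less_mono[of "- t" 0 2] powr_less_mono[of "- (real K + 1 - t)" 0 2]
  by (auto simp: series_const_def intro!: add_nonneg_pos mult_nonneg_nonneg add_nonneg_nonneg)

text \<open>On a cube of side \<open>l\<close> the pieces of frequency below \<open>1/l\<close> are replaced by their Taylor
  polynomials and the others are estimated by their size; both errors are geometric sums.\<close>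

lemma camp_smooth_series:
  fixes f b :: "real ^ 'n::finite \<Rightarrow> complex"
  assumes D: "smooth_pieces K A s f D" and A: "0 < A" and t: "0 < t" "t < real K + 1"
    and c: "\<And>m. cmod (c m) \<le> E * 2 powr (real m * (s - t))" and E: "0 < E"
    and b: "b \<in> borel_measurable lebesgue"
    and lim: "\<And>x. AE y in lebesgue. y \<in> cube x 1 \<longrightarrow> (\<lambda>N. \<Sum>m<N. c m * D m y) \<longlonglongrightarrow> b y"
  shows "camp 1 t (int K) (series_const K t TYPE('n) * (A * E)) b"
proof -
  let ?n = "CARD('n)"
  define q1 where "q1 = 2 powr (- (real K + 1 - t))"
  define q2 where "q2 = 2 powr (- t)"
  have q: "0 < q1" "q1 < 1" "0 < q2" "q2 < 1"
    using t powr_less_mono[of "- t" 0 2] powr_less_mono[of "- (real K + 1 - t)" 0 2] by (auto simp: q1_def q2_def)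
  define G where "G = (32 * real ?n) powr t * (1 / (1 - q1) + 1 / (1 - q2))"
  have G: "0 \<le> G" using q by (simp add: G_def)
  have S: "series_const K t TYPE('n) = G + 1 / (1 - q2)" by (simp add: series_const_def G_def q1_def q2_def)
  have Dbd: "cmod (D m y) \<le> A * 2 powr (- (real m * s))" for m y using D unfolding smooth_pieces_def by blast
  have term_bd: "cmod (c m * D m y) \<le> E * A * 2 powr (- (real m * t))" for m y
  proof -
    have "cmod (c m * D m y) \<le> (E * 2 powr (real m * (s - t))) * (A * 2 powr (- (real m * s)))"
      unfolding norm_mult using c[of m] Dbd[of m y] E by (intro mult_mono) auto
    also have "\<dots> = E * A * (2 powr (real m * (s - t)) * 2 powr (- (real m * s)))" by simp
    also have "2 powr (real m * (s - t)) * 2 powr (- (real m * s)) = 2 powr (- (real m * t))"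
      by (simp add: algebra_simps flip: powr_add)
    finally show ?thesis .
  qed
  have q2m: "2 powr (- (real m * t)) = q2 ^ m" for m
    by (simp add: q2_def powr_powr mult.commute flip: powr_realpow)
  \<comment> \<open>A bound for the partial sums from some index on passes to the almost everywhere
    limit.\<close>
  have bound_lim: "AE y in lebesgue. y \<in> cube x l \<longrightarrow> cmod (b y - T y) \<le> B"
    if l: "l \<le> 1" and B: "\<And>N y. y \<in> cube x l \<Longrightarrow> N0 \<le> N \<Longrightarrow> cmod ((\<Sum>m<N. c m * D m y) - T y) \<le> B" for x l T B N0
    using lim[of x]
  proof eventually_elim
    case (elim y)
    show ?case
    proof
      assume y: "y \<in> cube x l"
      then have "y \<in> cube x 1" using l cube_subset[of x x l 1] by auto
      with elim have "(\<lambda>N. cmod ((\<Sum>m<N. c m * D m y) - T y)) \<longlonglongrightarrow> cmod (b y - T y)"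
        by (intro tendsto_intros) auto
      then show "cmod (b y - T y) \<le> B"
        by (rule tendsto_upperbound) (use B[OF y] in \<open>auto simp: eventually_sequentially\<close>)
    qed
  qed
  show ?thesis unfolding camp_def
  proof (intro conjI allI impI b)
    fix x :: "real ^ 'n"
    have "AE y in lebesgue. y \<in> cube x 1 \<longrightarrow> cmod (b y - 0) \<le> E * A * (1 / (1 - q2))"
    proof (rule bound_lim[where T = "\<lambda>_. 0"])
      fix N y
      have "cmod ((\<Sum>m<N. c m * D m y) - 0) \<le> (\<Sum>m<N. E * A * q2 ^ m)"
        using term_bd by (simp add: q2m) (intro sum_norm_le, simp add: q2m)
      also have "\<dots> = E * A * (\<Sum>m<N. q2 ^ m)" by (simp add: sum_distrib_left)
      also have "\<dots> \<le> E * A * (1 / (1 - q2))"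
        using E A q geometric_sum_le[of q2 "{..<N}" "\<lambda>m. m"] by (intro mult_left_mono) auto
      finally show "cmod ((\<Sum>m<N. c m * D m y) - 0) \<le> E * A * (1 / (1 - q2))" .
    qed simp
    then have "Lint 1 (cube x 1) b \<le> ennreal ((E * A * (1 / (1 - q2))) powr 1 * 1 ^ ?n)"
      by (intro Lint_cube_bound_AE) auto
    also have "\<dots> \<le> ennreal ((series_const K t TYPE('n) * (A * E)) powr 1)"
    proof (rule ennreal_leI)
      have "E * A * (1 / (1 - q2)) \<le> series_const K t TYPE('n) * (A * E)"
        unfolding S using G A E by (simp add: algebra_simps)
      moreover have "0 \<le> E * A * (1 / (1 - q2))" using E A q by simp
      ultimately show "(E * A * (1 / (1 - q2))) powr 1 * 1 ^ ?n \<le> (series_const K t TYPE('n) * (A * E)) powr 1" 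
        unfolding power_one mult_1_right by (intro powr_mono2) auto
    qed
    finally show "Lint 1 (cube x 1) b \<le> ennreal ((series_const K t TYPE('n) * (A * E)) powr 1)" .
  next
    fix x :: "real ^ 'n" and l :: real assume l: "0 < l" "l \<le> 1"
    define r where "r = real ?n * l"
    have r: "0 < r" using l by (simp add: r_def)
    \<comment> \<open>The radius r, which covers the cube, measured in units of the grid spacing of
      level m; it doubles with each level.\<close>
    define L where "L m = 32 * 2 ^ m * r" for m :: nat
    have L: "0 < L m" "L (m + j) = 2 ^ j * L m" for m j using r by (auto simp: L_def power_add)
    have Lp: "E * A * 2 powr (- (real m * t)) = E * A * (32 * r) powr t * L m powr (- t)" for m
    proof -
      have "(32 * r) powr t * L m powr (- t) = (32 * r) powr t * (2 ^ m) powr (- t) * (32 * r) powr (- t)"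
        using r by (simp add: L_def powr_mult mult_ac)
      also have "\<dots> = (2 ^ m) powr (- t) * ((32 * r) powr t * (32 * r) powr (- t))" by simp
      also have "(32 * r) powr t * (32 * r) powr (- t) = 1" using r by (simp flip: powr_add)
      also have "(2 ^ m) powr (- t) = 2 powr (- (real m * t))" by (simp add: powr_powr flip: powr_realpow)
      finally show ?thesis by (simp add: mult.assoc)
    qed
    obtain j0 where "1 / (32 * r) < 2 ^ j0" using real_arch_pow[of 2 "1 / (32 * r)"] by auto
    then have "1 < L j0" using r by (simp add: L_def pos_divide_less_eq mult_ac)
    \<comment> \<open>The first level whose Taylor estimate no longer reaches radius r. Below it L m
      <= 1; from it on L m grows at least like 2^(m - m0).\<close>
    define m0 where "m0 = (LEAST m. 1 < L m)"
    have m0: "1 < L m0" unfolding m0_def by (rule LeastI[of _ j0]) fact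
    have m0': "L m \<le> 1" if "m < m0" for m using not_less_Least[of m "\<lambda>m. 1 < L m"] that by (simp add: m0_def)
    have "\<forall>m. \<exists>P. P \<in> polys (int K) \<and> (\<forall>y r. 0 < r \<longrightarrow> 32 * 2 ^ m * r \<le> 1 \<longrightarrow> norm (y - x) \<le> r \<longrightarrow>
      cmod (D m y - P y) \<le> A * 2 powr (- (real m * s)) * (32 * 2 ^ m * r) ^ Suc K)"
      using D unfolding smooth_pieces_def by blast
    then obtain P where P: "\<And>m. P m \<in> polys (int K)" "\<And>m y r. 0 < r \<Longrightarrow> 32 * 2 ^ m * r \<le> 1 \<Longrightarrow> norm (y - x) \<le> r \<Longrightarrow>
      cmod (D m y - P m y) \<le> A * 2 powr (- (real m * s)) * (32 * 2 ^ m * r) ^ Suc K" by metis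
    define T where "T y = (\<Sum>m<m0. c m * P m y)" for y
    have T: "T \<in> polys (int K)" unfolding T_def by (intro polys_sum polys_scale P)
    let ?X = "E * A * (32 * r) powr t"
    have X: "0 \<le> ?X" using E A by simp
    have low: "cmod (c m * (D m y - P m y)) \<le> ?X * q1 ^ (m0 - 1 - m)" if y: "y \<in> cube x l" and m: "m < m0" for y m
    proof -
      have "norm (y - x) \<le> r"
        using y cube_subset_ball[of x l] by (auto simp: r_def dist_norm norm_minus_commute)
      then have "cmod (D m y - P m y) \<le> A * 2 powr (- (real m * s)) * L m ^ Suc K"
        using P(2)[OF r, of m y] m0'[OF m] by (simp add: L_def)
      then have "cmod (c m * (D m y - P m y)) \<le> (E * 2 powr (real m * (s - t))) * (A * 2 powr (- (real m * s)) * L m ^ Suc K)"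
        unfolding norm_mult using c[of m] E by (intro mult_mono) auto
      also have "\<dots> = E * A * (2 powr (real m * (s - t)) * 2 powr (- (real m * s))) * L m ^ Suc K" by simp
      also have "2 powr (real m * (s - t)) * 2 powr (- (real m * s)) = 2 powr (- (real m * t))"
        by (simp add: algebra_simps flip: powr_add)
      also have "E * A * 2 powr (- (real m * t)) * L m ^ Suc K = ?X * (L m powr (- t) * L m powr (real (Suc K)))"
        unfolding Lp using L(1)[of m] by (simp only: powr_realpow mult.assoc)
      also have "L m powr (- t) * L m powr (real (Suc K)) = L m powr (real K + 1 - t)"
        by (simp add: add.commute flip: powr_add)
      also have "\<dots> \<le> q1 ^ (m0 - 1 - m)"
      proof -
        let ?j = "m0 - 1 - m"
        have "2 ^ ?j * L m \<le> 1" using m0'[of "m + ?j"] m by (simp add: L(2)[symmetric])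
        then have "L m \<le> 2 powr (- real ?j)" by (simp add: powr_minus_divide powr_realpow pos_le_divide_eq mult.commute)
        then have "L m powr (real K + 1 - t) \<le> (2 powr (- real ?j)) powr (real K + 1 - t)"
          using t L(1)[of m] by (intro powr_mono2) auto
        also have "\<dots> = q1 ^ ?j" by (simp add: q1_def powr_powr algebra_simps flip: powr_realpow)
        finally show ?thesis .
      qed
      finally show ?thesis using X by (simp add: mult_left_mono)
    qed
    have high: "cmod (c m * D m y) \<le> ?X * q2 ^ (m - m0)" if m: "m0 \<le> m" for m y
    proof -
      have "2 ^ (m - m0) * 1 \<le> L m" using L(2)[of m0 "m - m0"] m m0 mult_left_mono[of 1 "L m0" "2 ^ (m - m0)"] by simp
      then have "L m powr (- t) \<le> (2 ^ (m - m0)) powr (- t)" using t by (intro powr_mono2') auto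
      also have "\<dots> = q2 ^ (m - m0)" by (simp add: q2_def powr_powr mult.commute flip: powr_realpow)
      finally have "?X * L m powr (- t) \<le> ?X * q2 ^ (m - m0)" using X by (rule mult_left_mono)
      then show ?thesis using term_bd[of m y] unfolding Lp by linarith
    qed
    have "AE y in lebesgue. y \<in> cube x l \<longrightarrow> cmod (b y - T y) \<le> ?X * (1 / (1 - q1) + 1 / (1 - q2))"
    proof (rule bound_lim[OF l(2), where ?N0.0 = m0])
      fix N y assume y: "y \<in> cube x l" and N: "m0 \<le> N"
      have "(\<Sum>m<N. c m * D m y) = (\<Sum>m<m0. c m * D m y) + (\<Sum>m\<in>{m0..<N}. c m * D m y)"
        using N by (metis atLeast0LessThan le0 sum.atLeastLessThan_concat)
      then have "(\<Sum>m<N. c m * D m y) - T y = (\<Sum>m<m0. c m * (D m y - P m y)) + (\<Sum>m\<in>{m0..<N}. c m * D m y)"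
        by (simp add: T_def right_diff_distrib sum_subtractf)
      then have "cmod ((\<Sum>m<N. c m * D m y) - T y) \<le> cmod (\<Sum>m<m0. c m * (D m y - P m y)) + cmod (\<Sum>m\<in>{m0..<N}. c m * D m y)"
        by (simp add: norm_triangle_ineq)
      also have "\<dots> \<le> (\<Sum>m<m0. ?X * q1 ^ (m0 - 1 - m)) + (\<Sum>m\<in>{m0..<N}. ?X * q2 ^ (m - m0))"
        using low[OF y] high by (intro add_mono sum_norm_le) auto
      also have "\<dots> = ?X * (\<Sum>m<m0. q1 ^ (m0 - 1 - m)) + ?X * (\<Sum>m\<in>{m0..<N}. q2 ^ (m - m0))"
        by (simp add: sum_distrib_left)
      also have "\<dots> \<le> ?X * (1 / (1 - q1)) + ?X * (1 / (1 - q2))"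
        using q X by (intro add_mono mult_left_mono geometric_sum_le) (auto simp: inj_on_def)
      finally show "cmod ((\<Sum>m<N. c m * D m y) - T y) \<le> ?X * (1 / (1 - q1) + 1 / (1 - q2))"
        by (simp add: distrib_left)
    qed
    then have "Lint 1 (cube x l) (\<lambda>y. b y - T y) \<le> ennreal ((?X * (1 / (1 - q1) + 1 / (1 - q2))) powr 1 * l ^ ?n)"
      using l by (intro Lint_cube_bound_AE) auto
    also have "\<dots> \<le> ennreal ((series_const K t TYPE('n) * (A * E) * l powr t) powr 1 * l ^ ?n)"
    proof (rule ennreal_leI, rule mult_right_mono)
      have "?X * (1 / (1 - q1) + 1 / (1 - q2)) = G * (A * E) * l powr t"
        using l by (simp add: G_def r_def powr_mult mult_ac)
      also have "\<dots> \<le> series_const K t TYPE('n) * (A * E) * l powr t"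
        unfolding S using A E q by (intro mult_right_mono) auto
      finally have "?X * (1 / (1 - q1) + 1 / (1 - q2)) \<le> series_const K t TYPE('n) * (A * E) * l powr t" .
      moreover have "0 \<le> ?X * (1 / (1 - q1) + 1 / (1 - q2))" using X q by simp
      ultimately show "(?X * (1 / (1 - q1) + 1 / (1 - q2))) powr 1 \<le> (series_const K t TYPE('n) * (A * E) * l powr t) powr 1" by simp
      show "0 \<le> l ^ ?n" using l by simp
    qed
    finally show "\<exists>P\<in>polys (int K). Lint 1 (cube x l) (\<lambda>y. b y - P y)
        \<le> ennreal ((series_const K t TYPE('n) * (A * E) * l powr t) powr 1 * l ^ ?n)"
      using T by blast
  qed
qed

lemma inball_mono: "inball X M f \<Longrightarrow> M \<le> M' \<Longrightarrow> inball X M' f"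
  unfolding inball_def using ennreal_leI order_trans by blast

text \<open>At smoothness t the m-th piece has size 2^(m (t - s)). As s - s0 = \<Theta> d and s - s1
  = - (1 - \<Theta>) d with d = s1 - s0, the weights of an index i near - m d cancel this growth in
  both end spaces simultaneously, and \<open>camp_smooth_series\<close> sums the pieces with
  arbitrary bounded multipliers.\<close>

lemma pm_superset_smooth:
  fixes X0 X1 :: "(real ^ 'n::finite) quasi_space"
  assumes T: "0 < \<Theta>" "\<Theta> < 1" and s: "0 < s0" "0 < s1" "s0 \<noteq> s1" "s = (1 - \<Theta>) * s0 + \<Theta> * s1"
    and K: "1 \<le> K" "s0 < real K + 1" "s1 < real K + 1"
    and X0: "dominated (camp 1 s0 (int K)) (inball X0)" and X1: "dominated (camp 1 s1 (int K)) (inball X1)"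
  shows "dominated (camp 1 s (int K)) (in_pm X0 X1 \<Theta>)"
proof -
  obtain C0 where C0: "0 < C0" "\<And>M f. 0 < M \<Longrightarrow> camp 1 s0 (int K) M f \<Longrightarrow> inball X0 (C0 * M) f"
    using X0 unfolding dominated_def by blast
  obtain C1 where C1: "0 < C1" "\<And>M f. 0 < M \<Longrightarrow> camp 1 s1 (int K) M f \<Longrightarrow> inball X1 (C1 * M) f"
    using X1 unfolding dominated_def by blast
  have "0 < s" using s T by (simp add: add_pos_pos)
  then obtain Cd where Cd: "0 < Cd" "\<And>M f. 0 < M \<Longrightarrow> camp 1 s (int K) M (f :: real ^ 'n \<Rightarrow> complex) \<Longrightarrow> \<exists>D. smooth_pieces K (Cd * M) s f D"
    using smooth_decomposition[OF _ K(1)] by metis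
  define S0 where "S0 = series_const K s0 TYPE('n)"
  define S1 where "S1 = series_const K s1 TYPE('n)"
  have S: "0 < S0" "0 < S1" using s K by (auto simp: S0_def S1_def series_const_pos)
  define d where "d = s1 - s0"
  have d: "d \<noteq> 0" using s by (simp add: d_def)
  have sd: "s - s0 = \<Theta> * d" "s - s1 = - ((1 - \<Theta>) * d)" by (auto simp: s(4) d_def algebra_simps)
  define C where "C = (C0 * S0 + C1 * S1) * (2 * Cd)"
  have C: "0 < C" using C0 C1 S Cd by (simp add: C_def add_pos_pos)
  have "in_pm X0 X1 \<Theta> (C * M) f" if M: "0 < M" and f: "camp 1 s (int K) M f" for M f
  proof -
    define A where "A = Cd * M"
    have A: "0 < A" using Cd M by (simp add: A_def)
    obtain D where D: "smooth_pieces K A s f D" using Cd(2)[OF M f] unfolding A_def by blast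
    have Dm [measurable]: "D m \<in> borel_measurable lebesgue" for m using D unfolding smooth_pieces_def by blast
    have fm [measurable]: "f \<in> borel_measurable lebesgue" using f by (rule campD)
    define ix where "ix m = \<lfloor>- (real m * d)\<rfloor>" for m
    have ix: "of_int (ix m) \<le> - (real m * d)" "- (real m * d) < of_int (ix m) + 1" for m unfolding ix_def by linarith+
    \<comment> \<open>This is where d must be nonzero: each index collects only finitely many
      levels.\<close>
    have fin1: "finite {m. ix m = i}" for i
    proof (rule finite_subset)
      show "{m. ix m = i} \<subseteq> {..nat \<lceil>(\<bar>of_int i\<bar> + 1) / \<bar>d\<bar>\<rceil>}"
      proof
        fix m assume "m \<in> {m. ix m = i}"
        then have "\<bar>real m * d\<bar> \<le> \<bar>of_int i\<bar> + 1" using ix[of m] by auto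
        then have "real m \<le> (\<bar>of_int i\<bar> + 1) / \<bar>d\<bar>" using d by (simp add: abs_mult pos_le_divide_eq)
        then show "m \<in> {..nat \<lceil>(\<bar>of_int i\<bar> + 1) / \<bar>d\<bar>\<rceil>}" by simp linarith
      qed
    qed simp
    have fin: "finite {m. ix m \<in> F}" if "finite F" for F
    proof -
      have "{m. ix m \<in> F} = (\<Union>i\<in>F. {m. ix m = i})" by auto
      then show ?thesis using that fin1 by simp
    qed
    define u where "u i y = (\<Sum>m | ix m = i. D m y)" for i :: int and y
    have um [measurable]: "u i \<in> borel_measurable lebesgue" for i unfolding u_def by measurable
    have sum_u: "(\<Sum>i\<in>F. a i * u i y) = (\<Sum>m | ix m \<in> F. a (ix m) * D m y)" if F: "finite F" for F a y
    proof -
      have "(\<Sum>i\<in>F. a i * u i y) = (\<Sum>i\<in>F. \<Sum>m\<in>{m \<in> {m. ix m \<in> F}. ix m = i}. a (ix m) * D m y)"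
        unfolding u_def sum_distrib_left by (intro sum.cong) auto
      also have "\<dots> = (\<Sum>m | ix m \<in> F. a (ix m) * D m y)"
        using F by (intro sum.group fin) auto
      finally show ?thesis .
    qed
    have series: "camp 1 t (int K) (series_const K t TYPE('n) * (A * E)) (\<lambda>y. \<Sum>m\<in>G. c m * D m y)"
      if "0 < t" "t < real K + 1" "finite G" "0 < E" "\<And>m. m \<in> G \<Longrightarrow> cmod (c m) \<le> E * 2 powr (real m * (s - t))" for t E G c
    proof (rule camp_smooth_series[OF D A that(1,2), where c = "\<lambda>m. if m \<in> G then c m else 0"])
      show "(\<lambda>y. \<Sum>m\<in>G. c m * D m y) \<in> borel_measurable lebesgue" by measurable
      show "AE y in lebesgue. y \<in> cube x 1 \<longrightarrow> (\<lambda>N. \<Sum>m<N. (if m \<in> G then c m else 0) * D m y) \<longlonglongrightarrow> (\<Sum>m\<in>G. c m * D m y)" for x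
      proof (intro AE_I2 impI)
        fix y
        have "(\<lambda>m. (if m \<in> G then c m else 0) * D m y) sums (\<Sum>m\<in>G. (if m \<in> G then c m else 0) * D m y)"
          using that(3) by (intro sums_finite) auto
        then show "(\<lambda>N. \<Sum>m<N. (if m \<in> G then c m else 0) * D m y) \<longlonglongrightarrow> (\<Sum>m\<in>G. c m * D m y)"
          by (simp add: sums_def cong: sum.cong)
      qed
    qed (use that in auto)
    \<comment> \<open>Only membership in the two carriers is wanted here, so the constant may depend
      on the index.\<close>
    have u_camp: "\<exists>B>0. camp 1 t (int K) B (u i)" if t: "0 < t" "t < real K + 1" for t i
    proof -
      define E where "E = (\<Sum>m | ix m = i. 2 powr - (real m * (s - t))) + 1"
      have E: "0 < E" by (simp add: E_def add_nonneg_pos sum_nonneg)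
      have "camp 1 t (int K) (series_const K t TYPE('n) * (A * E)) (\<lambda>y. \<Sum>m | ix m = i. 1 * D m y)"
      proof (rule series[OF t fin1 E])
        fix m assume m: "m \<in> {m. ix m = i}"
        have "2 powr - (real m * (s - t)) \<le> E"
          unfolding E_def using member_le_sum[OF m, of "\<lambda>m. 2 powr - (real m * (s - t))"] fin1 by simp
        then have "2 powr - (real m * (s - t)) * 2 powr (real m * (s - t)) \<le> E * 2 powr (real m * (s - t))"
          by (intro mult_right_mono) auto
        then show "cmod 1 \<le> E * 2 powr (real m * (s - t))" by (simp flip: powr_add)
      qed
      then show ?thesis using series_const_pos[OF t, where 'n = 'n] A E
        by (intro exI[of _ "series_const K t TYPE('n) * (A * E)"]) (simp add: u_def[abs_def])
    qed
    have u0: "u i \<in> carrier X0" for i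
      using u_camp[OF s(1) K(2), of i] C0(2) unfolding inball_def by blast
    have u1: "u i \<in> carrier X1" for i
      using u_camp[OF s(2) K(3), of i] C1(2) unfolding inball_def by blast
    have b0: "pm_bound X0 (0 - \<Theta>) u (C0 * (S0 * (A * 2)))"
    proof (rule pm_boundI[where P = "camp 1 s0 (int K)", OF C0(2) C0(1)])
      fix F :: "int set" and \<epsilon> :: "int \<Rightarrow> complex" and E :: real assume F: "finite F" "0 < E" "\<And>i. cmod (\<epsilon> i) \<le> E"
      have "camp 1 s0 (int K) (S0 * (A * (2 * E))) (\<lambda>y. \<Sum>m | ix m \<in> F. (\<epsilon> (ix m) * of_real (2 powr (of_int (ix m) * (0 - \<Theta>)))) * D m y)"
        unfolding S0_def
      proof (rule series[OF s(1) K(2) fin[OF F(1)]])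
        fix m
        have "of_int (ix m) * (0 - \<Theta>) \<le> (- (real m * d) - 1) * (0 - \<Theta>)"
          using ix[of m] T by (intro mult_right_mono_neg) auto
        also have "\<dots> \<le> 1 + real m * (s - s0)" using T by (simp add: sd algebra_simps)
        finally have "2 powr (of_int (ix m) * (0 - \<Theta>)) \<le> 2 powr (1 + real m * (s - s0))" by (intro powr_mono) auto
        then have "cmod (\<epsilon> (ix m)) * 2 powr (of_int (ix m) * (0 - \<Theta>)) \<le> E * (2 * 2 powr (real m * (s - s0)))"
          unfolding powr_add using F by (intro mult_mono) auto
        then show "cmod (\<epsilon> (ix m) * of_real (2 powr (of_int (ix m) * (0 - \<Theta>)))) \<le> 2 * E * 2 powr (real m * (s - s0))"
          by (simp add: norm_mult mult_ac)
      qed (use F in simp)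
      then show "camp 1 s0 (int K) (S0 * (A * 2) * E) (\<lambda>y. \<Sum>i\<in>F. \<epsilon> i * of_real (2 powr (of_int i * (0 - \<Theta>))) * u i y)"
        unfolding sum_u[OF F(1)] by (simp only: mult.assoc)
    qed (use S A in auto)
    have b1: "pm_bound X1 (1 - \<Theta>) u (C1 * (S1 * (A * 2)))"
    proof (rule pm_boundI[where P = "camp 1 s1 (int K)", OF C1(2) C1(1)])
      fix F :: "int set" and \<epsilon> :: "int \<Rightarrow> complex" and E :: real assume F: "finite F" "0 < E" "\<And>i. cmod (\<epsilon> i) \<le> E"
      have "camp 1 s1 (int K) (S1 * (A * (2 * E))) (\<lambda>y. \<Sum>m | ix m \<in> F. (\<epsilon> (ix m) * of_real (2 powr (of_int (ix m) * (1 - \<Theta>)))) * D m y)"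
        unfolding S1_def
      proof (rule series[OF s(2) K(3) fin[OF F(1)]])
        fix m
        have "of_int (ix m) * (1 - \<Theta>) \<le> (- (real m * d)) * (1 - \<Theta>)"
          using ix[of m] T by (intro mult_right_mono) auto
        also have "\<dots> \<le> 1 + real m * (s - s1)" using T by (simp add: sd algebra_simps)
        finally have "2 powr (of_int (ix m) * (1 - \<Theta>)) \<le> 2 powr (1 + real m * (s - s1))" by (intro powr_mono) auto
        then have "cmod (\<epsilon> (ix m)) * 2 powr (of_int (ix m) * (1 - \<Theta>)) \<le> E * (2 * 2 powr (real m * (s - s1)))"
          unfolding powr_add using F by (intro mult_mono) auto
        then show "cmod (\<epsilon> (ix m) * of_real (2 powr (of_int (ix m) * (1 - \<Theta>)))) \<le> 2 * E * 2 powr (real m * (s - s1))"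
          by (simp add: norm_mult mult_ac)
      qed (use F in simp)
      then show "camp 1 s1 (int K) (S1 * (A * 2) * E) (\<lambda>y. \<Sum>i\<in>F. \<epsilon> i * of_real (2 powr (of_int i * (1 - \<Theta>))) * u i y)"
        unfolding sum_u[OF F(1)] by (simp only: mult.assoc)
    qed (use S A in auto)
    \<comment> \<open>Removing the levels with indices in F leaves only levels with m |d| >= N.
      Measured at a smoothness below s, these gain the factor 2^(- N \<kappa>).\<close>
    have tail: "camp 1 t (int K) (series_const K t TYPE('n) * (A * 2 powr (- (real N * \<kappa>)))) (\<lambda>y. f y - (\<Sum>i\<in>F. u i y))"
      if t: "0 < t" "t < real K + 1" and \<kappa>: "0 < \<kappa>" "s - t = \<kappa> * \<bar>d\<bar>" and F: "finite F"
        and N: "\<And>m. ix m \<notin> F \<Longrightarrow> real N \<le> real m * \<bar>d\<bar>" for t \<kappa> F and N :: nat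
    proof (rule camp_smooth_series[OF D A t, where c = "\<lambda>m. if ix m \<notin> F then 1 else 0"])
      show "cmod (if ix m \<notin> F then 1 else 0) \<le> 2 powr (- (real N * \<kappa>)) * 2 powr (real m * (s - t))" for m
      proof (cases "ix m \<in> F")
        case False
        then have "real N * \<kappa> \<le> real m * \<bar>d\<bar> * \<kappa>" using N \<kappa> by (intro mult_right_mono) auto
        then have "0 \<le> - (real N * \<kappa>) + real m * (s - t)" by (simp add: \<kappa> mult_ac)
        then have "2 powr 0 \<le> 2 powr (- (real N * \<kappa>)) * 2 powr (real m * (s - t))"
          unfolding powr_add[symmetric] by (intro powr_mono) auto
        then show ?thesis using False by simp
      qed simp
      show "(\<lambda>y. f y - (\<Sum>i\<in>F. u i y)) \<in> borel_measurable lebesgue" by measurable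
      fix x
      have "AE y in lebesgue. y \<in> cube x 1 \<longrightarrow> (\<lambda>N. \<Sum>m<N. D m y) \<longlonglongrightarrow> f y"
        using D unfolding smooth_pieces_def by blast
      then show "AE y in lebesgue. y \<in> cube x 1 \<longrightarrow> (\<lambda>N. \<Sum>m<N. (if ix m \<notin> F then 1 else 0) * D m y) \<longlonglongrightarrow> f y - (\<Sum>i\<in>F. u i y)"
      proof eventually_elim
        case (elim y)
        show ?case
        proof
          assume "y \<in> cube x 1"
          have "(\<Sum>m | ix m \<in> F. if ix m \<in> F then D m y else 0) = (\<Sum>m | ix m \<in> F. 1 * D m y)"
            by (intro sum.cong) auto
          then have eq: "(\<Sum>m | ix m \<in> F. if ix m \<in> F then D m y else 0) = (\<Sum>i\<in>F. u i y)"
            using sum_u[OF F, of "\<lambda>_. 1" y] by simp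
          have "(\<lambda>m. if ix m \<in> F then D m y else 0) sums (\<Sum>m | ix m \<in> F. if ix m \<in> F then D m y else 0)"
            using fin[OF F] by (intro sums_finite) auto
          then have "(\<lambda>N. \<Sum>m<N. if ix m \<in> F then D m y else 0) \<longlonglongrightarrow> (\<Sum>i\<in>F. u i y)"
            unfolding sums_def eq .
          then have "(\<lambda>N. (\<Sum>m<N. D m y) - (\<Sum>m<N. if ix m \<in> F then D m y else 0)) \<longlonglongrightarrow> f y - (\<Sum>i\<in>F. u i y)"
            using elim \<open>y \<in> cube x 1\<close> by (intro tendsto_diff) auto
          moreover have "(\<Sum>m<N. D m y) - (\<Sum>m<N. if ix m \<in> F then D m y else 0) = (\<Sum>m<N. (if ix m \<notin> F then 1 else 0) * D m y)" for N
            unfolding sum_subtractf[symmetric] by (intro sum.cong) auto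
          ultimately show "(\<lambda>N. \<Sum>m<N. (if ix m \<notin> F then 1 else 0) * D m y) \<longlonglongrightarrow> f y - (\<Sum>i\<in>F. u i y)" by simp
        qed
      qed
    qed simp
    have far: "real N \<le> real m * \<bar>d\<bar>" if "{- int N..int N} \<subseteq> F" "ix m \<notin> F" for F N m
    proof -
      have "ix m \<notin> {- int N..int N}" using that by blast
      then have "ix m \<le> - int N - 1 \<or> int N + 1 \<le> ix m" by auto
      then have "real_of_int (ix m) \<le> - real N - 1 \<or> real N + 1 \<le> real_of_int (ix m)"
        by linarith
      then have "real N \<le> \<bar>real m * d\<bar>" using ix[of m] by linarith
      then show ?thesis by (simp add: abs_mult)
    qed
    have zero: "inball X0 (C0 * B) (\<lambda>_. 0)" "inball X1 (C1 * B) (\<lambda>_. 0)" if "0 < B" for B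
    proof -
      have "camp 1 t (int K) B (\<lambda>_ :: real ^ 'n. 0)" if t: "0 < t" "t < real K + 1" for t
      proof -
        have "0 < series_const K t TYPE('n)" using t by (rule series_const_pos)
        then show ?thesis using series[OF t, of "{}" "B / (series_const K t TYPE('n) * A)" "\<lambda>_. 0"] A \<open>0 < B\<close> by simp
      qed
      then show "inball X0 (C0 * B) (\<lambda>_. 0)" "inball X1 (C1 * B) (\<lambda>_. 0)"
        using C0(2) C1(2) s(1,2) K(2,3) \<open>0 < B\<close> by auto
    qed
    \<comment> \<open>The remainder is placed entirely in the end space of lower smoothness,
      \<open>X0\<close> if d > 0 and \<open>X1\<close> otherwise; \<kappa> |d| is the gap between s
      and that smoothness.\<close>
    define \<kappa> where "\<kappa> = (if 0 < d then \<Theta> else 1 - \<Theta>)"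
    have \<kappa>: "0 < \<kappa>" using T by (simp add: \<kappa>_def)
    define H where "H = (C0 * S0 + C1 * S1) * A"
    have H: "0 < H" using C0 C1 S A by (simp add: H_def add_pos_pos)
    have split: "\<exists>b c. inball X0 (H * 2 powr (- (real N * \<kappa>))) b \<and> inball X1 (H * 2 powr (- (real N * \<kappa>))) c \<and>
        (\<lambda>y. f y - (\<Sum>i\<in>F. u i y)) = (\<lambda>y. b y + c y)"
      if F: "finite F" and N: "\<And>m. ix m \<notin> F \<Longrightarrow> real N \<le> real m * \<bar>d\<bar>" for F and N :: nat
    proof -
      let ?e = "2 powr (- (real N * \<kappa>))"
      let ?g = "\<lambda>y. f y - (\<Sum>i\<in>F. u i y)"
      have le: "C0 * (S0 * (A * ?e)) \<le> H * ?e" "C1 * (S1 * (A * ?e)) \<le> H * ?e"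
        using C0 C1 S A by (simp_all add: H_def distrib_right mult.assoc)
      have pos: "0 < S0 * (A * ?e)" "0 < S1 * (A * ?e)" using S A by simp_all
      show ?thesis
      proof (cases "0 < d")
        case True
        then have "camp 1 s0 (int K) (S0 * (A * ?e)) ?g"
          unfolding S0_def using sd T s by (intro tail[OF s(1) K(2) _ _ F N]) (auto simp: \<kappa>_def)
        from inball_mono[OF C0(2)[OF pos(1) this] le(1)] inball_mono[OF zero(2)[OF pos(2)] le(2)] show ?thesis
          by (intro exI[of _ ?g] exI[of _ "\<lambda>_. 0"]) simp
      next
        case False
        then have "camp 1 s1 (int K) (S1 * (A * ?e)) ?g"
          unfolding S1_def using sd T d by (intro tail[OF s(2) K(3) _ _ F N]) (auto simp: \<kappa>_def)
        from inball_mono[OF C1(2)[OF pos(2) this] le(2)] inball_mono[OF zero(1)[OF pos(1)] le(1)] show ?thesis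
          by (intro exI[of _ ?g] exI[of _ "\<lambda>_. 0"]) simp
      qed
    qed
    have tail': "(\<lambda>y. f y - (\<Sum>i\<in>F. u i y)) \<in> carrier (sum_space X0 X1)"
      "qnorm (sum_space X0 X1) (\<lambda>y. f y - (\<Sum>i\<in>F. u i y)) \<le> ennreal (2 * (H * 2 powr (- (real N * \<kappa>))))"
      if F: "finite F" and N: "\<And>m. ix m \<notin> F \<Longrightarrow> real N \<le> real m * \<bar>d\<bar>" for F and N :: nat
    proof -
      obtain b c where bc: "inball X0 (H * 2 powr (- (real N * \<kappa>))) b" "inball X1 (H * 2 powr (- (real N * \<kappa>))) c"
        "(\<lambda>y. f y - (\<Sum>i\<in>F. u i y)) = (\<lambda>y. b y + c y)"
        using split[OF F N] by blast
      have "0 \<le> H * 2 powr (- (real N * \<kappa>))" using H by simp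
      from sum_space_inball[OF bc this this]
      show "(\<lambda>y. f y - (\<Sum>i\<in>F. u i y)) \<in> carrier (sum_space X0 X1)"
        "qnorm (sum_space X0 X1) (\<lambda>y. f y - (\<Sum>i\<in>F. u i y)) \<le> ennreal (2 * (H * 2 powr (- (real N * \<kappa>))))"
        by (simp_all only: mult_2)
    qed
    have "f \<in> carrier (sum_space X0 X1)" using tail'(1)[of "{}" 0] by simp
    moreover have "((\<lambda>F. qnorm (sum_space X0 X1) (\<lambda>y. f y - (\<Sum>i\<in>F. u i y))) \<longlongrightarrow> 0) (finite_subsets_at_top UNIV)"
    proof (rule pm_tendstoI)
      have pw: "2 powr (- (real N * \<kappa>)) = (2 powr (- \<kappa>)) ^ N" for N
        by (simp add: powr_powr mult.commute flip: powr_realpow)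
      have "2 powr (- \<kappa>) < (1::real)" using \<kappa> powr_less_mono[of "- \<kappa>" 0 2] by auto
      then have "(\<lambda>N. 2 * (H * 2 powr (- (real N * \<kappa>)))) \<longlonglongrightarrow> 2 * (H * 0)"
        unfolding pw by (intro tendsto_intros LIMSEQ_realpow_zero) auto
      then show "(\<lambda>N. 2 * (H * 2 powr (- (real N * \<kappa>)))) \<longlonglongrightarrow> 0" by simp
      show "qnorm (sum_space X0 X1) (\<lambda>y. f y - (\<Sum>i\<in>F. u i y)) \<le> ennreal (2 * (H * 2 powr (- (real N * \<kappa>))))"
        if "finite F" "{- int N..int N} \<subseteq> F" for N F
        using that(1) far[OF that(2)] by (rule tail'(2))
    qed
    moreover have "C0 * (S0 * (A * 2)) \<le> C * M" "C1 * (S1 * (A * 2)) \<le> C * M"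
      using C0 C1 S M Cd by (auto simp: C_def A_def algebra_simps)
    moreover have "0 \<le> C * M" using M C by simp
    ultimately show ?thesis
      unfolding in_pm_def pm_admissible_def using u0 u1 pm_bound_mono[OF b0] pm_bound_mono[OF b1]
      by (intro conjI exI[of _ u]) auto
  qed
  then show ?thesis using C unfolding dominated_def by blast
qed

section \<open>Choice of the regime and assembly\<close>

theorem corollary2p15:
  fixes \<Theta> p0 p1 p \<tau>0 \<tau>1 \<tau> :: real and k0 k1 k :: int
  assumes "0 < \<Theta>" and "\<Theta> < 1"
    and "0 < p0" and "0 < p1"
    and "0 \<le> \<tau>0" and "0 \<le> \<tau>1"
    and "\<tau> = (1 - \<Theta>) * \<tau>0 + \<Theta> * \<tau>1"
    and "1 / p = (1 - \<Theta>) / p0 + \<Theta> / p1"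
    and "p0 * \<tau>0 = p1 * \<tau>1"
    and "admissible_degree CARD('n) \<tau>0 p0 k0"
    and "admissible_degree CARD('n) \<tau>1 p1 k1"
    and "admissible_degree CARD('n) \<tau> p k"
  shows "quasi_space_eq
    (pm_interpolation (campanato \<tau>0 p0 k0) (campanato \<tau>1 p1 k1) \<Theta>)
    (campanato \<tau> p k :: (real ^ 'n::finite) quasi_space)"
proof -
  let ?n = "real CARD('n)"
  define s0 where "s0 = ?n * (\<tau>0 - 1 / p0)"
  define s1 where "s1 = ?n * (\<tau>1 - 1 / p1)"
  define s where "s = ?n * (\<tau> - 1 / p)"
  have "0 < 1 / p" unfolding assms(8) using assms(1-4) by (intro add_pos_pos divide_pos_pos) auto
  then have p: "0 < p" by simp
  have \<tau>: "0 \<le> \<tau>" unfolding assms(7) using assms(1,2,5,6) by simp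
  define c where "c = p0 * \<tau>0"
  have c: "\<tau>0 = c / p0" "\<tau>1 = c / p1" using assms(3,4,9) by (auto simp: c_def field_simps)
  \<comment> \<open>The same convex combination defines \<tau> and 1 / p, so the common product c is
    inherited by the interpolated parameters.\<close>
  have "\<tau> = c * (1 / p)" unfolding assms(7,8) c by (simp add: algebra_simps)
  then have rel: "p0 * s0 = ?n * (c - 1)" "p1 * s1 = ?n * (c - 1)" "p * s = ?n * (c - 1)"
    using assms(3,4) p by (auto simp: s0_def s1_def s_def c right_diff_distrib)
  have s_eq: "s = (1 - \<Theta>) * s0 + \<Theta> * s1"
    unfolding s_def s0_def s1_def assms(7,8) by (simp add: algebra_simps)
  have sgn: "s0 < 0 \<longleftrightarrow> s < 0" "s1 < 0 \<longleftrightarrow> s < 0" "0 < s0 \<longleftrightarrow> 0 < s" "0 < s1 \<longleftrightarrow> 0 < s"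
  proof -
    have "p0 * s0 < 0 \<longleftrightarrow> p * s < 0" "p1 * s1 < 0 \<longleftrightarrow> p * s < 0" "0 < p0 * s0 \<longleftrightarrow> 0 < p * s" "0 < p1 * s1 \<longleftrightarrow> 0 < p * s"
      unfolding rel by simp_all
    then show "s0 < 0 \<longleftrightarrow> s < 0" "s1 < 0 \<longleftrightarrow> s < 0" "0 < s0 \<longleftrightarrow> 0 < s" "0 < s1 \<longleftrightarrow> 0 < s"
      using p assms(3,4) by (simp_all add: mult_less_0_iff zero_less_mult_iff)
  qed
  have k: "-1 \<le> k0" "s0 < real_of_int k0 + 1" "-1 \<le> k1" "s1 < real_of_int k1 + 1" "-1 \<le> k" "s < real_of_int k + 1"
    using assms(10-12) by (simp_all add: admissible_degree_def s0_def s1_def s_def)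
  let ?Y = "campanato \<tau>0 p0 k0 :: (real ^ 'n) quasi_space"
  let ?Z = "campanato \<tau>1 p1 k1 :: (real ^ 'n) quasi_space"
  let ?X = "campanato \<tau> p k :: (real ^ 'n) quasi_space"
  have fin: "qnorm ?X f < \<infinity>" if "f \<in> carrier ?X" for f using that by (simp add: campanato_def)
  show ?thesis
  proof (cases "s < 0")
    case True
    have e0: "equivalent ?Y (camp p0 s0 (-1))"
      using True sgn by (intro campanato_equivalent[OF assms(3,5) s0_def k(1,2)]) auto
    have e1: "equivalent ?Z (camp p1 s1 (-1))"
      using True sgn by (intro campanato_equivalent[OF assms(4,6) s1_def k(3,4)]) auto
    have e: "equivalent ?X (camp p s (-1))"
      using True by (intro campanato_equivalent[OF p \<tau> s_def k(5,6)]) auto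
    have r: "p0 * s0 = p * s" "p1 * s1 = p * s" by (simp_all only: rel)
    show ?thesis
    proof (rule pm_interpolation_eq[OF e _ _ fin])
      show "dominated (in_pm ?Y ?Z \<Theta>) (camp p s (-1))"
        using e0 e1 unfolding equivalent_def
        by (intro pm_subset_morrey[OF assms(1-4) p assms(8) r refl _ refl]) auto
      show "dominated (camp p s (-1)) (in_pm ?Y ?Z \<Theta>)"
        using e0 e1 unfolding equivalent_def
        by (intro pm_superset_morrey[OF assms(1-4) p assms(8) r]) auto
    qed
  next
    case False
    \<comment> \<open>One degree serves all three spaces; K >= 1 is what the Taylor approximation of
      the coordinates in the partition of unity requires.\<close>
    obtain K :: nat where "max 1 (max s0 s1) < real K" using reals_Archimedean2 by blast
    then have K: "1 \<le> K" "s0 < real K + 1" "s1 < real K + 1" by simp_all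
    have "s < (1 - \<Theta>) * (real K + 1) + \<Theta> * (real K + 1)"
      unfolding s_eq using K assms(1,2) by (intro add_strict_mono mult_strict_left_mono) auto
    then have Ks: "s < real K + 1" by (simp add: algebra_simps)
    have nn: "0 \<le> s0" "0 \<le> s1" "0 \<le> s" using False sgn by linarith+
    have e0: "equivalent ?Y (camp 1 s0 (int K))"
      by (rule campanato_equivalent_jn[OF assms(3,5) s0_def nn(1) k(1,2) K(2) zero_less_one])
    have e1: "equivalent ?Z (camp 1 s1 (int K))"
      by (rule campanato_equivalent_jn[OF assms(4,6) s1_def nn(2) k(3,4) K(3) zero_less_one])
    have e: "equivalent ?X (camp 1 s (int K))"
      by (rule campanato_equivalent_jn[OF p \<tau> s_def nn(3) k(5,6) Ks zero_less_one])
    show ?thesis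
    proof (rule pm_interpolation_eq[OF e _ _ fin])
      show "dominated (in_pm ?Y ?Z \<Theta>) (camp 1 s (int K))"
        using e0 e1 unfolding equivalent_def
        by (intro pm_subset_smooth[OF assms(1-4) nn(1,2) s_eq refl _ refl]) auto
      show "dominated (camp 1 s (int K)) (in_pm ?Y ?Z \<Theta>)"
      proof (cases "s0 = s1")
        case True
        then have "s = s0" "s = s1" using s_eq by (simp_all add: algebra_simps)
        then show ?thesis using e0 e1 unfolding equivalent_def by (intro pm_superset_trivial) auto
      next
        \<comment> \<open>Smoothness s = 0 would force s0 = s1 = 0, so here all three are positive,
          as the geometric sums over smooth pieces require.\<close>
        case neq: False
        then have "0 < s0" "0 < s1" using nn sgn by linarith+
        then show ?thesis
          using e0 e1 neq unfolding equivalent_def by (intro pm_superset_smooth[OF assms(1,2) _ _ _ s_eq K]) auto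
      qed
    qed
  qed
qed

end
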